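(* Let $\bm A\in\mathbb R^{n\times n}$ be symmetric positive semi-definite, $2\le k\le\operatorname{rank}(\bm A)$, and $p\ge4$. Let $\bm\Omega\in\mathbb R^{n\times(k+p)}$ have i.i.d. $\mathcal N(\bm0,\bm K)$ columns, with $\bm K$ symmetric positive semi-definite such that $\widetilde{\bm K}_{11}$ is invertible, and let $\widehat{\bm A}=\bm A\bm\Omega(\bm\Omega^*\bm A\bm\Omega)^\dagger\bm\Omega^*\bm A$. Let $d_1=\frac{3k}{p+1}$, $d_2=e^2\frac{k+p}{(p+1)^2}$, $d_3=\sqrt k\,d_2$, and let $u,t\ge1$. Then \[ \|\bm A-\widehat{\bm A}\|_\mathrm F\le\|\bm\Sigma_2\|_\mathrm F+4\big(\delta_k^{(\mathrm F)}+t^2(d_1+d_3)\beta_k^{(\mathrm F)}\big)\|\bm\Sigma_2\|_\mathrm F+4t^2d_3\beta_k^{( * )}\|\bm\Sigma_2\|_*+2t^2u^2d_2\beta_k^{(2)}\|\bm\Sigma_2\|_2 \] holds with probability at least $1-3t^{-p}-e^{-u^2/2}$.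
   Context: Write $\bm A=\bm U\bm\Sigma\bm U^*$ with $\bm U=[\bm U_1\ \bm U_2]$ orthogonal, $\bm U_1\in\mathbb R^{n\times k}$, eigenvalues $\sigma_1\ge\dots\ge\sigma_n\ge0$, $\bm\Sigma_2=\operatorname{diag}(\sigma_{k+1},\dots,\sigma_n)$. Set $\widetilde{\bm K}_{11}=\bm U_1^*\bm K\bm U_1$, $\widetilde{\bm K}_{21}=\bm U_2^*\bm K\bm U_1$, $\widetilde{\bm K}_{22}=\bm U_2^*\bm K\bm U_2$, $\widetilde{\bm K}_{22.1}=\widetilde{\bm K}_{22}-\widetilde{\bm K}_{21}\widetilde{\bm K}_{11}^{-1}\widetilde{\bm K}_{21}^*$. For $\xi\in\{\mathrm F,2,*\}$, $\beta_k^{(\xi)}=\frac{\|\bm\Sigma_2^{1/2}\widetilde{\bm K}_{22.1}\bm\Sigma_2^{1/2}\|_\xi}{\|\bm\Sigma_2\|_\xi}\|\widetilde{\bm K}_{11}^{-1}\|_2$, $\delta_k^{(\xi)}=\frac{\|\bm\Sigma_2^{1/2}\widetilde{\bm K}_{21}\widetilde{\bm K}_{11}^{-2}\widetilde{\bm K}_{21}^*\bm\Sigma_2^{1/2}\|_\xi}{\|\bm\Sigma_2\|_\xi}$. Norms: Frobenius, spectral ($\|\cdot\|_2$), nuclear ($\|\cdot\|_*$); $\dagger$ is the Moore–Penrose pseudoinverse. *)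

theory Defs
  imports "HOL-Probability.Probability" "Jordan_Normal_Form.DL_Rank" "Jordan_Normal_Form.Char_Poly"
begin

text \<open>All matrices are real matrices of the Jordan_Normal_Form library (type real mat,
  dimensions carried as values). Since the matrices are real, the adjoint is the transpose.\<close>

definition orthogonal_real_mat :: "nat \<Rightarrow> real mat \<Rightarrow> bool" where
  "orthogonal_real_mat n U \<longleftrightarrow> U \<in> carrier_mat n n \<and>
     transpose_mat U * U = 1\<^sub>m n \<and> U * transpose_mat U = 1\<^sub>m n"

definition sym_psd :: "nat \<Rightarrow> real mat \<Rightarrow> bool" where
  "sym_psd n A \<longleftrightarrow> A \<in> carrier_mat n n \<and> transpose_mat A = A \<and>
     (\<forall>v \<in> carrier_vec n. v \<bullet> (A *\<^sub>v v) \<ge> 0)"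

definition mat_inv :: "real mat \<Rightarrow> real mat" where
  "mat_inv A = (THE B. B \<in> carrier_mat (dim_row A) (dim_row A) \<and> inverts_mat A B \<and> inverts_mat B A)"

definition pinv :: "real mat \<Rightarrow> real mat" where
  "pinv X = (THE Y. Y \<in> carrier_mat (dim_col X) (dim_row X) \<and>
      X * Y * X = X \<and> Y * X * Y = Y \<and>
      transpose_mat (X * Y) = X * Y \<and> transpose_mat (Y * X) = Y * X)"

definition fro_norm :: "real mat \<Rightarrow> real" where
  "fro_norm A = sqrt (\<Sum>i<dim_row A. \<Sum>j<dim_col A. (A $$ (i,j))\<^sup>2)"

definition sq_sing_vals :: "real mat \<Rightarrow> real set" where
  "sq_sing_vals A = {x. poly (char_poly (transpose_mat A * A)) x = 0}"

definition sq_sing_mult :: "real mat \<Rightarrow> real \<Rightarrow> nat" where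
  "sq_sing_mult A x = Polynomial.order x (char_poly (transpose_mat A * A))"

text \<open>Spectral norm: largest singular value (0 for an empty matrix).\<close>
definition spec_norm :: "real mat \<Rightarrow> real" where
  "spec_norm A = sqrt (Max (insert 0 (sq_sing_vals A)))"

definition nuc_norm :: "real mat \<Rightarrow> real" where
  "nuc_norm A = (\<Sum>x \<in> sq_sing_vals A. real (sq_sing_mult A x) * sqrt x)"

definition centered_normal_rv :: "'w measure \<Rightarrow> ('w \<Rightarrow> real) \<Rightarrow> real \<Rightarrow> bool" where
  "centered_normal_rv M Y s2 \<longleftrightarrow>
     (if s2 = 0 then Y \<in> borel_measurable M \<and> (AE \<omega> in M. Y \<omega> = 0)
      else distributed M lborel Y (normal_density 0 (sqrt s2)))"

text \<open>A random vector X in R^n has law N(0,K) iff every linear functional v^T X has law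
  N(0, v^T K v) (standard definition, covering singular K).\<close>
definition gaussian_vec_rv :: "'w measure \<Rightarrow> nat \<Rightarrow> real mat \<Rightarrow> ('w \<Rightarrow> real vec) \<Rightarrow> bool" where
  "gaussian_vec_rv M n K X \<longleftrightarrow>
     (\<forall>v \<in> carrier_vec n. centered_normal_rv M (\<lambda>\<omega>. v \<bullet> X \<omega>) (v \<bullet> (K *\<^sub>v v)))"

definition iid_gaussian_cols :: "'w measure \<Rightarrow> nat \<Rightarrow> nat \<Rightarrow> real mat \<Rightarrow> ('w \<Rightarrow> real mat) \<Rightarrow> bool" where
  "iid_gaussian_cols M n m K \<Omega> \<longleftrightarrow>
     (\<forall>\<omega> \<in> space M. \<Omega> \<omega> \<in> carrier_mat n m) \<and>
     prob_space.indep_vars M (\<lambda>_. PiM {..<n} (\<lambda>_. borel)) (\<lambda>j \<omega>. \<lambda>i\<in>{..<n}. \<Omega> \<omega> $$ (i,j)) {..<m} \<and>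
     (\<forall>j<m. gaussian_vec_rv M n K (\<lambda>\<omega>. col (\<Omega> \<omega>) j))"

section \<open>Blocks relative to the eigendecomposition A = U Sigma U^T\<close>

definition U1 :: "nat \<Rightarrow> nat \<Rightarrow> real mat \<Rightarrow> real mat" where
  "U1 n k U = Matrix.mat n k (\<lambda>(i,j). U $$ (i,j))"

definition U2 :: "nat \<Rightarrow> nat \<Rightarrow> real mat \<Rightarrow> real mat" where
  "U2 n k U = Matrix.mat n (n - k) (\<lambda>(i,j). U $$ (i, k + j))"

text \<open>sigma is indexed from 0: sigma 0 \<ge> sigma 1 \<ge> ... \<ge> sigma (n-1).\<close>
definition Sig2 :: "nat \<Rightarrow> nat \<Rightarrow> (nat \<Rightarrow> real) \<Rightarrow> real mat" where
  "Sig2 n k \<sigma> = mat_diag (n - k) (\<lambda>i. \<sigma> (k + i))"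

definition Sig2_half :: "nat \<Rightarrow> nat \<Rightarrow> (nat \<Rightarrow> real) \<Rightarrow> real mat" where
  "Sig2_half n k \<sigma> = mat_diag (n - k) (\<lambda>i. sqrt (\<sigma> (k + i)))"

definition Kt11 :: "nat \<Rightarrow> nat \<Rightarrow> real mat \<Rightarrow> real mat \<Rightarrow> real mat" where
  "Kt11 n k U K = transpose_mat (U1 n k U) * K * U1 n k U"

definition Kt21 :: "nat \<Rightarrow> nat \<Rightarrow> real mat \<Rightarrow> real mat \<Rightarrow> real mat" where
  "Kt21 n k U K = transpose_mat (U2 n k U) * K * U1 n k U"

definition Kt22 :: "nat \<Rightarrow> nat \<Rightarrow> real mat \<Rightarrow> real mat \<Rightarrow> real mat" where
  "Kt22 n k U K = transpose_mat (U2 n k U) * K * U2 n k U"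

definition Kt22_1 :: "nat \<Rightarrow> nat \<Rightarrow> real mat \<Rightarrow> real mat \<Rightarrow> real mat" where
  "Kt22_1 n k U K = Kt22 n k U K -
     Kt21 n k U K * mat_inv (Kt11 n k U K) * transpose_mat (Kt21 n k U K)"

definition beta_k :: "(real mat \<Rightarrow> real) \<Rightarrow> nat \<Rightarrow> nat \<Rightarrow> real mat \<Rightarrow> (nat \<Rightarrow> real) \<Rightarrow> real mat \<Rightarrow> real" where
  "beta_k nrm n k U \<sigma> K =
     nrm (Sig2_half n k \<sigma> * Kt22_1 n k U K * Sig2_half n k \<sigma>) / nrm (Sig2 n k \<sigma>)
     * spec_norm (mat_inv (Kt11 n k U K))"

definition delta_k :: "(real mat \<Rightarrow> real) \<Rightarrow> nat \<Rightarrow> nat \<Rightarrow> real mat \<Rightarrow> (nat \<Rightarrow> real) \<Rightarrow> real mat \<Rightarrow> real" where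
  "delta_k nrm n k U \<sigma> K =
     nrm (Sig2_half n k \<sigma> * Kt21 n k U K * mat_inv (Kt11 n k U K) * mat_inv (Kt11 n k U K)
          * transpose_mat (Kt21 n k U K) * Sig2_half n k \<sigma>) / nrm (Sig2 n k \<sigma>)"

definition nystrom :: "real mat \<Rightarrow> real mat \<Rightarrow> real mat" where
  "nystrom A \<Omega> = A * \<Omega> * pinv (transpose_mat \<Omega> * A * \<Omega>) * transpose_mat \<Omega> * A"

end

theory Submission
  imports Defs
begin

text \<open>If R is a right inverse of \<open>U1\<^sup>T * \<Omega>\<close>, the error is at most the norm of \<open>\<Sigma>2\<close> plus the Frobenius
  norm of \<open>F * F\<^sup>T\<close> with \<open>F = sqrt \<Sigma>2 * (U2\<^sup>T * \<Omega>) * R\<close>, so only the Schatten 4-norm of F matters.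
  In law, \<open>U\<^sup>T * \<Omega> = L * Z\<close> with Z standard Gaussian and L block lower triangular. Hence F is a
  deterministic matrix, which gives the \<open>\<delta>\<close> term, plus \<open>sqrt \<Sigma>2 * L2 * G * R\<close> with G standard Gaussian
  and independent of R. Given R, the Schatten 4-norm of the latter is Lipschitz in G and
  concentrates around its mean, which is bounded by the fourth moment; Wick's formula gives the
  fourth moment exactly. The norms of R are those of the inverse Gram matrix \<open>W = R\<^sup>T * R\<close>. Its
  diagonal entries are dominated by inverse chi-square variables, which bounds the trace of W. The
  spectral norm of W is read off the p-th absolute moment of \<open>z \<bullet> W y\<close> for an independent
  Gaussian vector z, and no net is needed.\<close>

section \<open>Gaussian concentration\<close>

text \<open>Origin of the constants. Let a be the Schatten 4-norm of the deterministic part of F, b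
  a bound for the mean of the norm of the Gaussian part and c a bound for its deviation. Then
  \<open>(a + b + c)\<^sup>2 \<le> 4 * a\<^sup>2 + 4 * b\<^sup>2 + 2 * c\<^sup>2\<close> produces
  the factors 4, 4 and 2. The trace of W stays below a multiple of d1, its spectral norm below a
  multiple of d2; its Frobenius norm costs a further factor sqrt k, which is d3. Both tail bounds
  rest on the lower bound of \<open>gmoment p\<close> by 3/4 times
  \<open>((p + 1) / e) powr (p / 2)\<close>. They carry the factors 11/10 and 16/9, whose sum is
  below 3.

  Two obstacles shape the rest. K may be singular, so the sample need not have a density, and its
  law is identified through characteristic functions. The term \<open>exp (- u\<^sup>2 / 2)\<close>
  demands Gaussian concentration with its exact constant; this comes from a transport inequality,
  proved on the line with a monotone map.\<close>

abbreviation gauss :: "real measure" where "gauss \<equiv> std_normal_distribution"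

text \<open>\<open>T\<close> is the increasing map from the Gaussian, normalized on the interval, to
  the law with density proportional to \<open>std_normal_density x * exp (g x)\<close>. The change
  of variables formula and the bound of \<open>ln (T' y)\<close> by \<open>T' y - 1\<close> estimate
  \<open>ln (Z / c)\<close> by \<open>f\<close> plus a remainder that is an exact derivative.
  \<open>T\<close> fixes both endpoints of the compact interval, so the remainder integrates to
  zero.\<close>

lemma transport_interval:
  fixes f g :: "real \<Rightarrow> real"
  assumes A: "0 < A" and g: "continuous_on UNIV g"
    and f: "((\<lambda>x. std_normal_density x * f x) has_integral I) {-A..A}"
    and le: "\<And>x y. g x \<le> f y + (x - y)\<^sup>2 / 2"
  defines "Z \<equiv> integral {-A..A} (\<lambda>x. std_normal_density x * exp (g x))"
    and "c \<equiv> integral {-A..A} std_normal_density"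
  shows "0 < c" "0 < Z" "c * ln (Z / c) \<le> I"
proof -
  let ?\<phi> = std_normal_density
  define h where "h = (\<lambda>x. ?\<phi> x * exp (g x))"
  have \<phi>pos: "0 < ?\<phi> x" for x by (simp add: normal_density_pos)
  have hpos: "0 < h x" for x by (simp add: h_def \<phi>pos)
  have \<phi>c: "continuous_on S ?\<phi>" for S
    unfolding std_normal_density_def by (intro continuous_intros) auto
  have hc: "continuous_on S h" for S
    unfolding h_def by (intro continuous_intros \<phi>c continuous_on_subset[OF g]) auto
  define F where "F = (\<lambda>y. integral {-A..y} ?\<phi>)"
  define G where "G = (\<lambda>y. integral {-A..y} h)"
  have dF: "(F has_real_derivative ?\<phi> x) (at x within {-A..A})" if "x \<in> {-A..A}" for x
    unfolding F_def by (rule integral_has_real_derivative[OF \<phi>c that])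
  have dG: "(G has_real_derivative h x) (at x within {-A..A})" if "x \<in> {-A..A}" for x
    unfolding G_def by (rule integral_has_real_derivative[OF hc that])
  have mono: "H x < H y"
    if d: "\<And>x. x \<in> {-A..A} \<Longrightarrow> (H has_real_derivative w x) (at x within {-A..A})"
      and w: "\<And>x. 0 < w x" and xy: "-A \<le> x" "x < y" "y \<le> A" for H w x y
  proof (rule DERIV_pos_imp_increasing_open[OF xy(2)])
    fix z assume z: "x < z" "z < y"
    have "(H has_real_derivative w z) (at z)"
      using d[of z] z xy by (auto simp: at_within_Icc_at)
    thus "\<exists>D. (H has_real_derivative D) (at z) \<and> 0 < D" using w by blast
  next
    have "continuous_on {-A..A} H"
      by (rule DERIV_continuous_on[OF d])
    thus "continuous_on {x..y} H" by (rule continuous_on_subset) (use xy in auto)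
  qed
  have F0: "F (-A) = 0" and G0: "G (-A) = 0" unfolding F_def G_def by auto
  have FA: "F A = c" and GA: "G A = Z" unfolding F_def G_def c_def Z_def h_def by auto
  show cpos: "0 < c" using mono[OF dF \<phi>pos, of "-A" A] A F0 FA by auto
  show Zpos: "0 < Z" using mono[OF dG hpos, of "-A" A] A G0 GA by auto
  have contF: "continuous_on {-A..A} F" by (rule DERIV_continuous_on[OF dF])
  have contG: "continuous_on {-A..A} G" by (rule DERIV_continuous_on[OF dG])
  have injG: "inj_on G {-A..A}"
    by (rule linorder_inj_onI) (use mono[OF dG hpos] in fastforce)+
  have imG: "G ` {-A..A} = {0..Z}"
  proof (intro equalityI subsetI)
    fix v assume "v \<in> G ` {-A..A}"
    then obtain x where x: "x \<in> {-A..A}" "v = G x" by auto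
    have "G (-A) \<le> G x" using mono[OF dG hpos, of "-A" x] x by (cases "x = -A") auto
    moreover have "G x \<le> G A" using mono[OF dG hpos, of x A] x by (cases "x = A") auto
    ultimately show "v \<in> {0..Z}" using x G0 GA by auto
  next
    fix v assume "v \<in> {0..Z}"
    then have "\<exists>x\<ge>-A. x \<le> A \<and> G x = v"
      by (intro IVT') (use A G0 GA contG in auto)
    thus "v \<in> G ` {-A..A}" by auto
  qed
  define S where "S = the_inv_into {-A..A} G"
  have SG: "S (G x) = x" if "x \<in> {-A..A}" for x
    unfolding S_def by (rule the_inv_into_f_f[OF injG that])
  have GS: "G (S v) = v" if "v \<in> {0..Z}" for v
    unfolding S_def by (rule f_the_inv_into_f[OF injG]) (use that imG in auto)
  have Sin: "S v \<in> {-A..A}" if "v \<in> {0..Z}" for v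
    using that imG SG by (metis imageE)
  have contS: "continuous_on {0..Z} S"
    using continuous_on_inv[of "{-A..A}" G S] contG SG imG by auto
  have dS: "(S has_real_derivative inverse (h (S v))) (at v)" if v: "0 < v" "v < Z" for v
  proof (rule DERIV_inverse_function[where f = G and a = 0 and b = Z])
    have "S v \<in> {-A..A}" using Sin v by auto
    moreover have "S v \<noteq> -A" using GS[of v] G0 v by auto
    moreover have "S v \<noteq> A" using GS[of v] GA v by auto
    ultimately have "S v \<in> {-A<..<A}" by auto
    thus "(G has_real_derivative h (S v)) (at (S v))"
      using dG[of "S v"] by (auto simp: at_within_Icc_at)
    show "h (S v) \<noteq> 0" using hpos[of "S v"] by auto
    show "isCont S v" using continuous_on_interior[OF contS] v by auto
  qed (use v GS in auto)
  \<comment> \<open>\<open>T\<close> matches quantiles: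
    \<open>G (T y) / Z = F y / c\<close>.\<close>
  define T where "T = (\<lambda>y. S (F y * Z / c))"
  have Frange: "F y * Z / c \<in> {0..Z}" if "y \<in> {-A..A}" for y
  proof -
    have "F (-A) \<le> F y" using mono[OF dF \<phi>pos, of "-A" y] that by (cases "y = -A") auto
    moreover have "F y \<le> F A" using mono[OF dF \<phi>pos, of y A] that by (cases "y = A") auto
    ultimately show ?thesis using F0 FA cpos Zpos by (auto simp: field_simps)
  qed
  have Frange': "F y * Z / c \<in> {0<..<Z}" if "y \<in> {-A<..<A}" for y
    using mono[OF dF \<phi>pos, of "-A" y] mono[OF dF \<phi>pos, of y A] that F0 FA cpos Zpos
    by (auto simp: field_simps)
  have TmA: "T (-A) = -A" using SG[of "-A"] A unfolding T_def F0 by (simp add: G0)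
  have TA: "T A = A" using SG[of A] A cpos unfolding T_def FA by (simp add: GA)
  have contT: "continuous_on {-A..A} T"
    unfolding T_def
    by (rule continuous_on_compose2[OF contS]) (use Frange contF cpos in \<open>auto intro!: continuous_intros\<close>)
  define T' where "T' = (\<lambda>y. ?\<phi> y * (Z / c) / h (T y))"
  have dT: "(T has_real_derivative T' y) (at y)" if y: "y \<in> {-A<..<A}" for y
  proof -
    have "(F has_real_derivative ?\<phi> y) (at y)" using dF[of y] y by (auto simp: at_within_Icc_at)
    hence "((\<lambda>y. F y * Z / c) has_real_derivative ?\<phi> y * Z / c) (at y)"
      using cpos by (auto intro!: derivative_eq_intros)
    from DERIV_chain2[OF dS this] Frange'[OF y]
    show ?thesis unfolding T_def T'_def by (auto simp: field_simps)
  qed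
  \<comment> \<open>Logarithm of \<open>T' y * h (T y) = std_normal_density y * Z / c\<close>, with
    the hypothesis used at the pair \<open>T y\<close>, y. The cost
    \<open>(T y - y)\<^sup>2 / 2\<close> and the two Gaussian exponents combine to
    \<open>y\<^sup>2 - y * T y\<close>.\<close>
  have key: "?\<phi> y * ln (Z / c) \<le> ?\<phi> y * f y + ?\<phi> y * (y\<^sup>2 - 1 + T' y - y * T y)"
    if y: "y \<in> {-A<..<A}" for y
  proof -
    have T'pos: "0 < T' y" unfolding T'_def using \<phi>pos hpos Zpos cpos by simp
    have "Z / c = T' y * h (T y) / ?\<phi> y"
      unfolding T'_def using \<phi>pos[of y] hpos[of "T y"] by (simp add: field_simps)
    also have "\<dots> = T' y * exp (g (T y) - (T y)\<^sup>2 / 2 + y\<^sup>2 / 2)"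
    proof -
      have "exp (g (T y) - (T y)\<^sup>2 / 2 + y\<^sup>2 / 2) = exp (- (T y)\<^sup>2 / 2) * exp (g (T y)) / exp (- y\<^sup>2 / 2)"
        by (simp add: exp_add[symmetric] exp_diff[symmetric])
      thus ?thesis unfolding h_def std_normal_density_def by simp
    qed
    finally have "ln (Z / c) = ln (T' y) + (g (T y) - (T y)\<^sup>2 / 2 + y\<^sup>2 / 2)"
      using T'pos by (simp add: ln_mult)
    also have "\<dots> \<le> (T' y - 1) + (f y + (T y - y)\<^sup>2 / 2 - (T y)\<^sup>2 / 2 + y\<^sup>2 / 2)"
      using ln_le_minus_one[OF T'pos] le[of "T y" y] by linarith
    also have "\<dots> = f y + (y\<^sup>2 - 1 + T' y - y * T y)"
      by (simp add: power2_eq_square field_simps)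
    finally show ?thesis using \<phi>pos[of y]
      by (metis distrib_left mult_left_mono less_imp_le)
  qed
  have d\<phi>: "(?\<phi> has_real_derivative - y * ?\<phi> y) (at y)" for y
    unfolding std_normal_density_def
    by (rule derivative_eq_intros refl | simp)+
  \<comment> \<open>The remainder is the derivative of
    \<open>(T y - y) * std_normal_density y\<close>, which vanishes at both endpoints.\<close>
  have "((\<lambda>y. ?\<phi> y * (y\<^sup>2 - 1 + T' y - y * T y)) has_integral
      ((T A - A) * ?\<phi> A - (T (-A) - (-A)) * ?\<phi> (-A))) {-A..A}"
  proof (rule fundamental_theorem_of_calculus_interior)
    show "continuous_on {- A..A} (\<lambda>y. (T y - y) * ?\<phi> y)"
      by (intro continuous_intros contT \<phi>c)
    fix y assume "y \<in> {-A<..<A}"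
    from dT[OF this] have "((\<lambda>y. (T y - y) * ?\<phi> y) has_real_derivative
        ?\<phi> y * (y\<^sup>2 - 1 + T' y - y * T y)) (at y)"
      by (auto intro!: derivative_eq_intros d\<phi> simp: power2_eq_square field_simps)
    thus "((\<lambda>y. (T y - y) * ?\<phi> y) has_vector_derivative
        ?\<phi> y * (y\<^sup>2 - 1 + T' y - y * T y)) (at y)"
      by (simp add: has_real_derivative_iff_has_vector_derivative)
  qed (use A in auto)
  hence I2: "((\<lambda>y. ?\<phi> y * (y\<^sup>2 - 1 + T' y - y * T y)) has_integral 0) {-A<..<A}"
    unfolding TA TmA by (simp add: has_integral_Icc_iff_Ioo)
  have I1: "((\<lambda>y. ?\<phi> y * ln (Z / c)) has_integral (c * ln (Z / c))) {-A<..<A}"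
  proof -
    have "(?\<phi> has_integral c) {-A..A}"
      unfolding c_def by (intro integrable_integral integrable_continuous_interval \<phi>c)
    thus ?thesis unfolding has_integral_Icc_iff_Ioo by (rule has_integral_mult_left)
  qed
  have "c * ln (Z / c) \<le> I + 0"
    by (rule has_integral_le[OF I1 has_integral_add[OF _ I2]])
       (use f key in \<open>auto simp: has_integral_Icc_iff_Ioo\<close>)
  thus "c * ln (Z / c) \<le> I" by simp
qed


lemma prob_space_gauss: "prob_space gauss"
  by (rule real_distribution.axioms(1)[OF real_dist_normal_dist])

text \<open>The intervals \<open>{-n..n}\<close> exhaust the line. The integrals of f converge by
  dominated convergence and those of \<open>exp (g x)\<close> by monotone convergence, so finiteness
  of the latter is part of the conclusion.\<close>

lemma transport_gauss:
  fixes f g :: "real \<Rightarrow> real"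
  assumes g: "continuous_on UNIV g"
    and f: "integrable gauss f"
    and le: "\<And>x y. g x \<le> f y + (x - y)\<^sup>2 / 2"
  shows "(\<integral>\<^sup>+x. ennreal (exp (g x)) \<partial>gauss) \<le> ennreal (exp (\<integral>x. f x \<partial>gauss))"
proof -
  let ?\<phi> = std_normal_density
  have \<phi>c: "continuous_on S ?\<phi>" for S
    unfolding std_normal_density_def by (intro continuous_intros) auto
  have [measurable]: "g \<in> borel_measurable borel"
    by (rule borel_measurable_continuous_onI[OF g])
  have [measurable]: "f \<in> borel_measurable borel"
    using borel_measurable_integrable[OF f] by simp
  have f': "integrable lborel (\<lambda>x. ?\<phi> x * f x)"
    using f by (subst (asm) integrable_density) auto
  define I c where "I = (\<lambda>n::nat. LINT x:{-real n..real n}|lborel. ?\<phi> x * f x)"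
    and "c = (\<lambda>n::nat. LINT x:{-real n..real n}|lborel. ?\<phi> x)"
  define J where "J = (\<lambda>n::nat. \<integral>\<^sup>+x. indicator {-real n..real n} x * ennreal (?\<phi> x * exp (g x)) \<partial>lborel)"
  have lim: "(\<lambda>n. LINT x:{-real n..real n}|lborel. h x) \<longlonglongrightarrow> (\<integral>x. h x \<partial>lborel)"
    if "integrable lborel h" for h :: "real \<Rightarrow> real"
    unfolding set_lebesgue_integral_def
  proof (rule integral_dominated_convergence[where w = "\<lambda>x. norm (h x)"])
    show "AE x in lborel. (\<lambda>n. indicat_real {-real n..real n} x *\<^sub>R h x) \<longlonglongrightarrow> h x"
    proof (intro AE_I2 tendsto_eventually)
      fix x :: real
      obtain m :: nat where m: "\<bar>x\<bar> \<le> real m" using real_arch_simple by blast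
      show "\<forall>\<^sub>F n in sequentially. indicat_real {-real n..real n} x *\<^sub>R h x = h x"
        using eventually_ge_at_top[of m] by eventually_elim (use m in \<open>auto simp: indicator_def\<close>)
    qed
  qed (use that in \<open>auto simp: indicator_def\<close>)
  have limI: "I \<longlonglongrightarrow> (\<integral>x. f x \<partial>gauss)"
    using lim[OF f'] unfolding I_def by (subst integral_density) auto
  have limc: "c \<longlonglongrightarrow> 1"
    using lim[of ?\<phi>] unfolding c_def by simp
  have bound: "J n \<le> ennreal (c n * exp (I n / c n))" if "0 < n" for n
  proof -
    let ?A = "real n"
    have fi: "((\<lambda>x. ?\<phi> x * f x) has_integral I n) {-?A..?A}"
    proof -
      have "set_integrable lborel {-?A..?A} (\<lambda>x. ?\<phi> x * f x)"
        unfolding set_integrable_def using f' by (intro integrable_mult_indicator) auto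
      from set_borel_integral_eq_integral[OF this] show ?thesis
        unfolding I_def by (simp add: integrable_integral)
    qed
    have ceq: "c n = integral {-?A..?A} ?\<phi>"
    proof -
      have "set_integrable lborel {-?A..?A} ?\<phi>"
        unfolding set_integrable_def by (intro integrable_mult_indicator) auto
      from set_borel_integral_eq_integral(2)[OF this] show ?thesis unfolding c_def .
    qed
    define Z where "Z = integral {-?A..?A} (\<lambda>x. ?\<phi> x * exp (g x))"
    have hc: "continuous_on {-?A..?A} (\<lambda>x. ?\<phi> x * exp (g x))"
      by (intro continuous_intros \<phi>c continuous_on_subset[OF g]) auto
    have "J n = ennreal Z"
    proof -
      have "((\<lambda>x. ?\<phi> x * exp (g x)) has_integral Z) {-?A..?A}"
        unfolding Z_def by (intro integrable_integral integrable_continuous_interval hc)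
      hence "(\<integral>\<^sup>+x. ennreal (?\<phi> x * exp (g x)) * indicator {-?A..?A} x \<partial>lborel) = ennreal Z"
        by (intro nn_integral_has_integral_lebesgue') auto
      thus ?thesis unfolding J_def by (simp add: mult.commute)
    qed
    moreover have "0 < c n" "0 < Z" "c n * ln (Z / c n) \<le> I n"
      using transport_interval[OF _ g fi le] that by (auto simp: ceq Z_def)
    hence "ln (Z / c n) \<le> I n / c n" by (simp add: field_simps)
    hence "Z / c n \<le> exp (I n / c n)"
      using \<open>0 < c n\<close> \<open>0 < Z\<close> by (metis exp_le_cancel_iff exp_ln divide_pos_pos)
    hence "Z \<le> c n * exp (I n / c n)" using \<open>0 < c n\<close> by (simp add: field_simps)
    ultimately show ?thesis by (simp add: ennreal_leI)
  qed
  have "incseq (\<lambda>n x. indicator {-real n..real n} x * ennreal (?\<phi> x * exp (g x)))"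
    by (auto simp: incseq_def le_fun_def indicator_def)
  hence "J \<longlonglongrightarrow> (\<integral>\<^sup>+x. (SUP n. indicator {-real n..real n} x * ennreal (?\<phi> x * exp (g x))) \<partial>lborel)"
    unfolding J_def
    by (subst nn_integral_monotone_convergence_SUP)
       (auto intro!: LIMSEQ_SUP nn_integral_mono simp: incseq_def indicator_def le_fun_def)
  also have "(\<lambda>x. (SUP n. indicator {-real n..real n} x * ennreal (?\<phi> x * exp (g x)))) =
      (\<lambda>x. ennreal (?\<phi> x * exp (g x)))"
  proof
    fix x :: real
    obtain m :: nat where m: "\<bar>x\<bar> \<le> real m" using real_arch_simple by blast
    show "(SUP n::nat. indicator {-real n..real n} x * ennreal (?\<phi> x * exp (g x))) = ennreal (?\<phi> x * exp (g x))"
      by (rule antisym)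
         (use m in \<open>auto intro!: SUP_least SUP_upper2[of m] simp: indicator_def\<close>)
  qed
  finally have "J \<longlonglongrightarrow> (\<integral>\<^sup>+x. ennreal (exp (g x)) \<partial>gauss)"
    by (simp add: nn_integral_density ennreal_mult')
  moreover have "(\<lambda>n. ennreal (c n * exp (I n / c n))) \<longlonglongrightarrow> ennreal (1 * exp ((\<integral>x. f x \<partial>gauss) / 1))"
    by (intro tendsto_ennrealI tendsto_intros limI limc) auto
  ultimately have "(\<integral>\<^sup>+x. ennreal (exp (g x)) \<partial>gauss) \<le> ennreal (1 * exp ((\<integral>x. f x \<partial>gauss) / 1))"
    using eventually_mono[OF eventually_gt_at_top[of 0] bound]
    by (intro tendsto_le[OF sequentially_bot])
  thus ?thesis by simp
qed

section \<open>Tensorization to finite products and concentration of Lipschitz functions\<close>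

abbreviation gaussp :: "'i set \<Rightarrow> ('i \<Rightarrow> real) measure" where
  "gaussp I \<equiv> PiM I (\<lambda>_. gauss)"

lemma product_prob_space_gauss: "product_prob_space (\<lambda>_. gauss)"
  by (intro product_prob_spaceI prob_space_gauss)

lemma prob_space_gaussp: "prob_space (gaussp I)"
  by (intro prob_space_PiM prob_space_gauss)

lemma space_gaussp: "space (gaussp I) = PiE I (\<lambda>_. UNIV)"
  by (simp add: space_PiM)

lemma distr_gaussp_component:
  assumes "i \<in> I" shows "distr (gaussp I) gauss (\<lambda>x. x i) = gauss"
  using distr_PiM_component[of I "\<lambda>_. gauss" i] prob_space_gauss assms by simp

lemma integrable_gaussp_component:
  fixes f :: "real \<Rightarrow> real"
  assumes "i \<in> I" "integrable gauss f"
  shows "integrable (gaussp I) (\<lambda>x. f (x i))" 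
  using assms integrable_distr[of "\<lambda>x. x i" "gaussp I" gauss f]
  by (simp add: distr_gaussp_component)

lemma integrable_gauss_abs: "integrable gauss (\<lambda>x. \<bar>x\<bar>)"
  using integrable_std_normal_distribution_moment[of 1] by (simp add: integrable_abs)

lemma integrable_gaussp_Lipschitz:
  fixes f :: "('i \<Rightarrow> real) \<Rightarrow> real"
  assumes I: "finite I" and [measurable]: "f \<in> borel_measurable (gaussp I)"
    and L: "\<And>x y. x \<in> space (gaussp I) \<Longrightarrow> y \<in> space (gaussp I) \<Longrightarrow> \<bar>f x - f y\<bar> \<le> C * (\<Sum>i\<in>I. \<bar>x i - y i\<bar>)"
  shows "integrable (gaussp I) f"
proof -
  interpret prob_space "gaussp I" by (rule prob_space_gaussp)
  define z where "z = (\<lambda>i\<in>I. 0::real)"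
  have z: "z \<in> space (gaussp I)" by (auto simp: z_def space_gaussp)
  show ?thesis
  proof (rule Bochner_Integration.integrable_bound)
    show "integrable (gaussp I) (\<lambda>x. \<bar>f z\<bar> + C * (\<Sum>i\<in>I. \<bar>x i\<bar>))"
      by (intro Bochner_Integration.integrable_add integrable_const Bochner_Integration.integrable_mult_right
          Bochner_Integration.integrable_sum integrable_gaussp_component[of _ _ abs] integrable_gauss_abs)
    show "AE x in gaussp I. norm (f x) \<le> norm (\<bar>f z\<bar> + C * (\<Sum>i\<in>I. \<bar>x i\<bar>))"
    proof (rule AE_I2)
      fix x assume x: "x \<in> space (gaussp I)"
      have "(\<Sum>i\<in>I. \<bar>x i - z i\<bar>) = (\<Sum>i\<in>I. \<bar>x i\<bar>)" by (intro sum.cong) (auto simp: z_def)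
      with L[OF x z] show "norm (f x) \<le> norm (\<bar>f z\<bar> + C * (\<Sum>i\<in>I. \<bar>x i\<bar>))" by auto
    qed
  qed auto
qed


lemma space_gaussp_upd:
  "x \<in> space (gaussp I) \<Longrightarrow> x(i := s) \<in> space (gaussp (insert i I))"
  by (auto simp: space_gaussp PiE_def extensional_def)

lemma continuous_on_Lipschitz_real:
  fixes h :: "real \<Rightarrow> real"
  assumes "\<And>s t. \<bar>h s - h t\<bar> \<le> C * \<bar>s - t\<bar>"
  shows "continuous_on UNIV h"
proof (rule lipschitz_on_continuous_on)
  have "0 \<le> C" using assms[of 1 0] by (metis abs_ge_zero abs_one diff_zero mult.right_neutral order_trans)
  thus "C-lipschitz_on UNIV h" by (intro lipschitz_onI) (auto simp: dist_real_def assms)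
qed

text \<open>The one-dimensional inequality is dual to Talagrand's transport inequality; in this dual
  form it tensorizes without any measurable selection.\<close>
lemma transport_gaussp:
  fixes f g :: "('i \<Rightarrow> real) \<Rightarrow> real"
  assumes I: "finite I"
    and "f \<in> borel_measurable (gaussp I)" "g \<in> borel_measurable (gaussp I)"
    and "\<And>x y. x \<in> space (gaussp I) \<Longrightarrow> y \<in> space (gaussp I) \<Longrightarrow> \<bar>f x - f y\<bar> \<le> C * (\<Sum>i\<in>I. \<bar>x i - y i\<bar>)"
    and "\<And>x y. x \<in> space (gaussp I) \<Longrightarrow> y \<in> space (gaussp I) \<Longrightarrow> \<bar>g x - g y\<bar> \<le> C * (\<Sum>i\<in>I. \<bar>x i - y i\<bar>)"
    and "\<And>x y. x \<in> space (gaussp I) \<Longrightarrow> y \<in> space (gaussp I) \<Longrightarrow> g x \<le> f y + (\<Sum>i\<in>I. (x i - y i)\<^sup>2) / 2"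
  shows "(\<integral>\<^sup>+x. ennreal (exp (g x)) \<partial>gaussp I) \<le> ennreal (exp (\<integral>x. f x \<partial>gaussp I))"
  using assms
proof (induction I arbitrary: f g rule: finite_induct)
  case empty
  interpret product_sigma_finite "\<lambda>_. gauss"
    by (intro product_sigma_finite.intro prob_space_imp_sigma_finite prob_space_gauss)
  have u: "(\<lambda>_. undefined) \<in> space (gaussp {})" by (auto simp: space_gaussp)
  from empty(5)[OF u u] show ?case
    by (simp add: PiM_empty nn_integral_count_space_finite lebesgue_integral_count_space_finite ennreal_leI)
next
  case (insert i I)
  interpret g: prob_space gauss by (rule prob_space_gauss)
  interpret product_prob_space "\<lambda>_. gauss" by (rule product_prob_space_gauss)
  note [measurable] = insert.prems(1,2)
  note i = \<open>i \<notin> I\<close> and fI = \<open>finite I\<close>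
  let ?M = "gaussp I" and ?M' = "gaussp (insert i I)"
  have upd: "x(i := s) \<in> space ?M'" if "x \<in> space ?M" for x s
    using space_gaussp_upd[OF that] .
  have C0: "0 \<le> C"
  proof -
    define z z' where "z = (\<lambda>j\<in>insert i I. 0::real)" and "z' = z(i := 1)"
    have "z \<in> space ?M'" "z' \<in> space ?M'" by (auto simp: z_def z'_def space_gaussp extensional_def PiE_def)
    from insert.prems(3)[OF this] have "0 \<le> C * (\<Sum>j\<in>insert i I. \<bar>z j - z' j\<bar>)" by linarith
    also have "(\<Sum>j\<in>insert i I. \<bar>z j - z' j\<bar>) = 1 + (\<Sum>j\<in>I. 0)"
      unfolding z_def z'_def using i fI by (subst sum.insert) (auto intro!: sum.neutral)
    finally show ?thesis by simp
  qed
  have sumupd: "(\<Sum>j\<in>insert i I. q ((x(i:=s)) j) ((y(i:=t)) j)) = q s t + (\<Sum>j\<in>I. q (x j) (y j))"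
    for q :: "real \<Rightarrow> real \<Rightarrow> real" and x y s t
    using i fI by (auto intro!: arg_cong2[where f="(+)"] sum.cong)
  have Lip: "\<bar>h (x(i:=s)) - h (y(i:=t))\<bar> \<le> C * \<bar>s - t\<bar> + C * (\<Sum>j\<in>I. \<bar>x j - y j\<bar>)"
    if "h = f \<or> h = g" "x \<in> space ?M" "y \<in> space ?M" for h x y s t
    using that(1) insert.prems(3,4)[OF upd[OF that(2)] upd[OF that(3)], of s t,
        unfolded sumupd[of "\<lambda>a b. \<bar>a - b\<bar>"] distrib_left]
    by blast
  have [measurable]: "(\<lambda>s. h (x(i := s))) \<in> borel_measurable gauss"
    if "h \<in> borel_measurable ?M'" "x \<in> space ?M" for h :: "('i \<Rightarrow> real) \<Rightarrow> real" and x
    by (rule measurable_compose[OF measurable_fun_upd[where J = I] that(1)]) (use that(2) in auto)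
  have int1: "integrable gauss (\<lambda>s. f (x(i := s)))" if x: "x \<in> space ?M" for x
  proof (rule Bochner_Integration.integrable_bound)
    show "integrable gauss (\<lambda>s. \<bar>f (x(i:=0))\<bar> + C * \<bar>s\<bar>)"
      by (intro Bochner_Integration.integrable_add g.integrable_const Bochner_Integration.integrable_mult_right integrable_gauss_abs)
    show "AE s in gauss. norm (f (x(i := s))) \<le> norm (\<bar>f (x(i:=0))\<bar> + C * \<bar>s\<bar>)"
    proof (rule AE_I2)
      fix s show "norm (f (x(i := s))) \<le> norm (\<bar>f (x(i:=0))\<bar> + C * \<bar>s\<bar>)"
        using Lip[of f x x s 0] x by auto
    qed
  qed (use x insert.prems in auto)
  \<comment> \<open>The new coordinate is integrated out linearly from f and exponentially from g.
    The pair \<open>\<phi>\<close>, \<open>\<psi>\<close> again satisfies all hypotheses, with the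
    same constant C.\<close>
  define \<phi> where "\<phi> = (\<lambda>x. \<integral>s. f (x(i := s)) \<partial>gauss)"
  define E where "E = (\<lambda>x. \<integral>\<^sup>+s. ennreal (exp (g (x(i := s)))) \<partial>gauss)"
  define \<psi> where "\<psi> = (\<lambda>x. ln (enn2real (E x)))"
  have updm[measurable]: "(\<lambda>(x,s). x(i := s)) \<in> measurable (?M \<Otimes>\<^sub>M gauss) ?M'"
    using measurable_add_dim[of i I "\<lambda>_. gauss"] by simp
  have m1[measurable]: "(\<lambda>(x,s). h (x(i := s))) \<in> borel_measurable (?M \<Otimes>\<^sub>M gauss)"
    if "h \<in> borel_measurable ?M'" for h :: "('i \<Rightarrow> real) \<Rightarrow> real"
    using measurable_comp[OF updm that] by (simp add: comp_def split_beta')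
  have \<phi>m[measurable]: "\<phi> \<in> borel_measurable ?M"
    unfolding \<phi>_def using m1[OF insert.prems(1)] by measurable
  have Em[measurable]: "E \<in> borel_measurable ?M"
    unfolding E_def using m1[OF insert.prems(2)] by measurable
  \<comment> \<open>For fixed x and y the one-dimensional inequality is applied to the slices of g
    at x and of f at y. The cost of the remaining coordinates is then a constant and is subtracted
    from g.\<close>
  have Ele: "E x \<le> ennreal (exp (\<phi> y + (\<Sum>j\<in>I. (x j - y j)\<^sup>2) / 2))"
    if x: "x \<in> space ?M" and y: "y \<in> space ?M" for x y
  proof -
    let ?d = "(\<Sum>j\<in>I. (x j - y j)\<^sup>2) / 2"
    have "(\<integral>\<^sup>+s. ennreal (exp (g (x(i := s)) - ?d)) \<partial>gauss) \<le> ennreal (exp (\<phi> y))"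
      unfolding \<phi>_def
    proof (rule transport_gauss)
      show "continuous_on UNIV (\<lambda>s. g (x(i := s)) - ?d)"
        by (rule continuous_on_Lipschitz_real[of _ C]) (use Lip[of g x x] x in auto)
      show "integrable gauss (\<lambda>s. f (y(i := s)))" by (rule int1[OF y])
      show "g (x(i := s)) - ?d \<le> f (y(i := t)) + (s - t)\<^sup>2 / 2" for s t
        using insert.prems(5)[OF upd[OF x] upd[OF y], of s t, unfolded sumupd[of "\<lambda>a b. (a - b)\<^sup>2"]]
        by argo
    qed
    also have "(\<integral>\<^sup>+s. ennreal (exp (g (x(i := s)) - ?d)) \<partial>gauss) = ennreal (exp (- ?d)) * E x"
    proof -
      have "ennreal (exp (g (x(i := s)) - ?d)) = ennreal (exp (- ?d)) * ennreal (exp (g (x(i := s))))" for s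
        by (simp add: ennreal_mult'[symmetric] exp_add[symmetric])
      thus ?thesis unfolding E_def using x insert.prems(2)
        by (simp only:) (rule nn_integral_cmult, measurable)
    qed
    finally have "ennreal (exp ?d) * (ennreal (exp (- ?d)) * E x) \<le> ennreal (exp ?d) * ennreal (exp (\<phi> y))"
      by (intro mult_left_mono) auto
    thus ?thesis
      by (simp add: mult.assoc[symmetric] ennreal_mult'[symmetric] exp_add[symmetric] add.commute)
  qed
  have Efin: "E x < \<infinity>" if "x \<in> space ?M" for x
    using Ele[OF that that] by (simp add: order_le_less_trans)
  have Epos: "0 < E x" if x: "x \<in> space ?M" for x
  proof -
    have "E x \<noteq> 0"
    proof
      assume "E x = 0"
      hence "AE s in gauss. ennreal (exp (g (x(i := s)))) = 0"
        unfolding E_def using x insert.prems(2) by (subst (asm) nn_integral_0_iff_AE) auto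
      hence "AE s in gauss. False" by eventually_elim (simp add: ennreal_eq_0_iff not_le[symmetric])
      thus False by simp
    qed
    thus ?thesis by (simp add: zero_less_iff_neq_zero)
  qed
  have E\<psi>: "E x = ennreal (exp (\<psi> x))" if "x \<in> space ?M" for x
    using Efin[OF that] Epos[OF that] unfolding \<psi>_def
    by (simp add: enn2real_positive_iff)
  have "(\<integral>\<^sup>+x. ennreal (exp (g x)) \<partial>?M') = (\<integral>\<^sup>+x. E x \<partial>?M)"
    unfolding E_def by (rule product_nn_integral_insert[OF fI i]) measurable
  also have "\<dots> = (\<integral>\<^sup>+x. ennreal (exp (\<psi> x)) \<partial>?M)"
    by (intro nn_integral_cong E\<psi>)
  also have "\<dots> \<le> ennreal (exp (\<integral>x. \<phi> x \<partial>?M))"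
  proof (rule insert.IH)
    show "\<psi> \<in> borel_measurable ?M" unfolding \<psi>_def by measurable
    fix x y assume x: "x \<in> space ?M" and y: "y \<in> space ?M"
    have "\<bar>\<phi> x - \<phi> y\<bar> = \<bar>\<integral>s. f (x(i := s)) - f (y(i := s)) \<partial>gauss\<bar>"
      unfolding \<phi>_def using int1[OF x] int1[OF y] by simp
    also have "\<dots> \<le> (\<integral>s. C * (\<Sum>j\<in>I. \<bar>x j - y j\<bar>) \<partial>gauss)"
      by (rule integral_abs_bound_integral[OF Bochner_Integration.integrable_diff[OF int1[OF x] int1[OF y]] g.integrable_const])
         (use Lip[of f x y s s for s] x y in auto)
    finally show "\<bar>\<phi> x - \<phi> y\<bar> \<le> C * (\<Sum>j\<in>I. \<bar>x j - y j\<bar>)"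
      using g.prob_space by simp
    \<comment> \<open>Raising g by a constant multiplies E by the exponential of that constant, so
      the Lipschitz bound survives the logarithm.\<close>
    have half: "\<psi> x \<le> \<psi> y + C * (\<Sum>j\<in>I. \<bar>x j - y j\<bar>)" if x: "x \<in> space ?M" and y: "y \<in> space ?M" for x y
    proof -
      let ?d = "C * (\<Sum>j\<in>I. \<bar>x j - y j\<bar>)"
      have "E x \<le> (\<integral>\<^sup>+s. ennreal (exp ?d) * ennreal (exp (g (y(i := s)))) \<partial>gauss)"
        unfolding E_def
      proof (rule nn_integral_mono)
        fix s
        have "g (x(i := s)) \<le> ?d + g (y(i := s))" using Lip[of g x y s s] x y by auto
        thus "ennreal (exp (g (x(i := s)))) \<le> ennreal (exp ?d) * ennreal (exp (g (y(i := s))))"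
          by (simp add: ennreal_mult'[symmetric] exp_add[symmetric])
      qed
      also have "\<dots> = ennreal (exp ?d) * E y"
        unfolding E_def using y insert.prems(2) by (intro nn_integral_cmult) auto
      finally show ?thesis
        by (simp add: E\<psi>[OF x] E\<psi>[OF y] ennreal_mult'[symmetric] exp_add[symmetric] add.commute)
    qed
    show "\<bar>\<psi> x - \<psi> y\<bar> \<le> C * (\<Sum>j\<in>I. \<bar>x j - y j\<bar>)"
      using half[OF x y] half[OF y x] by (simp add: abs_minus_commute[of "y _"] abs_le_iff)
    show "\<psi> x \<le> \<phi> y + (\<Sum>j\<in>I. (x j - y j)\<^sup>2) / 2"
      using Ele[OF x y] by (simp add: E\<psi>[OF x])
  qed (use \<phi>m in auto)
  also have "(\<integral>x. \<phi> x \<partial>?M) = (\<integral>x. f x \<partial>?M')"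
    unfolding \<phi>_def
    by (rule product_integral_insert[OF fI i, symmetric])
       (rule integrable_gaussp_Lipschitz[OF _ insert.prems(1) insert.prems(3)], use fI in auto)
  finally show ?case .
qed

text \<open>The tilt \<open>a = u / L\<close> makes \<open>a * F\<close> u-Lipschitz, and
  \<open>u * r \<le> u\<^sup>2 / 2 + r\<^sup>2 / 2\<close> turns this into the quadratic cost
  between \<open>a * F - u\<^sup>2 / 2\<close> and \<open>a * F\<close>. The transport inequality
  bounds the exponential moment, and Markov's inequality finishes without loss in the
  exponent.\<close>

theorem gauss_concentration:
  fixes F :: "('i \<Rightarrow> real) \<Rightarrow> real"
  assumes I: "finite I" and F[measurable]: "F \<in> borel_measurable (gaussp I)"
    and L: "0 \<le> L" "\<And>x y. x \<in> space (gaussp I) \<Longrightarrow> y \<in> space (gaussp I) \<Longrightarrow>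
        \<bar>F x - F y\<bar> \<le> L * sqrt (\<Sum>i\<in>I. (x i - y i)\<^sup>2)"
    and u: "0 \<le> u"
  shows "integrable (gaussp I) F"
    and "measure (gaussp I) {x \<in> space (gaussp I). (\<integral>x. F x \<partial>gaussp I) + L * u < F x} \<le> exp (- u\<^sup>2 / 2)"
proof -
  let ?M = "gaussp I"
  interpret prob_space ?M by (rule prob_space_gaussp)
  have l1: "sqrt (\<Sum>i\<in>I. (x i - y i)\<^sup>2) \<le> (\<Sum>i\<in>I. \<bar>x i - y i\<bar>)" for x y :: "'i \<Rightarrow> real"
    using L2_set_le_sum_abs[of "\<lambda>i. x i - y i" I] by (simp add: L2_set_def)
  have Lip: "\<bar>F x - F y\<bar> \<le> L * (\<Sum>i\<in>I. \<bar>x i - y i\<bar>)" if "x \<in> space ?M" "y \<in> space ?M" for x y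
    using L(2)[OF that] mult_left_mono[OF l1[of x y] L(1)] by linarith
  show int: "integrable ?M F" by (rule integrable_gaussp_Lipschitz[OF I F Lip])
  show "measure ?M {x \<in> space ?M. (\<integral>x. F x \<partial>?M) + L * u < F x} \<le> exp (- u\<^sup>2 / 2)"
  \<comment> \<open>The tilt needs a positive L. For L = 0 the function is constant, and the strict
    inequality makes the event empty.\<close>
  proof (cases "L = 0")
    case True
    obtain z where z: "z \<in> space ?M" using not_empty by blast
    have const: "F x = F z" if "x \<in> space ?M" for x using L(2)[OF that z] True by simp
    have "(\<integral>x. F x \<partial>?M) = (\<integral>x. F z \<partial>?M)" by (intro Bochner_Integration.integral_cong) (auto simp: const)
    hence "(\<integral>x. F x \<partial>?M) = F z" by (simp add: prob_space)
    hence e: "{x \<in> space ?M. (\<integral>x. F x \<partial>?M) + L * u < F x} = {}" using True const by auto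
    show ?thesis unfolding e by simp
  next
    case False
    hence Lpos: "0 < L" using L(1) by simp
    define a where "a = u / L"
    have a: "0 \<le> a" using u Lpos by (simp add: a_def)
    let ?m = "\<integral>x. F x \<partial>?M"
    have "(\<integral>\<^sup>+x. ennreal (exp (a * F x - u\<^sup>2 / 2)) \<partial>?M) \<le> ennreal (exp (\<integral>x. a * F x \<partial>?M))"
    proof (rule transport_gaussp[OF I, where C = "a * L"])
      fix x y assume x: "x \<in> space ?M" and y: "y \<in> space ?M"
      have *: "\<bar>a * F x - a * F y\<bar> \<le> a * L * (\<Sum>i\<in>I. \<bar>x i - y i\<bar>)"
        using mult_left_mono[OF Lip[OF x y] a] a by (simp add: abs_mult right_diff_distrib[symmetric] mult.assoc)
      thus "\<bar>a * F x - a * F y\<bar> \<le> a * L * (\<Sum>i\<in>I. \<bar>x i - y i\<bar>)" .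
      from * show "\<bar>(a * F x - u\<^sup>2 / 2) - (a * F y - u\<^sup>2 / 2)\<bar> \<le> a * L * (\<Sum>i\<in>I. \<bar>x i - y i\<bar>)" by simp
      let ?r = "sqrt (\<Sum>i\<in>I. (x i - y i)\<^sup>2)"
      have "a * F x - a * F y \<le> a * (L * ?r)"
        using mult_left_mono[OF L(2)[OF x y] a] a
        by (metis abs_ge_self abs_mult abs_of_nonneg order_trans right_diff_distrib)
      also have "\<dots> = u * ?r" using Lpos by (simp add: a_def)
      also have "\<dots> \<le> u\<^sup>2 / 2 + ?r\<^sup>2 / 2"
        using sum_squares_bound[of u ?r] by simp
      also have "?r\<^sup>2 = (\<Sum>i\<in>I. (x i - y i)\<^sup>2)" by (simp add: sum_nonneg)
      finally show "a * F x - u\<^sup>2 / 2 \<le> a * F y + (\<Sum>i\<in>I. (x i - y i)\<^sup>2) / 2" by linarith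
    qed auto
    hence E: "(\<integral>\<^sup>+x. ennreal (exp (a * F x - u\<^sup>2 / 2)) \<partial>?M) \<le> ennreal (exp (a * ?m))"
      using int by simp
    have "emeasure ?M {x \<in> space ?M. ?m + L * u < F x} \<le>
        emeasure ?M {x \<in> space ?M. 1 \<le> ennreal (exp (- a * ?m - u\<^sup>2 / 2)) * ennreal (exp (a * F x - u\<^sup>2 / 2))}"
    proof (rule emeasure_mono)
      show "{x \<in> space ?M. ?m + L * u < F x} \<subseteq> {x \<in> space ?M. 1 \<le> ennreal (exp (- a * ?m - u\<^sup>2 / 2)) * ennreal (exp (a * F x - u\<^sup>2 / 2))}"
      proof safe
        fix x assume "?m + L * u < F x"
        hence "a * (?m + L * u) \<le> a * F x" using a by (intro mult_left_mono) auto
        also have "a * (?m + L * u) = a * ?m + u\<^sup>2" using Lpos by (simp add: a_def field_simps power2_eq_square)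
        finally show "1 \<le> ennreal (exp (- a * ?m - u\<^sup>2 / 2)) * ennreal (exp (a * F x - u\<^sup>2 / 2))"
          by (simp add: ennreal_mult'[symmetric] exp_add[symmetric])
      qed
    qed measurable
    also have "\<dots> \<le> ennreal (exp (- a * ?m - u\<^sup>2 / 2)) * (\<integral>\<^sup>+x. ennreal (exp (a * F x - u\<^sup>2 / 2)) \<partial>?M)"
    proof -
      have "(\<integral>\<^sup>+x. ennreal (exp (a * F x - u\<^sup>2 / 2)) * indicator (space ?M) x \<partial>?M) =
          (\<integral>\<^sup>+x. ennreal (exp (a * F x - u\<^sup>2 / 2)) \<partial>?M)"
        by (intro nn_integral_cong) auto
      with nn_integral_Markov_inequality[where A = "space ?M" and M = ?M and u = "\<lambda>x. ennreal (exp (a * F x - u\<^sup>2 / 2))" and c = "ennreal (exp (- a * ?m - u\<^sup>2 / 2))"]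
      show ?thesis by (simp add: Int_def)
    qed
    also have "\<dots> \<le> ennreal (exp (- a * ?m - u\<^sup>2 / 2)) * ennreal (exp (a * ?m))"
      by (intro mult_left_mono E) auto
    also have "\<dots> = ennreal (exp (- u\<^sup>2 / 2))"
      by (simp add: ennreal_mult'[symmetric] exp_add[symmetric])
    finally show ?thesis by (simp add: emeasure_eq_measure)
  qed
qed

section \<open>Characterization of Gaussian laws\<close>

text \<open>After normalization the weights are probability densities and Levy's uniqueness theorem
  applies to the laws of X and Y under them. The value s = 0 in the hypothesis shows that both
  weights have the same total mass; if that mass is 0, both sides vanish.\<close>

lemma Levy_weighted:
  fixes X :: "'a \<Rightarrow> real" and Y :: "'b \<Rightarrow> real" and w :: "'a \<Rightarrow> real" and v :: "'b \<Rightarrow> real"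
  assumes M: "prob_space M" and N: "prob_space N"
    and [measurable]: "X \<in> borel_measurable M" "w \<in> borel_measurable M"
      "Y \<in> borel_measurable N" "v \<in> borel_measurable N"
    and w: "\<And>x. 0 \<le> w x" "\<And>x. w x \<le> K" and v: "\<And>x. 0 \<le> v x" "\<And>x. v x \<le> K"
    and eq: "\<And>s. (CLINT x|M. w x * iexp (s * X x)) = (CLINT y|N. v y * iexp (s * Y y))"
    and B[measurable]: "B \<in> sets borel"
  shows "(\<integral>x. w x * indicator B (X x) \<partial>M) = (\<integral>y. v y * indicator B (Y y) \<partial>N)"
proof -
  interpret M: prob_space M by fact
  interpret N: prob_space N by fact
  have iw: "integrable M w" by (rule M.integrable_const_bound[of _ K]) (use w in auto)
  have iv: "integrable N v" by (rule N.integrable_const_bound[of _ K]) (use v in auto)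
  define c where "c = (\<integral>x. w x \<partial>M)"
  have "complex_of_real c = complex_of_real (\<integral>y. v y \<partial>N)"
    using eq[of 0] by (simp add: c_def)
  hence c': "c = (\<integral>y. v y \<partial>N)" by (simp only: of_real_eq_iff)
  have cnn: "0 \<le> c" unfolding c_def using w by simp
  show ?thesis
  proof (cases "c = 0")
    case True
    have "AE x in M. w x = 0"
      using True integral_nonneg_eq_0_iff_AE[OF iw] w unfolding c_def by auto
    hence "(\<integral>x. w x * indicator B (X x) \<partial>M) = (\<integral>x. 0 \<partial>M)"
      by (intro integral_cong_AE) auto
    moreover have "AE y in N. v y = 0"
      using True integral_nonneg_eq_0_iff_AE[OF iv] v unfolding c' by auto
    hence "(\<integral>y. v y * indicator B (Y y) \<partial>N) = (\<integral>x. 0 \<partial>N)"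
      by (intro integral_cong_AE) auto
    ultimately show ?thesis by simp
  next
    case False
    hence cpos: "0 < c" using cnn by simp
    define M' where "M' = density M (\<lambda>x. ennreal (w x / c))"
    define N' where "N' = density N (\<lambda>x. ennreal (v x / c))"
    have pM: "prob_space M'"
    proof
      have "emeasure M' (space M') = (\<integral>\<^sup>+x. ennreal (w x / c) \<partial>M)"
        unfolding M'_def by (simp add: emeasure_density cong: nn_integral_cong)
      also have "\<dots> = ennreal (\<integral>x. w x / c \<partial>M)"
        by (rule nn_integral_eq_integral) (use iw w cpos in auto)
      also have "\<dots> = 1" using cpos by (simp add: c_def)
      finally show "emeasure M' (space M') = 1" .
    qed
    have pN: "prob_space N'"
    proof
      have "emeasure N' (space N') = (\<integral>\<^sup>+x. ennreal (v x / c) \<partial>N)"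
        unfolding N'_def by (simp add: emeasure_density cong: nn_integral_cong)
      also have "\<dots> = ennreal (\<integral>x. v x / c \<partial>N)"
        by (rule nn_integral_eq_integral) (use iv v cpos in auto)
      also have "\<dots> = 1" using cpos by (simp add: c')
      finally show "emeasure N' (space N') = 1" .
    qed
    have [measurable]: "X \<in> borel_measurable M'" "Y \<in> borel_measurable N'"
      by (simp_all add: M'_def N'_def)
    have rM: "real_distribution (distr M' borel X)" by (intro prob_space.real_distribution_distr pM) auto
    have rN: "real_distribution (distr N' borel Y)" by (intro prob_space.real_distribution_distr pN) auto
    have "distr M' borel X = distr N' borel Y"
    proof (rule Levy_uniqueness[OF rM rN], rule ext)
      fix t
      have "char (distr M' borel X) t = (CLINT x|M. (w x / c) *\<^sub>R iexp (t * X x))"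
        unfolding char_def by (subst integral_distr) (auto simp: M'_def integral_density w cpos less_imp_le)
      also have "\<dots> = (CLINT x|M. w x * iexp (t * X x)) / c"
        by (simp add: scaleR_conv_of_real flip: Bochner_Integration.integral_divide_zero)
      also have "\<dots> = (CLINT x|N. v x * iexp (t * Y x)) / c" by (simp only: eq)
      also have "\<dots> = (CLINT x|N. (v x / c) *\<^sub>R iexp (t * Y x))"
        by (simp add: scaleR_conv_of_real flip: Bochner_Integration.integral_divide_zero)
      also have "\<dots> = char (distr N' borel Y) t"
        unfolding char_def by (subst integral_distr) (auto simp: N'_def integral_density v cpos less_imp_le)
      finally show "char (distr M' borel X) t = char (distr N' borel Y) t" .
    qed
    hence "(\<integral>x. indicat_real B x \<partial>distr M' borel X) = (\<integral>x. indicat_real B x \<partial>distr N' borel Y)" by (simp only:)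
    moreover have "(\<integral>x. indicat_real B x \<partial>distr M' borel X) = (\<integral>x. (w x / c) *\<^sub>R indicat_real B (X x) \<partial>M)"
      by (subst integral_distr) (auto simp: M'_def integral_density w cpos less_imp_le)
    moreover have "(\<integral>x. indicat_real B x \<partial>distr N' borel Y) = (\<integral>x. (v x / c) *\<^sub>R indicat_real B (Y x) \<partial>N)"
      by (subst integral_distr) (auto simp: N'_def integral_density v cpos less_imp_le)
    ultimately have "(\<integral>x. (w x / c) *\<^sub>R indicat_real B (X x) \<partial>M) = (\<integral>x. (v x / c) *\<^sub>R indicat_real B (Y x) \<partial>N)"
      by (simp only:)
    hence "(\<integral>x. w x * indicat_real B (X x) \<partial>M) / c = (\<integral>x. v x * indicat_real B (Y x) \<partial>N) / c"
      by (simp flip: Bochner_Integration.integral_divide_zero)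
    thus ?thesis using cpos by simp
  qed
qed

lemma integrable_bounded_iexp:
  fixes a :: "'a \<Rightarrow> real" and w :: "'a \<Rightarrow> real"
  assumes "prob_space M" and [measurable]: "a \<in> borel_measurable M" "w \<in> borel_measurable M"
    and w: "\<And>x. \<bar>w x\<bar> \<le> K"
  shows "integrable M (\<lambda>x. complex_of_real (w x) * iexp (a x))"
proof -
  interpret prob_space M by fact
  show ?thesis
    by (rule integrable_const_bound[of _ K]) (use w in \<open>auto simp: norm_mult\<close>)
qed

text \<open>The induction replaces the complex exponentials by indicators one coordinate at a time.
  The remaining oscillating factor is turned into the nonnegative weights
  1, 1 + cos and 1 + sin, to which the one-dimensional uniqueness theorem applies.\<close>
lemma char_rectangles:
  fixes I :: "'i set"
  assumes M: "prob_space M" and N: "prob_space N"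
    and X[measurable]: "\<And>i. i \<in> I \<Longrightarrow> (\<lambda>x. X x i) \<in> borel_measurable M"
    and Y[measurable]: "\<And>i. i \<in> I \<Longrightarrow> (\<lambda>x. Y x i) \<in> borel_measurable N"
    and J: "finite J" "J \<subseteq> I" and I: "finite I"
    and B: "\<And>i. i \<in> J \<Longrightarrow> B i \<in> sets borel"
    and eq: "\<And>v :: 'i \<Rightarrow> real. (CLINT x|M. iexp (\<Sum>i\<in>I. v i * X x i)) = (CLINT y|N. iexp (\<Sum>i\<in>I. v i * Y y i))"
  shows "(CLINT x|M. complex_of_real (\<Prod>i\<in>J. indicat_real (B i) (X x i)) * iexp (\<Sum>i\<in>I. v i * X x i)) =
    (CLINT y|N. complex_of_real (\<Prod>i\<in>J. indicat_real (B i) (Y y i)) * iexp (\<Sum>i\<in>I. v i * Y y i))"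
  using J B
proof (induction J arbitrary: v rule: finite_induct)
  case empty
  show ?case using eq[of v] by simp
next
  case (insert j J)
  hence jI: "j \<in> I" and JI: "J \<subseteq> I" and Bj[measurable]: "B j \<in> sets borel"
    and BJ: "\<And>i. i \<in> J \<Longrightarrow> B i \<in> sets borel" by auto
  have IH: "(CLINT x|M. complex_of_real (\<Prod>i\<in>J. indicat_real (B i) (X x i)) * iexp (\<Sum>i\<in>I. u i * X x i)) =
    (CLINT y|N. complex_of_real (\<Prod>i\<in>J. indicat_real (B i) (Y y i)) * iexp (\<Sum>i\<in>I. u i * Y y i))" for u
    by (rule insert.IH[OF JI BJ])
  define P where "P = (\<lambda>z :: 'i \<Rightarrow> real. \<Prod>i\<in>J. indicat_real (B i) (z i))"
  define a where "a = (\<lambda>z :: 'i \<Rightarrow> real. \<Sum>i\<in>I. v i * z i)"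
  have P01: "0 \<le> P z" "P z \<le> 1" "\<bar>P z\<bar> \<le> 1" for z
  proof -
    show "0 \<le> P z" unfolding P_def by (intro prod_nonneg) auto
    moreover show "P z \<le> 1" unfolding P_def by (intro prod_le_1) auto
    ultimately show "\<bar>P z\<bar> \<le> 1" by simp
  qed
  \<comment> \<open>The extra phase in coordinate j is absorbed into the coefficients of the linear
    form, so the induction hypothesis covers it. The parameter r takes the values 0, 1 and -1, the
    phases into which \<open>trig\<close> expands a weight.\<close>
  have gen: "(CLINT x|Q. complex_of_real (P (Z x)) * iexp (s * Z x j) * iexp (r * a (Z x))) =
     (CLINT x|Q. complex_of_real (\<Prod>i\<in>J. indicat_real (B i) (Z x i)) * iexp (\<Sum>i\<in>I. (r * v i + (if i = j then s else 0)) * Z x i))"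
    for r s and Q :: "'q measure" and Z
  proof -
    have "(\<Sum>i\<in>I. (r * v i + (if i = j then s else 0)) * z i) = s * z j + r * a z" for z :: "'i \<Rightarrow> real"
    proof -
      have "(\<Sum>i\<in>I. (r * v i + (if i = j then s else 0)) * z i) = (\<Sum>i\<in>I. r * (v i * z i) + (if i = j then s * z i else 0))"
        by (intro sum.cong) (auto simp: algebra_simps)
      also have "\<dots> = r * a z + s * z j"
        using I jI by (simp add: sum.distrib sum.delta a_def sum_distrib_left)
      finally show ?thesis by simp
    qed
    thus ?thesis unfolding P_def
      by (intro Bochner_Integration.integral_cong) (auto simp: exp_add[symmetric] distrib_left mult.assoc)
  qed
  have E: "(CLINT x|M. complex_of_real (P (X x)) * iexp (s * X x j) * iexp (r * a (X x))) =
      (CLINT y|N. complex_of_real (P (Y y)) * iexp (s * Y y j) * iexp (r * a (Y y)))" for s r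
    unfolding gen by (rule IH)
  have [measurable]: "(\<lambda>x. a (X x)) \<in> borel_measurable M" "(\<lambda>x. a (Y x)) \<in> borel_measurable N"
    unfolding a_def by measurable
  have [measurable]: "(\<lambda>x. P (X x)) \<in> borel_measurable M" "(\<lambda>x. P (Y x)) \<in> borel_measurable N"
    unfolding P_def using BJ JI by (auto intro!: borel_measurable_prod borel_measurable_indicator' simp: subset_iff)
  have [measurable]: "(\<lambda>x. X x j) \<in> borel_measurable M" "(\<lambda>x. Y x j) \<in> borel_measurable N"
    using jI by auto
  have intM: "integrable M (\<lambda>x. complex_of_real (P (X x)) * iexp (s * X x j) * iexp (r * a (X x)))" for s r
    using integrable_bounded_iexp[OF M, of "\<lambda>x. s * X x j + r * a (X x)" "\<lambda>x. P (X x)" 1] P01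
    by (simp add: exp_add distrib_left mult.assoc)
  have intN: "integrable N (\<lambda>x. complex_of_real (P (Y x)) * iexp (s * Y x j) * iexp (r * a (Y x)))" for s r
    using integrable_bounded_iexp[OF N, of "\<lambda>x. s * Y x j + r * a (Y x)" "\<lambda>x. P (Y x)" 1] P01
    by (simp add: exp_add distrib_left mult.assoc)
  have trig: "complex_of_real (p * (\<alpha> + \<beta> * cos b + \<gamma> * sin b)) * z =
     \<alpha> * (complex_of_real p * z * iexp (0 * b))
     + (\<beta> - \<i> * \<gamma>) / 2 * (complex_of_real p * z * iexp (1 * b))
     + (\<beta> + \<i> * \<gamma>) / 2 * (complex_of_real p * z * iexp (-1 * b))"
    for \<alpha> \<beta> \<gamma> p b :: real and z
    by (simp add: complex_eq_iff Re_exp Im_exp field_simps)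
  \<comment> \<open>Only a bracket with values in \<open>{0..2}\<close> can serve as a weight. The
    triples 1, 0, 0 and 1, 1, 0 and 1, 0, 1 are used.\<close>
  have wt: "(\<integral>x. P (X x) * (\<alpha> + \<beta> * cos (a (X x)) + \<gamma> * sin (a (X x))) * indicator (B j) (X x j) \<partial>M) =
        (\<integral>x. P (Y x) * (\<alpha> + \<beta> * cos (a (Y x)) + \<gamma> * sin (a (Y x))) * indicator (B j) (Y x j) \<partial>N)"
    if pos: "\<And>b. 0 \<le> \<alpha> + \<beta> * cos b + \<gamma> * sin b" "\<And>b. \<alpha> + \<beta> * cos b + \<gamma> * sin b \<le> 2" for \<alpha> \<beta> \<gamma>
  proof (rule Levy_weighted[OF M N, where K = 2])
    fix s
    show "(CLINT x|M. complex_of_real (P (X x) * (\<alpha> + \<beta> * cos (a (X x)) + \<gamma> * sin (a (X x)))) * iexp (s * X x j)) =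
      (CLINT x|N. complex_of_real (P (Y x) * (\<alpha> + \<beta> * cos (a (Y x)) + \<gamma> * sin (a (Y x)))) * iexp (s * Y x j))"
      unfolding trig
      by (simp only: Bochner_Integration.integral_add Bochner_Integration.integral_mult_right_zero E
          Bochner_Integration.integrable_add integrable_mult_right intM intN)
  next
    show "P (X x) * (\<alpha> + \<beta> * cos (a (X x)) + \<gamma> * sin (a (X x))) \<le> 2" for x
      using mult_mono[OF P01(2) pos(2)] P01 pos by auto
    show "P (Y x) * (\<alpha> + \<beta> * cos (a (Y x)) + \<gamma> * sin (a (Y x))) \<le> 2" for x
      using mult_mono[OF P01(2) pos(2)] P01 pos by auto
  qed (use P01 pos in auto)
  define Q where "Q = (\<lambda>z. P z * indicat_real (B j) (z j))"
  have Q1: "\<bar>Q z\<bar> \<le> 1" for z using P01[of z] by (auto simp: Q_def indicator_def)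
  have [measurable]: "(\<lambda>x. Q (X x)) \<in> borel_measurable M" "(\<lambda>x. Q (Y x)) \<in> borel_measurable N"
    unfolding Q_def by measurable
  have wt1: "(\<integral>x. Q (X x) * 1 \<partial>M) = (\<integral>x. Q (Y x) * 1 \<partial>N)"
    using wt[of 1 0 0] by (simp add: Q_def mult_ac)
  have cos1: "0 \<le> 1 + cos b" for b :: real using cos_ge_minus_one[of b] by linarith
  have sin1: "0 \<le> 1 + sin b" for b :: real using sin_ge_minus_one[of b] by linarith
  have wt2: "(\<integral>x. Q (X x) * (1 + cos (a (X x))) \<partial>M) = (\<integral>x. Q (Y x) * (1 + cos (a (Y x))) \<partial>N)"
    using wt[of 1 1 0] cos1 by (simp add: Q_def mult_ac)
  have wt3: "(\<integral>x. Q (X x) * (1 + sin (a (X x))) \<partial>M) = (\<integral>x. Q (Y x) * (1 + sin (a (Y x))) \<partial>N)"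
    using wt[of 1 0 1] sin1 by (simp add: Q_def mult_ac)
  interpret M: prob_space M by fact
  interpret N: prob_space N by fact
  have bd: "\<bar>Q z * b\<bar> \<le> 1" if "\<bar>b\<bar> \<le> 1" for z b
    using mult_mono[OF Q1[of z] that] by (simp add: abs_mult)
  have iM: "integrable M (\<lambda>x. Q (X x))" "integrable M (\<lambda>x. Q (X x) * cos (a (X x)))" "integrable M (\<lambda>x. Q (X x) * sin (a (X x)))"
    by (rule M.integrable_const_bound[of _ 1]; use Q1 bd in auto)+
  have iN: "integrable N (\<lambda>x. Q (Y x))" "integrable N (\<lambda>x. Q (Y x) * cos (a (Y x)))" "integrable N (\<lambda>x. Q (Y x) * sin (a (Y x)))"
    by (rule N.integrable_const_bound[of _ 1]; use Q1 bd in auto)+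
  \<comment> \<open>Subtracting the identity for the constant weight isolates the cosine, and
    likewise the sine below; together they restore the complex exponential.\<close>
  have c: "(\<integral>x. Q (X x) * cos (a (X x)) \<partial>M) = (\<integral>x. Q (Y x) * cos (a (Y x)) \<partial>N)"
    using wt1 wt2 iM iN by (simp add: distrib_left)
  have s: "(\<integral>x. Q (X x) * sin (a (X x)) \<partial>M) = (\<integral>x. Q (Y x) * sin (a (Y x)) \<partial>N)"
    using wt1 wt3 iM iN by (simp add: distrib_left)
  have split: "(CLINT x|R. complex_of_real (Q (Z x)) * iexp (a (Z x))) =
      complex_of_real (\<integral>x. Q (Z x) * cos (a (Z x)) \<partial>R) + \<i> * complex_of_real (\<integral>x. Q (Z x) * sin (a (Z x)) \<partial>R)"
    if "integrable R (\<lambda>x. Q (Z x) * cos (a (Z x)))" "integrable R (\<lambda>x. Q (Z x) * sin (a (Z x)))"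
    for R :: "'q measure" and Z
  proof -
    have "complex_of_real (Q z) * iexp (a z) = complex_of_real (Q z * cos (a z)) + \<i> * complex_of_real (Q z * sin (a z))" for z
      by (simp add: cis_conv_exp[symmetric] complex_eq_iff)
    thus ?thesis using that by (simp del: of_real_mult)
  qed
  have prd: "(\<Prod>i\<in>insert j J. indicat_real (B i) (z i)) = Q z" for z
    using insert.hyps by (simp add: Q_def P_def mult.commute)
  have "(CLINT x|M. complex_of_real (Q (X x)) * iexp (a (X x))) = (CLINT y|N. complex_of_real (Q (Y y)) * iexp (a (Y y)))"
    by (simp only: split[OF iM(2,3)] split[OF iN(2,3)] c s)
  thus ?case by (simp only: prd a_def)
qed

text \<open>With all coordinates replaced by indicators and v = 0, \<open>char_rectangles\<close>
  equates the probabilities of boxes, and these determine a probability measure on the finite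
  product.\<close>

lemma distr_PiM_eq_char:
  fixes I :: "'i set"
  assumes M: "prob_space M" and N: "prob_space N" and I: "finite I"
    and X: "X \<in> measurable M (PiM I (\<lambda>_. borel))" and Y: "Y \<in> measurable N (PiM I (\<lambda>_. borel))"
    and eq: "\<And>v :: 'i \<Rightarrow> real. (CLINT x|M. iexp (\<Sum>i\<in>I. v i * X x i)) = (CLINT y|N. iexp (\<Sum>i\<in>I. v i * Y y i))"
  shows "distr M (PiM I (\<lambda>_. borel)) X = distr N (PiM I (\<lambda>_. borel)) Y"
proof (rule measure_eqI_PiM_finite[OF I])
  interpret M: prob_space M by fact
  interpret N: prob_space N by fact
  have Xi: "(\<lambda>x. X x i) \<in> borel_measurable M" if "i \<in> I" for i
    using measurable_compose[OF X measurable_component_singleton[OF that]] by simp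
  have Yi: "(\<lambda>x. Y x i) \<in> borel_measurable N" if "i \<in> I" for i
    using measurable_compose[OF Y measurable_component_singleton[OF that]] by simp
  show "emeasure (distr M (PiM I (\<lambda>_. borel)) X) (Pi\<^sub>E I A) = emeasure (distr N (PiM I (\<lambda>_. borel)) Y) (Pi\<^sub>E I A)"
    if A: "\<And>i. i \<in> I \<Longrightarrow> A i \<in> sets borel" for A
  proof -
    have AE: "Pi\<^sub>E I A \<in> sets (PiM I (\<lambda>_. borel :: real measure))"
      using A I by (intro sets_PiM_I_finite) auto
    have gen: "measure (distr Q (PiM I (\<lambda>_. borel)) Z) (Pi\<^sub>E I A) = (\<integral>x. (\<Prod>i\<in>I. indicat_real (A i) (Z x i)) \<partial>Q)"
      if Q: "prob_space Q" and Z: "Z \<in> measurable Q (PiM I (\<lambda>_. borel))" for Q :: "'q measure" and Z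
    proof -
      interpret Q: prob_space Q by fact
      have "measure (distr Q (PiM I (\<lambda>_. borel)) Z) (Pi\<^sub>E I A) = (\<integral>x. indicat_real (Pi\<^sub>E I A) (Z x) \<partial>Q)"
        using AE Z by (subst integral_distr[symmetric, where g = Z]) auto
      also have "\<dots> = (\<integral>x. (\<Prod>i\<in>I. indicat_real (A i) (Z x i)) \<partial>Q)"
      proof (intro Bochner_Integration.integral_cong refl)
        fix x assume "x \<in> space Q"
        hence zx: "Z x \<in> extensional I" using measurable_space[OF Z] by (auto simp: space_PiM PiE_def)
        show "indicat_real (Pi\<^sub>E I A) (Z x) = (\<Prod>i\<in>I. indicat_real (A i) (Z x i))"
        proof (cases "\<forall>i\<in>I. Z x i \<in> A i")
          case True
          thus ?thesis using zx by (simp add: PiE_def Pi_def)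
        next
          case False
          then obtain i where "i \<in> I" "Z x i \<notin> A i" by auto
          hence "(\<Prod>i\<in>I. indicat_real (A i) (Z x i)) = 0" "Z x \<notin> Pi\<^sub>E I A"
            using I by (auto intro!: prod_zero bexI[of _ i])
          thus ?thesis by simp
        qed
      qed
      finally show ?thesis .
    qed
    have "complex_of_real (\<integral>x. (\<Prod>i\<in>I. indicat_real (A i) (X x i)) \<partial>M) = complex_of_real (\<integral>x. (\<Prod>i\<in>I. indicat_real (A i) (Y x i)) \<partial>N)"
      using char_rectangles[OF M N Xi Yi I order_refl I A eq, where v = "\<lambda>_. 0"]
      by (simp del: of_real_prod)
    hence "measure (distr M (PiM I (\<lambda>_. borel)) X) (Pi\<^sub>E I A) = measure (distr N (PiM I (\<lambda>_. borel)) Y) (Pi\<^sub>E I A)"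
      using gen[OF M X] gen[OF N Y] by (simp only: of_real_eq_iff)
    moreover have "prob_space (distr M (PiM I (\<lambda>_. borel)) X)" "prob_space (distr N (PiM I (\<lambda>_. borel)) Y)"
      by (intro M.prob_space_distr X N.prob_space_distr Y)+
    ultimately show ?thesis
      by (simp add: finite_measure.emeasure_eq_measure prob_space.finite_measure)
  qed
  show "range (\<lambda>_::nat. Pi\<^sub>E I (\<lambda>_. UNIV)) \<subseteq> prod_algebra I (\<lambda>_. borel)"
    by (auto intro!: prod_algebraI_finite I)
  show "(\<Union>i::nat. Pi\<^sub>E I (\<lambda>_. UNIV)) = space (PiM I (\<lambda>_. borel :: real measure))" by (auto simp: space_PiM)
  show "emeasure (distr M (PiM I (\<lambda>_. borel)) X) (Pi\<^sub>E I (\<lambda>_. UNIV)) \<noteq> \<infinity>"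
    using finite_measure.emeasure_finite[OF prob_space.finite_measure[OF M.prob_space_distr[OF X]]] by simp
qed auto


section \<open>Linear images of the standard Gaussian measure\<close>

lemma sets_gaussp [measurable_cong]: "sets (gaussp I) = sets (PiM I (\<lambda>_. borel))"
  by (intro sets_PiM_cong) auto

lemma char_gaussp:
  assumes I: "finite I"
  shows "(CLINT x|gaussp I. iexp (\<Sum>i\<in>I. v i * x i)) = exp (- complex_of_real ((\<Sum>i\<in>I. (v i)\<^sup>2) / 2))"
proof -
  interpret product_sigma_finite "\<lambda>_. gauss"
    by (intro product_sigma_finite.intro prob_space_imp_sigma_finite prob_space_gauss)
  interpret g: prob_space gauss by (rule prob_space_gauss)
  have "(CLINT x|gaussp I. iexp (\<Sum>i\<in>I. v i * x i)) = (CLINT x|gaussp I. (\<Prod>i\<in>I. iexp (v i * x i)))"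
    using I by (simp add: exp_sum sum_distrib_left)
  also have "\<dots> = (\<Prod>i\<in>I. CLINT x|gauss. iexp (v i * x))"
    by (intro product_integral_prod I g.integrable_iexp) auto
  also have "\<dots> = (\<Prod>i\<in>I. exp (- complex_of_real ((v i)\<^sup>2 / 2)))"
  proof (intro prod.cong refl)
    fix i
    have "(CLINT x|gauss. iexp (v i * x)) = char gauss (v i)" by (simp add: char_def)
    also have "\<dots> = complex_of_real (exp (- (v i)\<^sup>2 / 2))"
      using char_std_normal_distribution by (simp add: fun_eq_iff)
    finally show "(CLINT x|gauss. iexp (v i * x)) = exp (- complex_of_real ((v i)\<^sup>2 / 2))"
      by (simp add: exp_of_real[symmetric])
  qed
  also have "\<dots> = exp (- complex_of_real ((\<Sum>i\<in>I. (v i)\<^sup>2) / 2))"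
    using I by (simp add: exp_sum[symmetric] sum_negf sum_divide_distrib)
  finally show ?thesis .
qed

lemma measurable_linear_gaussp:
  "(\<lambda>x. \<lambda>i\<in>I. \<Sum>j\<in>J. a i j * x j) \<in> measurable (gaussp J) (PiM I (\<lambda>_. borel :: real measure))"
  by (intro measurable_restrict) measurable

text \<open>This is how a possibly singular covariance enters: the hypothesis is the characteristic
  function of the centered Gaussian law with covariance \<open>a * a\<^sup>T\<close>, so no density
  has to exist.\<close>

lemma distr_linear_gaussp:
  fixes a :: "'i \<Rightarrow> 'j \<Rightarrow> real"
  assumes N: "prob_space N" and I: "finite I" and J: "finite J"
    and Y: "Y \<in> measurable N (PiM I (\<lambda>_. borel))"
    and char: "\<And>v. (CLINT y|N. iexp (\<Sum>i\<in>I. v i * Y y i)) =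
        exp (- complex_of_real ((\<Sum>j\<in>J. (\<Sum>i\<in>I. v i * a i j)\<^sup>2) / 2))"
  shows "distr N (PiM I (\<lambda>_. borel)) Y = distr (gaussp J) (PiM I (\<lambda>_. borel)) (\<lambda>x. \<lambda>i\<in>I. \<Sum>j\<in>J. a i j * x j)"
proof (rule distr_PiM_eq_char[OF N prob_space_gaussp I Y measurable_linear_gaussp])
  fix v :: "'i \<Rightarrow> real"
  have "(\<Sum>i\<in>I. v i * (\<lambda>i\<in>I. \<Sum>j\<in>J. a i j * x j) i) = (\<Sum>j\<in>J. (\<Sum>i\<in>I. v i * a i j) * x j)" for x
    by (simp add: sum_distrib_left sum_distrib_right mult.assoc) (rule sum.swap)
  thus "(CLINT y|N. iexp (\<Sum>i\<in>I. v i * Y y i)) =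
      (CLINT x|gaussp J. iexp (\<Sum>i\<in>I. v i * (\<lambda>i\<in>I. \<Sum>j\<in>J. a i j * x j) i))"
    unfolding char by (simp only: char_gaussp[OF J])
qed

text \<open>The hypothesis says that the transpose of a is an isometry, so the characteristic
  function is unchanged.\<close>

lemma distr_gaussp_orthogonal:
  fixes a :: "'i \<Rightarrow> 'i \<Rightarrow> real"
  assumes I: "finite I"
    and a: "\<And>v. (\<Sum>j\<in>I. (\<Sum>i\<in>I. v i * a i j)\<^sup>2) = (\<Sum>i\<in>I. (v i)\<^sup>2)"
  shows "distr (gaussp I) (gaussp I) (\<lambda>x. \<lambda>i\<in>I. \<Sum>j\<in>I. a i j * x j) = gaussp I"
proof -
  let ?B = "PiM I (\<lambda>_. borel :: real measure)"
  have id: "(\<lambda>x. x) \<in> measurable (gaussp I) ?B"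
    by (rule measurable_ident_sets) (rule sets_gaussp)
  have "distr (gaussp I) ?B (\<lambda>x. x) = distr (gaussp I) ?B (\<lambda>x. \<lambda>i\<in>I. \<Sum>j\<in>I. a i j * x j)"
    by (rule distr_linear_gaussp[OF prob_space_gaussp I I id]) (simp only: char_gaussp[OF I] a)
  moreover have "distr (gaussp I) ?B f = distr (gaussp I) (gaussp I) f" for f
    by (intro distr_cong refl) (simp add: sets_gaussp)
  ultimately show ?thesis by (simp add: distr_id2)
qed

lemma char_centered_normal_rv:
  assumes M: "prob_space M" and s: "0 \<le> s" and Y: "centered_normal_rv M Y s"
  shows "Y \<in> borel_measurable M" and "char (distr M borel Y) 1 = exp (- complex_of_real (s / 2))"
proof -
  interpret prob_space M by fact
  show Ym[measurable]: "Y \<in> borel_measurable M"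
    using Y unfolding centered_normal_rv_def by (auto split: if_splits dest: distributed_measurable)
  show "char (distr M borel Y) 1 = exp (- complex_of_real (s / 2))"
  proof (cases "s = 0")
    case True
    hence "AE \<omega> in M. Y \<omega> = 0" using Y by (simp add: centered_normal_rv_def)
    hence "(CLINT \<omega>|M. iexp (Y \<omega>)) = (CLINT \<omega>|M. 1)"
      by (intro integral_cong_AE) (auto elim!: eventually_mono)
    thus ?thesis using True by (simp add: char_def integral_distr prob_space)
  next
    case False
    hence sp: "0 < s" using s by simp
    have "distributed M lborel Y (normal_density 0 (sqrt s))"
      using Y False by (simp add: centered_normal_rv_def)
    hence "distributed M lborel (\<lambda>\<omega>. 0 + (1 / sqrt s) * Y \<omega>) (normal_density (0 + (1 / sqrt s) * 0) (\<bar>1 / sqrt s\<bar> * sqrt s))"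
      by (rule normal_density_affine) (use sp in auto)
    hence d: "distributed M lborel (\<lambda>\<omega>. Y \<omega> / sqrt s) std_normal_density" using sp by simp
    have "distr M borel (\<lambda>\<omega>. Y \<omega> / sqrt s) = distr M lborel (\<lambda>\<omega>. Y \<omega> / sqrt s)"
      by (intro distr_cong) auto
    also have "\<dots> = gauss" using distributed_distr_eq_density[OF d] .
    finally have g: "distr M borel (\<lambda>\<omega>. Y \<omega> / sqrt s) = gauss" .
    have "char (distr M borel Y) 1 = (CLINT \<omega>|M. iexp (sqrt s * (Y \<omega> / sqrt s)))"
      using sp by (simp add: char_def integral_distr)
    also have "\<dots> = char (distr M borel (\<lambda>\<omega>. Y \<omega> / sqrt s)) (sqrt s)"
      by (subst char_def, subst integral_distr) auto
    also have "\<dots> = exp (- complex_of_real (s / 2))"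
    proof -
      have "(complex_of_real (sqrt s))\<^sup>2 = complex_of_real s" using sp by (simp flip: of_real_power)
      thus ?thesis unfolding g char_std_normal_distribution by (simp add: exp_of_real[symmetric])
    qed
    finally show ?thesis .
  qed
qed

text \<open>Independence factors the characteristic function over the columns, and each factor
  involves a single linear functional of one column. These functionals are exactly what
  \<open>gaussian_vec_rv\<close> describes.\<close>

lemma char_iid_gaussian_cols:
  assumes M: "prob_space M" and Om: "iid_gaussian_cols M n m K \<Omega>" and K: "sym_psd n K"
    and V: "\<And>j. j < m \<Longrightarrow> V j \<in> carrier_vec n"
  shows "(CLINT \<omega>|M. iexp (\<Sum>j<m. V j \<bullet> col (\<Omega> \<omega>) j)) = exp (- complex_of_real ((\<Sum>j<m. V j \<bullet> (K *\<^sub>v V j)) / 2))"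
proof -
  interpret prob_space M by fact
  have Oc: "\<Omega> \<omega> \<in> carrier_mat n m" if "\<omega> \<in> space M" for \<omega>
    using Om that by (auto simp: iid_gaussian_cols_def)
  \<comment> \<open>Written through the restricted column, because the independence in
    \<open>iid_gaussian_cols\<close> is stated for these random elements. It agrees with
    \<open>V j \<bullet> col (\<Omega> \<omega>) j\<close> on the sample space.\<close>
  let ?Z = "\<lambda>j \<omega>. \<Sum>i<n. V j $ i * (\<lambda>i\<in>{..<n}. \<Omega> \<omega> $$ (i,j)) i"
  have Z: "?Z j \<omega> = V j \<bullet> col (\<Omega> \<omega>) j" if "\<omega> \<in> space M" "j < m" for j \<omega>
    using Oc[OF that(1)] that(2) V[OF that(2)]
    by (auto simp: scalar_prod_def lessThan_atLeast0 intro!: sum.cong)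
  have nrv: "centered_normal_rv M (?Z j) (V j \<bullet> (K *\<^sub>v V j))" if j: "j < m" for j
  proof -
    have c: "centered_normal_rv M (\<lambda>\<omega>. V j \<bullet> col (\<Omega> \<omega>) j) (V j \<bullet> (K *\<^sub>v V j))"
      using Om j V[OF j] by (auto simp: iid_gaussian_cols_def gaussian_vec_rv_def)
    have "centered_normal_rv M f s = centered_normal_rv M g s"
      if "\<And>\<omega>. \<omega> \<in> space M \<Longrightarrow> f \<omega> = g \<omega>" for f g :: "'a \<Rightarrow> real" and s
    proof -
      have 1: "(f \<in> borel_measurable M) = (g \<in> borel_measurable M)"
        by (rule measurable_cong) (rule that)
      have 2: "(AE \<omega> in M. f \<omega> = 0) = (AE \<omega> in M. g \<omega> = 0)"
        by (rule AE_cong) (simp add: that)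
      have 3: "distr M lborel f = distr M lborel g" by (rule distr_cong) (use that in auto)
      show ?thesis unfolding centered_normal_rv_def distributed_def 2 3
        using 1 by simp
    qed
    from this[of "?Z j" "\<lambda>\<omega>. V j \<bullet> col (\<Omega> \<omega>) j"] c Z[OF _ j] show ?thesis by auto
  qed
  have ind: "indep_vars (\<lambda>_. borel) ?Z {..<m}"
    by (rule indep_vars_compose2[where M' = "\<lambda>_. PiM {..<n} (\<lambda>_. borel)" and X = "\<lambda>j \<omega>. \<lambda>i\<in>{..<n}. \<Omega> \<omega> $$ (i,j)"
         and Y = "\<lambda>j z. \<Sum>i<n. V j $ i * z i"])
       (use Om in \<open>auto simp: iid_gaussian_cols_def\<close>)
  have "(CLINT \<omega>|M. iexp (\<Sum>j<m. V j \<bullet> col (\<Omega> \<omega>) j)) = (CLINT \<omega>|M. iexp (\<Sum>j<m. ?Z j \<omega>))"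
  proof (intro Bochner_Integration.integral_cong refl)
    fix \<omega> assume "\<omega> \<in> space M"
    hence "(\<Sum>j<m. V j \<bullet> col (\<Omega> \<omega>) j) = (\<Sum>j<m. ?Z j \<omega>)" by (intro sum.cong refl Z[symmetric]) auto
    thus "iexp (\<Sum>j<m. V j \<bullet> col (\<Omega> \<omega>) j) = iexp (\<Sum>j<m. ?Z j \<omega>)" by (simp only:)
  qed
  also have "\<dots> = char (distr M borel (\<lambda>\<omega>. \<Sum>j<m. ?Z j \<omega>)) 1"
    unfolding char_def
  proof (subst integral_distr)
    show "(\<lambda>\<omega>. \<Sum>j<m. ?Z j \<omega>) \<in> borel_measurable M"
      by (intro borel_measurable_sum char_centered_normal_rv(1)[OF M _ nrv])
         (use K V in \<open>auto simp: sym_psd_def\<close>)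
  qed auto
  also have "\<dots> = (\<Prod>j<m. char (distr M borel (?Z j)) 1)"
    by (rule char_distr_sum[OF ind])
  also have "\<dots> = (\<Prod>j<m. exp (- complex_of_real (V j \<bullet> (K *\<^sub>v V j) / 2)))"
    by (intro prod.cong refl char_centered_normal_rv(2)[OF M _ nrv]) (use K V in \<open>auto simp: sym_psd_def\<close>)
  also have "\<dots> = exp (- complex_of_real ((\<Sum>j<m. V j \<bullet> (K *\<^sub>v V j)) / 2))"
    by (simp add: exp_sum[symmetric] sum_negf sum_divide_distrib)
  finally show ?thesis .
qed

section \<open>Gaussian moments\<close>

text \<open>These numbers occur in two roles: as moments of linear forms with unit coefficient
  vector, and, through their reciprocals, as bounds for the negative moments of the norm in p + 1
  dimensions.\<close>

definition gmoment :: "nat \<Rightarrow> real" where "gmoment p = (\<integral>x. \<bar>x\<bar> ^ p \<partial>gauss)"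

lemma integrable_gauss_abs_power: "integrable gauss (\<lambda>x. \<bar>x\<bar> ^ p)"
  using integrable_abs[OF integrable_std_normal_distribution_moment[of p]] by (simp add: power_abs)

lemma gmoment_0: "gmoment 0 = 1"
  using std_normal_distribution_even_moments_abs[of 0] by (simp add: gmoment_def)

lemma gmoment_1: "gmoment 1 = sqrt (2 / pi)"
  using std_normal_distribution_odd_moments_abs[of 0] by (simp add: gmoment_def)

lemma gmoment_Suc_Suc: "gmoment (Suc (Suc p)) = (real p + 1) * gmoment p"
proof (cases "even p")
  case True
  then obtain k where k: "p = 2 * k" by (elim evenE)
  hence k': "Suc (Suc p) = 2 * Suc k" by simp
  show ?thesis
  proof -
    have c: "2 * A * r * F / (2 * T * (A * G)) = r * (F / (T * G))" if "A \<noteq> 0" for A r F T G :: real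
      using that by simp
    have f: "fact (2 * Suc k) = 2 * (real k + 1) * (real p + 1) * fact (2 * k)"
      "(2::real) ^ Suc k * fact (Suc k) = 2 * 2 ^ k * ((real k + 1) * fact k)"
      by (simp_all add: k algebra_simps)
    show ?thesis
      unfolding gmoment_def k' std_normal_distribution_even_moments_abs f
      unfolding k std_normal_distribution_even_moments_abs by (rule c) simp
  qed
next
  case False
  then obtain k where k: "p = 2 * k + 1" by (elim oddE)
  hence k': "Suc (Suc p) = 2 * Suc k + 1" by simp
  show ?thesis
    unfolding gmoment_def k' unfolding k std_normal_distribution_odd_moments_abs
    by (simp add: field_simps)
qed

lemma gmoment_pos: "0 < gmoment p"
  by (induction p rule: induct_nat_012) (simp_all add: gmoment_0 gmoment_1[simplified] gmoment_Suc_Suc)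

text \<open>A Stirling-type bound: the correction \<open>1 / (2 (p + 1))\<close> makes the ratio of both sides
  monotone along steps of length two, by the trapezoidal rule for \<open>1 / x\<close>.\<close>
lemma gmoment_lower_ln:
  assumes "4 \<le> p"
  shows "ln (3 / 4) + real p / 2 * (ln (real p + 1) - 1) + 1 / (2 * (real p + 1)) \<le> ln (gmoment p)"
  using assms
proof (induction p rule: less_induct)
  case (less p)
  \<comment> \<open>A rational lower bound for e: the fourth power of the quadratic Taylor bound at
    1/4.\<close>
  have e1: "(269/100::real) \<le> exp 1"
  proof -
    have "(1 + 1/4 + (1/4)\<^sup>2 / 2 :: real) ^ 4 \<le> exp (1/4) ^ 4"
      by (intro power_mono exp_lower_Taylor_quadratic) auto
    also have "exp (1/4::real) ^ 4 = exp 1" by (simp add: exp_of_nat_mult[symmetric])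
    finally show ?thesis by (simp add: power2_eq_square eval_nat_numeral)
  qed
  \<comment> \<open>The recursion for \<open>gmoment\<close> has step two, so each parity needs its
    own start. Both starting values reduce to numerical inequalities between rational powers, e and
    pi.\<close>
  consider "p = 4" | "p = 5" | "6 \<le> p" using less.prems by linarith
  thus ?case
  proof cases
    case 1
    have g: "gmoment 4 = 3" using gmoment_Suc_Suc[of 2] gmoment_Suc_Suc[of 0] by (simp add: gmoment_0 eval_nat_numeral)
    have "(25/4 :: real) \<le> (269/100)^2 * (1 - 1/10)" by (simp add: power2_eq_square)
    also have "\<dots> \<le> exp 1 ^ 2 * exp (-1/10)"
      using exp_ge_add_one_self[of "-1/10"] by (intro mult_mono power_mono e1) auto
    also have "\<dots> = exp (19/10)" by (simp add: exp_of_nat_mult[symmetric] exp_add[symmetric])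
    finally have "ln (25/4) \<le> ln (exp (19/10 :: real))" by (subst ln_le_cancel_iff) auto
    hence "ln (25/4) \<le> (19/10 :: real)" by simp
    moreover have "ln (3/4) + ln 25 = ln 3 + ln (25/4 :: real)"
      using ln_mult[of "3/4" "25::real"] ln_mult[of 3 "25/4::real"] by simp
    moreover have "ln (25::real) = 2 * ln 5" using ln_realpow[of "5::real" 2] by simp
    ultimately show ?thesis using 1 by (simp add: g)
  next
    case 2
    have g: "gmoment 5 = 8 * sqrt (2 / pi)"
      using gmoment_Suc_Suc[of 3] gmoment_Suc_Suc[of 1] by (simp add: gmoment_1[simplified] eval_nat_numeral)
    have e56: "(1 + 5/6 + (5/6)^2/2 :: real) \<le> exp (5/6)"
      by (rule exp_lower_Taylor_quadratic) auto
    have "(9/16 * 6^5 * 315/100 :: real) \<le> 128 * ((269/100)^4 * (1 + 5/6 + (5/6)^2/2))"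
      by (simp add: power2_eq_square eval_nat_numeral)
    also have "\<dots> \<le> 128 * (exp 1 ^ 4 * exp (5/6))"
      by (intro mult_left_mono mult_mono power_mono e1 e56) auto
    also have "exp 1 ^ 4 * exp (5/6) = exp (29/6 :: real)"
      by (simp add: exp_of_nat_mult[symmetric] exp_add[symmetric])
    finally have "9/16 * 6^5 * pi \<le> 128 * exp (29/6)" using pi_less_4 pi_approx by simp
    hence "ln (9/16 * 6^5 * pi) \<le> ln (128 * exp (29/6))"
      by (subst ln_le_cancel_iff) auto
    also have "9/16 * 6^5 * pi = (3/4)^2 * 6^5 * pi" by (simp add: power2_eq_square)
    also have "ln ((3/4)^2 * 6^5 * pi) = 2 * ln (3/4) + 5 * ln 6 + ln pi"
      using ln_mult[of "(3/4)^2 * 6^5" pi] ln_mult[of "(3/4)^2" "6^5::real"]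
        ln_realpow[of "3/4::real" 2] ln_realpow[of "6::real" 5] by simp
    also have "ln (128 * exp (29/6 :: real)) = ln 128 + 29/6" by (subst ln_mult) auto
    also have "ln (128::real) = 2 * ln 8 + ln 2"
      using ln_mult[of "8^2" "2::real"] ln_realpow[of "8::real" 2] by simp
    finally have "2 * ln (3/4) + 5 * ln 6 + ln pi \<le> 2 * ln 8 + ln 2 + 29/6" .
    moreover have "ln (8 * sqrt (2/pi)) = ln 8 + (ln 2 - ln pi) / 2"
      by (simp add: ln_mult ln_sqrt ln_div)
    ultimately show ?thesis using 2 by (simp add: g) argo
  next
    case 3
    define q where "q = p - 2"
    have p: "p = Suc (Suc q)" using 3 by (simp add: q_def)
    define y where "y = real q + 1"
    have y: "0 < y" by (simp add: y_def)
    have IH: "ln (3 / 4) + real q / 2 * (ln y - 1) + 1 / (2 * y) \<le> ln (gmoment q)"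
      using less.IH[of q] 3 by (simp add: q_def y_def)
    \<comment> \<open>Trapezoidal rule on \<open>{y..y+2}\<close>, an upper bound because
      \<open>1 / x\<close> is convex. Multiplied by \<open>(y + 1) / 2\<close> it becomes 1 plus a
      telescoping difference, which is what the correction term absorbs.\<close>
    have "ln (y + 2) - ln y \<le> inverse y + inverse (y + 2)"
      using ln_inverse_approx_le[OF y, of 2] by simp
    hence "(y + 1) / 2 * (ln (y + 2) - ln y) \<le> (y + 1) / 2 * (inverse y + inverse (y + 2))"
      using y by (intro mult_left_mono) auto
    also have "\<dots> = 1 + 1 / (2 * y) - 1 / (2 * (y + 2))"
    proof -
      have "y * inverse y = 1" "y * inverse (y + 2) = 1 - 2 * inverse (y + 2)"
        using y by (simp_all add: field_simps)
      hence "(y + 1) / 2 * (inverse y + inverse (y + 2)) = 1 + inverse y / 2 - inverse (y + 2) / 2"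
        by (simp add: algebra_simps) argo
      thus ?thesis by (simp add: inverse_eq_divide)
    qed
    finally have "(y + 1) / 2 * (ln (y + 2) - ln y) \<le> 1 + 1 / (2 * y) - 1 / (2 * (y + 2))" .
    hence "(y + 1) / 2 * (ln (y + 2) - 1) + 1 / (2 * (y + 2)) \<le> ln y + ((y - 1) / 2 * (ln y - 1) + 1 / (2 * y))"
      by (simp add: field_simps)
    also have "\<dots> \<le> ln y + (ln (gmoment q) - ln (3/4))" using IH by (simp add: y_def)
    also have "\<dots> = ln (gmoment p) - ln (3/4)"
      using gmoment_pos[of q] y by (simp add: p gmoment_Suc_Suc ln_mult y_def)
    finally show ?thesis by (simp add: p y_def add_ac)
  qed
qed

text \<open>The correction term is dropped. The quotient of \<open>gmoment p\<close> by the power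
  alone tends to \<open>sqrt (2 / e)\<close>, about 0.86, which leaves room for the factor
  3/4.\<close>

lemma gmoment_lower:
  assumes "4 \<le> p"
  shows "3 / 4 * ((real p + 1) / exp 1) powr (real p / 2) \<le> gmoment p"
proof -
  have "ln (3 / 4 * ((real p + 1) / exp 1) powr (real p / 2)) = ln (3 / 4) + real p / 2 * (ln (real p + 1) - 1)"
    by (subst ln_mult) (auto simp: ln_powr ln_div)
  also have "\<dots> \<le> ln (gmoment p)" using gmoment_lower_ln[OF assms] 
    by (smt (verit) of_nat_0_le_iff zero_le_divide_1_iff)
  finally show ?thesis using gmoment_pos[of p] by (subst (asm) ln_le_cancel_iff) auto
qed

section \<open>Positive and negative moments of the norm of a Gaussian vector\<close>

lemma nn_integral_gauss_exp_square:
  assumes s: "-1 < s"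
  shows "(\<integral>\<^sup>+x. ennreal (exp (- s * x\<^sup>2 / 2)) \<partial>gauss) = ennreal (1 / sqrt (1 + s))"
proof -
  define c where "c = 1 / sqrt (1 + s)"
  have c: "0 < c" "c\<^sup>2 * (1 + s) = 1" using s by (simp_all add: c_def power_divide)
  have e: "std_normal_density (c * x) * exp (- s * (c * x)\<^sup>2 / 2) = std_normal_density x" for x
  proof -
    have "- (c * x)\<^sup>2 / 2 + (- s * (c * x)\<^sup>2 / 2) = - (c\<^sup>2 * (1 + s)) * x\<^sup>2 / 2"
      by (simp add: power_mult_distrib field_simps)
    thus ?thesis unfolding std_normal_density_def by (simp add: c(2) exp_add[symmetric])
  qed
  have "(\<integral>\<^sup>+x. ennreal (exp (- s * x\<^sup>2 / 2)) \<partial>gauss) =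
      (\<integral>\<^sup>+x. ennreal (std_normal_density x * exp (- s * x\<^sup>2 / 2)) \<partial>lborel)"
    by (simp add: nn_integral_density ennreal_mult')
  also have "\<dots> = ennreal c * (\<integral>\<^sup>+x. ennreal (std_normal_density (c * x) * exp (- s * (c * x)\<^sup>2 / 2)) \<partial>lborel)"
    using c by (subst nn_integral_real_affine[where c = c and t = 0]) auto
  also have "(\<integral>\<^sup>+x. ennreal (std_normal_density (c * x) * exp (- s * (c * x)\<^sup>2 / 2)) \<partial>lborel) = 1"
    unfolding e by (subst nn_integral_eq_integral) auto
  finally show ?thesis by (simp add: c_def)
qed

lemma nn_integral_gaussp_exp_square:
  assumes s: "-1 < s" and I: "finite I"
  shows "(\<integral>\<^sup>+x. ennreal (exp (- s * (\<Sum>i\<in>I. (x i)\<^sup>2) / 2)) \<partial>gaussp I) = ennreal ((1 / sqrt (1 + s)) ^ card I)"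
proof -
  interpret product_sigma_finite "\<lambda>_. gauss"
    by (intro product_sigma_finite.intro prob_space_imp_sigma_finite prob_space_gauss)
  have "exp (- s * (\<Sum>i\<in>I. (x i)\<^sup>2) / 2) = (\<Prod>i\<in>I. exp (- s * (x i)\<^sup>2 / 2))" for x :: "'a \<Rightarrow> real"
    using I by (simp add: exp_sum[symmetric] sum_distrib_left sum_divide_distrib sum_negf)
  hence "(\<integral>\<^sup>+x. ennreal (exp (- s * (\<Sum>i\<in>I. (x i)\<^sup>2) / 2)) \<partial>gaussp I) =
      (\<integral>\<^sup>+x. (\<Prod>i\<in>I. ennreal (exp (- s * (x i)\<^sup>2 / 2))) \<partial>gaussp I)"
    by (simp add: prod_ennreal)
  also have "\<dots> = (\<Prod>i\<in>I. \<integral>\<^sup>+x. ennreal (exp (- s * x\<^sup>2 / 2)) \<partial>gauss)"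
    by (rule product_nn_integral_prod[OF I]) auto
  also have "\<dots> = ennreal ((1 / sqrt (1 + s)) ^ card I)"
    using s by (simp add: nn_integral_gauss_exp_square[OF s, simplified] ennreal_power)
  finally show ?thesis .
qed

text \<open>The tangent of the logarithm at \<open>k + p\<close> bounds the power by an exponential
  of rate \<open>s = p / (k + p)\<close>, which is below 1, so the expectation is finite. That
  expectation is \<open>(1 + p / k) powr (k / 2)\<close>, at most \<open>exp (p / 2)\<close>, and
  this cancels the factor \<open>exp (- p / 2)\<close> of the tangent exactly.\<close>

lemma nn_integral_gaussp_norm_power:
  assumes I: "finite I" and k: "0 < card I" and p: "0 < p"
  shows "(\<integral>\<^sup>+x. ennreal ((\<Sum>i\<in>I. (x i)\<^sup>2) powr (real p / 2)) \<partial>gaussp I) \<le> ennreal ((real (card I) + real p) powr (real p / 2))"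
proof -
  define k where "k = real (card I)"
  define s where "s = p / (k + p)"
  have kp: "0 < k" "0 < real p" using k p by (auto simp: k_def)
  have s: "0 < s" "s < 1" using kp by (auto simp: s_def field_simps)
  have pt: "r powr (p / 2) \<le> (k + p) powr (p / 2) * exp (- p / 2) * exp (- (- s) * r / 2)" if r: "0 \<le> r" for r
  proof (cases "r = 0")
    case False
    hence r: "0 < r" using r by simp
    have "ln r - ln (k + p) = ln (r / (k + p))" using r kp by (simp add: ln_div)
    also have "\<dots> \<le> r / (k + p) - 1" using r kp by (intro ln_le_minus_one) auto
    finally have "p / 2 * ln r \<le> p / 2 * (ln (k + p) + r / (k + p) - 1)"
      using kp by (intro mult_left_mono) auto
    also have "\<dots> = p / 2 * ln (k + p) + (- p / 2) + (- (- s) * r / 2)"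
    proof -
      have "p / 2 * (r / (k + p)) = - (- s) * r / 2" by (simp add: s_def)
      thus ?thesis by (simp add: right_diff_distrib distrib_left)
    qed
    finally have "exp (p / 2 * ln r) \<le> exp (p / 2 * ln (k + p) + (- p / 2) + (- (- s) * r / 2))"
      by (simp only: exp_le_cancel_iff)
    thus ?thesis using r kp unfolding exp_add by (simp add: powr_def)
  qed auto
  let ?C = "(k + p) powr (p / 2) * exp (- p / 2)"
  have "(\<integral>\<^sup>+x. ennreal ((\<Sum>i\<in>I. (x i)\<^sup>2) powr (real p / 2)) \<partial>gaussp I) \<le>
      (\<integral>\<^sup>+x. ennreal ?C * ennreal (exp (- (- s) * (\<Sum>i\<in>I. (x i)\<^sup>2) / 2)) \<partial>gaussp I)"
    using pt by (intro nn_integral_mono) (auto simp: ennreal_mult'[symmetric] sum_nonneg intro!: ennreal_leI)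
  also have "\<dots> = ennreal ?C * ennreal ((1 / sqrt (1 + - s)) ^ card I)"
    using s I by (subst nn_integral_cmult) (auto simp: nn_integral_gaussp_exp_square[of "-s", simplified])
  also have "\<dots> = ennreal (?C * (1 / sqrt (1 + - s)) ^ card I)" by (simp add: ennreal_mult')
  also have "\<dots> \<le> ennreal ((k + p) powr (p / 2))"
  proof (rule ennreal_leI)
    have "1 / (1 + - s) = 1 + p / k" using kp by (simp add: s_def field_simps)
    hence "1 / sqrt (1 + - s) = sqrt (1 + p / k)" by (metis real_sqrt_divide real_sqrt_one)
    also have "\<dots> \<le> sqrt (exp (p / k))" by (simp add: exp_ge_add_one_self)
    also have "sqrt (exp (p / k)) = exp (p / k / 2)"
      by (rule real_sqrt_unique) (auto simp: exp_of_nat_mult[symmetric] power2_eq_square exp_add[symmetric])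
    finally have "(1 / sqrt (1 + - s)) ^ card I \<le> exp (p / k / 2) ^ card I"
      by (rule power_mono) (use s in auto)
    also have "\<dots> = exp (p / 2)" using kp by (simp add: exp_of_nat_mult[symmetric] k_def)
    finally have "?C * (1 / sqrt (1 + - s)) ^ card I \<le> ?C * exp (p / 2)"
      by (intro mult_left_mono) auto
    also have "\<dots> = (k + p) powr (p / 2)" by (simp add: mult.assoc exp_add[symmetric])
    finally show "?C * (1 / sqrt (1 + - s)) ^ card I \<le> (k + p) powr (p / 2)" .
  qed
  finally show ?thesis by (simp add: k_def)
qed

lemma nn_integral_atLeast_0_le:
  fixes f :: "real \<Rightarrow> ennreal"
  assumes [measurable]: "f \<in> borel_measurable borel"
    and le: "\<And>n::nat. (\<integral>\<^sup>+x. f x * indicator {0..real n} x \<partial>lborel) \<le> c"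
  shows "(\<integral>\<^sup>+x. f x * indicator {0..} x \<partial>lborel) \<le> c"
proof -
  have "f x * indicator {0..} x = (SUP n::nat. f x * indicator {0..real n} x)" for x
  proof -
    obtain m :: nat where m: "x \<le> real m" using real_arch_simple by blast
    show ?thesis
      by (rule antisym) (use m in \<open>auto intro!: SUP_least SUP_upper2[of m] simp: indicator_def\<close>)
  qed
  hence "(\<integral>\<^sup>+x. f x * indicator {0..} x \<partial>lborel) = (\<integral>\<^sup>+x. (SUP n::nat. f x * indicator {0..real n} x) \<partial>lborel)"
    by simp
  also have "\<dots> = (SUP n::nat. \<integral>\<^sup>+x. f x * indicator {0..real n} x \<partial>lborel)"
    by (rule nn_integral_monotone_convergence_SUP) (auto simp: incseq_def le_fun_def indicator_def)
  also have "\<dots> \<le> c" by (intro SUP_least le)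
  finally show ?thesis .
qed

text \<open>With \<open>w = y / sqrt (1 + y\<^sup>2) = sin (arctan y)\<close> these are Wallis' integrals in the
  variable \<open>arctan y\<close>.\<close>
lemma Wallis_integral_le:
  assumes b: "0 \<le> b"
  shows "integral {0..b} (\<lambda>y. (y / sqrt (1 + y\<^sup>2)) ^ n / (1 + y\<^sup>2)) \<le> sqrt (2 * pi) * gmoment n / (2 * gmoment (Suc n))"
proof -
  define w where "w = (\<lambda>y::real. y / sqrt (1 + y\<^sup>2))"
  have pos: "0 < 1 + y\<^sup>2" for y :: real by (simp add: add_pos_nonneg)
  have sq: "(sqrt (1 + y\<^sup>2))\<^sup>2 = 1 + y\<^sup>2" "sqrt (1 + y\<^sup>2) \<noteq> 0" for y :: real
    using pos[of y] by auto
  have w2: "(w y)\<^sup>2 = 1 - 1 / (1 + y\<^sup>2)" for y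
    using pos[of y] by (simp add: w_def power_divide field_simps)
  have dr: "((\<lambda>y. 1 / sqrt (1 + y\<^sup>2)) has_real_derivative - w y / (1 + y\<^sup>2)) (at y within S)" for y S
    unfolding w_def using pos[of y] sq[of y]
    by (auto intro!: derivative_eq_intros simp: power2_eq_square field_simps)
  have dw: "(w has_real_derivative 1 / sqrt (1 + y\<^sup>2) / (1 + y\<^sup>2)) (at y within S)" for y S
  proof -
    have "((\<lambda>y. y * (1 / sqrt (1 + y\<^sup>2))) has_real_derivative 1 * (1 / sqrt (1 + y\<^sup>2)) + y * (- w y / (1 + y\<^sup>2))) (at y within S)"
      by (rule derivative_eq_intros dr refl | simp)+
    moreover have "1 * (1 / sqrt (1 + y\<^sup>2)) + y * (- w y / (1 + y\<^sup>2)) = 1 / sqrt (1 + y\<^sup>2) / (1 + y\<^sup>2)"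
      using pos[of y] sq[of y] unfolding w_def by (simp add: divide_simps) (simp add: algebra_simps power2_eq_square)
    moreover have "(\<lambda>y. y * (1 / sqrt (1 + y\<^sup>2))) = w" by (simp add: w_def fun_eq_iff)
    ultimately show ?thesis by simp
  qed
  have wc: "continuous_on S (\<lambda>y. w y ^ n / (1 + y\<^sup>2))" for S n
    unfolding w_def using pos sq by (intro continuous_intros) (auto simp: less_imp_neq[THEN not_sym])
  have int: "(\<lambda>y. w y ^ n / (1 + y\<^sup>2)) integrable_on {0..b}" for n
    by (intro integrable_continuous_interval wc)
  have "integral {0..b} (\<lambda>y. w y ^ n / (1 + y\<^sup>2)) \<le> sqrt (2 * pi) * gmoment n / (2 * gmoment (Suc n))"
  proof (induction n rule: induct_nat_012)
    case 0
    have "((\<lambda>y. 1 / (1 + y\<^sup>2)) has_integral arctan b - arctan 0) {0..b}"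
      by (rule fundamental_theorem_of_calculus[OF b])
         (auto intro!: derivative_eq_intros simp: has_real_derivative_iff_has_vector_derivative[symmetric] divide_inverse)
    hence "integral {0..b} (\<lambda>y. 1 / (1 + y\<^sup>2)) = arctan b" by (simp add: integral_unique)
    also have "\<dots> \<le> pi / 2" using arctan_ubound[of b] by simp
    also have "pi / 2 = sqrt (2 * pi) * gmoment 0 / (2 * gmoment 1)"
      unfolding gmoment_0 gmoment_1 by (simp add: real_sqrt_mult real_sqrt_divide field_simps)
    finally show ?case by simp
  next
    case 1
    have "((\<lambda>y. w y / (1 + y\<^sup>2)) has_integral - (1 / sqrt (1 + b\<^sup>2)) - - (1 / sqrt (1 + 0\<^sup>2))) {0..b}"
    proof (rule fundamental_theorem_of_calculus[OF b])
      fix y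
      have "((\<lambda>y. - (1 / sqrt (1 + y\<^sup>2))) has_real_derivative w y / (1 + y\<^sup>2)) (at y within {0..b})"
        using DERIV_minus[OF dr[of y "{0..b}"]] by simp
      thus "((\<lambda>y. - (1 / sqrt (1 + y\<^sup>2))) has_vector_derivative w y / (1 + y\<^sup>2)) (at y within {0..b})"
        by (simp add: has_real_derivative_iff_has_vector_derivative)
    qed
    hence "integral {0..b} (\<lambda>y. w y / (1 + y\<^sup>2)) = 1 - 1 / sqrt (1 + b\<^sup>2)" by (simp add: integral_unique)
    also have "\<dots> \<le> 1" by simp
    also have "1 = sqrt (2 * pi) * gmoment 1 / (2 * gmoment 2)"
      using gmoment_Suc_Suc[of 0] unfolding gmoment_0 gmoment_1
      by (simp add: eval_nat_numeral real_sqrt_mult real_sqrt_divide gmoment_0)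
    finally show ?case by (simp add: eval_nat_numeral)
  next
    case (ge2 n)
    \<comment> \<open>The primitive is \<open>w y ^ (n + 1) / sqrt (1 + y\<^sup>2)\<close>. It
      vanishes at 0 and is nonnegative at b; dropping the value at b turns Wallis' recursion into
      the inequality needed.\<close>
    have "((\<lambda>y. (real n + 1) * (w y ^ n / (1 + y\<^sup>2)) - (real n + 2) * (w y ^ (n + 2) / (1 + y\<^sup>2))) has_integral
        w b ^ (n + 1) * (1 / sqrt (1 + b\<^sup>2)) - w 0 ^ (n + 1) * (1 / sqrt (1 + 0\<^sup>2))) {0..b}"
    proof (rule fundamental_theorem_of_calculus[OF b])
      fix y
      have "((\<lambda>y. w y ^ (n + 1) * (1 / sqrt (1 + y\<^sup>2))) has_real_derivative
         (real (n + 1) * w y ^ n * (1 / sqrt (1 + y\<^sup>2) / (1 + y\<^sup>2))) * (1 / sqrt (1 + y\<^sup>2)) + (- w y / (1 + y\<^sup>2)) * w y ^ (n + 1)) (at y within {0..b})"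
        by (rule DERIV_mult) (rule dr DERIV_power[OF dw, THEN DERIV_cong] | simp)+
      moreover have "(real (n + 1) * w y ^ n * (1 / sqrt (1 + y\<^sup>2) / (1 + y\<^sup>2))) * (1 / sqrt (1 + y\<^sup>2)) + (- w y / (1 + y\<^sup>2)) * w y ^ (n + 1)
         = (real n + 1) * (w y ^ n / (1 + y\<^sup>2)) - (real n + 2) * (w y ^ (n + 2) / (1 + y\<^sup>2))"
      proof -
        have a: "1 / sqrt (1 + y\<^sup>2) * (1 / sqrt (1 + y\<^sup>2)) = 1 - (w y)\<^sup>2"
          using w2[of y] sq[of y] by (simp add: power2_eq_square)
        have "(real (n + 1) * w y ^ n * (1 / sqrt (1 + y\<^sup>2) / (1 + y\<^sup>2))) * (1 / sqrt (1 + y\<^sup>2)) =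
          real (n + 1) * (w y ^ n / (1 + y\<^sup>2)) * (1 / sqrt (1 + y\<^sup>2) * (1 / sqrt (1 + y\<^sup>2)))" by simp
        also have "\<dots> = (real n + 1) * (w y ^ n / (1 + y\<^sup>2)) - (real n + 1) * (w y ^ (n + 2) / (1 + y\<^sup>2))"
          unfolding a by (simp add: algebra_simps power2_eq_square diff_divide_distrib add_divide_distrib)
        finally show ?thesis by (simp add: algebra_simps power2_eq_square diff_divide_distrib add_divide_distrib)
      qed
      ultimately show "((\<lambda>y. w y ^ (n + 1) * (1 / sqrt (1 + y\<^sup>2))) has_vector_derivative
         (real n + 1) * (w y ^ n / (1 + y\<^sup>2)) - (real n + 2) * (w y ^ (n + 2) / (1 + y\<^sup>2))) (at y within {0..b})"
        by (simp add: has_real_derivative_iff_has_vector_derivative)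
    qed
    hence "integral {0..b} (\<lambda>y. (real n + 1) * (w y ^ n / (1 + y\<^sup>2)) - (real n + 2) * (w y ^ (n + 2) / (1 + y\<^sup>2)))
       = w b ^ (n + 1) * (1 / sqrt (1 + b\<^sup>2))"
      by (simp add: integral_unique w_def)
    moreover have "0 \<le> w b ^ (n + 1) * (1 / sqrt (1 + b\<^sup>2))" using b by (simp add: w_def)
    moreover have "integral {0..b} (\<lambda>y. (real n + 1) * (w y ^ n / (1 + y\<^sup>2)) - (real n + 2) * (w y ^ (n + 2) / (1 + y\<^sup>2)))
       = (real n + 1) * integral {0..b} (\<lambda>y. w y ^ n / (1 + y\<^sup>2)) - (real n + 2) * integral {0..b} (\<lambda>y. w y ^ (n + 2) / (1 + y\<^sup>2))"
      by (simp only: integral_diff[OF integrable_on_mult_right[OF int] integrable_on_mult_right[OF int]] integral_mult_right)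
    ultimately have "0 \<le> (real n + 1) * integral {0..b} (\<lambda>y. w y ^ n / (1 + y\<^sup>2)) - (real n + 2) * integral {0..b} (\<lambda>y. w y ^ (n + 2) / (1 + y\<^sup>2))"
      by (simp only:)
    hence "(real n + 2) * integral {0..b} (\<lambda>y. w y ^ (n + 2) / (1 + y\<^sup>2)) \<le> (real n + 1) * integral {0..b} (\<lambda>y. w y ^ n / (1 + y\<^sup>2))" by simp
    also have "\<dots> \<le> (real n + 1) * (sqrt (2 * pi) * gmoment n / (2 * gmoment (Suc n)))"
      using ge2 by (intro mult_left_mono) auto
    finally have "integral {0..b} (\<lambda>y. w y ^ (n + 2) / (1 + y\<^sup>2)) \<le>
        (real n + 1) * (sqrt (2 * pi) * gmoment n / (2 * gmoment (Suc n))) / (real n + 2)"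
      by (simp only: pos_le_divide_eq mult.commute[of _ "real n + 2"] zero_less_numeral of_nat_0_le_iff add_nonneg_pos)
    also have "\<dots> = sqrt (2 * pi) * gmoment (Suc (Suc n)) / (2 * gmoment (Suc (Suc (Suc n))))"
      by (simp add: gmoment_Suc_Suc mult_ac add_ac)
    finally show ?case by simp
  qed
  thus ?thesis by (simp add: w_def)
qed

text \<open>A negative power is a mixture of Gaussians: with n = p - 1,
  \<open>C * r powr (- p / 2)\<close> is the integral over y of
  \<open>\<bar>y\<bar> ^ n * exp (- y\<^sup>2 * r / 2)\<close>. After the integrals are exchanged,
  each of the p + 1 = n + 2 coordinates contributes \<open>1 / sqrt (1 + y\<^sup>2)\<close>, and
  Wallis' integral remains.\<close>

lemma nn_integral_inverse_chi_le:
  assumes I: "finite I" and card: "card I = p + 1" and p: "0 < p"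
  shows "(\<integral>\<^sup>+x. ennreal ((\<Sum>i\<in>I. (x i)\<^sup>2) powr (- real p / 2)) \<partial>gaussp I) \<le> ennreal (1 / gmoment p)"
proof -
  define n where "n = p - 1"
  have pn: "p = Suc n" using p by (simp add: n_def)
  define C where "C = sqrt (2 * pi) * gmoment n"
  have C: "0 < C" by (simp add: C_def gmoment_pos)
  have mixture: "ennreal C * ennreal (r powr (- real p / 2)) = (\<integral>\<^sup>+y. ennreal (\<bar>y\<bar> ^ n * exp (- y\<^sup>2 * r / 2)) \<partial>lborel)"
    if r: "0 < r" for r
  proof -
    define c where "c = 1 / sqrt r"
    have c: "0 < c" "c\<^sup>2 * r = 1" using r by (simp_all add: c_def power_divide)
    have "(\<integral>\<^sup>+y. ennreal (\<bar>y\<bar> ^ n * exp (- y\<^sup>2 * r / 2)) \<partial>lborel) =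
        ennreal c * (\<integral>\<^sup>+y. ennreal (\<bar>c * y\<bar> ^ n * exp (- (c * y)\<^sup>2 * r / 2)) \<partial>lborel)"
      using c by (subst nn_integral_real_affine[where c = c and t = 0]) auto
    also have "(\<lambda>y. \<bar>c * y\<bar> ^ n * exp (- (c * y)\<^sup>2 * r / 2)) = (\<lambda>y. c ^ n * sqrt (2 * pi) * (std_normal_density y * \<bar>y\<bar> ^ n))"
    proof
      fix y
      have "(c * y)\<^sup>2 * r = y\<^sup>2" using c by (simp add: power_mult_distrib mult_ac)
      thus "\<bar>c * y\<bar> ^ n * exp (- (c * y)\<^sup>2 * r / 2) = c ^ n * sqrt (2 * pi) * (std_normal_density y * \<bar>y\<bar> ^ n)"
        using c by (simp add: std_normal_density_def abs_mult power_mult_distrib)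
    qed
    also have "(\<integral>\<^sup>+y. ennreal (c ^ n * sqrt (2 * pi) * (std_normal_density y * \<bar>y\<bar> ^ n)) \<partial>lborel) =
       ennreal (c ^ n * sqrt (2 * pi)) * (\<integral>\<^sup>+y. ennreal (std_normal_density y * \<bar>y\<bar> ^ n) \<partial>lborel)"
      using c by (subst nn_integral_cmult[symmetric]) (auto simp: ennreal_mult'[symmetric])
    also have "(\<integral>\<^sup>+y. ennreal (std_normal_density y * \<bar>y\<bar> ^ n) \<partial>lborel) = ennreal (gmoment n)"
    proof -
      have "(\<integral>\<^sup>+y. ennreal (std_normal_density y * \<bar>y\<bar> ^ n) \<partial>lborel) = (\<integral>\<^sup>+y. ennreal (\<bar>y\<bar> ^ n) \<partial>gauss)"
        by (simp add: nn_integral_density ennreal_mult')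
      also have "\<dots> = ennreal (gmoment n)" unfolding gmoment_def
        by (rule nn_integral_eq_integral[OF integrable_gauss_abs_power]) auto
      finally show ?thesis .
    qed
    also have "ennreal c * (ennreal (c ^ n * sqrt (2 * pi)) * ennreal (gmoment n)) = ennreal (C * c ^ p)"
      using c gmoment_pos[of n] by (simp add: ennreal_mult'[symmetric] C_def pn mult_ac)
    also have "c ^ p = r powr (- real p / 2)"
    proof -
      have "c = r powr (- 1/2)" using r by (simp add: c_def powr_minus_divide powr_half_sqrt)
      thus ?thesis using r by (simp add: powr_powr flip: powr_realpow)
    qed
    finally show ?thesis using C by (simp add: ennreal_mult')
  qed
  have inner: "(\<integral>\<^sup>+x. ennreal (\<bar>y\<bar> ^ n * exp (- y\<^sup>2 * (\<Sum>i\<in>I. (x i)\<^sup>2) / 2)) \<partial>gaussp I) =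
     ennreal ((\<bar>y\<bar> / sqrt (1 + y\<^sup>2)) ^ n / (1 + y\<^sup>2))" for y
  proof -
    have pos: "0 < 1 + y\<^sup>2" by (simp add: add_pos_nonneg)
    have "-1 < y\<^sup>2" by (rule less_le_trans[of _ 0]) auto
    from nn_integral_gaussp_exp_square[OF this I]
    have "(\<integral>\<^sup>+x. ennreal (\<bar>y\<bar> ^ n * exp (- y\<^sup>2 * (\<Sum>i\<in>I. (x i)\<^sup>2) / 2)) \<partial>gaussp I) =
      ennreal (\<bar>y\<bar> ^ n) * ennreal ((1 / sqrt (1 + y\<^sup>2)) ^ card I)"
      by (simp add: ennreal_mult' nn_integral_cmult)
    also have "\<dots> = ennreal (\<bar>y\<bar> ^ n * ((1 / sqrt (1 + y\<^sup>2)) ^ card I))" by (simp add: ennreal_mult')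
    also have "\<bar>y\<bar> ^ n * ((1 / sqrt (1 + y\<^sup>2)) ^ card I) = (\<bar>y\<bar> / sqrt (1 + y\<^sup>2)) ^ n / (1 + y\<^sup>2)"
      using pos by (simp add: card pn power_divide)
    finally show ?thesis .
  qed
  let ?W = "\<lambda>y::real. (\<bar>y\<bar> / sqrt (1 + y\<^sup>2)) ^ n / (1 + y\<^sup>2)"
  let ?D = "sqrt (2 * pi) * gmoment n / (2 * gmoment (Suc n))"
  have half: "(\<integral>\<^sup>+y. ennreal (?W y) * indicator {0..} y \<partial>lborel) \<le> ennreal ?D"
  proof (rule nn_integral_atLeast_0_le)
    fix m :: nat
    have "((\<lambda>y. (y / sqrt (1 + y\<^sup>2)) ^ n / (1 + y\<^sup>2)) has_integral
        integral {0..real m} (\<lambda>y. (y / sqrt (1 + y\<^sup>2)) ^ n / (1 + y\<^sup>2))) {0..real m}"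
    proof (intro integrable_integral integrable_continuous_interval continuous_intros)
      show "\<forall>x\<in>{0..real m}. sqrt (1 + x\<^sup>2) \<noteq> 0" "\<forall>x\<in>{0..real m}. 1 + x\<^sup>2 \<noteq> 0"
        by (simp_all add: add_nonneg_eq_0_iff)
    qed
    hence "(\<integral>\<^sup>+y. ennreal ((y / sqrt (1 + y\<^sup>2)) ^ n / (1 + y\<^sup>2)) * indicator {0..real m} y \<partial>lborel) =
       ennreal (integral {0..real m} (\<lambda>y. (y / sqrt (1 + y\<^sup>2)) ^ n / (1 + y\<^sup>2)))"
      by (intro nn_integral_has_integral_lebesgue') auto
    also have "\<dots> \<le> ennreal ?D" by (intro ennreal_leI Wallis_integral_le) auto
    also have "(\<integral>\<^sup>+y. ennreal ((y / sqrt (1 + y\<^sup>2)) ^ n / (1 + y\<^sup>2)) * indicator {0..real m} y \<partial>lborel) =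
      (\<integral>\<^sup>+y. ennreal (?W y) * indicator {0..real m} y \<partial>lborel)"
      by (intro nn_integral_cong) (auto simp: indicator_def)
    finally show "(\<integral>\<^sup>+y. ennreal (?W y) * indicator {0..real m} y \<partial>lborel) \<le> ennreal ?D" .
  qed measurable
  have full: "(\<integral>\<^sup>+y. ennreal (?W y) \<partial>lborel) \<le> ennreal (2 * ?D)"
  proof -
    have "(\<integral>\<^sup>+y. ennreal (?W y) \<partial>lborel) \<le>
       (\<integral>\<^sup>+y. ennreal (?W y) * indicator {0..} y + ennreal (?W (0 + -1 * y)) * indicator {0..} (0 + -1 * y) \<partial>lborel)"
      by (intro nn_integral_mono) (auto simp: indicator_def)
    also have "\<dots> = (\<integral>\<^sup>+y. ennreal (?W y) * indicator {0..} y \<partial>lborel) + (\<integral>\<^sup>+y. ennreal (?W (0 + -1 * y)) * indicator {0..} (0 + -1 * y) \<partial>lborel)"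
      by (rule nn_integral_add) auto
    also have "(\<integral>\<^sup>+y. ennreal (?W (0 + -1 * y)) * indicator {0..} (0 + -1 * y) \<partial>lborel) = (\<integral>\<^sup>+y. ennreal (?W y) * indicator {0..} y \<partial>lborel)"
      by (subst (2) nn_integral_real_affine[where c = "-1" and t = 0]) auto
    also have "(\<integral>\<^sup>+y. ennreal (?W y) * indicator {0..} y \<partial>lborel) + (\<integral>\<^sup>+y. ennreal (?W y) * indicator {0..} y \<partial>lborel) \<le> ennreal ?D + ennreal ?D"
      by (intro add_mono half)
    also have "\<dots> = ennreal (2 * ?D)"
      using gmoment_pos[of n] gmoment_pos[of "Suc n"] by (simp add: ennreal_plus[symmetric] del: ennreal_plus)
    finally show ?thesis .
  qed
  interpret g: sigma_finite_measure "gaussp I"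
    by (intro prob_space_imp_sigma_finite prob_space_gaussp)
  interpret pair_sigma_finite "gaussp I" lborel ..
  have "ennreal C * (\<integral>\<^sup>+x. ennreal ((\<Sum>i\<in>I. (x i)\<^sup>2) powr (- real p / 2)) \<partial>gaussp I) =
      (\<integral>\<^sup>+x. ennreal C * ennreal ((\<Sum>i\<in>I. (x i)\<^sup>2) powr (- real p / 2)) \<partial>gaussp I)"
    by (rule nn_integral_cmult[symmetric]) measurable
  also have "\<dots> \<le> (\<integral>\<^sup>+x. (\<integral>\<^sup>+y. ennreal (\<bar>y\<bar> ^ n * exp (- y\<^sup>2 * (\<Sum>i\<in>I. (x i)\<^sup>2) / 2)) \<partial>lborel) \<partial>gaussp I)"
  proof (rule nn_integral_mono)
    fix x
    show "ennreal C * ennreal ((\<Sum>i\<in>I. (x i)\<^sup>2) powr (- real p / 2)) \<le>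
      (\<integral>\<^sup>+y. ennreal (\<bar>y\<bar> ^ n * exp (- y\<^sup>2 * (\<Sum>i\<in>I. (x i)\<^sup>2) / 2)) \<partial>lborel)"
    \<comment> \<open>At the origin \<open>0 powr\<close> a negative exponent is 0, so the mixture
      formula is only needed for a positive argument.\<close>
    proof (cases "(\<Sum>i\<in>I. (x i)\<^sup>2) = 0")
      case False
      hence "0 < (\<Sum>i\<in>I. (x i)\<^sup>2)" by (simp add: order_less_le sum_nonneg)
      from mixture[OF this] show ?thesis by simp
    qed simp
  qed
  also have "\<dots> = (\<integral>\<^sup>+y. (\<integral>\<^sup>+x. ennreal (\<bar>y\<bar> ^ n * exp (- y\<^sup>2 * (\<Sum>i\<in>I. (x i)\<^sup>2) / 2)) \<partial>gaussp I) \<partial>lborel)"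
    by (rule Fubini'[symmetric]) measurable
  also have "\<dots> \<le> ennreal (2 * ?D)" using full by (simp only: inner)
  also have "2 * ?D = C * (1 / gmoment p)" by (simp add: C_def pn)
  finally have "ennreal C * (\<integral>\<^sup>+x. ennreal ((\<Sum>i\<in>I. (x i)\<^sup>2) powr (- real p / 2)) \<partial>gaussp I) \<le> ennreal C * ennreal (1 / gmoment p)"
    using C by (simp only: ennreal_mult' less_imp_le)
  thus ?thesis using C by (subst (asm) ennreal_mult_le_mult_iff) auto
qed

section \<open>Moments of linear forms and Wick's formula of order four\<close>

lemma distr_gaussp_linear_form:
  assumes I: "finite I" and a: "(\<Sum>i\<in>I. (a i)\<^sup>2) = 1"
  shows "distr (gaussp I) borel (\<lambda>x. \<Sum>i\<in>I. a i * x i) = gauss"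
proof (rule Levy_uniqueness[OF _ real_dist_normal_dist])
  interpret prob_space "gaussp I" by (rule prob_space_gaussp)
  show "real_distribution (distr (gaussp I) borel (\<lambda>x. \<Sum>i\<in>I. a i * x i))"
    by (intro real_distribution_distr) measurable
  show "char (distr (gaussp I) borel (\<lambda>x. \<Sum>i\<in>I. a i * x i)) = char gauss"
  proof
    fix t
    have "char (distr (gaussp I) borel (\<lambda>x. \<Sum>i\<in>I. a i * x i)) t = (CLINT x|gaussp I. iexp (\<Sum>i\<in>I. (t * a i) * x i))"
      unfolding char_def by (subst integral_distr) (auto simp: sum_distrib_left mult.assoc)
    also have "\<dots> = exp (- complex_of_real (t\<^sup>2 / 2))"
      unfolding char_gaussp[OF I] by (simp add: power_mult_distrib a flip: sum_distrib_left)
    also have "\<dots> = char gauss t"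
      unfolding char_std_normal_distribution by (simp add: exp_of_real[symmetric])
    finally show "char (distr (gaussp I) borel (\<lambda>x. \<Sum>i\<in>I. a i * x i)) t = char gauss t" .
  qed
qed

lemma gaussp_linear_form_moment:
  assumes I: "finite I"
  shows "integrable (gaussp I) (\<lambda>x. \<bar>\<Sum>i\<in>I. a i * x i\<bar> ^ p)" (is ?A)
    and "(\<integral>x. \<bar>\<Sum>i\<in>I. a i * x i\<bar> ^ p \<partial>gaussp I) = sqrt (\<Sum>i\<in>I. (a i)\<^sup>2) ^ p * gmoment p" (is ?B)
proof -
  define s where "s = sqrt (\<Sum>i\<in>I. (a i)\<^sup>2)"
  interpret prob_space "gaussp I" by (rule prob_space_gaussp)
  have "?A \<and> ?B"
  proof (cases "s = 0")
    case True
    hence "(\<Sum>i\<in>I. (a i)\<^sup>2) = 0" by (simp add: s_def)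
    hence "\<forall>i\<in>I. a i = 0" using I by (simp add: sum_nonneg_eq_0_iff)
    hence "(\<Sum>i\<in>I. a i * x i) = 0" for x :: "'a \<Rightarrow> real" by simp
    thus ?thesis using True by (cases p) (simp_all add: s_def gmoment_0 prob_space)
  next
    case False
    hence s: "0 < s" by (simp add: s_def sum_nonneg order_less_le)
    define b where "b = (\<lambda>i. a i / s)"
    have "(\<Sum>i\<in>I. (b i)\<^sup>2) = (\<Sum>i\<in>I. (a i)\<^sup>2) / s\<^sup>2"
      by (simp add: b_def power_divide sum_divide_distrib)
    also have "s\<^sup>2 = (\<Sum>i\<in>I. (a i)\<^sup>2)" by (simp add: s_def sum_nonneg)
    finally have "(\<Sum>i\<in>I. (b i)\<^sup>2) = 1" using s by (simp add: s_def)
    note d = distr_gaussp_linear_form[OF I this]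
    have eq: "\<bar>\<Sum>i\<in>I. a i * x i\<bar> ^ p = s ^ p * \<bar>\<Sum>i\<in>I. b i * x i\<bar> ^ p" for x
    proof -
      have "(\<Sum>i\<in>I. a i * x i) = s * (\<Sum>i\<in>I. b i * x i)" using s by (simp add: b_def sum_distrib_left)
      thus ?thesis using s by (simp add: abs_mult power_mult_distrib)
    qed
    have i: "integrable (gaussp I) (\<lambda>x. \<bar>\<Sum>i\<in>I. b i * x i\<bar> ^ p)"
      using integrable_distr[of "\<lambda>x. \<Sum>i\<in>I. b i * x i" "gaussp I" borel "\<lambda>x. \<bar>x\<bar> ^ p"] integrable_gauss_abs_power[of p]
      unfolding d by simp
    moreover have "(\<integral>x. \<bar>\<Sum>i\<in>I. b i * x i\<bar> ^ p \<partial>gaussp I) = gmoment p"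
      using integral_distr[of "\<lambda>x. \<Sum>i\<in>I. b i * x i" "gaussp I" borel "\<lambda>x. \<bar>x\<bar> ^ p"]
      unfolding d by (simp add: gmoment_def)
    ultimately show ?thesis unfolding eq s_def[symmetric] by simp
  qed
  thus ?A ?B by auto
qed

text \<open>The signed sum over the eight sign patterns keeps only monomials odd in each of b, c and
  d. The only one of degree four is \<open>a * b * c * d\<close>, with coefficient 4! = 24, and 192
  = 8 * 24.\<close>

lemma polarize4:
  fixes a b c d :: real
  shows "192 * (a * b * c * d) = (a+b+c+d)^4 - (a+b+c-d)^4 - (a+b-c+d)^4 + (a+b-c-d)^4 - (a-b+c+d)^4 + (a-b+c-d)^4 + (a-b-c+d)^4 - (a-b-c-d)^4"
  by (simp add: power4_eq_xxxx algebra_simps)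

text \<open>The companion of \<open>polarize4\<close> for squared norms of the eight combinations: s
  collects the diagonal and the six letters are the inner products of the pairs. The products that
  survive the signs are the three pairings of Wick's formula.\<close>

lemma polarize4_square:
  fixes s u v w x y z :: real
  shows "(s + 2 * (u + v + w + x + y + z))\<^sup>2 - (s + 2 * (u + v - w + x - y - z))\<^sup>2 - (s + 2 * (u - v + w - x + y - z))\<^sup>2 + (s + 2 * (u - v - w - x - y + z))\<^sup>2
   - (s + 2 * (- u + v + w - x - y + z))\<^sup>2 + (s + 2 * (- u + v - w - x + y - z))\<^sup>2 + (s + 2 * (- u - v + w + x - y - z))\<^sup>2 - (s + 2 * (- u - v - w + x + y + z))\<^sup>2 = 64 * (u * z + v * y + w * x)"
  by (simp add: power2_eq_square algebra_simps)

text \<open>By polarization of the fourth moment of a single linear form.\<close>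
lemma gaussp_Wick4:
  fixes a b c d :: "'i \<Rightarrow> real"
  assumes I: "finite I"
  defines "Y \<equiv> \<lambda>a x. \<Sum>i\<in>I. a i * x i" and "D \<equiv> \<lambda>a b. \<Sum>i\<in>I. a i * b i"
  shows "integrable (gaussp I) (\<lambda>x. Y a x * Y b x * Y c x * Y d x)" (is ?A)
    and "(\<integral>x. Y a x * Y b x * Y c x * Y d x \<partial>gaussp I) = D a b * D c d + D a c * D b d + D a d * D b c" (is ?B)
proof -
  have g4: "gmoment 4 = 3" using gmoment_Suc_Suc[of 2] gmoment_Suc_Suc[of 0] by (simp add: gmoment_0 eval_nat_numeral)
  have D: "D v v = (\<Sum>i\<in>I. (v i)\<^sup>2)" for v by (simp add: D_def power2_eq_square)
  have i4: "integrable (gaussp I) (\<lambda>x. Y v x ^ 4)" and e4: "(\<integral>x. Y v x ^ 4 \<partial>gaussp I) = 3 * (D v v)\<^sup>2" for v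
  proof -
    have "sqrt (D v v) ^ 4 = (D v v)\<^sup>2"
    proof -
      have "sqrt (D v v) ^ 4 = ((sqrt (D v v))\<^sup>2)\<^sup>2" by simp
      thus ?thesis by (simp add: D sum_nonneg)
    qed
    thus "integrable (gaussp I) (\<lambda>x. Y v x ^ 4)" "(\<integral>x. Y v x ^ 4 \<partial>gaussp I) = 3 * (D v v)\<^sup>2"
      using gaussp_linear_form_moment[OF I, of v 4] by (simp_all add: power_even_abs g4 Y_def D)
  qed
  define S where "S = {1, -1 :: real}"
  have fS: "finite S" by (simp add: S_def)
  define T where "T = S \<times> S \<times> S"
  define e where "e = (\<lambda>(p,q,r) i. a i + p * b i + q * c i + r * d i)"
  define w where "w = (\<lambda>(p,q,r). p * q * r :: real)"
  have Ye: "Y (e (p,q,r)) x = Y a x + p * Y b x + q * Y c x + r * Y d x" for p q r x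
    by (simp add: Y_def e_def algebra_simps sum.distrib sum_distrib_left)
  have De: "D (e (p,q,r)) (e (p,q,r)) = D a a + p\<^sup>2 * D b b + q\<^sup>2 * D c c + r\<^sup>2 * D d d
      + 2 * (p * D a b + q * D a c + r * D a d + p * q * D b c + p * r * D b d + q * r * D c d)" for p q r
    by (simp add: D_def e_def algebra_simps sum.distrib sum_distrib_left power2_eq_square)
  have sumT: "(\<Sum>t\<in>T. f t) = f (1,1,1) + f (1,1,-1) + f (1,-1,1) + f (1,-1,-1) + f (-1,1,1) + f (-1,1,-1) + f (-1,-1,1) + f (-1,-1,-1)"
    for f :: "real \<times> real \<times> real \<Rightarrow> real"
    unfolding T_def S_def by (simp add: sum.cartesian_product[symmetric] sum.insert)
  have pol: "Y a x * Y b x * Y c x * Y d x = (\<Sum>t\<in>T. w t * Y (e t) x ^ 4) / 192" for x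
    unfolding sumT w_def Ye using polarize4[of "Y a x" "Y b x" "Y c x" "Y d x"] by simp
  have "integrable (gaussp I) (\<lambda>x. (\<Sum>t\<in>T. w t * Y (e t) x ^ 4) / 192)"
    by (intro Bochner_Integration.integrable_divide_zero Bochner_Integration.integrable_sum integrable_mult_right i4)
  thus ?A unfolding pol .
  have "(\<integral>x. Y a x * Y b x * Y c x * Y d x \<partial>gaussp I) = (\<Sum>t\<in>T. w t * (3 * (D (e t) (e t))\<^sup>2)) / 192"
    unfolding pol using i4 by (simp add: e4)
  also have "\<dots> = D a b * D c d + D a c * D b d + D a d * D b c"
    unfolding sumT w_def De
    using polarize4_square[of "D a a + D b b + D c c + D d d" "D a b" "D a c" "D a d" "D b c" "D b d" "D c d"]
    by (simp add: algebra_simps)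
  finally show ?B .
qed

section \<open>Real matrices\<close>

unbundle no vec_syntax
no_notation inner (infix "\<bullet>" 70)
notation transpose_mat ("(_\<^sup>T)" [1000] 1000)

text \<open>The side conditions are equations between dimensions instead of carrier memberships, so
  that rewriting can discharge them in long products.\<close>

lemma massoc:
  fixes A B C :: "'a :: semiring_0 mat"
  assumes "dim_col A = dim_row B" "dim_col B = dim_row C"
  shows "(A * B) * C = A * (B * C)"
proof (rule assoc_mult_mat)
  show "A \<in> carrier_mat (dim_row A) (dim_row B)" by (rule carrier_matI[OF refl assms(1)])
  show "B \<in> carrier_mat (dim_row B) (dim_row C)" by (rule carrier_matI[OF refl assms(2)])
  show "C \<in> carrier_mat (dim_row C) (dim_col C)" by (rule carrier_matI[OF refl refl])
qed

lemma vassoc: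
  fixes A B :: "'a :: semiring_0 mat"
  assumes "dim_col A = dim_row B" "dim_col B = dim_vec v"
  shows "(A * B) *\<^sub>v v = A *\<^sub>v (B *\<^sub>v v)"
proof (rule assoc_mult_mat_vec)
  show "A \<in> carrier_mat (dim_row A) (dim_row B)" by (rule carrier_matI[OF refl assms(1)])
  show "B \<in> carrier_mat (dim_row B) (dim_vec v)" by (rule carrier_matI[OF refl assms(2)])
  show "v \<in> carrier_vec (dim_vec v)" by (rule carrier_vecI) simp
qed

lemma mtrans:
  fixes A B :: "'a :: comm_semiring_0 mat"
  assumes "dim_col A = dim_row B" shows "(A * B)\<^sup>T = B\<^sup>T * A\<^sup>T"
proof (rule transpose_mult)
  show "A \<in> carrier_mat (dim_row A) (dim_row B)" by (rule carrier_matI[OF refl assms(1)])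
  show "B \<in> carrier_mat (dim_row B) (dim_col B)" by (rule carrier_matI[OF refl refl])
qed

lemma mult_mat_index:
  fixes A B :: "real mat"
  shows "i < dim_row A \<Longrightarrow> j < dim_col B \<Longrightarrow> dim_col A = dim_row B \<Longrightarrow>
    (A * B) $$ (i,j) = (\<Sum>l<dim_row B. A $$ (i,l) * B $$ (l,j))"
  by (simp add: scalar_prod_def lessThan_atLeast0)

lemma mult_vec_index:
  fixes A :: "real mat"
  shows "i < dim_row A \<Longrightarrow> dim_col A = dim_vec v \<Longrightarrow> (A *\<^sub>v v) $ i = (\<Sum>l<dim_vec v. A $$ (i,l) * v $ l)"
  by (simp add: scalar_prod_def lessThan_atLeast0)

lemma sprod_index:
  fixes v w :: "real vec"
  shows "v \<bullet> w = (\<Sum>l<dim_vec w. v $ l * w $ l)"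
  by (simp add: scalar_prod_def lessThan_atLeast0)

lemma sprod_trans:
  fixes A :: "real mat"
  assumes "dim_vec x = dim_col A" "dim_vec y = dim_row A"
  shows "(A\<^sup>T *\<^sub>v y) \<bullet> x = y \<bullet> (A *\<^sub>v x)"
proof (rule transpose_vec_mult_scalar)
  show "A \<in> carrier_mat (dim_row A) (dim_col A)" by (rule carrier_matI[OF refl refl])
  show "x \<in> carrier_vec (dim_col A)" "y \<in> carrier_vec (dim_row A)" by (rule carrier_vecI[OF assms(1)], rule carrier_vecI[OF assms(2)])
qed

lemma sprod_comm: "dim_vec (v::real vec) = dim_vec w \<Longrightarrow> v \<bullet> w = w \<bullet> v"
  by (simp add: sprod_index mult.commute)

lemma sprod_self: "(v::real vec) \<bullet> v = (\<Sum>l<dim_vec v. (v $ l)\<^sup>2)"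
  by (simp add: sprod_index power2_eq_square)

lemma sprod_smult: "(c \<cdot>\<^sub>v (v::real vec)) \<bullet> (c \<cdot>\<^sub>v v) = c\<^sup>2 * (v \<bullet> v)"
  by (simp add: sprod_self power_mult_distrib sum_distrib_left)

lemma sprod_self_nonneg: "0 \<le> (v::real vec) \<bullet> v"
  by (simp add: sprod_self sum_nonneg)

lemma sprod_self_eq_0: "(v::real vec) \<bullet> v = 0 \<longleftrightarrow> v = 0\<^sub>v (dim_vec v)"
proof
  assume "v = 0\<^sub>v (dim_vec v)"
  hence "v $ l = 0" if "l < dim_vec v" for l using that by (metis index_zero_vec(1))
  thus "v \<bullet> v = 0" by (simp add: sprod_self)
qed (auto simp: sprod_self sum_nonneg_eq_0_iff intro!: eq_vecI)

lemma sprod_cauchy_schwarz: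
  assumes "dim_vec v = dim_vec (w::real vec)" shows "(v \<bullet> w)\<^sup>2 \<le> (v \<bullet> v) * (w \<bullet> w)"
  using Cauchy_Schwarz_ineq_sum[of "\<lambda>l. v $ l" "\<lambda>l. w $ l" "{..<dim_vec w}"] assms
  by (simp add: sprod_index power2_eq_square)

section \<open>Orthogonal matrices and reflections\<close>

lemma orthogonal_dims:
  "orthogonal_real_mat n Q \<Longrightarrow> dim_row Q = n" "orthogonal_real_mat n Q \<Longrightarrow> dim_col Q = n"
  by (auto simp: orthogonal_real_mat_def)

lemma orthogonal_trans: "orthogonal_real_mat n Q \<Longrightarrow> orthogonal_real_mat n (Q\<^sup>T)"
  by (auto simp: orthogonal_real_mat_def)

lemma orthogonal_one: "orthogonal_real_mat n (1\<^sub>m n)"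
  by (auto simp: orthogonal_real_mat_def)

lemma orthogonal_mult:
  assumes P: "orthogonal_real_mat n P" and Q: "orthogonal_real_mat n Q"
  shows "orthogonal_real_mat n (P * Q)"
proof -
  note d = orthogonal_dims[OF P] orthogonal_dims[OF Q]
  have "P\<^sup>T * (P * Q) = (P\<^sup>T * P) * Q" by (rule massoc[symmetric]) (simp_all add: d)
  also have "\<dots> = Q" using P Q by (auto simp: orthogonal_real_mat_def)
  finally have 1: "P\<^sup>T * (P * Q) = Q" .
  have "Q * (Q\<^sup>T * P\<^sup>T) = (Q * Q\<^sup>T) * P\<^sup>T" by (rule massoc[symmetric]) (simp_all add: d)
  also have "\<dots> = P\<^sup>T" using P Q by (auto simp: orthogonal_real_mat_def)
  finally have 2: "Q * (Q\<^sup>T * P\<^sup>T) = P\<^sup>T" .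
  show ?thesis using P Q by (auto simp: orthogonal_real_mat_def mtrans massoc 1 2)
qed

lemma orthogonal_sprod:
  assumes Q: "orthogonal_real_mat n Q" and v: "dim_vec v = n" "dim_vec w = n"
  shows "(Q *\<^sub>v v) \<bullet> (Q *\<^sub>v w) = v \<bullet> w"
proof -
  note d = orthogonal_dims[OF Q]
  have "(Q *\<^sub>v v) \<bullet> (Q *\<^sub>v w) = (Q\<^sup>T *\<^sub>v (Q *\<^sub>v v)) \<bullet> w" by (simp add: sprod_trans d v)
  also have "Q\<^sup>T *\<^sub>v (Q *\<^sub>v v) = (Q\<^sup>T * Q) *\<^sub>v v" by (rule vassoc[symmetric]) (simp_all add: d v)
  also have "\<dots> = v"
    using Q one_mult_mat_vec[OF carrier_vecI[OF v(1)]] by (simp only: orthogonal_real_mat_def)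
  finally show ?thesis .
qed

lemma sum_if_mult: "finite A \<Longrightarrow> (\<Sum>l\<in>A. (if i = l then a else 0) * f l) = (if i \<in> A then a * f i else (0::real))"
  by (subst sum.cong[OF refl, of _ _ "\<lambda>l. if i = l then a * f i else 0"]) auto

text \<open>The reflection along \<open>w = e - v\<close>, where e is the first unit vector. Because
  e and v have the same length, \<open>W = 2 * w 0\<close>, and this makes the reflection send e to
  v. If w = 0, the identity serves.\<close>

lemma householder:
  fixes v :: "real vec"
  assumes v: "v \<in> carrier_vec n" "v \<bullet> v = 1" and n: "0 < n"
  obtains Q where "orthogonal_real_mat n Q" "Q *\<^sub>v unit_vec n 0 = v" "Q\<^sup>T *\<^sub>v v = unit_vec n 0"
proof -
  have dv: "dim_vec v = n" using v by auto
  define w where "w = (\<lambda>i. (if i = 0 then 1 else 0) - v $ i)"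
  define W where "W = (\<Sum>i<n. (w i)\<^sup>2)"
  have ex: "\<exists>Q. orthogonal_real_mat n Q \<and> Q *\<^sub>v unit_vec n 0 = v"
  proof (cases "W = 0")
    case True
    hence "\<forall>i<n. w i = 0" by (simp add: W_def sum_nonneg_eq_0_iff)
    hence "unit_vec n 0 = v" by (intro eq_vecI) (auto simp: w_def dv unit_vec_def split: if_splits)
    thus ?thesis using v by (intro exI[of _ "1\<^sub>m n"]) (auto simp: orthogonal_one)
  next
    case False
    define Q where "Q = Matrix.mat n n (\<lambda>(i,j). (if i = j then 1 else 0) - 2 * w i * w j / W)"
    have Qc: "Q \<in> carrier_mat n n" by (simp add: Q_def)
    have QT: "Q\<^sup>T = Q" by (rule eq_matI) (auto simp: Q_def)
    have QQ: "Q * Q = 1\<^sub>m n"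
    proof (rule eq_matI)
      fix i j assume "i < dim_row (1\<^sub>m n :: real mat)" "j < dim_col (1\<^sub>m n :: real mat)"
      hence ij: "i < n" "j < n" by auto
      have "(Q * Q) $$ (i,j) = (\<Sum>l<n. ((if i = l then 1 else 0) - 2 * w i * w l / W) * ((if l = j then 1 else 0) - 2 * w l * w j / W))"
        using ij by (subst mult_mat_index) (auto simp: Q_def intro!: sum.cong)
      also have "\<dots> = (\<Sum>l<n. (if i = l then 1 else 0) * (if l = j then 1 else 0)
          - (if i = l then 1 else 0) * (2 * w l * w j / W) - (if j = l then 1 else 0) * (2 * w i * w l / W)
          + 4 * w i * w j / W\<^sup>2 * (w l)\<^sup>2)"
        by (intro sum.cong refl) (auto simp: algebra_simps power2_eq_square)
      also have "\<dots> = (if i = j then 1 else 0) - 2 * w i * w j / W - 2 * w i * w j / W + 4 * w i * w j / W\<^sup>2 * W"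
      proof -
        have "(\<Sum>l<n. (if i = l then 1 else 0) * (if l = j then 1 else 0)) = (if i = j then 1 else (0::real))"
          using ij by (simp add: sum_if_mult)
        moreover have "(\<Sum>l<n. (if i = l then 1 else 0) * (2 * w l * w j / W)) = 2 * w i * w j / W"
          using ij by (simp only: sum_if_mult finite_lessThan) simp
        moreover have "(\<Sum>l<n. (if j = l then 1 else 0) * (2 * w i * w l / W)) = 2 * w i * w j / W"
          using ij by (simp only: sum_if_mult finite_lessThan) simp
        moreover have "(\<Sum>l<n. 4 * w i * w j / W\<^sup>2 * (w l)\<^sup>2) = 4 * w i * w j / W\<^sup>2 * W"
          by (simp only: sum_distrib_left[symmetric] W_def[symmetric])
        ultimately show ?thesis by (simp only: sum.distrib sum_subtractf)
      qed
      also have "\<dots> = (if i = j then 1 else 0)" using False by (simp add: power2_eq_square)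
      finally show "(Q * Q) $$ (i,j) = 1\<^sub>m n $$ (i,j)" using ij by simp
    qed (auto simp: Q_def)
    have "W = (\<Sum>i<n. ((if 0 = i then 1 else 0) - 2 * ((if 0 = i then 1 else 0) * v $ i) + (v $ i)\<^sup>2))"
      unfolding W_def w_def by (intro sum.cong refl) (auto simp: power2_eq_square algebra_simps)
    also have "\<dots> = 2 - 2 * v $ 0"
    proof -
      have "(\<Sum>i<n. (if 0 = i then 1 else 0)) = (1::real)" using n by simp
      moreover have "(\<Sum>i<n. (if 0 = i then 1 else 0) * v $ i) = v $ 0" using n by (subst sum_if_mult) auto
      moreover have "(\<Sum>i<n. (v $ i)\<^sup>2) = 1" using v(2) by (simp add: sprod_self dv)
      ultimately show ?thesis
        by (simp only: sum.distrib sum_subtractf sum_distrib_left[symmetric])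
    qed
    finally have W2: "W = 2 * w 0" by (simp add: w_def)
    have "Q *\<^sub>v unit_vec n 0 = v"
    proof (rule eq_vecI)
      fix i assume i: "i < dim_vec v"
      hence i: "i < n" by (simp add: dv)
      have "(Q *\<^sub>v unit_vec n 0) $ i = (\<Sum>l<n. (if 0 = l then 1 else 0) * Q $$ (i,l))"
        using i by (subst mult_vec_index) (auto simp: Q_def unit_vec_def intro!: sum.cong)
      also have "\<dots> = (if i = 0 then 1 else 0) - 2 * w i * w 0 / W"
        using i n by (subst sum_if_mult) (auto simp: Q_def)
      also have "\<dots> = (if i = 0 then 1 else 0) - w i" using False by (simp add: W2)
      finally show "(Q *\<^sub>v unit_vec n 0) $ i = v $ i" by (simp add: w_def)
    qed (simp add: dv Q_def)
    moreover have "orthogonal_real_mat n Q"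
      unfolding orthogonal_real_mat_def QT using Qc QQ by simp
    ultimately show ?thesis by blast
  qed
  then obtain Q where Q: "orthogonal_real_mat n Q" "Q *\<^sub>v unit_vec n 0 = v" by blast
  have "Q\<^sup>T *\<^sub>v v = (Q\<^sup>T * Q) *\<^sub>v unit_vec n 0"
    unfolding Q(2)[symmetric] by (rule vassoc[symmetric]) (simp_all add: orthogonal_dims[OF Q(1)])
  also have "\<dots> = unit_vec n 0" using Q(1) by (simp add: orthogonal_real_mat_def)
  finally show ?thesis using that Q by blast
qed

section \<open>The spectral theorem and orthogonal triangularization\<close>

definition bordered :: "real \<Rightarrow> real mat \<Rightarrow> real mat" where
  "bordered a Q = four_block_mat (Matrix.mat 1 1 (\<lambda>_. a)) (0\<^sub>m 1 (dim_col Q)) (0\<^sub>m (dim_row Q) 1) Q"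

lemma bordered_carrier: "Q \<in> carrier_mat r c \<Longrightarrow> bordered a Q \<in> carrier_mat (Suc r) (Suc c)"
  unfolding bordered_def using four_block_carrier_mat[of "Matrix.mat 1 1 (\<lambda>_. a)" 1 1 Q r c] by simp

lemma bordered_index:
  "Q \<in> carrier_mat r c \<Longrightarrow> i < Suc r \<Longrightarrow> j < Suc c \<Longrightarrow>
   bordered a Q $$ (i,j) = (if i = 0 then (if j = 0 then a else 0) else if j = 0 then 0 else Q $$ (i - 1, j - 1))"
  unfolding bordered_def by auto

lemma bordered_mult:
  assumes P: "P \<in> carrier_mat r m" and Q: "Q \<in> carrier_mat m c"
  shows "bordered a P * bordered b Q = bordered (a * b) (P * Q)"
proof -
  have "Matrix.mat 1 1 (\<lambda>_. a) * Matrix.mat 1 1 (\<lambda>_. b) = Matrix.mat 1 1 (\<lambda>_. a * b)"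
    by (rule eq_matI) (auto simp: scalar_prod_def)
  thus ?thesis
    unfolding bordered_def using P Q
    by (subst mult_four_block_mat[of _ 1 1 _ m _ r _ _ 1 _ c]) auto
qed

lemma bordered_trans:
  assumes "Q \<in> carrier_mat r c" shows "(bordered a Q)\<^sup>T = bordered a (Q\<^sup>T)"
  using assms unfolding bordered_def
  by (subst transpose_four_block_mat[of _ 1 1 _ c _ r]) (auto intro!: cong_four_block_mat eq_matI)

lemma bordered_one: "bordered 1 (1\<^sub>m n) = 1\<^sub>m (Suc n)"
proof -
  have "Matrix.mat 1 1 (\<lambda>_. 1::real) = 1\<^sub>m 1" by (rule eq_matI) auto
  thus ?thesis unfolding bordered_def using four_block_one_mat[of 1 n] by simp
qed

lemma orthogonal_bordered:
  assumes "orthogonal_real_mat n Q" shows "orthogonal_real_mat (Suc n) (bordered 1 Q)"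
  using assms bordered_mult[of "Q\<^sup>T" n n Q n 1 1] bordered_mult[of Q n n "Q\<^sup>T" n 1 1]
  by (auto simp: orthogonal_real_mat_def bordered_trans[of Q n n] bordered_one intro: bordered_carrier)

lemma mat_diag_index: "i < n \<Longrightarrow> j < n \<Longrightarrow> mat_diag n f $$ (i,j) = (if i = j then f j else 0)"
  by (simp add: mat_diag_def)

lemma mat_diag_dims: "dim_row (mat_diag n f) = n" "dim_col (mat_diag n f) = n"
  by (simp_all add: mat_diag_def)

text \<open>An eigenvector exists over the complex numbers. Symmetry makes its Hermitian form real,
  hence the eigenvalue too; then the real and imaginary parts satisfy the same eigenvalue equation,
  and at least one of them is nonzero.\<close>

lemma symmetric_eigenvector:
  fixes A :: "real mat"
  assumes A: "A \<in> carrier_mat n n" and sym: "A\<^sup>T = A" and n: "0 < n"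
  obtains v c where "v \<in> carrier_vec n" "v \<bullet> v = 1" "A *\<^sub>v v = c \<cdot>\<^sub>v v"
proof -
  define B where "B = map_mat complex_of_real A"
  have B: "B \<in> carrier_mat n n" using A by (simp add: B_def)
  have "degree (char_poly B) = n" using degree_monic_char_poly[OF B] by simp
  hence "\<not> constant (poly (char_poly B))" using n by (simp add: constant_degree)
  then obtain z where "poly (char_poly B) z = 0" using fundamental_theorem_of_algebra by blast
  hence "eigenvalue B z" using eigenvalue_root_char_poly[OF B] by simp
  then obtain x where x: "x \<in> carrier_vec n" "x \<noteq> 0\<^sub>v n" "B *\<^sub>v x = z \<cdot>\<^sub>v x"
    using B by (auto simp: eigenvalue_def eigenvector_def)
  have row: "(\<Sum>j<n. complex_of_real (A $$ (i,j)) * x $ j) = z * x $ i" if "i < n" for i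
  proof -
    have "(B *\<^sub>v x) $ i = (\<Sum>j<n. complex_of_real (A $$ (i,j)) * x $ j)"
      using that A x(1) by (auto simp: B_def scalar_prod_def lessThan_atLeast0 intro!: sum.cong)
    thus ?thesis using x(3) x(1) that by simp
  qed
  have symA: "A $$ (i,j) = A $$ (j,i)" if "i < n" "j < n" for i j
    using arg_cong[OF sym, of "\<lambda>M. M $$ (i,j)"] A that by auto
  define S where "S = (\<Sum>i<n. (cmod (x $ i))\<^sup>2)"
  have "S \<noteq> 0"
  proof
    assume "S = 0"
    hence "\<forall>i<n. x $ i = 0" by (simp add: S_def sum_nonneg_eq_0_iff)
    hence "x = 0\<^sub>v n" using x(1) by (intro eq_vecI) auto
    thus False using x(2) by simp
  qed
  define q where "q = (\<Sum>i<n. \<Sum>j<n. cnj (x $ i) * (complex_of_real (A $$ (i,j)) * x $ j))"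
  have "q = (\<Sum>i<n. cnj (x $ i) * (z * x $ i))"
    unfolding q_def sum_distrib_left[symmetric] by (intro sum.cong) (auto simp: row)
  also have "\<dots> = z * complex_of_real S"
    unfolding S_def of_real_sum sum_distrib_left complex_norm_square by (simp add: mult_ac)
  finally have q: "q = z * complex_of_real S" .
  have "cnj q = (\<Sum>i<n. \<Sum>j<n. cnj (x $ j) * (complex_of_real (A $$ (j,i)) * x $ i))"
    unfolding q_def by (simp, intro sum.cong refl) (auto simp: symA)
  also have "\<dots> = q" unfolding q_def by (rule sum.swap)
  finally have "cnj z * complex_of_real S = z * complex_of_real S" by (simp add: q)
  hence "Im z = 0" using \<open>S \<noteq> 0\<close> by (simp add: complex_eq_iff)
  hence z: "z = complex_of_real (Re z)" by (simp add: complex_eq_iff)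
  define r where "r = Matrix.vec n (\<lambda>i. Re (x $ i))"
  define s where "s = Matrix.vec n (\<lambda>i. Im (x $ i))"
  have "A *\<^sub>v r = Re z \<cdot>\<^sub>v r"
  proof (rule eq_vecI)
    fix i assume "i < dim_vec (Re z \<cdot>\<^sub>v r)"
    hence i: "i < n" by (simp add: r_def)
    have "(A *\<^sub>v r) $ i = (\<Sum>j<n. A $$ (i,j) * Re (x $ j))" using i A by (subst mult_vec_index) (auto simp: r_def intro!: sum.cong)
    also have "\<dots> = Re (\<Sum>j<n. complex_of_real (A $$ (i,j)) * x $ j)" by simp
    also have "\<dots> = Re z * Re (x $ i)" unfolding row[OF i] using \<open>Im z = 0\<close> by simp
    finally show "(A *\<^sub>v r) $ i = (Re z \<cdot>\<^sub>v r) $ i" using i by (simp add: r_def)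
  qed (use A in \<open>auto simp: r_def\<close>)
  moreover have "A *\<^sub>v s = Re z \<cdot>\<^sub>v s"
  proof (rule eq_vecI)
    fix i assume "i < dim_vec (Re z \<cdot>\<^sub>v s)"
    hence i: "i < n" by (simp add: s_def)
    have "(A *\<^sub>v s) $ i = (\<Sum>j<n. A $$ (i,j) * Im (x $ j))" using i A by (subst mult_vec_index) (auto simp: s_def intro!: sum.cong)
    also have "\<dots> = Im (\<Sum>j<n. complex_of_real (A $$ (i,j)) * x $ j)" by simp
    also have "\<dots> = Re z * Im (x $ i)" unfolding row[OF i] using \<open>Im z = 0\<close> by simp
    finally show "(A *\<^sub>v s) $ i = (Re z \<cdot>\<^sub>v s) $ i" using i by (simp add: s_def)
  qed (use A in \<open>auto simp: s_def\<close>)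
  moreover have "r \<bullet> r + s \<bullet> s = S"
    by (simp add: S_def sprod_self r_def s_def cmod_power2 sum.distrib)
  hence "r \<bullet> r \<noteq> 0 \<or> s \<bullet> s \<noteq> 0" using \<open>S \<noteq> 0\<close> by auto
  ultimately obtain y where y: "dim_vec y = n" "y \<bullet> y \<noteq> 0" "A *\<^sub>v y = Re z \<cdot>\<^sub>v y"
    by (metis dim_vec r_def s_def)
  have yp: "0 < y \<bullet> y" using y(2) sprod_self_nonneg[of y] by simp
  define v where "v = (1 / sqrt (y \<bullet> y)) \<cdot>\<^sub>v y"
  have yc: "y \<in> carrier_vec n" by (rule carrier_vecI[OF y(1)])
  have "v \<in> carrier_vec n" unfolding v_def by (rule smult_carrier_vec[THEN iffD2, OF yc])
  moreover have "v \<bullet> v = 1"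
  proof -
    have "v \<bullet> v = (1 / sqrt (y \<bullet> y))\<^sup>2 * (y \<bullet> y)" unfolding v_def by (rule sprod_smult)
    thus ?thesis using yp by (simp add: power_divide)
  qed
  moreover have "A *\<^sub>v v = Re z \<cdot>\<^sub>v v"
    unfolding v_def mult_mat_vec[OF A yc] y(3) by (simp add: smult_smult_assoc mult.commute)
  ultimately show ?thesis using that by blast
qed

text \<open>Deflation: a reflection moves a unit eigenvector to the first coordinate. The first
  column of the conjugated matrix is then a multiple of the unit vector, and symmetry clears the
  first row as well.\<close>

theorem real_spectral_theorem:
  fixes A :: "real mat"
  assumes "A \<in> carrier_mat n n" and "A\<^sup>T = A"
  shows "\<exists>Q d. orthogonal_real_mat n Q \<and> A = Q * mat_diag n d * Q\<^sup>T"
  using assms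
proof (induction n arbitrary: A)
  case 0
  thus ?case by (intro exI[of _ "1\<^sub>m 0"]) (auto simp: orthogonal_one intro!: eq_matI)
next
  case (Suc n)
  note A = Suc.prems(1) and sym = Suc.prems(2)
  obtain v c where v: "v \<in> carrier_vec (Suc n)" "v \<bullet> v = 1" "A *\<^sub>v v = c \<cdot>\<^sub>v v"
    using symmetric_eigenvector[OF A sym] by blast
  obtain Q where Q: "orthogonal_real_mat (Suc n) Q" "Q *\<^sub>v unit_vec (Suc n) 0 = v" "Q\<^sup>T *\<^sub>v v = unit_vec (Suc n) 0"
    using householder[OF v(1,2)] by blast
  have Qc: "Q \<in> carrier_mat (Suc n) (Suc n)" using Q(1) by (simp add: orthogonal_real_mat_def)
  have dims: "dim_row A = Suc n" "dim_col A = Suc n" "dim_row Q = Suc n" "dim_col Q = Suc n" "dim_vec v = Suc n"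
    using A Qc v by auto
  define B where "B = Q\<^sup>T * A * Q"
  have B: "B \<in> carrier_mat (Suc n) (Suc n)" using A Qc by (simp add: B_def)
  have BT: "B\<^sup>T = B" unfolding B_def using sym by (simp add: mtrans massoc dims)
  have "B *\<^sub>v unit_vec (Suc n) 0 = Q\<^sup>T *\<^sub>v (A *\<^sub>v (Q *\<^sub>v unit_vec (Suc n) 0))"
    unfolding B_def by (simp add: vassoc massoc dims)
  also have "\<dots> = Q\<^sup>T *\<^sub>v (c \<cdot>\<^sub>v v)" by (simp add: Q(2) v(3))
  also have "\<dots> = c \<cdot>\<^sub>v unit_vec (Suc n) 0"
    using mult_mat_vec[of "Q\<^sup>T" "Suc n" "Suc n" v c] Qc v(1) Q(3) by simp
  finally have Be: "B *\<^sub>v unit_vec (Suc n) 0 = c \<cdot>\<^sub>v unit_vec (Suc n) 0" .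
  have B0: "B $$ (i,0) = (if i = 0 then c else 0)" if "i < Suc n" for i
  proof -
    have "(B *\<^sub>v unit_vec (Suc n) 0) $ i = (\<Sum>l<Suc n. (if 0 = l then 1 else 0) * B $$ (i,l))"
      using that B unfolding mult_mat_vec_def
      by (auto simp: scalar_prod_def lessThan_atLeast0 unit_vec_def intro!: sum.cong)
    also have "\<dots> = B $$ (i,0)" by (subst sum_if_mult) auto
    finally show ?thesis unfolding Be using that by (auto simp: unit_vec_def)
  qed
  have B0': "B $$ (0,j) = (if j = 0 then c else 0)" if "j < Suc n" for j
    using arg_cong[OF BT, of "\<lambda>M. M $$ (j,0)"] B B0[OF that] that by auto
  define C where "C = Matrix.mat n n (\<lambda>(i,j). B $$ (Suc i, Suc j))"
  have C: "C \<in> carrier_mat n n" by (simp add: C_def)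
  have "C\<^sup>T = C"
  proof (rule eq_matI)
    fix i j assume "i < dim_row C" "j < dim_col C"
    thus "C\<^sup>T $$ (i,j) = C $$ (i,j)"
      using arg_cong[OF BT, of "\<lambda>M. M $$ (Suc i,Suc j)"] B by (auto simp: C_def)
  qed (auto simp: C_def)
  from Suc.IH[OF C this] obtain P d where P: "orthogonal_real_mat n P" "C = P * mat_diag n d * P\<^sup>T" by blast
  have Pc: "P \<in> carrier_mat n n" using P(1) by (simp add: orthogonal_real_mat_def)
  have "B = bordered c C"
  proof (rule eq_matI)
    have Cidx: "C $$ (i,j) = B $$ (Suc i, Suc j)" if "i < n" "j < n" for i j
      using that by (simp add: C_def)
    fix i j assume "i < dim_row (bordered c C)" "j < dim_col (bordered c C)"
    hence "i < Suc n" "j < Suc n" by (simp_all add: carrier_matD[OF bordered_carrier[OF C]])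
    thus "B $$ (i,j) = bordered c C $$ (i,j)"
      using B0 B0' by (cases i; cases j) (simp_all add: bordered_index[OF C] Cidx)
  qed (use B in \<open>simp_all add: carrier_matD[OF bordered_carrier[OF C]]\<close>)
  also have "\<dots> = bordered 1 P * bordered c (mat_diag n d) * bordered 1 (P\<^sup>T)"
    using Pc P(2) by (simp add: bordered_mult[where m = n and r = n and c = n])
  also have "bordered c (mat_diag n d) = mat_diag (Suc n) (case_nat c d)"
  proof (rule eq_matI)
    fix i j assume "i < dim_row (mat_diag (Suc n) (case_nat c d))" "j < dim_col (mat_diag (Suc n) (case_nat c d))"
    thus "bordered c (mat_diag n d) $$ (i,j) = mat_diag (Suc n) (case_nat c d) $$ (i,j)"
      by (cases i; cases j) (simp_all add: bordered_index[OF mat_diag_dim] mat_diag_index mat_diag_dims)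
  qed (simp_all add: carrier_matD[OF bordered_carrier[OF mat_diag_dim]] mat_diag_dims)
  also have "bordered 1 (P\<^sup>T) = (bordered 1 P)\<^sup>T" by (rule bordered_trans[OF Pc, symmetric])
  finally have BP: "B = bordered 1 P * mat_diag (Suc n) (case_nat c d) * (bordered 1 P)\<^sup>T" .
  have oP: "orthogonal_real_mat (Suc n) (bordered 1 P)" by (rule orthogonal_bordered[OF P(1)])
  have QB: "Q * B * Q\<^sup>T = A"
  proof -
    have "Q * B * Q\<^sup>T = (Q * Q\<^sup>T) * A * (Q * Q\<^sup>T)" unfolding B_def by (simp add: massoc dims)
    also have "\<dots> = A" using Q(1) A by (simp add: orthogonal_real_mat_def)
    finally show ?thesis .
  qed
  have dd: "dim_row (mat_diag (Suc n) f) = Suc n" "dim_col (mat_diag (Suc n) f) = Suc n" for f :: "nat \<Rightarrow> real"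
    by (auto simp: mat_diag_def)
  have "A = (Q * bordered 1 P) * mat_diag (Suc n) (case_nat c d) * (Q * bordered 1 P)\<^sup>T"
    unfolding QB[symmetric] BP by (simp add: massoc mtrans dims dd orthogonal_dims[OF oP])
  thus ?case using orthogonal_mult[OF Q(1) oP] by blast
qed

text \<open>Triangularization by successive reflections, as in a QR factorization. Linear
  independence plays no part, since a zero vector is simply left alone. It serves to bring all rows
  but one of a Gaussian matrix into the leading coordinates.\<close>

lemma orthogonal_reduction:
  fixes bs :: "real vec list"
  assumes "set bs \<subseteq> carrier_vec N" "length bs \<le> N"
  shows "\<exists>Q. orthogonal_real_mat N Q \<and> (\<forall>b\<in>set bs. \<forall>j. length bs \<le> j \<longrightarrow> j < N \<longrightarrow> (Q *\<^sub>v b) $ j = 0)"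
  using assms
proof (induction "length bs" arbitrary: bs N)
  case 0
  thus ?case using orthogonal_one by auto
next
  case (Suc k ds)
  then obtain b bs where ds: "ds = b # bs" by (cases ds) auto
  note prems = Suc.prems[unfolded ds]
  then obtain m where N: "N = Suc m" by (cases N) auto
  have b: "dim_vec b = Suc m" using prems N by auto
  obtain Q where Q: "orthogonal_real_mat (Suc m) Q" "\<And>j. 0 < j \<Longrightarrow> j < Suc m \<Longrightarrow> (Q *\<^sub>v b) $ j = 0"
  proof (cases "b \<bullet> b = 0")
    case True
    have "b = 0\<^sub>v (dim_vec b)" by (rule iffD1[OF sprod_self_eq_0 True])
    hence "b = 0\<^sub>v (Suc m)" unfolding b .
    hence "(1\<^sub>m (Suc m) *\<^sub>v b) $ j = 0" if "j < Suc m" for j using that by simp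
    thus ?thesis using that[OF orthogonal_one] by blast
  next
    case False
    hence bp: "0 < b \<bullet> b" using sprod_self_nonneg[of b] by simp
    define v where "v = (1 / sqrt (b \<bullet> b)) \<cdot>\<^sub>v b"
    have v: "v \<in> carrier_vec (Suc m)"
      unfolding v_def by (rule smult_carrier_vec[THEN iffD2, OF carrier_vecI[OF b]])
    have "v \<bullet> v = (1 / sqrt (b \<bullet> b))\<^sup>2 * (b \<bullet> b)" unfolding v_def by (rule sprod_smult)
    hence v1: "v \<bullet> v = 1" using bp by (simp add: power_divide)
    obtain Q where Q: "orthogonal_real_mat (Suc m) Q" "Q\<^sup>T *\<^sub>v v = unit_vec (Suc m) 0"
      using householder[OF v v1] by blast
    have bv: "b = sqrt (b \<bullet> b) \<cdot>\<^sub>v v" using bp by (intro eq_vecI) (auto simp: v_def)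
    have Qc: "Q\<^sup>T \<in> carrier_mat (Suc m) (Suc m)" using Q(1) by (simp add: orthogonal_real_mat_def)
    have "Q\<^sup>T *\<^sub>v b = sqrt (b \<bullet> b) \<cdot>\<^sub>v unit_vec (Suc m) 0"
      by (subst bv) (simp add: mult_mat_vec[OF Qc v] Q(2))
    thus ?thesis using that[OF orthogonal_trans[OF Q(1)]] by auto
  qed
  note Qd = orthogonal_dims[OF Q(1)]
  define tl' where "tl' = (\<lambda>w :: real vec. Matrix.vec m (\<lambda>j. w $ Suc j))"
  have "set (map (\<lambda>c. tl' (Q *\<^sub>v c)) bs) \<subseteq> carrier_vec m" by (auto simp: tl'_def)
  moreover have "length (map (\<lambda>c. tl' (Q *\<^sub>v c)) bs) \<le> m" using prems N by simp
  ultimately obtain P where P: "orthogonal_real_mat m P"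
    "\<And>c j. c \<in> set bs \<Longrightarrow> length bs \<le> j \<Longrightarrow> j < m \<Longrightarrow> (P *\<^sub>v tl' (Q *\<^sub>v c)) $ j = 0"
    using Suc.hyps(1)[of "map (\<lambda>c. tl' (Q *\<^sub>v c)) bs" m] Suc.hyps(2) ds by auto
  have Pc: "P \<in> carrier_mat m m" using P(1) by (simp add: orthogonal_real_mat_def)
  have oP: "orthogonal_real_mat (Suc m) (bordered 1 P)" by (rule orthogonal_bordered[OF P(1)])
  have bP: "(bordered 1 P *\<^sub>v w) $ Suc j = (P *\<^sub>v tl' w) $ j" if "dim_vec w = Suc m" "j < m" for w j
  proof -
    have "(bordered 1 P *\<^sub>v w) $ Suc j = (\<Sum>l<Suc m. bordered 1 P $$ (Suc j, l) * w $ l)"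
      using that by (subst mult_vec_index) (auto simp: orthogonal_dims[OF oP])
    also have "\<dots> = (\<Sum>l<m. P $$ (j, l) * w $ Suc l)"
      unfolding sum.lessThan_Suc_shift using that by (simp add: bordered_index[OF Pc])
    also have "\<dots> = (P *\<^sub>v tl' w) $ j" using that Pc by (subst mult_vec_index) (auto simp: tl'_def)
    finally show ?thesis .
  qed
  have "(bordered 1 P * Q *\<^sub>v c) $ j = 0" if c: "c \<in> set (b # bs)" and j: "length (b # bs) \<le> j" "j < N" for c j
  proof -
    obtain j' where j': "j = Suc j'" "j' < m" "length bs \<le> j'" using j N by (cases j) auto
    have cd: "dim_vec c = Suc m" using c prems N by auto
    have "(bordered 1 P * Q *\<^sub>v c) $ j = (bordered 1 P *\<^sub>v (Q *\<^sub>v c)) $ Suc j'"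
      by (simp add: vassoc orthogonal_dims[OF oP] Qd cd j')
    also have "\<dots> = (P *\<^sub>v tl' (Q *\<^sub>v c)) $ j'" by (rule bP) (simp_all add: Qd j')
    also have "\<dots> = 0"
    proof (cases "c \<in> set bs")
      case True
      thus ?thesis using P(2) j' by simp
    next
      case False
      hence "c = b" using c by simp
      hence "tl' (Q *\<^sub>v c) = 0\<^sub>v m" using Q(2) by (intro eq_vecI) (auto simp: tl'_def)
      thus ?thesis using Pc j' by simp
    qed
    finally show ?thesis .
  qed
  thus ?case using orthogonal_mult[OF oP Q(1)] N ds by blast
qed

section \<open>The Frobenius inner product and the norms derived from it\<close>

definition fip :: "real mat \<Rightarrow> real mat \<Rightarrow> real" where
  "fip A B = (\<Sum>i<dim_row A. \<Sum>j<dim_col A. A $$ (i,j) * B $$ (i,j))"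

definition mtrace :: "real mat \<Rightarrow> real" where "mtrace A = (\<Sum>i<dim_row A. A $$ (i,i))"

lemma fro_norm_nonneg: "0 \<le> fro_norm A"
  by (simp add: fro_norm_def sum_nonneg)

lemma fro_norm_square: "(fro_norm A)\<^sup>2 = fip A A"
  by (simp add: fro_norm_def fip_def sum_nonneg power2_eq_square)

lemma fip_comm: "dim_row A = dim_row B \<Longrightarrow> dim_col A = dim_col B \<Longrightarrow> fip A B = fip B A"
  by (simp add: fip_def mult.commute)

lemma fip_trans: "dim_row A = dim_row B \<Longrightarrow> dim_col A = dim_col B \<Longrightarrow> fip (A\<^sup>T) (B\<^sup>T) = fip A B"
  unfolding fip_def by (subst sum.swap) simp

lemma fro_norm_trans: "fro_norm (A\<^sup>T) = fro_norm A"
  using fip_trans[of A A] fro_norm_square[of A] fro_norm_square[of "A\<^sup>T"] fro_norm_nonneg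
  by (metis power2_eq_imp_eq)

lemma fip_mult_left:
  assumes "dim_col A = dim_row B" "dim_row C = dim_row A" "dim_col C = dim_col B"
  shows "fip (A * B) C = fip B (A\<^sup>T * C)"
proof -
  have "fip (A * B) C = (\<Sum>i<dim_row A. \<Sum>j<dim_col B. \<Sum>l<dim_row B. A $$ (i,l) * B $$ (l,j) * C $$ (i,j))"
    unfolding fip_def using assms by (simp add: mult_mat_index sum_distrib_right del: index_mult_mat(1))
  also have "\<dots> = (\<Sum>i<dim_row A. \<Sum>l<dim_row B. \<Sum>j<dim_col B. A $$ (i,l) * B $$ (l,j) * C $$ (i,j))"
    by (intro sum.cong refl sum.swap)
  also have "\<dots> = (\<Sum>l<dim_row B. \<Sum>i<dim_row A. \<Sum>j<dim_col B. A $$ (i,l) * B $$ (l,j) * C $$ (i,j))"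
    by (rule sum.swap)
  also have "\<dots> = (\<Sum>l<dim_row B. \<Sum>j<dim_col B. \<Sum>i<dim_row A. A $$ (i,l) * B $$ (l,j) * C $$ (i,j))"
    by (intro sum.cong refl sum.swap)
  also have "\<dots> = fip B (A\<^sup>T * C)"
    unfolding fip_def using assms
    by (intro sum.cong refl, subst mult_mat_index) (auto simp: sum_distrib_left mult_ac intro!: sum.cong)
  finally show ?thesis .
qed

lemma fip_mult_right:
  assumes "dim_col A = dim_row B" "dim_row C = dim_row A" "dim_col C = dim_col B"
  shows "fip (A * B) C = fip A (C * B\<^sup>T)"
proof -
  have "fip (A * B) C = fip (B\<^sup>T * A\<^sup>T) (C\<^sup>T)"
    using assms fip_trans[of "A * B" C] by (simp add: mtrans)
  also have "\<dots> = fip (A\<^sup>T) (B * C\<^sup>T)" using assms by (subst fip_mult_left) simp_all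
  also have "\<dots> = fip A (C * B\<^sup>T)"
    using assms fip_trans[of A "C * B\<^sup>T"] by (simp add: mtrans)
  finally show ?thesis .
qed

lemma fip_le_fro:
  assumes "dim_row A = dim_row B" "dim_col A = dim_col B"
  shows "\<bar>fip A B\<bar> \<le> fro_norm A * fro_norm B"
proof -
  have c: "fip A B = (\<Sum>z\<in>{..<dim_row A} \<times> {..<dim_col A}. A $$ z * B $$ z)" for A B
    unfolding fip_def by (simp add: sum.cartesian_product)
  have "(fip A B)\<^sup>2 \<le> fip A A * fip B B"
    using Cauchy_Schwarz_ineq_sum[of "\<lambda>z. A $$ z" "\<lambda>z. B $$ z" "{..<dim_row A} \<times> {..<dim_col A}"] assms
    by (simp add: c power2_eq_square)
  also have "\<dots> = (fro_norm A * fro_norm B)\<^sup>2" by (simp add: fro_norm_square power_mult_distrib)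
  finally show ?thesis
    using fro_norm_nonneg[of A] fro_norm_nonneg[of B] by (simp add: abs_le_square_iff[symmetric])
qed

lemma fip_add_left: "dim_row A = dim_row B \<Longrightarrow> dim_col A = dim_col B \<Longrightarrow> fip (A + B) C = fip A C + fip B C"
  by (simp add: fip_def sum.distrib distrib_right)

lemma fip_add_right: "dim_row C = dim_row B \<Longrightarrow> dim_col C = dim_col B \<Longrightarrow> dim_row A = dim_row B \<Longrightarrow> dim_col A = dim_col B \<Longrightarrow>
    fip C (A + B) = fip C A + fip C B"
  by (simp add: fip_def sum.distrib distrib_left)

lemma fro_norm_triangle:
  assumes d: "dim_row A = dim_row B" "dim_col A = dim_col B"
  shows "fro_norm (A + B) \<le> fro_norm A + fro_norm B"
proof (rule power2_le_imp_le)
  have "(fro_norm (A + B))\<^sup>2 = fip A A + 2 * fip A B + fip B B"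
    using d by (simp add: fro_norm_square fip_add_left fip_add_right fip_comm[of B A])
  also have "\<dots> \<le> (fro_norm A + fro_norm B)\<^sup>2"
    using fip_le_fro[OF d] by (simp add: power2_sum fro_norm_square)
  finally show "(fro_norm (A + B))\<^sup>2 \<le> (fro_norm A + fro_norm B)\<^sup>2" .
qed (simp add: fro_norm_nonneg)

text \<open>Both squares become the same inner product once a factor is moved to the other
  side.\<close>

lemma fro_norm_gram: "fro_norm (X * X\<^sup>T) = fro_norm (X\<^sup>T * X)"
proof -
  have "fip (X * X\<^sup>T) (X * X\<^sup>T) = fip X ((X * X\<^sup>T) * X)"
    by (subst fip_mult_right) simp_all
  also have "(X * X\<^sup>T) * X = X * (X\<^sup>T * X)" by (rule massoc) simp_all
  also have "fip X (X * (X\<^sup>T * X)) = fip (X * (X\<^sup>T * X)) X" by (rule fip_comm) simp_all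
  also have "\<dots> = fip (X\<^sup>T * X) (X\<^sup>T * X)" by (subst fip_mult_left) simp_all
  finally show ?thesis
    using fro_norm_square[of "X * X\<^sup>T"] fro_norm_square[of "X\<^sup>T * X"] fro_norm_nonneg
    by (metis power2_eq_imp_eq)
qed

text \<open>Regrouping the factors turns the square into the inner product of the two Gram matrices
  \<open>Y\<^sup>T * Y\<close> and \<open>X\<^sup>T * X\<close>, where the Cauchy-Schwarz inequality
  applies. This controls the cross terms in the triangle inequality for
  \<open>s4_norm\<close>.\<close>

lemma fro_norm_mult_trans_le:
  assumes d: "dim_row X = dim_row Y" "dim_col X = dim_col Y"
  shows "(fro_norm (X * Y\<^sup>T))\<^sup>2 \<le> fro_norm (X * X\<^sup>T) * fro_norm (Y * Y\<^sup>T)"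
proof -
  have "(fro_norm (X * Y\<^sup>T))\<^sup>2 = fip X ((X * Y\<^sup>T) * Y)"
    unfolding fro_norm_square using d by (subst fip_mult_right) simp_all
  also have "(X * Y\<^sup>T) * Y = X * (Y\<^sup>T * Y)" using d by (intro massoc) simp_all
  also have "fip X (X * (Y\<^sup>T * Y)) = fip (X * (Y\<^sup>T * Y)) X" using d by (intro fip_comm) simp_all
  also have "\<dots> = fip (Y\<^sup>T * Y) (X\<^sup>T * X)" using d by (subst fip_mult_left) simp_all
  also have "\<dots> \<le> fro_norm (Y\<^sup>T * Y) * fro_norm (X\<^sup>T * X)"
    using d fip_le_fro[of "Y\<^sup>T * Y" "X\<^sup>T * X"] by simp
  finally show ?thesis by (simp add: fro_norm_gram mult.commute)
qed

text \<open>The Schatten 4-norm.\<close>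
definition s4_norm :: "real mat \<Rightarrow> real" where "s4_norm X = sqrt (fro_norm (X * X\<^sup>T))"

lemma s4_norm_nonneg: "0 \<le> s4_norm X"
  by (simp add: s4_norm_def fro_norm_nonneg)

lemma s4_norm_square: "(s4_norm X)\<^sup>2 = fro_norm (X * X\<^sup>T)"
  by (simp add: s4_norm_def fro_norm_nonneg)

lemma s4_norm_triangle:
  assumes d: "dim_row X = dim_row Y" "dim_col X = dim_col Y"
  shows "s4_norm (X + Y) \<le> s4_norm X + s4_norm Y"
proof (rule power2_le_imp_le)
  have c: "X \<in> carrier_mat (dim_row X) (dim_col X)" "Y \<in> carrier_mat (dim_row X) (dim_col X)"
    using d by (auto intro: carrier_matI)
  have "(X + Y) * (X + Y)\<^sup>T = (X * X\<^sup>T + Y * X\<^sup>T) + (X * Y\<^sup>T + Y * Y\<^sup>T)"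
    using c by (simp add: transpose_add[OF c] mult_add_distrib_mat[of _ "dim_row X" "dim_col X" _ "dim_row X"]
        add_mult_distrib_mat[of _ "dim_row X" "dim_col X" _ _ "dim_row X"])
  hence "(s4_norm (X + Y))\<^sup>2 \<le> fro_norm (X * X\<^sup>T + Y * X\<^sup>T) + fro_norm (X * Y\<^sup>T + Y * Y\<^sup>T)"
    unfolding s4_norm_square using d by (simp add: fro_norm_triangle)
  also have "\<dots> \<le> (fro_norm (X * X\<^sup>T) + fro_norm (Y * X\<^sup>T)) + (fro_norm (X * Y\<^sup>T) + fro_norm (Y * Y\<^sup>T))"
    using d by (intro add_mono fro_norm_triangle) simp_all
  also have "fro_norm (Y * X\<^sup>T) = fro_norm (X * Y\<^sup>T)"
    using d fro_norm_trans[of "X * Y\<^sup>T"] by (simp add: mtrans)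
  also have "fro_norm (X * Y\<^sup>T) \<le> s4_norm X * s4_norm Y"
  proof (rule power2_le_imp_le)
    show "(fro_norm (X * Y\<^sup>T))\<^sup>2 \<le> (s4_norm X * s4_norm Y)\<^sup>2"
      using fro_norm_mult_trans_le[OF d] by (simp add: power_mult_distrib s4_norm_square)
  qed (simp add: s4_norm_nonneg)
  finally show "(s4_norm (X + Y))\<^sup>2 \<le> (s4_norm X + s4_norm Y)\<^sup>2"
    by (simp add: power2_sum s4_norm_square)
qed (simp add: s4_norm_nonneg)

lemma fip_columns: "fip X X = (\<Sum>j<dim_col X. col X j \<bullet> col X j)"
  unfolding fip_def by (subst sum.swap) (simp add: sprod_self power2_eq_square)

lemma fip_mult_le:
  assumes B: "\<And>v. dim_vec v = dim_col B \<Longrightarrow> (B *\<^sub>v v) \<bullet> (B *\<^sub>v v) \<le> c * (v \<bullet> v)"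
    and d: "dim_col B = dim_row X"
  shows "fip (B * X) (B * X) \<le> c * fip X X"
proof -
  have "col (B * X) j = B *\<^sub>v col X j" if "j < dim_col X" for j
    using that d by (intro col_mult2[of _ "dim_row B" "dim_row X" _ "dim_col X"]) (auto intro: carrier_matI)
  hence "fip (B * X) (B * X) = (\<Sum>j<dim_col X. (B *\<^sub>v col X j) \<bullet> (B *\<^sub>v col X j))"
    unfolding fip_columns by simp
  also have "\<dots> \<le> (\<Sum>j<dim_col X. c * (col X j \<bullet> col X j))"
    by (intro sum_mono B) (simp add: d)
  finally show ?thesis by (simp add: fip_columns sum_distrib_left)
qed

lemma square_le_imp_le: "(x::real)\<^sup>2 \<le> a * x \<Longrightarrow> 0 \<le> x \<Longrightarrow> 0 \<le> a \<Longrightarrow> x \<le> a"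
  by (cases "x = 0") (auto simp: power2_eq_square)

text \<open>A matrix and its transpose have the same operator norm. Cauchy-Schwarz applied to
  \<open>(S\<^sup>T *\<^sub>v w) \<bullet> v\<close> with \<open>w = S *\<^sub>v v\<close> proves it
  without singular values.\<close>

lemma gram_bound_swap:
  fixes S :: "real mat"
  assumes S: "\<And>w. dim_vec w = dim_row S \<Longrightarrow> (S\<^sup>T *\<^sub>v w) \<bullet> (S\<^sup>T *\<^sub>v w) \<le> c * (w \<bullet> w)"
    and c: "0 \<le> c" and v: "dim_vec v = dim_col S"
  shows "(S *\<^sub>v v) \<bullet> (S *\<^sub>v v) \<le> c * (v \<bullet> v)"
proof (rule square_le_imp_le)
  let ?w = "S *\<^sub>v v"
  have "?w \<bullet> ?w = (S\<^sup>T *\<^sub>v ?w) \<bullet> v" using v by (simp add: sprod_trans)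
  hence "(?w \<bullet> ?w)\<^sup>2 \<le> ((S\<^sup>T *\<^sub>v ?w) \<bullet> (S\<^sup>T *\<^sub>v ?w)) * (v \<bullet> v)"
    using sprod_cauchy_schwarz[of "S\<^sup>T *\<^sub>v ?w" v] v by simp
  also have "\<dots> \<le> (c * (?w \<bullet> ?w)) * (v \<bullet> v)"
    by (intro mult_right_mono S sprod_self_nonneg) simp
  finally show "(?w \<bullet> ?w)\<^sup>2 \<le> c * (v \<bullet> v) * (?w \<bullet> ?w)" by (simp add: mult_ac)
qed (simp_all add: sprod_self_nonneg c)

lemma fro_norm_sandwich_le:
  assumes T: "\<And>v. dim_vec v = dim_col T \<Longrightarrow> (T *\<^sub>v v) \<bullet> (T *\<^sub>v v) \<le> v \<bullet> v"
    and d: "dim_row Y = dim_col T" "dim_col Y = dim_col T"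
  shows "fro_norm (T * (Y * T\<^sup>T)) \<le> fro_norm Y"
proof -
  have le: "fro_norm (T * X) \<le> fro_norm X" if "dim_row X = dim_col T" for X
  proof (rule power2_le_imp_le)
    show "(fro_norm (T * X))\<^sup>2 \<le> (fro_norm X)\<^sup>2"
      unfolding fro_norm_square using fip_mult_le[of T 1 X, OF _ that[symmetric]] T by (simp only: mult_1)
  qed (rule fro_norm_nonneg)
  have "fro_norm (T * (Y * T\<^sup>T)) \<le> fro_norm (Y * T\<^sup>T)" by (rule le) (simp add: d)
  also have "\<dots> = fro_norm (T * Y\<^sup>T)" using fro_norm_trans[of "T * Y\<^sup>T"] d by (simp add: mtrans)
  also have "\<dots> \<le> fro_norm (Y\<^sup>T)" by (rule le) (simp add: d)
  finally show ?thesis by (simp add: fro_norm_trans)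
qed

section \<open>Eigenvalues and the spectral and nuclear norms of symmetric matrices\<close>

lemma diag_conj_index:
  fixes Q :: "real mat"
  assumes Q: "dim_row Q = n" "dim_col Q = n" and ij: "i < n" "j < n"
  shows "(Q * mat_diag n d * Q\<^sup>T) $$ (i,j) = (\<Sum>l<n. Q $$ (i,l) * d l * Q $$ (j,l))"
proof -
  have Qc: "Q \<in> carrier_mat n n" using Q by (rule carrier_matI)
  show ?thesis
    unfolding mat_diag_mult_right[OF Qc]
    using Q ij by (subst mult_mat_index) auto
qed

lemma diag_conj_quadratic:
  assumes Q: "orthogonal_real_mat n Q" and v: "dim_vec v = n"
  shows "v \<bullet> ((Q * mat_diag n d * Q\<^sup>T) *\<^sub>v v) = (\<Sum>l<n. d l * ((Q\<^sup>T *\<^sub>v v) $ l)\<^sup>2)"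
proof -
  note Qd = orthogonal_dims[OF Q]
  let ?w = "Q\<^sup>T *\<^sub>v v"
  have "(Q * mat_diag n d * Q\<^sup>T) *\<^sub>v v = Q *\<^sub>v (mat_diag n d *\<^sub>v ?w)"
    by (simp add: vassoc massoc Qd v mat_diag_dims)
  hence "v \<bullet> ((Q * mat_diag n d * Q\<^sup>T) *\<^sub>v v) = ?w \<bullet> (mat_diag n d *\<^sub>v ?w)"
    by (simp add: sprod_trans Qd v mat_diag_dims)
  also have "mat_diag n d *\<^sub>v ?w = Matrix.vec n (\<lambda>l. d l * ?w $ l)"
  proof (rule eq_vecI)
    fix i assume "i < dim_vec (Matrix.vec n (\<lambda>l. d l * ?w $ l))"
    hence i: "i < n" by simp
    have "(mat_diag n d *\<^sub>v ?w) $ i = (\<Sum>l<n. (if i = l then d i else 0) * ?w $ l)"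
      using i by (subst mult_vec_index) (auto simp: mat_diag_dims mat_diag_index Qd intro!: sum.cong)
    also have "\<dots> = d i * ?w $ i" using i by (subst sum_if_mult) auto
    finally show "(mat_diag n d *\<^sub>v ?w) $ i = Matrix.vec n (\<lambda>l. d l * ?w $ l) $ i" using i by simp
  qed (simp add: mat_diag_dims)
  also have "?w \<bullet> \<dots> = (\<Sum>l<n. d l * (?w $ l)\<^sup>2)"
    unfolding sprod_index by (auto simp: power2_eq_square mult_ac intro!: sum.cong)
  finally show ?thesis .
qed

lemma psd_eigen_nonneg:
  assumes Q: "orthogonal_real_mat n Q" and psd: "\<And>v. dim_vec v = n \<Longrightarrow> 0 \<le> v \<bullet> ((Q * mat_diag n d * Q\<^sup>T) *\<^sub>v v)"
    and i: "i < n"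
  shows "0 \<le> d i"
proof -
  note Qd = orthogonal_dims[OF Q]
  let ?e = "unit_vec n i :: real vec"
  have "Q\<^sup>T *\<^sub>v (Q *\<^sub>v ?e) = (Q\<^sup>T * Q) *\<^sub>v ?e" by (rule vassoc[symmetric]) (simp_all add: Qd)
  also have "\<dots> = ?e" using Q by (simp add: orthogonal_real_mat_def)
  finally have w: "Q\<^sup>T *\<^sub>v (Q *\<^sub>v ?e) = ?e" .
  have "0 \<le> (\<Sum>l<n. d l * ((Q\<^sup>T *\<^sub>v (Q *\<^sub>v ?e)) $ l)\<^sup>2)"
    using psd[of "Q *\<^sub>v ?e"] diag_conj_quadratic[OF Q, of "Q *\<^sub>v ?e" d] Qd by simp
  also have "\<dots> = (\<Sum>l<n. if l = i then d l else 0)"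
    unfolding w using i by (intro sum.cong) (auto simp: unit_vec_def)
  also have "\<dots> = d i" using i by simp
  finally show ?thesis .
qed

lemma char_poly_diag_conj:
  assumes Q: "orthogonal_real_mat n Q"
  shows "char_poly (Q * mat_diag n d * Q\<^sup>T) = (\<Prod>i<n. [:- d i, 1:])"
proof -
  have Qc: "Q \<in> carrier_mat n n" using Q by (simp add: orthogonal_real_mat_def)
  have "similar_mat (Q * mat_diag n d * Q\<^sup>T) (mat_diag n d)"
    by (rule similar_matI[of _ _ Q "Q\<^sup>T" n]) (use Q Qc in \<open>auto simp: orthogonal_real_mat_def\<close>)
  hence "char_poly (Q * mat_diag n d * Q\<^sup>T) = char_poly (mat_diag n d)" by (rule char_poly_similar)
  also have "\<dots> = (\<Prod>a\<leftarrow>diag_mat (mat_diag n d). [:- a, 1:])"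
    by (rule char_poly_upper_triangular[OF mat_diag_dim]) (auto simp: mat_diag_def)
  also have "diag_mat (mat_diag n d) = map d [0..<n]"
    by (auto simp: diag_mat_def mat_diag_def)
  also have "(\<Prod>a\<leftarrow>map d [0..<n]. [:- a, 1:]) = (\<Prod>i<n. [:- d i, 1:])"
    using prod.distinct_set_conv_list[of "[0..<n]" "\<lambda>i. [:- d i, 1:]"]
    by (simp add: comp_def lessThan_atLeast0)
  finally show ?thesis .
qed

lemma order_prod_linear:
  fixes a :: "nat \<Rightarrow> real"
  shows "Polynomial.order x (\<Prod>i<n. [:- a i, 1:]) = card {i. i < n \<and> a i = x}"
proof (induction n)
  case 0
  show ?case by (auto intro: order_0I)
next
  case (Suc n)
  have "(\<Prod>i<n. [:- a i, 1:]) \<noteq> 0" by (simp add: prod_zero_iff)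
  hence nz: "(\<Prod>i<n. [:- a i, 1:]) * [:- a n, 1:] \<noteq> 0" by (rule no_zero_divisors) simp
  have "Polynomial.order x [:- a n, 1:] = (if a n = x then 1 else 0)"
    using order_power_n_n[of x 1] by (auto intro: order_0I)
  moreover have "{i. i < Suc n \<and> a i = x} = (if a n = x then insert n {i. i < n \<and> a i = x} else {i. i < n \<and> a i = x})"
    by (auto simp: less_Suc_eq)
  ultimately show ?case
    unfolding prod.lessThan_Suc order_mult[OF nz] Suc.IH by simp
qed

text \<open>The bridge from \<open>sq_sing_vals\<close> and \<open>sq_sing_mult\<close>, which are
  read off a characteristic polynomial, to an eigendecomposition. Signs of eigenvalues are lost, so
  a multiplicity counts the indices whose eigenvalues have equal squares.\<close>

lemma sing_vals_symmetric:
  assumes Q: "orthogonal_real_mat n Q" and C: "C = Q * mat_diag n d * Q\<^sup>T"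
  shows "sq_sing_vals C = (\<lambda>i. (d i)\<^sup>2) ` {..<n}"
    and "sq_sing_mult C x = card {i. i < n \<and> (d i)\<^sup>2 = x}"
proof -
  note Qd = orthogonal_dims[OF Q]
  have DT: "(mat_diag n d)\<^sup>T = mat_diag n d" by (rule eq_matI) (auto simp: mat_diag_def)
  have "C\<^sup>T * C = Q * mat_diag n d * (Q\<^sup>T * Q) * mat_diag n d * Q\<^sup>T"
    unfolding C by (simp add: mtrans massoc Qd mat_diag_dims DT)
  also have "\<dots> = Q * (mat_diag n d * mat_diag n d) * Q\<^sup>T"
    using Q by (simp add: orthogonal_real_mat_def massoc Qd mat_diag_dims del: mat_diag_diag)
  also have "\<dots> = Q * mat_diag n (\<lambda>i. (d i)\<^sup>2) * Q\<^sup>T" by (simp add: power2_eq_square)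
  finally have cp: "char_poly (C\<^sup>T * C) = (\<Prod>i<n. [:- ((d i)\<^sup>2), 1:])"
    using char_poly_diag_conj[OF Q, of "\<lambda>i. (d i)\<^sup>2"] by simp
  show "sq_sing_mult C x = card {i. i < n \<and> (d i)\<^sup>2 = x}"
    unfolding sq_sing_mult_def cp by (rule order_prod_linear)
  show "sq_sing_vals C = (\<lambda>i. (d i)\<^sup>2) ` {..<n}"
    unfolding sq_sing_vals_def cp by (auto simp: poly_prod prod_zero_iff)
qed

lemma spec_norm_symmetric:
  assumes "C \<in> carrier_mat n n" "C\<^sup>T = C"
  shows "0 \<le> spec_norm C" "dim_vec v = n \<Longrightarrow> v \<bullet> (C *\<^sub>v v) \<le> spec_norm C * (v \<bullet> v)"
proof -
  obtain Q d where Q: "orthogonal_real_mat n Q" and C: "C = Q * mat_diag n d * Q\<^sup>T"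
    using real_spectral_theorem[OF assms] by blast
  note sv = sing_vals_symmetric(1)[OF Q C]
  have "0 \<le> Max (insert 0 (sq_sing_vals C))" unfolding sv by (intro Max_ge) auto
  thus "0 \<le> spec_norm C" by (simp add: spec_norm_def)
  have le: "d i \<le> spec_norm C" if "i < n" for i
  proof -
    have "(d i)\<^sup>2 \<le> Max (insert 0 (sq_sing_vals C))" unfolding sv using that by (intro Max_ge) auto
    hence "\<bar>d i\<bar> \<le> spec_norm C" unfolding spec_norm_def by (intro real_le_rsqrt) simp
    thus ?thesis by simp
  qed
  assume v: "dim_vec v = n"
  have "v \<bullet> (C *\<^sub>v v) = (\<Sum>l<n. d l * ((Q\<^sup>T *\<^sub>v v) $ l)\<^sup>2)"
    unfolding C by (rule diag_conj_quadratic[OF Q v])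
  also have "\<dots> \<le> (\<Sum>l<n. spec_norm C * ((Q\<^sup>T *\<^sub>v v) $ l)\<^sup>2)"
    by (intro sum_mono mult_right_mono le) auto
  also have "\<dots> = spec_norm C * ((Q\<^sup>T *\<^sub>v v) \<bullet> (Q\<^sup>T *\<^sub>v v))"
    using orthogonal_dims[OF Q] by (simp add: sprod_self sum_distrib_left)
  also have "(Q\<^sup>T *\<^sub>v v) \<bullet> (Q\<^sup>T *\<^sub>v v) = v \<bullet> v" by (rule orthogonal_sprod[OF orthogonal_trans[OF Q] v v])
  finally show "v \<bullet> (C *\<^sub>v v) \<le> spec_norm C * (v \<bullet> v)" .
qed

lemma nuc_norm_nonneg:
  assumes "C \<in> carrier_mat n n" "C\<^sup>T = C"
  shows "0 \<le> nuc_norm C"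
proof -
  obtain Q d where Q: "orthogonal_real_mat n Q" and C: "C = Q * mat_diag n d * Q\<^sup>T"
    using real_spectral_theorem[OF assms] by blast
  show ?thesis unfolding nuc_norm_def
    using sing_vals_symmetric(1)[OF Q C] by (auto intro!: sum_nonneg)
qed

text \<open>The fourth moment produces a trace, the stated bound a nuclear norm. The trace is the
  sum of the eigenvalues; their absolute values, grouped by their squares, give
  \<open>nuc_norm\<close>.\<close>

lemma mtrace_le_nuc_norm:
  assumes "C \<in> carrier_mat n n" "C\<^sup>T = C"
  shows "mtrace C \<le> nuc_norm C"
proof -
  obtain Q d where Q: "orthogonal_real_mat n Q" and C: "C = Q * mat_diag n d * Q\<^sup>T"
    using real_spectral_theorem[OF assms] by blast
  note Qd = orthogonal_dims[OF Q]
  have QQ: "(\<Sum>i<n. Q $$ (i,l) * Q $$ (i,l)) = 1" if "l < n" for l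
  proof -
    have "(Q\<^sup>T * Q) $$ (l,l) = (\<Sum>i<n. Q $$ (i,l) * Q $$ (i,l))"
      using that Qd by (subst mult_mat_index) auto
    thus ?thesis using Q that by (simp add: orthogonal_real_mat_def)
  qed
  have "mtrace C = (\<Sum>i<n. \<Sum>l<n. Q $$ (i,l) * d l * Q $$ (i,l))"
    unfolding mtrace_def carrier_matD(1)[OF assms(1)]
    by (auto simp: C diag_conj_index[OF Qd] simp del: index_mult_mat(1) intro!: sum.cong)
  also have "\<dots> = (\<Sum>l<n. \<Sum>i<n. Q $$ (i,l) * d l * Q $$ (i,l))" by (rule sum.swap)
  also have "\<dots> = (\<Sum>l<n. d l * (\<Sum>i<n. Q $$ (i,l) * Q $$ (i,l)))"
    by (simp add: sum_distrib_left mult_ac)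
  also have "\<dots> \<le> (\<Sum>l<n. sqrt ((d l)\<^sup>2))" by (intro sum_mono) (simp add: QQ)
  also have "\<dots> = (\<Sum>x\<in>(\<lambda>l. (d l)\<^sup>2) ` {..<n}. \<Sum>l\<in>{l \<in> {..<n}. (d l)\<^sup>2 = x}. sqrt ((d l)\<^sup>2))"
    by (rule sum.image_gen) simp
  also have "\<dots> = nuc_norm C"
    unfolding nuc_norm_def sing_vals_symmetric[OF Q C] by (intro sum.cong refl) simp
  finally show ?thesis .
qed

lemma psd_factor:
  fixes C :: "real mat"
  assumes "C \<in> carrier_mat n n" "C\<^sup>T = C" "\<And>v. dim_vec v = n \<Longrightarrow> 0 \<le> v \<bullet> (C *\<^sub>v v)"
  obtains L where "L \<in> carrier_mat n n" "C = L * L\<^sup>T"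
proof -
  obtain Q d where Q: "orthogonal_real_mat n Q" and C: "C = Q * mat_diag n d * Q\<^sup>T"
    using real_spectral_theorem[OF assms(1,2)] by blast
  note Qd = orthogonal_dims[OF Q]
  have d: "0 \<le> d i" if "i < n" for i
    by (rule psd_eigen_nonneg[OF Q _ that]) (use assms(3) C in auto)
  define S where "S = mat_diag n (\<lambda>i. sqrt (d i))"
  have Sd: "dim_row S = n" "dim_col S = n" by (simp_all add: S_def mat_diag_dims)
  have ST: "S\<^sup>T = S" by (rule eq_matI) (auto simp: S_def mat_diag_def)
  have "S * S = mat_diag n d" unfolding S_def mat_diag_diag
    by (rule eq_matI) (auto simp: mat_diag_def d)
  moreover have "(Q * S) * (Q * S)\<^sup>T = Q * (S * S) * Q\<^sup>T" by (simp add: mtrans massoc Qd Sd ST)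
  ultimately have "C = (Q * S) * (Q * S)\<^sup>T" unfolding C by (simp only:)
  moreover have "Q * S \<in> carrier_mat n n" by (rule carrier_matI) (simp_all add: Qd Sd)
  ultimately show ?thesis using that by blast
qed

section \<open>Pseudoinverses, inverses and orthogonal projections\<close>

definition is_pinv :: "real mat \<Rightarrow> real mat \<Rightarrow> bool" where
  "is_pinv X Y \<longleftrightarrow> Y \<in> carrier_mat (dim_col X) (dim_row X) \<and> X * Y * X = X \<and> Y * X * Y = Y \<and>
      (X * Y)\<^sup>T = X * Y \<and> (Y * X)\<^sup>T = Y * X"

text \<open>The Penrose equations determine \<open>X * Y\<close> from X alone, and by transposition
  also \<open>Y * X\<close>. Then \<open>Y = Y * X * Y\<close> is determined as well.\<close>

lemma is_pinv_unique:
  assumes Y: "is_pinv X Y" and Z: "is_pinv X Z"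
  shows "Y = Z"
proof -
  have d: "dim_row Y = dim_col X" "dim_col Y = dim_row X" "dim_row Z = dim_col X" "dim_col Z = dim_row X"
    using Y Z by (auto simp: is_pinv_def)
  have half: "X * B = X * C" if B: "is_pinv X B" and C: "is_pinv X C" for X B C
  proof -
    have d: "dim_row B = dim_col X" "dim_col B = dim_row X" "dim_row C = dim_col X" "dim_col C = dim_row X"
      using B C by (auto simp: is_pinv_def)
    have "X * B = (X * C * X) * B" using C by (simp add: is_pinv_def)
    also have "\<dots> = (X * C) * (X * B)" by (simp add: massoc d)
    also have "\<dots> = (X * C)\<^sup>T * (X * B)\<^sup>T" using B C by (simp add: is_pinv_def)
    also have "\<dots> = ((X * B) * (X * C))\<^sup>T" by (rule mtrans[symmetric]) (simp add: d)
    also have "(X * B) * (X * C) = (X * B * X) * C" by (simp add: massoc d)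
    also have "\<dots> = X * C" using B by (simp add: is_pinv_def)
    also have "(X * C)\<^sup>T = X * C" using C by (simp add: is_pinv_def)
    finally show ?thesis .
  qed
  have tr: "is_pinv (X\<^sup>T) (B\<^sup>T)" if B: "is_pinv X B" for B
  proof -
    have d: "dim_row B = dim_col X" "dim_col B = dim_row X" using B by (auto simp: is_pinv_def)
    have 1: "X\<^sup>T * B\<^sup>T = (B * X)\<^sup>T" "B\<^sup>T * X\<^sup>T = (X * B)\<^sup>T" by (simp_all add: mtrans d)
    have "X\<^sup>T * B\<^sup>T * X\<^sup>T = (X * B * X)\<^sup>T" "B\<^sup>T * X\<^sup>T * B\<^sup>T = (B * X * B)\<^sup>T" by (simp_all add: mtrans massoc d)
    thus ?thesis using B unfolding is_pinv_def 1 by (auto simp: d)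
  qed
  have "(X\<^sup>T * Y\<^sup>T)\<^sup>T = (X\<^sup>T * Z\<^sup>T)\<^sup>T" using half[OF tr[OF Y] tr[OF Z]] by simp
  hence YX: "Y * X = Z * X" by (simp add: mtrans d)
  have "Y = Y * X * Y" using Y by (simp add: is_pinv_def)
  also have "\<dots> = Y * (X * Z)" using half[OF Y Z] by (simp add: massoc d)
  also have "\<dots> = Z * X * Z" using YX by (simp add: d flip: massoc)
  also have "\<dots> = Z" using Z by (simp add: is_pinv_def)
  finally show ?thesis .
qed

text \<open>In an orthonormal eigenbasis the pseudoinverse inverts the eigenvalues, and
  \<open>1 / 0 = 0\<close> gives the right value on the kernel.\<close>

lemma pinv_symmetric:
  assumes N: "N \<in> carrier_mat n n" "N\<^sup>T = N"
  shows "is_pinv N (pinv N)" "(pinv N)\<^sup>T = pinv N"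
proof -
  obtain Q d where Q: "orthogonal_real_mat n Q" and C: "N = Q * mat_diag n d * Q\<^sup>T"
    using real_spectral_theorem[OF N] by blast
  note Qd = orthogonal_dims[OF Q]
  have QQ: "Q\<^sup>T * Q = 1\<^sub>m n" using Q by (simp add: orthogonal_real_mat_def)
  have mul: "(Q * mat_diag n a * Q\<^sup>T) * (Q * mat_diag n b * Q\<^sup>T) = Q * mat_diag n (\<lambda>i. a i * b i) * Q\<^sup>T" for a b
  proof -
    have "(Q * mat_diag n a * Q\<^sup>T) * (Q * mat_diag n b * Q\<^sup>T) = Q * mat_diag n a * (Q\<^sup>T * Q) * mat_diag n b * Q\<^sup>T"
      by (simp add: massoc Qd mat_diag_dims)
    also have "\<dots> = Q * (mat_diag n a * mat_diag n b) * Q\<^sup>T"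
      unfolding QQ by (simp add: massoc Qd mat_diag_dims del: mat_diag_diag)
    finally show ?thesis by simp
  qed
  have sym: "(Q * mat_diag n a * Q\<^sup>T)\<^sup>T = Q * mat_diag n a * Q\<^sup>T" for a
  proof -
    have "(mat_diag n a)\<^sup>T = mat_diag n a" by (rule eq_matI) (auto simp: mat_diag_def)
    thus ?thesis by (simp add: mtrans massoc Qd mat_diag_dims)
  qed
  define Y where "Y = Q * mat_diag n (\<lambda>i. 1 / d i) * Q\<^sup>T"
  have dd: "(\<lambda>i. d i * (1 / d i) * d i) = d" "(\<lambda>i. 1 / d i * d i * (1 / d i)) = (\<lambda>i. 1 / d i)"
    by (auto simp: fun_eq_iff)
  have Y: "is_pinv N Y"
    unfolding is_pinv_def C Y_def mul sym dd by (auto simp: Qd)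
  have "pinv N = (THE Y. is_pinv N Y)" unfolding pinv_def is_pinv_def ..
  also have "\<dots> = Y" by (rule the_equality) (rule Y, erule is_pinv_unique[OF _ Y])
  finally have "pinv N = Y" .
  thus "is_pinv N (pinv N)" "(pinv N)\<^sup>T = pinv N" using Y sym by (simp_all add: Y_def)
qed

text \<open>For singular C the junk value is 0; \<open>minv C\<close> is thus measurable in the entries of C.\<close>
definition minv :: "real mat \<Rightarrow> real mat" where "minv C = (1 / det C) \<cdot>\<^sub>m adj_mat C"

lemma minv:
  assumes C: "C \<in> carrier_mat k k"
  shows "minv C \<in> carrier_mat k k"
    and "det C \<noteq> 0 \<Longrightarrow> C * minv C = 1\<^sub>m k" "det C \<noteq> 0 \<Longrightarrow> minv C * C = 1\<^sub>m k"
proof -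
  note A = adj_mat[OF C]
  show "minv C \<in> carrier_mat k k" using A(1) by (simp add: minv_def)
  have s: "(1 / c) \<cdot>\<^sub>m (c \<cdot>\<^sub>m 1\<^sub>m k) = 1\<^sub>m k" if "c \<noteq> 0" for c :: real
    by (rule eq_matI) (use that in auto)
  show "C * minv C = 1\<^sub>m k" if "det C \<noteq> 0"
    unfolding minv_def mult_smult_distrib[OF C A(1)] A(2) using that by (rule s)
  show "minv C * C = 1\<^sub>m k" if "det C \<noteq> 0"
    unfolding minv_def mult_smult_assoc_mat[OF A(1) C] A(3) using that by (rule s)
qed

lemma inverse_unique:
  fixes C :: "real mat"
  assumes "C \<in> carrier_mat k k" "B \<in> carrier_mat k k" "D \<in> carrier_mat k k" "B * C = 1\<^sub>m k" "C * D = 1\<^sub>m k"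
  shows "B = D"
proof -
  have "B = B * (C * D)" using assms by simp
  also have "\<dots> = (B * C) * D" using assms by (intro massoc[symmetric]) auto
  also have "\<dots> = D" using assms by simp
  finally show ?thesis .
qed

lemma invertible_det_nonzero:
  assumes C: "C \<in> carrier_mat k k" and B: "B \<in> carrier_mat k k" and "C * B = 1\<^sub>m k"
  shows "det (C :: real mat) \<noteq> 0"
  using det_mult[OF C B] assms(3) by auto

lemma mat_inv_eq_minv:
  assumes C: "C \<in> carrier_mat k k" and inv: "invertible_mat C"
  shows "det C \<noteq> 0" "mat_inv C = minv C"
proof -
  obtain B where B: "inverts_mat C B" "inverts_mat B C" using inv by (auto simp: invertible_mat_def)
  have d: "dim_row B = k"
  proof -
    have "dim_col (B * C) = dim_row B" using B(2) by (simp add: inverts_mat_def)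
    thus ?thesis using C by simp
  qed
  have d2: "dim_col B = k"
  proof -
    have "dim_col (C * B) = dim_row C" using B(1) by (simp add: inverts_mat_def)
    thus ?thesis using C by simp
  qed
  show nz: "det C \<noteq> 0"
    by (rule invertible_det_nonzero[OF C carrier_matI[OF d d2]]) (use B(1) C in \<open>simp add: inverts_mat_def\<close>)
  note M = minv[OF C]
  show "mat_inv C = minv C" unfolding mat_inv_def
  proof (rule the_equality)
    show "minv C \<in> carrier_mat (dim_row C) (dim_row C) \<and> inverts_mat C (minv C) \<and> inverts_mat (minv C) C"
      using M nz C by (simp add: inverts_mat_def)
    show "Y = minv C" if "Y \<in> carrier_mat (dim_row C) (dim_row C) \<and> inverts_mat C Y \<and> inverts_mat Y C" for Y
      by (rule inverse_unique[OF C _ M(1) _ M(2)[OF nz]]) (use that C in \<open>auto simp: inverts_mat_def\<close>)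
  qed
qed

lemma minv_symmetric:
  assumes C: "C \<in> carrier_mat k k" and sym: "C\<^sup>T = C" and nz: "det C \<noteq> 0"
  shows "(minv C)\<^sup>T = minv C"
proof (rule inverse_unique[OF C _ minv(1)[OF C] _ minv(2)[OF C nz]])
  show "(minv C)\<^sup>T \<in> carrier_mat k k" using minv(1)[OF C] by simp
  have "(minv C)\<^sup>T * C\<^sup>T = (C * minv C)\<^sup>T"
    using minv(1)[OF C] C by (intro mtrans[symmetric]) simp
  thus "(minv C)\<^sup>T * C = 1\<^sub>m k" using sym minv(2)[OF C nz] by simp
qed

lemma sym_idempotent_contraction:
  assumes E: "E\<^sup>T = E" "E * E = E" and v: "dim_vec v = dim_col E"
  shows "(E *\<^sub>v v) \<bullet> (E *\<^sub>v v) \<le> (v :: real vec) \<bullet> v"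
proof (rule square_le_imp_le)
  have d: "dim_row E = dim_col E" using arg_cong[OF E(1), of dim_row] by simp
  have "(E *\<^sub>v v) \<bullet> (E *\<^sub>v v) = (E\<^sup>T *\<^sub>v (E *\<^sub>v v)) \<bullet> v" using v d by (simp add: sprod_trans)
  also have "E\<^sup>T *\<^sub>v (E *\<^sub>v v) = (E * E) *\<^sub>v v"
    unfolding E(1) by (rule vassoc[symmetric]) (simp_all add: v d)
  also have "\<dots> = E *\<^sub>v v" by (simp only: E)
  finally have q: "(E *\<^sub>v v) \<bullet> (E *\<^sub>v v) = (E *\<^sub>v v) \<bullet> v" .
  have "((E *\<^sub>v v) \<bullet> v)\<^sup>2 \<le> ((E *\<^sub>v v) \<bullet> (E *\<^sub>v v)) * (v \<bullet> v)"
    by (rule sprod_cauchy_schwarz) (use v d in simp)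
  thus "((E *\<^sub>v v) \<bullet> (E *\<^sub>v v))\<^sup>2 \<le> (v \<bullet> v) * ((E *\<^sub>v v) \<bullet> (E *\<^sub>v v))" by (simp add: q mult.commute)
qed (simp_all add: sprod_self_nonneg)

section \<open>The deterministic error bound\<close>

lemma sum_split_index:
  fixes f :: "nat \<Rightarrow> real"
  assumes "k \<le> n" shows "(\<Sum>l<n. f l) = (\<Sum>l<k. f l) + (\<Sum>l<n - k. f (k + l))"
proof -
  have "{..<n} = {..<k} \<union> {k..<n}" using assms by auto
  hence "(\<Sum>l<n. f l) = (\<Sum>l<k. f l) + (\<Sum>l\<in>{k..<n}. f l)"
    by (simp add: sum.union_disjoint ivl_disj_int)
  also have "(\<Sum>l\<in>{k..<n}. f l) = (\<Sum>l<n - k. f (k + l))"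
    using sum.shift_bounds_nat_ivl[of f 0 k "n - k"] assms
    by (simp add: lessThan_atLeast0 add.commute)
  finally show ?thesis .
qed

text \<open>The error is \<open>G * G\<^sup>T\<close> with \<open>G = (1 - P) * sqrt \<Sigma>\<close> for an orthogonal projection P that
  annihilates \<open>sqrt \<Sigma> * U\<^sup>T * \<Omega>\<close>. Using the right inverse R, the first k columns of G are linear
  combinations of the remaining ones, with coefficients given by \<open>U2\<^sup>T * \<Omega> * R\<close>.\<close>
theorem nystrom_error_bound:
  assumes U: "orthogonal_real_mat n U" and A: "A = U * mat_diag n \<sigma> * U\<^sup>T"
    and \<sigma>: "\<And>i. i < n \<Longrightarrow> 0 \<le> \<sigma> i" and kn: "k \<le> n"
    and Om: "\<Omega> \<in> carrier_mat n m" and R: "R \<in> carrier_mat m k"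
    and inv: "((U1 n k U)\<^sup>T * \<Omega>) * R = 1\<^sub>m k"
  defines "F \<equiv> Sig2_half n k \<sigma> * (((U2 n k U)\<^sup>T * \<Omega>) * R)"
  shows "fro_norm (A - nystrom A \<Omega>) \<le> fro_norm (Sig2 n k \<sigma>) + fro_norm (F * F\<^sup>T)"
proof -
  define D where "D = mat_diag n (\<lambda>i. sqrt (\<sigma> i))"
  have Uc: "U \<in> carrier_mat n n" using U by (simp add: orthogonal_real_mat_def)
  have Dc: "D \<in> carrier_mat n n" by (simp add: D_def)
  have DT: "D\<^sup>T = D" by (rule eq_matI) (auto simp: D_def mat_diag_def)
  have DD: "D * D = mat_diag n \<sigma>" unfolding D_def mat_diag_diag
    by (rule eq_matI) (auto simp: mat_diag_def \<sigma>)
  note Ud = orthogonal_dims[OF U]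
  have dim: "dim_row D = n" "dim_col D = n" "dim_row \<Omega> = n" "dim_col \<Omega> = m" "dim_row R = m" "dim_col R = k"
    using Dc Om R by auto
  have UU: "U\<^sup>T * U = 1\<^sub>m n" using U by (simp add: orthogonal_real_mat_def)
  have A': "A = U * (D * (D * U\<^sup>T))" unfolding A DD[symmetric] by (simp add: massoc Ud dim)
  define W where "W = U\<^sup>T * \<Omega>"
  have Wd: "dim_row W = n" "dim_col W = m" by (simp_all add: W_def Ud dim)
  define X where "X = D * W"
  have Xd: "dim_row X = n" "dim_col X = m" by (simp_all add: X_def dim Wd)
  define N where "N = \<Omega>\<^sup>T * A * \<Omega>"
  have NX: "N = X\<^sup>T * X" unfolding N_def X_def W_def A' by (simp add: mtrans massoc Ud dim DT)
  have Nc: "N \<in> carrier_mat m m" by (rule carrier_matI) (simp_all add: NX Xd)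
  have NT: "N\<^sup>T = N" unfolding NX by (simp add: mtrans)
  define Y where "Y = pinv N"
  have Y: "is_pinv N Y" "Y\<^sup>T = Y" using pinv_symmetric[OF Nc NT] by (simp_all add: Y_def)
  have YNY: "Y * N * Y = Y" "N * Y * N = N" "Y \<in> carrier_mat (dim_col N) (dim_row N)"
    using Y(1) unfolding is_pinv_def by blast+
  have Yd: "dim_row Y = m" "dim_col Y = m" using YNY(3) Nc by auto
  \<comment> \<open>The orthogonal projection onto the column space of X.\<close>
  define P where "P = X * (Y * X\<^sup>T)"
  have Pd: "dim_row P = n" "dim_col P = n" by (simp_all add: P_def Xd)
  have Pc: "P \<in> carrier_mat n n" by (rule carrier_matI[OF Pd])
  have PT: "P\<^sup>T = P" by (simp add: P_def mtrans massoc Xd Yd Y(2))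
  have PP: "P * P = P"
  proof -
    have "P * P = X * ((Y * N * Y) * X\<^sup>T)" by (simp add: P_def NX massoc Xd Yd)
    thus ?thesis by (simp only: YNY P_def)
  qed
  \<comment> \<open>From \<open>N * Y * N = N\<close> the factor \<open>X\<^sup>T\<close> is
    cancelled by showing that the difference has vanishing Gram matrix.\<close>
  have PX: "P * X = X"
  proof -
    define Z where "Z = X - P * X"
    have Zd: "dim_row Z = n" "dim_col Z = m" by (simp_all add: Z_def Xd Pd)
    have PXc: "P * X \<in> carrier_mat n m" and Xc: "X \<in> carrier_mat n m"
      by (intro carrier_matI; simp add: Pd Xd)+
    have XPX: "X\<^sup>T * (P * X) = N"
    proof -
      have "X\<^sup>T * (P * X) = N * Y * N" by (simp add: P_def NX massoc Xd Yd)
      thus ?thesis by (simp only: YNY)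
    qed
    have PXT: "(P * X)\<^sup>T = X\<^sup>T * P" by (simp add: mtrans Pd Xd PT)
    have "Z\<^sup>T * Z = (X\<^sup>T - X\<^sup>T * P) * (X - P * X)"
      unfolding Z_def using transpose_minus[OF Xc PXc] by (simp add: PXT)
    also have "\<dots> = (X\<^sup>T * X - X\<^sup>T * (P * X)) - (X\<^sup>T * P * X - X\<^sup>T * P * (P * X))"
    proof -
      have c: "X\<^sup>T \<in> carrier_mat m n" "X\<^sup>T * P \<in> carrier_mat m n" "X\<^sup>T - X\<^sup>T * P \<in> carrier_mat m n"
        by (intro carrier_matI; simp add: Pd Xd)+
      show ?thesis
        unfolding minus_mult_distrib_mat[OF c(1,2) minus_carrier_mat[OF PXc]]
          mult_minus_distrib_mat[OF c(1) Xc PXc] mult_minus_distrib_mat[OF c(2) Xc PXc] ..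
    qed
    also have "X\<^sup>T * P * (P * X) = X\<^sup>T * (P * P * X)" by (simp add: massoc Pd Xd)
    also have "\<dots> = N" unfolding PP by (rule XPX)
    also have "X\<^sup>T * P * X = N" using XPX by (simp add: massoc Pd Xd)
    finally have "Z\<^sup>T * Z = 0\<^sub>m m m" unfolding XPX using Nc by (simp add: NX[symmetric])
    hence zz: "fip Z Z = 0"
    proof -
      assume z: "Z\<^sup>T * Z = 0\<^sub>m m m"
      have "fip Z Z = (\<Sum>j<m. (Z\<^sup>T * Z) $$ (j,j))"
        unfolding fip_columns Zd by (simp add: Zd)
      thus ?thesis by (simp add: z)
    qed
    have "Z $$ (i,j) = 0" if "i < n" "j < m" for i j
    proof -
      have "(\<Sum>i<n. \<Sum>j<m. Z $$ (i,j) * Z $$ (i,j)) = 0" using zz by (simp add: fip_def Zd)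
      hence "(\<Sum>j<m. Z $$ (i,j) * Z $$ (i,j)) = 0"
        using that(1) by (subst (asm) sum_nonneg_eq_0_iff) (auto intro!: sum_nonneg)
      thus ?thesis using that(2) by (subst (asm) sum_nonneg_eq_0_iff) auto
    qed
    thus ?thesis by (intro eq_matI) (auto simp: Z_def Pd Xd)
  qed
  define E where "E = 1\<^sub>m n - P"
  have Ed: "dim_row E = n" "dim_col E = n" by (simp_all add: E_def Pd)
  have oc: "1\<^sub>m n \<in> carrier_mat n n" by simp
  have ET: "E\<^sup>T = E" unfolding E_def using transpose_minus[OF oc Pc] by (simp add: PT)
  have EE: "E * E = E"
  proof -
    have "E * E = (1\<^sub>m n * 1\<^sub>m n - 1\<^sub>m n * P) - (P * 1\<^sub>m n - P * P)"
      unfolding E_def minus_mult_distrib_mat[OF oc Pc minus_carrier_mat[OF Pc]]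
        mult_minus_distrib_mat[OF oc oc Pc] mult_minus_distrib_mat[OF Pc oc Pc] ..
    also have "\<dots> = 1\<^sub>m n - P" using Pc by (simp add: PP) (intro eq_matI; auto)
    finally show ?thesis by (simp add: E_def)
  qed
  have EX: "E * X = 0\<^sub>m n m"
  proof -
    have Xc: "X \<in> carrier_mat n m" by (rule carrier_matI[OF Xd])
    have "E * X = 1\<^sub>m n * X - P * X" unfolding E_def by (rule minus_mult_distrib_mat[OF oc Pc Xc])
    thus ?thesis using Xc by (simp add: PX)
  qed
  define V where "V = E * (D * U\<^sup>T)"
  define G where "G = E * D"
  have Gd: "dim_row G = n" "dim_col G = n" by (simp_all add: G_def Ed dim)
  have Vd: "dim_row V = n" "dim_col V = n" by (simp_all add: V_def Ed dim Ud)
  have AV: "A - nystrom A \<Omega> = V\<^sup>T * V"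
  proof -
    have nys: "nystrom A \<Omega> = U * (D * (P * (D * U\<^sup>T)))"
    proof -
      have "nystrom A \<Omega> = A * \<Omega> * Y * \<Omega>\<^sup>T * A" by (simp add: nystrom_def Y_def N_def)
      also have "\<dots> = U * (D * (P * (D * U\<^sup>T)))"
        unfolding P_def X_def W_def A' by (simp add: mtrans massoc Ud dim DT Yd)
      finally show ?thesis .
    qed
    have DUc: "D * U\<^sup>T \<in> carrier_mat n n" by (rule carrier_matI) (simp_all add: dim Ud)
    have PDUc: "P * (D * U\<^sup>T) \<in> carrier_mat n n" by (rule carrier_matI) (simp_all add: dim Ud Pd)
    have "V\<^sup>T * V = U * (D * ((E * E) * (D * U\<^sup>T)))"
      unfolding V_def by (simp add: mtrans massoc Ed Ud dim DT ET)
    also have "\<dots> = U * (D * (D * U\<^sup>T - P * (D * U\<^sup>T)))"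
      unfolding EE using minus_mult_distrib_mat[OF oc Pc DUc] by (simp add: E_def dim)
    also have "\<dots> = A - nystrom A \<Omega>"
      unfolding nys unfolding A'
      using mult_minus_distrib_mat[OF Dc DUc PDUc]
        mult_minus_distrib_mat[OF Uc mult_carrier_mat[OF Dc DUc] mult_carrier_mat[OF Dc PDUc]] by simp
    finally show ?thesis ..
  qed
  \<comment> \<open>Exchanging the two Gram matrices of V removes U: the product
    \<open>V * V\<^sup>T\<close> contains U only through \<open>U\<^sup>T * U\<close>.\<close>
  have "fro_norm (A - nystrom A \<Omega>) = fro_norm (V * V\<^sup>T)" unfolding AV by (rule fro_norm_gram[symmetric])
  also have "V * V\<^sup>T = G * G\<^sup>T"
  proof -
    have "V * V\<^sup>T = E * (D * ((U\<^sup>T * U) * (D * E)))"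
      unfolding V_def by (simp add: mtrans massoc Ed Ud dim DT ET)
    also have "\<dots> = G * G\<^sup>T" unfolding UU G_def by (simp add: mtrans massoc Ed dim DT ET)
    finally show ?thesis .
  qed
  finally have err: "fro_norm (A - nystrom A \<Omega>) = fro_norm (G * G\<^sup>T)" .
  define H where "H = Sig2_half n k \<sigma>"
  have Hd: "dim_row H = n - k" "dim_col H = n - k" by (simp_all add: H_def Sig2_half_def mat_diag_dims)
  \<comment> \<open>Multiplication by J from the right selects the last n - k columns. They commute
    with the scaling: \<open>D * J = J * H\<close>.\<close>
  define J where "J = Matrix.mat n (n - k) (\<lambda>(i,l). if i = k + l then 1 else (0::real))"
  have Jd: "dim_row J = n" "dim_col J = n - k" by (simp_all add: J_def)
  have mJ: "(B * J) $$ (i,l) = B $$ (i, k + l)" if "i < dim_row B" "dim_col B = n" "l < n - k" for B i l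
  proof -
    have "(B * J) $$ (i,l) = (\<Sum>q<n. (if k + l = q then 1 else 0) * B $$ (i,q))"
      using that by (subst mult_mat_index) (auto simp: J_def intro!: sum.cong)
    also have "\<dots> = B $$ (i, k + l)" using that by (subst sum_if_mult) auto
    finally show ?thesis .
  qed
  define T where "T = E * J"
  have Td: "dim_row T = n" "dim_col T = n - k" by (simp_all add: T_def Ed Jd)
  have GJ: "G * J = T * H"
  proof -
    have "D * J = J * H"
    proof (rule eq_matI)
      fix i l assume "i < dim_row (J * H)" "l < dim_col (J * H)"
      hence il: "i < n" "l < n - k" by (simp_all add: Jd Hd)
      have "(D * J) $$ (i,l) = D $$ (i, k + l)" using il by (intro mJ) (simp_all add: dim)
      also have "\<dots> = J $$ (i,l) * sqrt (\<sigma> (k + l))" using il by (auto simp: D_def mat_diag_index J_def)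
      also have "\<dots> = (J * H) $$ (i,l)"
        unfolding H_def Sig2_half_def using mat_diag_mult_right[OF carrier_matI[OF Jd]] il by simp
      finally show "(D * J) $$ (i,l) = (J * H) $$ (i,l)" .
    qed (simp_all add: Jd Hd dim)
    thus ?thesis unfolding G_def T_def by (simp add: massoc Ed dim Jd Hd)
  qed
  define F0 where "F0 = ((U2 n k U)\<^sup>T * \<Omega>) * R"
  have F0d: "dim_row F0 = n - k" "dim_col F0 = k" by (simp_all add: F0_def U2_def dim)
  have FH: "F = H * F0" by (simp add: F_def F0_def H_def)
  have Fd: "dim_row F = n - k" "dim_col F = k" by (simp_all add: FH F0d Hd)
  have Wi: "W $$ (i,q) = (\<Sum>l<n. U $$ (l,i) * \<Omega> $$ (l,q))" if "i < n" "q < m" for i q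
    unfolding W_def using that by (subst mult_mat_index) (auto simp: dim Ud)
  have WR1: "(W * R) $$ (l,j) = (if l = j then 1 else 0)" if lj: "l < k" "j < k" for l j
  proof -
    have "(((U1 n k U)\<^sup>T * \<Omega>) * R) $$ (l,j) = (W * R) $$ (l,j)"
    proof -
      have "((U1 n k U)\<^sup>T * \<Omega>) $$ (l,q) = W $$ (l,q)" if "q < m" for q
        using that lj kn by (subst mult_mat_index) (auto simp: U1_def dim Wi)
      thus ?thesis using lj kn by (simp add: mult_mat_index U1_def dim Wd del: index_mult_mat(1))
    qed
    thus ?thesis using inv lj by simp
  qed
  have WR2: "(W * R) $$ (k + l,j) = F0 $$ (l,j)" if lj: "l < n - k" "j < k" for l j
  proof -
    have "((U2 n k U)\<^sup>T * \<Omega>) $$ (l,q) = W $$ (k + l,q)" if "q < m" for q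
      using that lj kn by (subst mult_mat_index) (auto simp: U2_def dim Wi)
    thus ?thesis using lj kn by (simp add: F0_def mult_mat_index U2_def dim Wd del: index_mult_mat(1))
  qed
  \<comment> \<open>G annihilates W, and \<open>W * R\<close> is the identity stacked on top of F0.
    Reading \<open>G * (W * R) = 0\<close> column by column expresses the first k columns of G
    through the others.\<close>
  have G1: "G $$ (i,j) = - (T * F) $$ (i,j)" if ij: "i < n" "j < k" for i j
  proof -
    have "G * W = 0\<^sub>m n m" using EX by (simp add: G_def X_def massoc Ed dim Wd)
    hence "G * (W * R) = 0\<^sub>m n m * R" using massoc[of G W R] by (simp add: Gd Wd dim)
    hence "(G * (W * R)) $$ (i,j) = 0" using ij R by simp
    hence "0 = (\<Sum>l<n. G $$ (i,l) * (W * R) $$ (l,j))"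
      using ij by (subst (asm) mult_mat_index) (simp_all add: Gd Wd dim del: index_mult_mat(1))
    also have "\<dots> = (\<Sum>l<k. (if j = l then 1 else 0) * G $$ (i,l)) + (\<Sum>l<n - k. G $$ (i,k + l) * F0 $$ (l,j))"
      unfolding sum_split_index[OF kn] using ij
      by (intro arg_cong2[where f="(+)"] sum.cong refl) (auto simp: WR1 WR2 simp del: index_mult_mat(1))
    also have "(\<Sum>l<k. (if j = l then 1 else 0) * G $$ (i,l)) = G $$ (i,j)"
      using ij by (subst sum_if_mult) auto
    also have "(\<Sum>l<n - k. G $$ (i,k + l) * F0 $$ (l,j)) = ((G * J) * F0) $$ (i,j)"
      using ij by (subst mult_mat_index) (simp_all add: Gd Jd F0d mJ del: index_mult_mat(1))
    also have "(G * J) * F0 = T * F" unfolding GJ FH by (simp add: massoc Td Hd F0d)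
    finally show ?thesis by simp
  qed
  \<comment> \<open>The first k columns contribute \<open>F * F\<^sup>T\<close> and the others
    \<open>H * H\<^sup>T\<close>, both seen through the contraction T.\<close>
  have split: "G * G\<^sup>T = T * ((F * F\<^sup>T) * T\<^sup>T) + T * ((H * H\<^sup>T) * T\<^sup>T)"
  proof (rule eq_matI)
    fix i j assume "i < dim_row (T * ((F * F\<^sup>T) * T\<^sup>T) + T * ((H * H\<^sup>T) * T\<^sup>T))"
      "j < dim_col (T * ((F * F\<^sup>T) * T\<^sup>T) + T * ((H * H\<^sup>T) * T\<^sup>T))"
    hence ij: "i < n" "j < n" by (simp_all add: Td)
    have "(G * G\<^sup>T) $$ (i,j) = (\<Sum>l<n. G $$ (i,l) * G $$ (j,l))"
      using ij by (subst mult_mat_index) (auto simp: Gd)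
    also have "\<dots> = (\<Sum>l<k. (T * F) $$ (i,l) * (T * F) $$ (j,l)) + (\<Sum>l<n - k. (G * J) $$ (i,l) * (G * J) $$ (j,l))"
      unfolding sum_split_index[OF kn] using ij
      by (intro arg_cong2[where f="(+)"] sum.cong refl) (simp_all add: G1 mJ Gd del: index_mult_mat(1))
    also have "(\<Sum>l<k. (T * F) $$ (i,l) * (T * F) $$ (j,l)) = ((T * F) * (T * F)\<^sup>T) $$ (i,j)"
      using ij by (subst mult_mat_index[of i "T * F"]) (auto simp: Td Fd simp del: index_mult_mat(1))
    also have "(\<Sum>l<n - k. (G * J) $$ (i,l) * (G * J) $$ (j,l)) = ((G * J) * (G * J)\<^sup>T) $$ (i,j)"
      using ij by (subst mult_mat_index[of i "G * J"]) (auto simp: Gd Jd simp del: index_mult_mat(1))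
    also have "(T * F) * (T * F)\<^sup>T = T * ((F * F\<^sup>T) * T\<^sup>T)" by (simp add: mtrans massoc Td Fd)
    also have "(G * J) * (G * J)\<^sup>T = T * ((H * H\<^sup>T) * T\<^sup>T)" unfolding GJ by (simp add: mtrans massoc Td Hd)
    finally show "(G * G\<^sup>T) $$ (i,j) = (T * ((F * F\<^sup>T) * T\<^sup>T) + T * ((H * H\<^sup>T) * T\<^sup>T)) $$ (i,j)"
      using ij by (simp add: Td del: index_mult_mat(1))
  qed (simp_all add: Gd Td)
  have contr: "(T *\<^sub>v v) \<bullet> (T *\<^sub>v v) \<le> v \<bullet> v" if v: "dim_vec v = dim_col T" for v
  proof -
    have "(T *\<^sub>v v) \<bullet> (T *\<^sub>v v) = (E *\<^sub>v (J *\<^sub>v v)) \<bullet> (E *\<^sub>v (J *\<^sub>v v))"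
      using v unfolding T_def by (simp add: vassoc Ed Jd)
    also have "\<dots> \<le> (J *\<^sub>v v) \<bullet> (J *\<^sub>v v)"
      by (rule sym_idempotent_contraction[OF ET EE]) (simp add: Ed Jd)
    also have "\<dots> = v \<bullet> v"
    proof -
      have "(J *\<^sub>v v) $ (k + l) = v $ l" if "l < n - k" for l
      proof -
        have "(J *\<^sub>v v) $ (k + l) = (\<Sum>q<n - k. (if l = q then 1 else 0) * v $ q)"
          using that v kn by (subst mult_vec_index) (auto simp: J_def Td intro!: sum.cong)
        also have "\<dots> = v $ l" using that by (subst sum_if_mult) auto
        finally show ?thesis .
      qed
      moreover have "(J *\<^sub>v v) $ l = 0" if "l < k" for l
        using that v kn by (subst mult_vec_index) (auto simp: J_def Td intro!: sum.neutral)
      ultimately show ?thesis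
        using v by (simp add: sprod_self Jd Td sum_split_index[OF kn] del: index_mult_mat_vec)
    qed
    finally show ?thesis .
  qed
  have HH: "H * H\<^sup>T = Sig2 n k \<sigma>"
  proof -
    have "H\<^sup>T = H" by (rule eq_matI) (auto simp: H_def Sig2_half_def mat_diag_def)
    moreover have "H * H = Sig2 n k \<sigma>" unfolding H_def Sig2_half_def Sig2_def mat_diag_diag
      by (rule eq_matI) (auto simp: mat_diag_def \<sigma>)
    ultimately show ?thesis by simp
  qed
  have "fro_norm (G * G\<^sup>T) \<le> fro_norm (T * ((F * F\<^sup>T) * T\<^sup>T)) + fro_norm (T * ((H * H\<^sup>T) * T\<^sup>T))"
    unfolding split by (rule fro_norm_triangle) simp_all
  also have "\<dots> \<le> fro_norm (F * F\<^sup>T) + fro_norm (H * H\<^sup>T)"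
    by (intro add_mono fro_norm_sandwich_le contr) (simp_all add: Fd Td Hd)
  finally show ?thesis unfolding err HH by simp
qed

section \<open>Inverse Gram matrices of Gaussian matrices\<close>

text \<open>Measurability is imposed entry by entry, and the dimensions are fixed at every point, so
  that determinants and products become finite sums over constant index ranges.\<close>

definition mmeas :: "'a measure \<Rightarrow> nat \<Rightarrow> nat \<Rightarrow> ('a \<Rightarrow> real mat) \<Rightarrow> bool" where
  "mmeas M r c X \<longleftrightarrow> (\<forall>\<omega>. dim_row (X \<omega>) = r \<and> dim_col (X \<omega>) = c) \<and>
     (\<forall>i<r. \<forall>j<c. (\<lambda>\<omega>. X \<omega> $$ (i,j)) \<in> borel_measurable M)"

lemma mmeas_dims: "mmeas M r c X \<Longrightarrow> dim_row (X \<omega>) = r" "mmeas M r c X \<Longrightarrow> dim_col (X \<omega>) = c"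
  by (auto simp: mmeas_def)

lemma mmeas_entry: "mmeas M r c X \<Longrightarrow> i < r \<Longrightarrow> j < c \<Longrightarrow> (\<lambda>\<omega>. X \<omega> $$ (i,j)) \<in> borel_measurable M"
  by (auto simp: mmeas_def)

lemma mmeas_const: "B \<in> carrier_mat r c \<Longrightarrow> mmeas M r c (\<lambda>_. B)"
  by (auto simp: mmeas_def)

lemma mmeas_trans: "mmeas M r c X \<Longrightarrow> mmeas M c r (\<lambda>\<omega>. (X \<omega>)\<^sup>T)"
  by (auto simp: mmeas_def)

lemma mmeas_mult:
  assumes X: "mmeas M r m X" and Y: "mmeas M m c Y"
  shows "mmeas M r c (\<lambda>\<omega>. X \<omega> * Y \<omega>)"
  unfolding mmeas_def
proof (intro conjI allI impI)
  fix i j assume ij: "i < r" "j < c"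
  have "(X \<omega> * Y \<omega>) $$ (i,j) = (\<Sum>l<m. X \<omega> $$ (i,l) * Y \<omega> $$ (l,j))" for \<omega>
    using ij by (subst mult_mat_index) (auto simp: mmeas_dims[OF X] mmeas_dims[OF Y])
  thus "(\<lambda>\<omega>. (X \<omega> * Y \<omega>) $$ (i,j)) \<in> borel_measurable M"
    using ij by (auto intro!: borel_measurable_sum borel_measurable_times mmeas_entry[OF X] mmeas_entry[OF Y])
qed (auto simp: mmeas_dims[OF X] mmeas_dims[OF Y])

lemma mmeas_det:
  assumes X: "mmeas M k k X" shows "(\<lambda>\<omega>. det (X \<omega>)) \<in> borel_measurable M"
proof -
  have "det (X \<omega>) = (\<Sum>p\<in>{p. p permutes {0..<k}}. signof p * (\<Prod>i = 0..<k. X \<omega> $$ (i, p i)))" for \<omega>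
    unfolding Determinant.det_def by (simp add: mmeas_dims[OF X])
  moreover have "(\<lambda>\<omega>. \<Sum>p\<in>{p. p permutes {0..<k}}. signof p * (\<Prod>i = 0..<k. X \<omega> $$ (i, p i))) \<in> borel_measurable M"
    by (intro borel_measurable_sum borel_measurable_times borel_measurable_const borel_measurable_prod mmeas_entry[OF X])
       (use permutes_in_image in fastforce)+
  ultimately show ?thesis by simp
qed

lemma mmeas_minv:
  assumes X: "mmeas M k k X" shows "mmeas M k k (\<lambda>\<omega>. minv (X \<omega>))"
  unfolding mmeas_def
proof (intro conjI allI impI)
  fix i j assume ij: "i < k" "j < k"
  have "mmeas M (k - 1) (k - 1) (\<lambda>\<omega>. mat_delete (X \<omega>) j i)"
    unfolding mmeas_def mat_delete_def
    using ij by (auto simp: mmeas_dims[OF X] intro!: mmeas_entry[OF X])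
  hence "(\<lambda>\<omega>. 1 / det (X \<omega>) * ((-1) ^ (j + i) * det (mat_delete (X \<omega>) j i))) \<in> borel_measurable M"
    using mmeas_det[OF X] mmeas_det by (intro borel_measurable_times borel_measurable_divide borel_measurable_const) auto
  thus "(\<lambda>\<omega>. minv (X \<omega>) $$ (i,j)) \<in> borel_measurable M"
    using ij by (simp add: minv_def adj_mat_def cofactor_def mmeas_dims[OF X])
qed (auto simp: minv_def adj_mat_def mmeas_dims[OF X])

lemma mmeas_fip:
  assumes X: "mmeas M r c X" and Y: "mmeas M r c Y"
  shows "(\<lambda>\<omega>. fip (X \<omega>) (Y \<omega>)) \<in> borel_measurable M"
  unfolding fip_def mmeas_dims[OF X]
  by (auto intro!: borel_measurable_sum borel_measurable_times mmeas_entry[OF X] mmeas_entry[OF Y])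

lemma fro_norm_eq: "fro_norm A = sqrt (fip A A)"
  by (metis fro_norm_nonneg fro_norm_square real_sqrt_unique)

lemma mmeas_fro_norm:
  assumes X: "mmeas M r c X" shows "(\<lambda>\<omega>. fro_norm (X \<omega>)) \<in> borel_measurable M"
  unfolding fro_norm_eq using mmeas_fip[OF X X] by measurable

lemma mmeas_s4_norm:
  assumes X: "mmeas M r c X" shows "(\<lambda>\<omega>. s4_norm (X \<omega>)) \<in> borel_measurable M"
  unfolding s4_norm_def using mmeas_fro_norm[OF mmeas_mult[OF X mmeas_trans[OF X]]] by measurable

lemma mmeas_mtrace:
  assumes X: "mmeas M k k X" shows "(\<lambda>\<omega>. mtrace (X \<omega>)) \<in> borel_measurable M"
  unfolding mtrace_def mmeas_dims[OF X] by (auto intro!: borel_measurable_sum mmeas_entry[OF X])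

lemma s4_norm_le_fro: "s4_norm X \<le> fro_norm X"
proof -
  have row: "(X *\<^sub>v v) \<bullet> (X *\<^sub>v v) \<le> fip X X * (v \<bullet> v)" if v: "dim_vec v = dim_col X" for v
  proof -
    have "(X *\<^sub>v v) \<bullet> (X *\<^sub>v v) = (\<Sum>i<dim_row X. (row X i \<bullet> v)\<^sup>2)" by (simp add: sprod_self)
    also have "\<dots> \<le> (\<Sum>i<dim_row X. (row X i \<bullet> row X i) * (v \<bullet> v))"
      by (intro sum_mono sprod_cauchy_schwarz) (simp add: v)
    also have "\<dots> = fip X X * (v \<bullet> v)"
      by (simp add: fip_def sprod_self power2_eq_square sum_distrib_right)
    finally show ?thesis .
  qed
  have "(fro_norm (X * X\<^sup>T))\<^sup>2 \<le> fip X X * fip (X\<^sup>T) (X\<^sup>T)"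
    unfolding fro_norm_square by (rule fip_mult_le[OF row]) simp_all
  also have "\<dots> = ((fro_norm X)\<^sup>2)\<^sup>2"
    unfolding fro_norm_square by (simp add: fip_trans power2_eq_square)
  finally have "fro_norm (X * X\<^sup>T) \<le> (fro_norm X)\<^sup>2" by (rule power2_le_imp_le) simp
  from real_sqrt_le_mono[OF this] show ?thesis by (simp add: s4_norm_def fro_norm_nonneg)
qed

lemma det_zero_kernel:
  fixes H :: "real mat"
  assumes H: "H \<in> carrier_mat k N" and det: "det (H * H\<^sup>T) = 0"
  obtains w where "w \<in> carrier_vec k" "w \<noteq> 0\<^sub>v k" "H\<^sup>T *\<^sub>v w = 0\<^sub>v N"
proof -
  have HH: "H * H\<^sup>T \<in> carrier_mat k k" using H by (intro carrier_matI) auto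
  obtain w where w: "w \<in> carrier_vec k" "w \<noteq> 0\<^sub>v k" "(H * H\<^sup>T) *\<^sub>v w = 0\<^sub>v k"
    using det det_0_iff_vec_prod_zero_field[OF HH] by blast
  have wd: "dim_vec w = k" using w(1) by simp
  have "(H\<^sup>T *\<^sub>v w) \<bullet> (H\<^sup>T *\<^sub>v w) = w \<bullet> (H *\<^sub>v (H\<^sup>T *\<^sub>v w))"
    using H wd by (subst sprod_trans) auto
  also have "H *\<^sub>v (H\<^sup>T *\<^sub>v w) = (H * H\<^sup>T) *\<^sub>v w" using H wd by (intro vassoc[symmetric]) auto
  also have "w \<bullet> \<dots> = 0" unfolding w(3) using w(1) by simp
  finally have "H\<^sup>T *\<^sub>v w = 0\<^sub>v (dim_vec (H\<^sup>T *\<^sub>v w))" by (rule iffD1[OF sprod_self_eq_0])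
  hence "H\<^sup>T *\<^sub>v w = 0\<^sub>v N" using H by simp
  thus ?thesis using that w by blast
qed

text \<open>After the rotation, the coordinates from r on of the combination
  \<open>H\<^sup>T *\<^sub>v w\<close> come from row i0 only, with coefficient
  \<open>w $ i0\<close>. Discarding the other coordinates gives the bound.\<close>

lemma gram_row_bound:
  fixes H :: "real mat"
  assumes H: "H \<in> carrier_mat k N" and Q: "orthogonal_real_mat N Q" and i0: "i0 < k" and r: "r \<le> N"
    and z: "\<And>i j. i < k \<Longrightarrow> i \<noteq> i0 \<Longrightarrow> r \<le> j \<Longrightarrow> j < N \<Longrightarrow> (Q *\<^sub>v row H i) $ j = 0"
    and w: "w \<in> carrier_vec k"
  shows "(w $ i0)\<^sup>2 * (\<Sum>j\<in>{r..<N}. ((Q *\<^sub>v row H i0) $ j)\<^sup>2) \<le> (H\<^sup>T *\<^sub>v w) \<bullet> (H\<^sup>T *\<^sub>v w)"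
proof -
  note Qd = orthogonal_dims[OF Q]
  have wd: "dim_vec w = k" using w by simp
  have Hd: "dim_row H = k" "dim_col H = N" using H by auto
  have Qi: "(Q *\<^sub>v row H i) $ j = (\<Sum>l<N. Q $$ (j,l) * H $$ (i,l))" if "i < k" "j < N" for i j
    using that Hd Qd by (subst mult_vec_index) auto
  have comp: "(Q *\<^sub>v (H\<^sup>T *\<^sub>v w)) $ j = w $ i0 * (Q *\<^sub>v row H i0) $ j" if j: "r \<le> j" "j < N" for j
  proof -
    have "(Q *\<^sub>v (H\<^sup>T *\<^sub>v w)) $ j = (\<Sum>l<N. Q $$ (j,l) * (\<Sum>i<k. H $$ (i,l) * w $ i))"
      using j Hd Qd wd
      by (subst mult_vec_index, simp_all del: index_mult_mat_vec, intro sum.cong refl, subst mult_vec_index) auto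
    also have "\<dots> = (\<Sum>i<k. w $ i * (Q *\<^sub>v row H i) $ j)"
      using j by (simp add: Qi sum_distrib_left mult_ac del: index_mult_mat_vec) (rule sum.swap)
    also have "\<dots> = (\<Sum>i<k. (if i0 = i then 1 else 0) * (w $ i * (Q *\<^sub>v row H i) $ j))"
      using z j by (intro sum.cong refl) (auto simp del: index_mult_mat_vec)
    also have "\<dots> = w $ i0 * (Q *\<^sub>v row H i0) $ j" using i0 by (subst sum_if_mult) (auto simp del: index_mult_mat_vec)
    finally show ?thesis .
  qed
  have "(w $ i0)\<^sup>2 * (\<Sum>j\<in>{r..<N}. ((Q *\<^sub>v row H i0) $ j)\<^sup>2) = (\<Sum>j\<in>{r..<N}. ((Q *\<^sub>v (H\<^sup>T *\<^sub>v w)) $ j)\<^sup>2)"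
    by (simp add: comp sum_distrib_left power_mult_distrib del: index_mult_mat_vec)
  also have "\<dots> \<le> (\<Sum>j<N. ((Q *\<^sub>v (H\<^sup>T *\<^sub>v w)) $ j)\<^sup>2)" by (intro sum_mono2) auto
  also have "\<dots> = (Q *\<^sub>v (H\<^sup>T *\<^sub>v w)) \<bullet> (Q *\<^sub>v (H\<^sup>T *\<^sub>v w))" using Qd by (simp add: sprod_self del: index_mult_mat_vec)
  also have "\<dots> = (H\<^sup>T *\<^sub>v w) \<bullet> (H\<^sup>T *\<^sub>v w)" by (rule orthogonal_sprod[OF Q]) (simp_all add: Hd)
  finally show ?thesis .
qed

text \<open>Turns a quadratic form in the inverse Gram matrix into the squared length of a
  combination of rows, the quantity that \<open>gram_row_bound\<close> estimates from below.\<close>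

lemma gram_inverse_quadratic:
  fixes H :: "real mat"
  assumes H: "H \<in> carrier_mat k N" and nz: "det (H * H\<^sup>T) \<noteq> 0" and y: "dim_vec y = k"
  shows "y \<bullet> (minv (H * H\<^sup>T) *\<^sub>v y) = (H\<^sup>T *\<^sub>v (minv (H * H\<^sup>T) *\<^sub>v y)) \<bullet> (H\<^sup>T *\<^sub>v (minv (H * H\<^sup>T) *\<^sub>v y))"
proof -
  have HH: "H * H\<^sup>T \<in> carrier_mat k k" using H by (intro carrier_matI) auto
  note W = minv[OF HH]
  have Hd: "dim_row H = k" "dim_col H = N" using H by auto
  have Wd: "dim_row (minv (H * H\<^sup>T)) = k" "dim_col (minv (H * H\<^sup>T)) = k" using W(1) by auto
  let ?w = "minv (H * H\<^sup>T) *\<^sub>v y"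
  have "(H\<^sup>T *\<^sub>v ?w) \<bullet> (H\<^sup>T *\<^sub>v ?w) = ?w \<bullet> (H *\<^sub>v (H\<^sup>T *\<^sub>v ?w))"
    by (subst sprod_trans) (simp_all add: Hd Wd)
  also have "H *\<^sub>v (H\<^sup>T *\<^sub>v ?w) = ((H * H\<^sup>T) * minv (H * H\<^sup>T)) *\<^sub>v y"
    by (simp add: vassoc Hd Wd y)
  also have "\<dots> = y" unfolding W(2)[OF nz] by (rule one_mult_mat_vec[OF carrier_vecI[OF y]])
  finally show ?thesis by (simp add: sprod_comm[of y] Wd y)
qed

section \<open>Distance of a Gaussian row from the span of the others\<close>

definition gmat :: "nat \<Rightarrow> nat \<Rightarrow> (nat \<times> nat \<Rightarrow> real) \<Rightarrow> real mat" where
  "gmat k N x = Matrix.mat k N x"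

lemma gmat_dims: "dim_row (gmat k N x) = k" "dim_col (gmat k N x) = N"
  by (simp_all add: gmat_def)

lemma gmat_carrier: "gmat k N x \<in> carrier_mat k N"
  by (simp add: gmat_def)

lemma gmat_index: "i < k \<Longrightarrow> j < N \<Longrightarrow> gmat k N x $$ (i,j) = x (i,j)"
  by (simp add: gmat_def)

lemma mmeas_gmat: "{..<k} \<times> {..<N} \<subseteq> I \<Longrightarrow> mmeas (gaussp I) k N (gmat k N)"
  by (auto simp: mmeas_def gmat_dims gmat_index intro!: measurable_component_singleton[THEN measurable_compose])

lemma AE_gauss_nonzero: "AE x in gauss. x \<noteq> 0"
proof -
  have "AE x in lborel. x \<noteq> (0::real)" by (rule AE_lborel_singleton)
  thus ?thesis by (subst AE_density) (auto elim: eventually_mono)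
qed

lemma sum_singleton_times: "(\<Sum>j\<in>{i} \<times> A. g j) = (\<Sum>l\<in>A. g (i,l))"
proof -
  have "{i} \<times> A = Pair i ` A" by auto
  thus ?thesis by (simp add: sum.reindex inj_on_def)
qed

text \<open>Rotation invariance of a single row: T is the squared length of the last N - r rotated
  coordinates. The law is tested with arbitrary f, so that it serves both for negative moments and,
  with an indicator of \<open>{0}\<close>, for the almost sure positivity.\<close>

lemma row_projection_law:
  fixes Q :: "real mat" and i0 :: nat
  assumes Q: "orthogonal_real_mat N Q" and r: "r < N"
  defines "J \<equiv> {i0} \<times> {..<N}"
  defines "T \<equiv> \<lambda>y :: nat \<times> nat \<Rightarrow> real. \<Sum>j\<in>{r..<N}. (\<Sum>l<N. Q $$ (j,l) * y (i0,l))\<^sup>2"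
  shows "\<And>f :: real \<Rightarrow> ennreal. f \<in> borel_measurable borel \<Longrightarrow>
      (\<integral>\<^sup>+y. f (T y) \<partial>gaussp J) = (\<integral>\<^sup>+z. f (\<Sum>j\<in>{i0} \<times> {r..<N}. (z j)\<^sup>2) \<partial>gaussp ({i0} \<times> {r..<N}))"
    and "AE y in gaussp J. T y \<noteq> 0"
proof -
  note Qd = orthogonal_dims[OF Q]
  have fJ: "finite J" by (simp add: J_def)
  let ?J' = "{i0} \<times> {r..<N}"
  have sub: "?J' \<subseteq> J" by (auto simp: J_def)
  define a where "a = (\<lambda>(i :: nat \<times> nat) (j :: nat \<times> nat). Q $$ (snd i, snd j))"
  have sJ: "(\<Sum>i\<in>J. g i) = (\<Sum>l<N. g (i0,l))" for g :: "nat \<times> nat \<Rightarrow> real"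
    unfolding J_def by (rule sum_singleton_times)
  have rot: "distr (gaussp J) (gaussp J) (\<lambda>x. \<lambda>i\<in>J. \<Sum>j\<in>J. a i j * x j) = gaussp J"
  proof (rule distr_gaussp_orthogonal[OF fJ])
    fix v :: "nat \<times> nat \<Rightarrow> real"
    define w where "w = Matrix.vec N (\<lambda>l. v (i0,l))"
    have wd: "dim_vec w = N" by (simp add: w_def)
    have "(Q\<^sup>T *\<^sub>v w) $ j = (\<Sum>l<N. v (i0,l) * Q $$ (l,j))" if "j < N" for j
      using that Qd by (subst mult_vec_index) (auto simp: w_def mult.commute intro!: sum.cong)
    hence "(\<Sum>j\<in>J. (\<Sum>i\<in>J. v i * a i j)\<^sup>2) = (Q\<^sup>T *\<^sub>v w) \<bullet> (Q\<^sup>T *\<^sub>v w)"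
      unfolding sJ by (simp add: a_def sprod_self Qd del: index_mult_mat_vec)
    also have "\<dots> = w \<bullet> w" by (rule orthogonal_sprod[OF orthogonal_trans[OF Q] wd wd])
    also have "\<dots> = (\<Sum>i\<in>J. (v i)\<^sup>2)" unfolding sJ by (simp add: sprod_self w_def)
    finally show "(\<Sum>j\<in>J. (\<Sum>i\<in>J. v i * a i j)\<^sup>2) = (\<Sum>i\<in>J. (v i)\<^sup>2)" .
  qed
  have am: "(\<lambda>x. \<lambda>i\<in>J. \<Sum>j\<in>J. a i j * x j) \<in> measurable (gaussp J) (gaussp J)"
    unfolding measurable_cong_sets[OF refl sets_gaussp] by (rule measurable_linear_gaussp)
  have res: "distr (gaussp J) (gaussp ?J') (\<lambda>x. restrict x ?J') = gaussp ?J'"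
  proof -
    interpret product_prob_space "\<lambda>_. gauss" by (rule product_prob_space_gauss)
    show ?thesis using distr_restrict[OF sub fJ] by simp
  qed
  have rm: "(\<lambda>x. restrict x ?J') \<in> measurable (gaussp J) (gaussp ?J')"
    by (rule measurable_restrict_subset[OF sub])
  have Ta: "T y = (\<Sum>j\<in>?J'. (restrict (\<lambda>i\<in>J. \<Sum>j\<in>J. a i j * y j) ?J' j)\<^sup>2)" for y
  proof -
    have "(\<Sum>j\<in>?J'. (restrict (\<lambda>i\<in>J. \<Sum>j\<in>J. a i j * y j) ?J' j)\<^sup>2) = (\<Sum>j\<in>?J'. (\<Sum>l\<in>J. a j l * y l)\<^sup>2)"
      using sub by (intro sum.cong refl) (auto simp: subset_iff)
    also have "\<dots> = T y" unfolding sJ T_def by (simp add: a_def sum_singleton_times)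
    finally show ?thesis ..
  qed
  show law: "(\<integral>\<^sup>+y. f (T y) \<partial>gaussp J) = (\<integral>\<^sup>+z. f (\<Sum>j\<in>?J'. (z j)\<^sup>2) \<partial>gaussp ?J')"
    if [measurable]: "f \<in> borel_measurable borel" for f :: "real \<Rightarrow> ennreal"
  proof -
    define g where "g = (\<lambda>z :: nat \<times> nat \<Rightarrow> real. f (\<Sum>j\<in>?J'. (z j)\<^sup>2))"
    have gm: "g \<in> borel_measurable (gaussp ?J')" unfolding g_def by measurable
    have hm: "(\<lambda>x. g (restrict x ?J')) \<in> borel_measurable (gaussp J)"
      by (rule measurable_compose[OF rm gm])
    have "(\<integral>\<^sup>+z. g z \<partial>gaussp ?J') = (\<integral>\<^sup>+x. g (restrict x ?J') \<partial>gaussp J)"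
      using nn_integral_distr[OF rm, of g] gm unfolding res by blast
    also have "\<dots> = (\<integral>\<^sup>+y. g (restrict (\<lambda>i\<in>J. \<Sum>j\<in>J. a i j * y j) ?J') \<partial>gaussp J)"
      using nn_integral_distr[OF am, of "\<lambda>x. g (restrict x ?J')"] hm unfolding rot by blast
    also have "\<dots> = (\<integral>\<^sup>+y. f (T y) \<partial>gaussp J)"
      by (simp only: g_def Ta)
    finally show ?thesis by (simp only: g_def)
  qed
  have "AE z in gaussp ?J'. z (i0,r) \<noteq> 0"
  proof -
    have "(i0,r) \<in> ?J'" using r by auto
    hence m: "(\<lambda>z. z (i0,r)) \<in> measurable (gaussp ?J') gauss" and d: "distr (gaussp ?J') gauss (\<lambda>z. z (i0,r)) = gauss"
      by (auto intro: distr_gaussp_component)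
    have "AE x in distr (gaussp ?J') gauss (\<lambda>z. z (i0,r)). x \<noteq> 0" unfolding d by (rule AE_gauss_nonzero)
    thus ?thesis by (subst (asm) AE_distr_iff[OF m]) auto
  qed
  hence "AE z in gaussp ?J'. (\<Sum>j\<in>?J'. (z j)\<^sup>2) \<noteq> 0"
  proof eventually_elim
    case (elim z)
    have "0 < (z (i0,r))\<^sup>2" using elim by simp
    also have "\<dots> \<le> (\<Sum>j\<in>?J'. (z j)\<^sup>2)" by (rule member_le_sum) (use r in auto)
    finally show ?case by simp
  qed
  hence "(\<integral>\<^sup>+z. indicator {0} (\<Sum>j\<in>?J'. (z j)\<^sup>2) \<partial>gaussp ?J') = 0"
    by (subst nn_integral_0_iff_AE) (auto elim!: eventually_mono)
  hence "(\<integral>\<^sup>+y. indicator {0} (T y) \<partial>gaussp J) = 0" using law[of "indicator {0}"] by simp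
  moreover have "T \<in> borel_measurable (gaussp J)" unfolding T_def J_def by measurable
  ultimately have "AE y in gaussp J. indicator {0} (T y) = (0::ennreal)"
    by (subst (asm) nn_integral_0_iff_AE) auto
  thus "AE y in gaussp J. T y \<noteq> 0" by eventually_elim (auto simp: indicator_def split: if_splits)
qed

lemma merge_measurable_nn:
  fixes f :: "('i \<Rightarrow> real) \<Rightarrow> ennreal"
  assumes "I \<inter> J = {}" "finite I" "finite J" "f \<in> borel_measurable (gaussp (I \<union> J))"
  shows "(\<integral>\<^sup>+x. f x \<partial>gaussp (I \<union> J)) = (\<integral>\<^sup>+x. (\<integral>\<^sup>+y. f (merge I J (x,y)) \<partial>gaussp J) \<partial>gaussp I)"
proof -
  interpret product_sigma_finite "\<lambda>_. gauss"
    by (intro product_sigma_finite.intro prob_space_imp_sigma_finite prob_space_gauss)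
  show ?thesis by (rule product_nn_integral_fold[OF assms])
qed

lemma gmat_merge_rows:
  assumes i0: "i0 < k" and x: "I1 = ({..<k} - {i0}) \<times> {..<N}"
  shows "i < k \<Longrightarrow> i \<noteq> i0 \<Longrightarrow> row (gmat k N (merge I1 ({i0} \<times> {..<N}) (x,y))) i = Matrix.vec N (\<lambda>j. x (i,j))"
    and "row (gmat k N (merge I1 ({i0} \<times> {..<N}) (x,y))) i0 = Matrix.vec N (\<lambda>j. y (i0,j))"
  using i0 x by (auto simp: gmat_def merge_def intro!: eq_vecI)

text \<open>After a rotation that aligns the other rows with the first k - 1 coordinates, the distance of
  a row to their span is at least the norm of its remaining coordinates.\<close>
lemma gram_row_split:
  assumes i0: "i0 < k" and kN: "k \<le> N" and I1: "I1 = ({..<k} - {i0}) \<times> {..<N}"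
  shows "\<exists>Q. orthogonal_real_mat N Q \<and> (\<forall>y w. w \<in> carrier_vec k \<longrightarrow>
      (w $ i0)\<^sup>2 * (\<Sum>j\<in>{k - 1..<N}. (\<Sum>l<N. Q $$ (j,l) * y (i0,l))\<^sup>2) \<le>
      ((gmat k N (merge I1 ({i0} \<times> {..<N}) (x,y)))\<^sup>T *\<^sub>v w) \<bullet> ((gmat k N (merge I1 ({i0} \<times> {..<N}) (x,y)))\<^sup>T *\<^sub>v w))"
proof -
  let ?is = "filter (\<lambda>i. i \<noteq> i0) [0..<k]"
  have "distinct ?is" by simp
  hence "length ?is = card (set ?is)" by (rule distinct_card[symmetric])
  also have "set ?is = {..<k} - {i0}" by auto
  finally have len: "length ?is = k - 1" using i0 by simp
  define bs where "bs = map (\<lambda>i. Matrix.vec N (\<lambda>j. x (i,j))) ?is"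
  have "set bs \<subseteq> carrier_vec N" "length bs \<le> N" using len kN by (auto simp: bs_def)
  from orthogonal_reduction[OF this] obtain Q where Q: "orthogonal_real_mat N Q"
    "\<And>b j. b \<in> set bs \<Longrightarrow> k - 1 \<le> j \<Longrightarrow> j < N \<Longrightarrow> (Q *\<^sub>v b) $ j = 0"
    using len by (auto simp: bs_def)
  show ?thesis
  proof (intro exI[of _ Q] conjI allI impI Q(1))
    fix y :: "nat \<times> nat \<Rightarrow> real" and w :: "real vec" assume w: "w \<in> carrier_vec k"
    let ?H = "gmat k N (merge I1 ({i0} \<times> {..<N}) (x,y))"
    note rows = gmat_merge_rows[OF i0 I1, where x = x and y = y]
    have "(w $ i0)\<^sup>2 * (\<Sum>j\<in>{k - 1..<N}. ((Q *\<^sub>v row ?H i0) $ j)\<^sup>2) \<le> (?H\<^sup>T *\<^sub>v w) \<bullet> (?H\<^sup>T *\<^sub>v w)"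
    proof (rule gram_row_bound[OF gmat_carrier Q(1) i0 _ _ w])
      show "k - 1 \<le> N" using kN by simp
      fix i j assume i: "i < k" "i \<noteq> i0" and j: "k - 1 \<le> j" "j < N"
      show "(Q *\<^sub>v row ?H i) $ j = 0"
        unfolding rows(1)[OF i] by (rule Q(2)[OF _ j]) (use i in \<open>auto simp: bs_def\<close>)
    qed
    also have "(\<Sum>j\<in>{k - 1..<N}. ((Q *\<^sub>v row ?H i0) $ j)\<^sup>2) = (\<Sum>j\<in>{k - 1..<N}. (\<Sum>l<N. Q $$ (j,l) * y (i0,l))\<^sup>2)"
      unfolding rows(2) using orthogonal_dims[OF Q(1)]
      by (intro sum.cong refl arg_cong[where f="\<lambda>t. t\<^sup>2"], subst mult_vec_index) auto
    finally show "(w $ i0)\<^sup>2 * (\<Sum>j\<in>{k - 1..<N}. (\<Sum>l<N. Q $$ (j,l) * y (i0,l))\<^sup>2) \<le> (?H\<^sup>T *\<^sub>v w) \<bullet> (?H\<^sup>T *\<^sub>v w)" .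
  qed
qed

lemma mmeas_gram: "{..<k} \<times> {..<N} \<subseteq> I \<Longrightarrow> mmeas (gaussp I) k k (\<lambda>x. gmat k N x * (gmat k N x)\<^sup>T)"
  by (intro mmeas_mult[where m = N] mmeas_trans mmeas_gmat)

lemma gram_carrier: "gmat k N x * (gmat k N x)\<^sup>T \<in> carrier_mat k k"
  by (rule carrier_matI) (simp_all add: gmat_dims)

text \<open>Induction on the rows. Almost surely the new row has a component outside the span of the
  earlier ones, so a kernel vector of the enlarged matrix has last entry 0. Its remaining entries
  would then be a kernel vector for the earlier rows.\<close>

lemma gram_det_AE:
  assumes "k \<le> N"
  shows "AE x in gaussp ({..<k} \<times> {..<N}). det (gmat k N x * (gmat k N x)\<^sup>T) \<noteq> 0"
  using assms
proof (induction k)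
  case 0
  have "det (gmat 0 N x * (gmat 0 N x)\<^sup>T) = 1" for x by (rule det_dim_zero) (auto simp: gmat_dims intro: carrier_matI)
  thus ?case by simp
next
  case (Suc k)
  let ?I = "{..<Suc k} \<times> {..<N}" and ?I1 = "{..<k} \<times> {..<N}" and ?J = "{k} \<times> {..<N}"
  let ?D = "\<lambda>k x. det (gmat k N x * (gmat k N x)\<^sup>T)"
  have un: "?I = ?I1 \<union> ?J" and I1: "?I1 = ({..<Suc k} - {k}) \<times> {..<N}" by auto
  define f where "f = (\<lambda>x. indicator {0} (?D (Suc k) x) :: ennreal)"
  have fm: "f \<in> borel_measurable (gaussp ?I)"
    unfolding f_def using mmeas_det[OF mmeas_gram[of "Suc k" N ?I]] by measurable
  have "(\<integral>\<^sup>+x. f x \<partial>gaussp ?I) = (\<integral>\<^sup>+x. (\<integral>\<^sup>+y. f (merge ?I1 ?J (x,y)) \<partial>gaussp ?J) \<partial>gaussp ?I1)"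
    unfolding un by (rule merge_measurable_nn) (use fm un in auto)
  also have "\<dots> = (\<integral>\<^sup>+x. 0 \<partial>gaussp ?I1)"
  proof (rule nn_integral_cong_AE)
    have "AE x in gaussp ?I1. ?D k x \<noteq> 0" using Suc by simp
    thus "AE x in gaussp ?I1. (\<integral>\<^sup>+y. f (merge ?I1 ?J (x,y)) \<partial>gaussp ?J) = 0"
    proof eventually_elim
      case (elim x)
      obtain Q where Q: "orthogonal_real_mat N Q" and Q2: "\<forall>y w. w \<in> carrier_vec (Suc k) \<longrightarrow>
        (w $ k)\<^sup>2 * (\<Sum>j\<in>{Suc k - 1..<N}. (\<Sum>l<N. Q $$ (j,l) * y (k,l))\<^sup>2) \<le>
        ((gmat (Suc k) N (merge ?I1 ?J (x,y)))\<^sup>T *\<^sub>v w) \<bullet> ((gmat (Suc k) N (merge ?I1 ?J (x,y)))\<^sup>T *\<^sub>v w)"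
        using gram_row_split[OF lessI Suc.prems I1, where x = x] by blast
      note Q = Q Q2[rule_format]
      have "AE y in gaussp ?J. (\<Sum>j\<in>{k..<N}. (\<Sum>l<N. Q $$ (j,l) * y (k,l))\<^sup>2) \<noteq> 0"
        using row_projection_law(2)[OF Q(1), of k k] Suc.prems by simp
      hence "AE y in gaussp ?J. f (merge ?I1 ?J (x,y)) = 0"
      proof eventually_elim
        case (elim y)
        let ?H = "gmat (Suc k) N (merge ?I1 ?J (x,y))"
        have "?D (Suc k) (merge ?I1 ?J (x,y)) \<noteq> 0"
        proof
          assume "?D (Suc k) (merge ?I1 ?J (x,y)) = 0"
          then obtain w where w: "w \<in> carrier_vec (Suc k)" "w \<noteq> 0\<^sub>v (Suc k)" "?H\<^sup>T *\<^sub>v w = 0\<^sub>v N"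
            by (rule det_zero_kernel[OF gmat_carrier])
          have "(w $ k)\<^sup>2 * (\<Sum>j\<in>{k..<N}. (\<Sum>l<N. Q $$ (j,l) * y (k,l))\<^sup>2) \<le> 0"
            using Q(2)[OF w(1), of y] w(3) by simp
          moreover have "0 < (\<Sum>j\<in>{k..<N}. (\<Sum>l<N. Q $$ (j,l) * y (k,l))\<^sup>2)"
            using elim by (simp add: order_less_le sum_nonneg)
          ultimately have wk: "w $ k = 0" by (simp add: mult_le_0_iff)
          define v where "v = Matrix.vec k (\<lambda>i. w $ i)"
          have "v \<noteq> 0\<^sub>v k"
          proof
            assume v0: "v = 0\<^sub>v k"
            have "w = 0\<^sub>v (Suc k)"
            proof (rule eq_vecI)
              fix i assume "i < dim_vec (0\<^sub>v (Suc k) :: real vec)"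
              hence "i < Suc k" by simp
              thus "w $ i = 0\<^sub>v (Suc k) $ i"
                using wk arg_cong[OF v0, of "\<lambda>u. u $ i"] by (cases "i = k") (simp_all add: v_def)
            qed (use w(1) in simp)
            thus False using w(2) by simp
          qed
          moreover have "(gmat k N x)\<^sup>T *\<^sub>v v = 0\<^sub>v N"
          proof (rule eq_vecI)
            fix j assume "j < dim_vec (0\<^sub>v N :: real vec)"
            hence j: "j < N" by simp
            have wd: "dim_vec w = Suc k" using w(1) by simp
            have "((gmat k N x)\<^sup>T *\<^sub>v v) $ j = (\<Sum>i<k. x (i,j) * w $ i)"
              using j by (subst mult_vec_index) (auto simp: gmat_dims gmat_index v_def intro!: sum.cong)
            also have "\<dots> = (\<Sum>i<Suc k. ?H $$ (i,j) * w $ i)"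
              using j wk by (simp add: gmat_index merge_def)
            also have "\<dots> = (?H\<^sup>T *\<^sub>v w) $ j"
              using j wd by (subst mult_vec_index) (auto simp: gmat_dims)
            finally show "((gmat k N x)\<^sup>T *\<^sub>v v) $ j = 0\<^sub>v N $ j" unfolding w(3) .
          qed (simp add: gmat_dims)
          hence "(gmat k N x * (gmat k N x)\<^sup>T) *\<^sub>v v = 0\<^sub>v k"
            by (subst vassoc) (auto simp: gmat_dims v_def sprod_index intro!: eq_vecI)
          moreover have vc: "v \<in> carrier_vec k" by (simp add: v_def)
          ultimately have "?D k x = 0"
            using det_0_iff_vec_prod_zero_field[OF gram_carrier, of k N x] vc by blast
          thus False using \<open>?D k x \<noteq> 0\<close> by simp
        qed
        thus ?case by (simp add: f_def)
      qed
      hence "(\<integral>\<^sup>+y. f (merge ?I1 ?J (x,y)) \<partial>gaussp ?J) = (\<integral>\<^sup>+y. 0 \<partial>gaussp ?J)"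
        by (rule nn_integral_cong_AE)
      thus ?case by simp
    qed
  qed
  finally have "(\<integral>\<^sup>+x. f x \<partial>gaussp ?I) = 0" by simp
  hence "AE x in gaussp ?I. f x = 0" using fm by (subst (asm) nn_integral_0_iff_AE) auto
  thus ?case by eventually_elim (auto simp: f_def indicator_def split: if_splits)
qed

text \<open>A diagonal entry of the inverse Gram matrix is at most the reciprocal squared length of
  the part of row i0 that lies beyond the span of the other k - 1 rows. That part has N - (k - 1) =
  p + 1 independent coordinates, just what \<open>nn_integral_inverse_chi_le\<close>
  requires.\<close>

lemma gram_inverse_diag_moment:
  assumes i0: "i0 < k" and N: "N = k + p" and p: "0 < p"
  shows "(\<integral>\<^sup>+x. ennreal ((minv (gmat k N x * (gmat k N x)\<^sup>T) $$ (i0,i0)) powr (real p / 2)) \<partial>gaussp ({..<k} \<times> {..<N}))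
    \<le> ennreal (1 / gmoment p)"
proof -
  let ?I = "{..<k} \<times> {..<N}" and ?J = "{i0} \<times> {..<N}"
  define I1 where "I1 = ({..<k} - {i0}) \<times> {..<N}"
  let ?W = "\<lambda>x. minv (gmat k N x * (gmat k N x)\<^sup>T)"
  have un: "?I = I1 \<union> ?J" using i0 by (auto simp: I1_def)
  have fI: "finite I1" by (simp add: I1_def)
  define f where "f = (\<lambda>x. ennreal ((?W x $$ (i0,i0)) powr (real p / 2)))"
  have fm: "f \<in> borel_measurable (gaussp ?I)"
    unfolding f_def using mmeas_entry[OF mmeas_minv[OF mmeas_gram[of k N ?I]] i0 i0] by measurable
  have "(\<integral>\<^sup>+x. f x \<partial>gaussp ?I) = (\<integral>\<^sup>+x. (\<integral>\<^sup>+y. f (merge I1 ?J (x,y)) \<partial>gaussp ?J) \<partial>gaussp I1)"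
    unfolding un by (rule merge_measurable_nn) (use fm un fI in \<open>auto simp: I1_def\<close>)
  also have "\<dots> \<le> (\<integral>\<^sup>+x. ennreal (1 / gmoment p) \<partial>gaussp I1)"
  proof (rule nn_integral_mono)
    fix x :: "nat \<times> nat \<Rightarrow> real"
    have kN: "k \<le> N" using N by simp
    obtain Q where Q: "orthogonal_real_mat N Q" and Q2: "\<forall>y w. w \<in> carrier_vec k \<longrightarrow>
        (w $ i0)\<^sup>2 * (\<Sum>j\<in>{k - 1..<N}. (\<Sum>l<N. Q $$ (j,l) * y (i0,l))\<^sup>2) \<le>
        ((gmat k N (merge I1 ?J (x,y)))\<^sup>T *\<^sub>v w) \<bullet> ((gmat k N (merge I1 ?J (x,y)))\<^sup>T *\<^sub>v w)"
      using gram_row_split[OF i0 kN I1_def, where x = x] by blast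
    note Q = Q Q2[rule_format]
    let ?T = "\<lambda>y. \<Sum>j\<in>{k - 1..<N}. (\<Sum>l<N. Q $$ (j,l) * y (i0,l))\<^sup>2"
    have r: "k - 1 < N" using i0 kN by simp
    note law = row_projection_law[OF Q(1) r, where ?i0.0 = i0]
    have "AE y in gaussp ?J. f (merge I1 ?J (x,y)) \<le> ennreal (?T y powr (- real p / 2))"
      using law(2)
    proof eventually_elim
      case (elim y)
      hence T: "0 < ?T y" by (simp add: order_less_le sum_nonneg)
      let ?z = "merge I1 ?J (x,y)"
      let ?H = "gmat k N ?z"
      show ?case
      \<comment> \<open>On a singular Gram matrix \<open>minv\<close> is 0, and the bound is
        trivial.\<close>
      proof (cases "det (?H * ?H\<^sup>T) = 0")
        case True
        hence "?W ?z $$ (i0,i0) = 0" using i0 by (simp add: minv_def adj_mat_def gmat_dims)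
        thus ?thesis by (simp add: f_def)
      next
        case False
        have HH: "?H * ?H\<^sup>T \<in> carrier_mat k k" by (rule carrier_matI) (simp_all add: gmat_dims)
        have Wc: "?W ?z \<in> carrier_mat k k" by (rule minv(1)[OF HH])
        let ?w = "?W ?z *\<^sub>v unit_vec k i0"
        have wi: "?w $ i0 = ?W ?z $$ (i0,i0)"
          using i0 Wc by simp
        have "unit_vec k i0 \<bullet> ?w = (?H\<^sup>T *\<^sub>v ?w) \<bullet> (?H\<^sup>T *\<^sub>v ?w)"
          by (rule gram_inverse_quadratic[OF gmat_carrier False]) simp
        also have "unit_vec k i0 \<bullet> ?w = ?w $ i0" using i0 Wc by simp
        finally have eq: "?W ?z $$ (i0,i0) = (?H\<^sup>T *\<^sub>v ?w) \<bullet> (?H\<^sup>T *\<^sub>v ?w)" unfolding wi .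
        have W0: "0 \<le> ?W ?z $$ (i0,i0)" unfolding eq by (rule sprod_self_nonneg)
        \<comment> \<open>The row bound at the column \<open>w = ?w\<close> of the inverse: both its
          entry i0 and the squared length \<open>(?H\<^sup>T *\<^sub>v ?w) \<bullet> (?H\<^sup>T
          *\<^sub>v ?w)\<close> equal the diagonal entry, so one power cancels.\<close>
        have "(?W ?z $$ (i0,i0))\<^sup>2 * ?T y \<le> ?W ?z $$ (i0,i0)"
          using Q(2)[of ?w y] Wc unfolding eq[symmetric] wi by simp
        hence "(?W ?z $$ (i0,i0))\<^sup>2 \<le> 1 / ?T y * ?W ?z $$ (i0,i0)" using T by (simp add: field_simps)
        hence "?W ?z $$ (i0,i0) \<le> 1 / ?T y" by (rule square_le_imp_le) (use W0 T in auto)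
        hence "(?W ?z $$ (i0,i0)) powr (real p / 2) \<le> (1 / ?T y) powr (real p / 2)"
          using W0 by (intro powr_mono2) auto
        also have "\<dots> = ?T y powr (- real p / 2)" using T by (simp add: powr_divide powr_minus_divide)
        finally show ?thesis unfolding f_def by (rule ennreal_leI)
      qed
    qed
    hence "(\<integral>\<^sup>+y. f (merge I1 ?J (x,y)) \<partial>gaussp ?J) \<le> (\<integral>\<^sup>+y. ennreal (?T y powr (- real p / 2)) \<partial>gaussp ?J)"
      by (rule nn_integral_mono_AE)
    also have "\<dots> = (\<integral>\<^sup>+z. ennreal ((\<Sum>j\<in>{i0} \<times> {k - 1..<N}. (z j)\<^sup>2) powr (- real p / 2)) \<partial>gaussp ({i0} \<times> {k - 1..<N}))"
      by (rule law(1)) measurable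
    also have "\<dots> \<le> ennreal (1 / gmoment p)"
      by (rule nn_integral_inverse_chi_le) (use i0 N p in \<open>auto simp: card_cartesian_product\<close>)
    finally show "(\<integral>\<^sup>+y. f (merge I1 ?J (x,y)) \<partial>gaussp ?J) \<le> ennreal (1 / gmoment p)" .
  qed
  also have "\<dots> = ennreal (1 / gmoment p)"
    by (simp add: prob_space.emeasure_space_1[OF prob_space_gaussp])
  finally show ?thesis by (simp add: f_def)
qed

text \<open>Left multiplication by L, written as one linear map on the flat index set so that
  \<open>distr_linear_gaussp\<close> applies. The test on second components keeps different columns
  apart.\<close>

definition lact :: "nat \<Rightarrow> nat \<Rightarrow> real mat \<Rightarrow> (nat \<times> nat \<Rightarrow> real) \<Rightarrow> (nat \<times> nat \<Rightarrow> real)" where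
  "lact n N L x = (\<lambda>z\<in>{..<n} \<times> {..<N}. \<Sum>z'\<in>{..<n} \<times> {..<N}. (if snd z = snd z' then L $$ (fst z, fst z') else 0) * x z')"

lemma sum_times: "(\<Sum>z\<in>A \<times> B. f z) = (\<Sum>i\<in>A. \<Sum>j\<in>B. f (i,j))"
  by (simp add: sum.cartesian_product')

lemma gmat_lact:
  assumes L: "L \<in> carrier_mat n n" shows "gmat n N (lact n N L x) = L * gmat n N x"
proof (rule eq_matI)
  fix i j assume "i < dim_row (L * gmat n N x)" "j < dim_col (L * gmat n N x)"
  hence ij: "i < n" "j < N" using L by (auto simp: gmat_dims)
  have "gmat n N (lact n N L x) $$ (i,j) = (\<Sum>i'<n. \<Sum>j'<N. (if j = j' then L $$ (i,i') else 0) * x (i',j'))"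
    using ij by (simp add: gmat_index lact_def sum_times cong: if_cong)
  also have "\<dots> = (\<Sum>i'<n. L $$ (i,i') * x (i',j))"
    using ij by (simp add: sum_if_mult)
  also have "\<dots> = (L * gmat n N x) $$ (i,j)"
    using ij L by (subst mult_mat_index) (auto simp: gmat_dims gmat_index)
  finally show "gmat n N (lact n N L x) $$ (i,j) = (L * gmat n N x) $$ (i,j)" .
qed (use L in \<open>auto simp: gmat_dims\<close>)

text \<open>The covariance of L times a standard Gaussian matrix: columns are independent, each with
  covariance \<open>L * L\<^sup>T\<close>. The left side is the exponent that occurs in
  \<open>distr_linear_gaussp\<close>.\<close>

lemma lact_quadratic:
  fixes v :: "nat \<times> nat \<Rightarrow> real"
  assumes L: "L \<in> carrier_mat n n"
  shows "(\<Sum>z'\<in>{..<n} \<times> {..<N}. (\<Sum>z\<in>{..<n} \<times> {..<N}. v z * (if snd z = snd z' then L $$ (fst z, fst z') else 0))\<^sup>2)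
    = (\<Sum>j<N. Matrix.vec n (\<lambda>i. v (i,j)) \<bullet> ((L * L\<^sup>T) *\<^sub>v Matrix.vec n (\<lambda>i. v (i,j))))"
proof -
  have Ld: "dim_row L = n" "dim_col L = n" using L by auto
  define w where "w = (\<lambda>j. Matrix.vec n (\<lambda>i. v (i,j)))"
  have wd: "dim_vec (w j) = n" for j by (simp add: w_def)
  have inner: "(\<Sum>z\<in>{..<n} \<times> {..<N}. v z * (if snd z = j then L $$ (fst z, i') else 0)) = (L\<^sup>T *\<^sub>v w j) $ i'"
    if "j < N" "i' < n" for i' j
  proof -
    have "(\<Sum>z\<in>{..<n} \<times> {..<N}. v z * (if snd z = j then L $$ (fst z, i') else 0)) =
        (\<Sum>i<n. \<Sum>j'<N. (if j = j' then L $$ (i,i') else 0) * v (i,j'))"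
      unfolding sum_times by (intro sum.cong refl) auto
    also have "\<dots> = (\<Sum>i<n. L $$ (i,i') * v (i,j))" using that by (simp add: sum_if_mult)
    also have "\<dots> = (L\<^sup>T *\<^sub>v w j) $ i'" using that Ld by (subst mult_vec_index) (auto simp: w_def)
    finally show ?thesis .
  qed
  have "(\<Sum>z'\<in>{..<n} \<times> {..<N}. (\<Sum>z\<in>{..<n} \<times> {..<N}. v z * (if snd z = snd z' then L $$ (fst z, fst z') else 0))\<^sup>2)
    = (\<Sum>i'<n. \<Sum>j<N. ((L\<^sup>T *\<^sub>v w j) $ i')\<^sup>2)"
    unfolding sum_times[where A="{..<n}" and f="\<lambda>z'. (\<Sum>z\<in>{..<n} \<times> {..<N}. v z * (if snd z = snd z' then L $$ (fst z, fst z') else 0))\<^sup>2"]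
    by (intro sum.cong refl) (simp add: inner del: index_mult_mat_vec)
  also have "\<dots> = (\<Sum>j<N. (L\<^sup>T *\<^sub>v w j) \<bullet> (L\<^sup>T *\<^sub>v w j))"
    by (subst sum.swap) (simp add: sprod_self Ld del: index_mult_mat_vec)
  also have "\<dots> = (\<Sum>j<N. w j \<bullet> ((L * L\<^sup>T) *\<^sub>v w j))"
    by (intro sum.cong refl) (simp add: sprod_trans vassoc Ld wd)
  finally show ?thesis by (simp add: w_def)
qed

lemma distr_lact_orthogonal:
  assumes Q: "orthogonal_real_mat k Q"
  shows "distr (gaussp ({..<k} \<times> {..<N})) (gaussp ({..<k} \<times> {..<N})) (lact k N Q) = gaussp ({..<k} \<times> {..<N})"
proof -
  have Qc: "Q \<in> carrier_mat k k" and QQ: "Q * Q\<^sup>T = 1\<^sub>m k" using Q by (auto simp: orthogonal_real_mat_def)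
  have "(\<Sum>z'\<in>{..<k} \<times> {..<N}. (\<Sum>z\<in>{..<k} \<times> {..<N}. v z * (if snd z = snd z' then Q $$ (fst z, fst z') else 0))\<^sup>2)
     = (\<Sum>z\<in>{..<k} \<times> {..<N}. (v z)\<^sup>2)" for v :: "nat \<times> nat \<Rightarrow> real"
  proof -
    have "(\<Sum>j<N. Matrix.vec k (\<lambda>i. v (i,j)) \<bullet> (1\<^sub>m k *\<^sub>v Matrix.vec k (\<lambda>i. v (i,j)))) = (\<Sum>j<N. \<Sum>i<k. (v (i,j))\<^sup>2)"
      by (simp add: sprod_self)
    also have "\<dots> = (\<Sum>i<k. \<Sum>j<N. (v (i,j))\<^sup>2)" by (rule sum.swap)
    finally show ?thesis unfolding lact_quadratic[OF Qc] QQ sum_times[where f="\<lambda>z. (v z)\<^sup>2"] .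
  qed
  from distr_gaussp_orthogonal[OF _ this]
  show ?thesis unfolding lact_def by simp
qed

lemma measurable_lact: "lact n N L \<in> measurable (gaussp ({..<n} \<times> {..<N})) (PiM ({..<n} \<times> {..<N}) (\<lambda>_. borel :: real measure))"
  unfolding lact_def by (rule measurable_linear_gaussp)

lemma measurable_lact_gaussp: "lact n N L \<in> measurable (gaussp ({..<n} \<times> {..<N})) (gaussp ({..<n} \<times> {..<N}))"
  unfolding measurable_cong_sets[OF refl sets_gaussp] by (rule measurable_lact)

lemma quadratic_sum:
  assumes "W \<in> carrier_mat k k" "dim_vec y = k"
  shows "(y :: real vec) \<bullet> (W *\<^sub>v y) = (\<Sum>i<k. \<Sum>j<k. y $ i * W $$ (i,j) * y $ j)"
proof -
  have "y \<bullet> (W *\<^sub>v y) = (\<Sum>i<k. y $ i * (W *\<^sub>v y) $ i)" unfolding sprod_index using assms by simp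
  also have "\<dots> = (\<Sum>i<k. \<Sum>j<k. y $ i * W $$ (i,j) * y $ j)"
    using assms by (intro sum.cong refl, subst mult_vec_index) (auto simp: sum_distrib_left mult.assoc)
  finally show ?thesis .
qed

lemma minv_singular: "C \<in> carrier_mat k k \<Longrightarrow> det C = 0 \<Longrightarrow> i < k \<Longrightarrow> j < k \<Longrightarrow> minv C $$ (i,j) = 0"
  using adj_mat(1)[of C k] by (simp add: minv_def)

lemma minv_singular_quadratic:
  assumes C: "C \<in> carrier_mat k k" "det C = 0" and y: "dim_vec y = k"
  shows "y \<bullet> (minv C *\<^sub>v y) = 0"
  unfolding quadratic_sum[OF minv(1)[OF C(1)] y] using minv_singular[OF C] by simp

lemma gram_inverse_mult:
  fixes L H :: "real mat"
  assumes H: "H \<in> carrier_mat k N" and L: "L \<in> carrier_mat k k" and Lnz: "det L \<noteq> 0" and nz: "det (H * H\<^sup>T) \<noteq> 0"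
  shows "det ((L * H) * (L * H)\<^sup>T) \<noteq> 0"
    and "dim_vec y = k \<Longrightarrow> y \<bullet> (minv ((L * H) * (L * H)\<^sup>T) *\<^sub>v y) = (minv L *\<^sub>v y) \<bullet> (minv (H * H\<^sup>T) *\<^sub>v (minv L *\<^sub>v y))"
proof -
  have d: "dim_row H = k" "dim_col H = N" "dim_row L = k" "dim_col L = k" using H L by auto
  have XX: "(L * H) * (L * H)\<^sup>T = L * ((H * H\<^sup>T) * L\<^sup>T)" by (simp add: mtrans massoc d)
  have Hc: "H * H\<^sup>T \<in> carrier_mat k k" and LTc: "L\<^sup>T \<in> carrier_mat k k" using d by (auto intro: carrier_matI)
  have Xc: "(L * H) * (L * H)\<^sup>T \<in> carrier_mat k k" by (rule carrier_matI) (simp_all add: d)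
  have "det ((L * H) * (L * H)\<^sup>T) = det L * (det (H * H\<^sup>T) * det L)"
    unfolding XX using det_mult[OF L mult_carrier_mat[OF Hc LTc]] det_mult[OF Hc LTc] det_transpose[OF L] by simp
  thus Xnz: "det ((L * H) * (L * H)\<^sup>T) \<noteq> 0" using Lnz nz by simp
  note Li = minv[OF L] and Wi = minv[OF Hc]
  have md: "dim_row (minv L) = k" "dim_col (minv L) = k" "dim_row (minv (H * H\<^sup>T)) = k" "dim_col (minv (H * H\<^sup>T)) = k"
    using Li(1) Wi(1) by auto
  let ?B = "(minv L)\<^sup>T * (minv (H * H\<^sup>T) * minv L)"
  have "?B = minv ((L * H) * (L * H)\<^sup>T)"
  proof (rule inverse_unique[OF Xc _ minv(1)[OF Xc] _ minv(2)[OF Xc Xnz]])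
    show "?B \<in> carrier_mat k k" by (rule carrier_matI) (simp_all add: md)
    have "?B * ((L * H) * (L * H)\<^sup>T) = (minv L)\<^sup>T * (minv (H * H\<^sup>T) * ((minv L * L) * ((H * H\<^sup>T) * L\<^sup>T)))"
      unfolding XX by (simp add: massoc md d)
    also have "\<dots> = (minv L)\<^sup>T * ((minv (H * H\<^sup>T) * (H * H\<^sup>T)) * L\<^sup>T)"
      unfolding Li(3)[OF Lnz] by (simp add: massoc md d)
    also have "\<dots> = (minv L)\<^sup>T * L\<^sup>T" unfolding Wi(3)[OF nz] by (simp add: d)
    also have "\<dots> = (L * minv L)\<^sup>T" by (simp add: mtrans d md)
    also have "\<dots> = 1\<^sub>m k" unfolding Li(2)[OF Lnz] by simp
    finally show "?B * ((L * H) * (L * H)\<^sup>T) = 1\<^sub>m k" .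
  qed
  hence W: "minv ((L * H) * (L * H)\<^sup>T) = ?B" ..
  assume y: "dim_vec y = k"
  have "y \<bullet> (?B *\<^sub>v y) = y \<bullet> ((minv L)\<^sup>T *\<^sub>v (minv (H * H\<^sup>T) *\<^sub>v (minv L *\<^sub>v y)))"
    by (simp add: vassoc massoc md y)
  also have "\<dots> = ((minv L)\<^sup>T *\<^sub>v (minv (H * H\<^sup>T) *\<^sub>v (minv L *\<^sub>v y))) \<bullet> y"
    by (rule sprod_comm) (simp add: md y)
  also have "\<dots> = (minv (H * H\<^sup>T) *\<^sub>v (minv L *\<^sub>v y)) \<bullet> (minv L *\<^sub>v y)"
    by (rule sprod_trans) (simp_all add: md y)
  also have "\<dots> = (minv L *\<^sub>v y) \<bullet> (minv (H * H\<^sup>T) *\<^sub>v (minv L *\<^sub>v y))"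
    by (rule sprod_comm) (simp add: md y)
  finally show "y \<bullet> (minv ((L * H) * (L * H)\<^sup>T) *\<^sub>v y) = (minv L *\<^sub>v y) \<bullet> (minv (H * H\<^sup>T) *\<^sub>v (minv L *\<^sub>v y))"
    unfolding W .
qed

lemma orthogonal_det: "orthogonal_real_mat k Q \<Longrightarrow> det Q \<noteq> 0"
  by (rule invertible_det_nonzero[of _ k "Q\<^sup>T"]) (auto simp: orthogonal_real_mat_def)

lemma orthogonal_minv: "orthogonal_real_mat k Q \<Longrightarrow> minv Q = Q\<^sup>T"
  using minv(1,2)[of Q k] orthogonal_det[of k Q]
  by (intro inverse_unique[of Q k "Q\<^sup>T" "minv Q", symmetric]) (auto simp: orthogonal_real_mat_def)

text \<open>Multiplication of the Gaussian matrix by \<open>Q\<^sup>T\<close> preserves its law and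
  conjugates the inverse Gram matrix by Q. Choosing Q with first column proportional to y reduces
  the form at y to a diagonal entry.\<close>

lemma gram_inverse_moment:
  assumes y: "dim_vec y = k" and N: "N = k + p" and p: "0 < p"
  shows "(\<integral>\<^sup>+x. ennreal ((y \<bullet> (minv (gmat k N x * (gmat k N x)\<^sup>T) *\<^sub>v y)) powr (real p / 2)) \<partial>gaussp ({..<k} \<times> {..<N}))
    \<le> ennreal ((y \<bullet> y) powr (real p / 2) / gmoment p)"
proof (cases "y \<bullet> y = 0")
  case True
  hence "y = 0\<^sub>v (dim_vec y)" by (rule iffD1[OF sprod_self_eq_0])
  hence y0: "y $ i = 0" if "i < k" for i using that y by (metis index_zero_vec(1))
  have "y \<bullet> (minv (gmat k N x * (gmat k N x)\<^sup>T) *\<^sub>v y) = 0" for x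
    unfolding quadratic_sum[OF minv(1)[OF gram_carrier] y] by (simp add: y0)
  thus ?thesis by simp
next
  case False
  hence yp: "0 < y \<bullet> y" using sprod_self_nonneg[of y] by simp
  have k: "0 < k"
  proof (rule ccontr)
    assume "\<not> 0 < k"
    hence "y \<bullet> y = 0" using y by (simp add: sprod_self)
    thus False using False by simp
  qed
  let ?I = "{..<k} \<times> {..<N}" and ?q = "real p / 2"
  let ?W = "\<lambda>x. minv (gmat k N x * (gmat k N x)\<^sup>T)"
  define v where "v = (1 / sqrt (y \<bullet> y)) \<cdot>\<^sub>v y"
  have yc: "y \<in> carrier_vec k" by (rule carrier_vecI[OF y])
  have v: "v \<in> carrier_vec k" unfolding v_def by (rule smult_carrier_vec[THEN iffD2, OF yc])
  have "v \<bullet> v = (1 / sqrt (y \<bullet> y))\<^sup>2 * (y \<bullet> y)" unfolding v_def by (rule sprod_smult)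
  hence v1: "v \<bullet> v = 1" using yp by (simp add: power_divide)
  obtain Q where Q: "orthogonal_real_mat k Q" "Q *\<^sub>v unit_vec k 0 = v" using householder[OF v v1 k] by blast
  have QT: "orthogonal_real_mat k (Q\<^sup>T)" by (rule orthogonal_trans[OF Q(1)])
  have QTc: "Q\<^sup>T \<in> carrier_mat k k" using QT by (simp add: orthogonal_real_mat_def)
  define f where "f = (\<lambda>x. ennreal ((?W x $$ (0,0)) powr ?q))"
  have fm: "f \<in> borel_measurable (gaussp ?I)"
    unfolding f_def using mmeas_entry[OF mmeas_minv[OF mmeas_gram[of k N ?I]] k k] by measurable
  have pt: "ennreal ((y \<bullet> (?W x *\<^sub>v y)) powr ?q) \<le> ennreal ((y \<bullet> y) powr ?q) * f (lact k N (Q\<^sup>T) x)" for x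
  proof (cases "det (gmat k N x * (gmat k N x)\<^sup>T) = 0")
    case True
    thus ?thesis using minv_singular_quadratic[OF gram_carrier True y] by simp
  next
    case nz: False
    let ?x = "lact k N (Q\<^sup>T) x"
    let ?e = "unit_vec k 0 :: real vec"
    have g: "gmat k N ?x = Q\<^sup>T * gmat k N x" by (rule gmat_lact[OF QTc])
    note G = gram_inverse_mult[OF gmat_carrier QTc orthogonal_det[OF QT] nz]
    have Wc: "?W ?x \<in> carrier_mat k k" "?W x \<in> carrier_mat k k" by (rule minv(1)[OF gram_carrier])+
    have "?W ?x $$ (0,0) = ?e \<bullet> (?W ?x *\<^sub>v ?e)" using Wc k by simp
    also have "\<dots> = (minv (Q\<^sup>T) *\<^sub>v ?e) \<bullet> (?W x *\<^sub>v (minv (Q\<^sup>T) *\<^sub>v ?e))"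
      unfolding g by (rule G(2)) simp
    also have "minv (Q\<^sup>T) *\<^sub>v ?e = v" using orthogonal_minv[OF QT] Q(2) by simp
    also have "v \<bullet> (?W x *\<^sub>v v) = (1 / sqrt (y \<bullet> y))\<^sup>2 * (y \<bullet> (?W x *\<^sub>v y))"
    proof -
      have vd: "dim_vec v = k" using v by simp
      show ?thesis unfolding quadratic_sum[OF Wc(2) vd] quadratic_sum[OF Wc(2) y]
        using y by (simp add: v_def sum_distrib_left power2_eq_square mult_ac)
    qed
    also have "\<dots> = (y \<bullet> (?W x *\<^sub>v y)) / (y \<bullet> y)" using yp by (simp add: power_divide)
    finally have "y \<bullet> (?W x *\<^sub>v y) = (y \<bullet> y) * ?W ?x $$ (0,0)" using yp by simp
    moreover have "0 \<le> y \<bullet> (?W x *\<^sub>v y)"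
      unfolding gram_inverse_quadratic[OF gmat_carrier nz y] by (rule sprod_self_nonneg)
    ultimately have "(y \<bullet> (?W x *\<^sub>v y)) powr ?q = (y \<bullet> y) powr ?q * (?W ?x $$ (0,0)) powr ?q"
      using yp by (simp add: powr_mult zero_le_mult_iff)
    thus ?thesis by (simp add: f_def ennreal_mult')
  qed
  have "(\<integral>\<^sup>+x. ennreal ((y \<bullet> (?W x *\<^sub>v y)) powr ?q) \<partial>gaussp ?I) \<le>
      (\<integral>\<^sup>+x. ennreal ((y \<bullet> y) powr ?q) * f (lact k N (Q\<^sup>T) x) \<partial>gaussp ?I)"
    by (intro nn_integral_mono pt)
  also have "\<dots> = ennreal ((y \<bullet> y) powr ?q) * (\<integral>\<^sup>+x. f (lact k N (Q\<^sup>T) x) \<partial>gaussp ?I)"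
    by (rule nn_integral_cmult) (rule measurable_compose[OF measurable_lact_gaussp fm])
  also have "(\<integral>\<^sup>+x. f (lact k N (Q\<^sup>T) x) \<partial>gaussp ?I) = (\<integral>\<^sup>+x. f x \<partial>gaussp ?I)"
    using nn_integral_distr[OF measurable_lact_gaussp, of f k N "Q\<^sup>T"] fm
    unfolding distr_lact_orthogonal[OF QT] by auto
  also have "\<dots> \<le> ennreal (1 / gmoment p)"
    unfolding f_def by (rule gram_inverse_diag_moment[OF k N p])
  finally show ?thesis
    using gmoment_pos[of p] by (simp add: ennreal_mult'[symmetric] mult_left_mono order_trans)
qed

text \<open>Jensen's inequality for the convex power, applied to the positive terms only. Their
  number is at most k, and the exponent q - 1 is nonnegative.\<close>

lemma sum_powr_le:
  fixes a :: "nat \<Rightarrow> real"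
  assumes q: "1 \<le> q" and a: "\<And>i. i < k \<Longrightarrow> 0 \<le> a i"
  shows "(\<Sum>i<k. a i) powr q \<le> real k powr (q - 1) * (\<Sum>i<k. a i powr q)"
proof -
  define S where "S = {i. i < k \<and> 0 < a i}"
  have fS: "finite S" by (simp add: S_def)
  have zero: "(\<Sum>i<k. g (a i)) = (\<Sum>i\<in>S. g (a i))" if "g 0 = 0" for g :: "real \<Rightarrow> real"
    by (rule sum.mono_neutral_right) (use a that in \<open>auto simp: S_def order_less_le\<close>)
  show ?thesis
  proof (cases "S = {}")
    case True
    thus ?thesis using zero[of "\<lambda>x. x"] zero[of "\<lambda>x. x powr q"] by simp
  next
    case False
    define c where "c = real (card S)"
    have c: "0 < c" using fS False by (simp add: c_def card_gt_0_iff)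
    have one: "(\<Sum>i\<in>S. 1 / c) = 1" using c by (simp add: c_def)
    have pos: "0 < a i" if "i \<in> S" for i using that by (simp add: S_def)
    have "card S \<le> card {..<k}" by (rule card_mono) (auto simp: S_def)
    hence ck: "c \<le> real k" by (simp add: c_def)
    have "(\<Sum>i\<in>S. (1 / c) *\<^sub>R a i) powr q \<le> (\<Sum>i\<in>S. (1 / c) * (a i powr q))"
      by (rule convex_on_sum[OF fS False powr_convex[OF q]]) (auto intro: one pos less_imp_le simp: c less_imp_le[OF c] simp del: sum_constant)
    hence "((\<Sum>i\<in>S. a i) / c) powr q \<le> (\<Sum>i\<in>S. a i powr q) / c"
      by (simp add: sum_divide_distrib)
    hence "(\<Sum>i\<in>S. a i) powr q \<le> c powr q * ((\<Sum>i\<in>S. a i powr q) / c)"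
      using c by (simp add: powr_divide sum_nonneg S_def field_simps)
    also have "\<dots> = c powr (q - 1) * (\<Sum>i\<in>S. a i powr q)" using c by (simp add: powr_diff)
    also have "\<dots> \<le> real k powr (q - 1) * (\<Sum>i\<in>S. a i powr q)"
      using c ck q by (intro mult_right_mono powr_mono2 sum_nonneg) auto
    finally show ?thesis using zero[of "\<lambda>x. x"] zero[of "\<lambda>x. x powr q"] by simp
  qed
qed

section \<open>Tails of the trace and of the spectral norm of the inverse Gram matrix\<close>

lemma Markov_powr:
  fixes f :: "'a \<Rightarrow> real"
  assumes [measurable]: "f \<in> borel_measurable M" and \<tau>: "0 < \<tau>" and q: "0 < q"
    and le: "(\<integral>\<^sup>+x. ennreal (f x powr q) \<partial>M) \<le> ennreal B" and B: "0 \<le> B"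
  shows "emeasure M {x \<in> space M. \<tau> < f x} \<le> ennreal (B / \<tau> powr q)"
proof -
  have "emeasure M {x \<in> space M. \<tau> < f x} \<le> emeasure M {x \<in> space M. 1 \<le> ennreal (1 / \<tau> powr q) * ennreal (f x powr q)}"
  proof (rule emeasure_mono)
    show "{x \<in> space M. \<tau> < f x} \<subseteq> {x \<in> space M. 1 \<le> ennreal (1 / \<tau> powr q) * ennreal (f x powr q)}"
    proof safe
      fix x assume "\<tau> < f x"
      hence "\<tau> powr q \<le> f x powr q" using \<tau> q by (intro powr_mono2) auto
      hence "1 \<le> 1 / \<tau> powr q * f x powr q" using \<tau> by simp
      thus "1 \<le> ennreal (1 / \<tau> powr q) * ennreal (f x powr q)" by (simp add: ennreal_mult'[symmetric])
    qed
  qed measurable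
  also have "\<dots> \<le> ennreal (1 / \<tau> powr q) * (\<integral>\<^sup>+x. ennreal (f x powr q) \<partial>M)"
  proof -
    have "(\<integral>\<^sup>+x. ennreal (f x powr q) * indicator (space M) x \<partial>M) = (\<integral>\<^sup>+x. ennreal (f x powr q) \<partial>M)"
      by (intro nn_integral_cong) auto
    with nn_integral_Markov_inequality[where A = "space M" and M = M and u = "\<lambda>x. ennreal (f x powr q)" and c = "ennreal (1 / \<tau> powr q)"]
    show ?thesis by simp
  qed
  also have "\<dots> \<le> ennreal (1 / \<tau> powr q) * ennreal B" by (intro mult_left_mono le) simp
  finally show ?thesis by (simp add: ennreal_mult'[symmetric])
qed

text \<open>The inverse Gram matrix in the model where \<open>L * gmat k N x\<close> stands for
  \<open>U1\<^sup>T * \<Omega>\<close>; L is later a factor of \<open>Kt11\<close>.\<close>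

definition Winv :: "nat \<Rightarrow> nat \<Rightarrow> real mat \<Rightarrow> (nat \<times> nat \<Rightarrow> real) \<Rightarrow> real mat" where
  "Winv k N L x = minv ((L * gmat k N x) * (L * gmat k N x)\<^sup>T)"

lemma gram_product_carrier:
  fixes L :: "real mat"
  shows "L \<in> carrier_mat k k \<Longrightarrow> (L * gmat k N x) * (L * gmat k N x)\<^sup>T \<in> carrier_mat k k"
  by (rule carrier_matI) auto

lemma Winv_carrier: "L \<in> carrier_mat k k \<Longrightarrow> Winv k N L x \<in> carrier_mat k k"
  unfolding Winv_def by (rule minv(1)[OF gram_product_carrier])

lemma mmeas_Winv:
  assumes L: "L \<in> carrier_mat k k" and I: "{..<k} \<times> {..<N} \<subseteq> I"
  shows "mmeas (gaussp I) k k (Winv k N L)"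
proof -
  have X: "mmeas (gaussp I) k N (\<lambda>x. L * gmat k N x)"
    by (rule mmeas_mult[OF mmeas_const[OF L] mmeas_gmat[OF I]])
  show ?thesis unfolding Winv_def
    by (rule mmeas_minv[OF mmeas_mult[OF X mmeas_trans[OF X]]])
qed

text \<open>Guarantees that \<open>Winv\<close> takes the value 0 wherever the Gram matrix of the
  standard model is singular, so that the two forms can be compared at every point.\<close>

lemma gram_product_singular:
  assumes L: "L \<in> carrier_mat k k" and z: "det (gmat k N x * (gmat k N x)\<^sup>T) = 0"
  shows "det ((L * gmat k N x) * (L * gmat k N x)\<^sup>T) = 0"
proof -
  have d: "dim_row L = k" "dim_col L = k" using L by auto
  have XX: "(L * gmat k N x) * (L * gmat k N x)\<^sup>T = L * ((gmat k N x * (gmat k N x)\<^sup>T) * L\<^sup>T)"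
    by (simp add: mtrans massoc d gmat_dims)
  have LTc: "L\<^sup>T \<in> carrier_mat k k" using d by (auto intro: carrier_matI)
  show ?thesis unfolding XX
    using det_mult[OF L mult_carrier_mat[OF gram_carrier LTc]] det_mult[OF gram_carrier LTc] z by simp
qed

lemma Winv_quadratic_nonneg:
  assumes L: "L \<in> carrier_mat k k" and y: "dim_vec y = k"
  shows "0 \<le> y \<bullet> (Winv k N L x *\<^sub>v y)"
proof (cases "det ((L * gmat k N x) * (L * gmat k N x)\<^sup>T) = 0")
  case True
  thus ?thesis unfolding Winv_def using minv_singular_quadratic[OF gram_product_carrier[OF L] True y] by simp
next
  case False
  show ?thesis unfolding Winv_def
    by (subst gram_inverse_quadratic[OF mult_carrier_mat[OF L gmat_carrier] False y]) (rule sprod_self_nonneg)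
qed

lemma Winv_moment:
  assumes L: "L \<in> carrier_mat k k" and Lnz: "det L \<noteq> 0" and y: "dim_vec y = k"
    and N: "N = k + p" and p: "0 < p"
    and \<kappa>: "(minv L *\<^sub>v y) \<bullet> (minv L *\<^sub>v y) \<le> \<kappa> * (y \<bullet> y)"
  shows "(\<integral>\<^sup>+x. ennreal ((y \<bullet> (Winv k N L x *\<^sub>v y)) powr (real p / 2)) \<partial>gaussp ({..<k} \<times> {..<N}))
    \<le> ennreal ((\<kappa> * (y \<bullet> y)) powr (real p / 2) / gmoment p)"
proof -
  let ?w = "minv L *\<^sub>v y"
  have w: "dim_vec ?w = k" using minv(1)[OF L] by simp
  have "(y \<bullet> (Winv k N L x *\<^sub>v y)) powr (real p / 2) \<le> (?w \<bullet> (minv (gmat k N x * (gmat k N x)\<^sup>T) *\<^sub>v ?w)) powr (real p / 2)" for x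
  proof (cases "det (gmat k N x * (gmat k N x)\<^sup>T) = 0")
    case True
    show ?thesis unfolding Winv_def
      using minv_singular_quadratic[OF gram_product_carrier[OF L] gram_product_singular[OF L True] y] by simp
  next
    case False
    show ?thesis unfolding Winv_def gram_inverse_mult(2)[OF gmat_carrier L Lnz False y] by simp
  qed
  hence "(\<integral>\<^sup>+x. ennreal ((y \<bullet> (Winv k N L x *\<^sub>v y)) powr (real p / 2)) \<partial>gaussp ({..<k} \<times> {..<N}))
    \<le> (\<integral>\<^sup>+x. ennreal ((?w \<bullet> (minv (gmat k N x * (gmat k N x)\<^sup>T) *\<^sub>v ?w)) powr (real p / 2)) \<partial>gaussp ({..<k} \<times> {..<N}))"
    by (intro nn_integral_mono ennreal_leI)
  also have "\<dots> \<le> ennreal ((?w \<bullet> ?w) powr (real p / 2) / gmoment p)" by (rule gram_inverse_moment[OF w N p])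
  also have "\<dots> \<le> ennreal ((\<kappa> * (y \<bullet> y)) powr (real p / 2) / gmoment p)"
    using gmoment_pos[of p] by (intro ennreal_leI divide_right_mono powr_mono2 \<kappa> sprod_self_nonneg) auto
  finally show ?thesis .
qed

lemma unit_quadratic:
  "W \<in> carrier_mat k k \<Longrightarrow> i < k \<Longrightarrow> (unit_vec k i :: real vec) \<bullet> (W *\<^sub>v unit_vec k i) = W $$ (i,i)"
  by simp

text \<open>The power mean inequality reduces the trace to its diagonal entries, whose moments are
  known. The condition on p makes the exponent p / 2 at least 1.\<close>

lemma Winv_trace_tail:
  assumes L: "L \<in> carrier_mat k k" and Lnz: "det L \<noteq> 0" and N: "N = k + p" and p: "2 \<le> p" and k: "0 < k"
    and \<kappa>0: "0 \<le> \<kappa>" and \<kappa>: "\<And>y. dim_vec y = k \<Longrightarrow> (minv L *\<^sub>v y) \<bullet> (minv L *\<^sub>v y) \<le> \<kappa> * (y \<bullet> y)" and \<tau>: "0 < \<tau>"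
  shows "emeasure (gaussp ({..<k} \<times> {..<N})) {x \<in> space (gaussp ({..<k} \<times> {..<N})). \<tau> < mtrace (Winv k N L x)}
    \<le> ennreal ((real k * \<kappa> / \<tau>) powr (real p / 2) / gmoment p)"
proof -
  let ?M = "gaussp ({..<k} \<times> {..<N})" and ?q = "real p / 2"
  have Wc: "Winv k N L x \<in> carrier_mat k k" for x by (rule Winv_carrier[OF L])
  have Wm: "mmeas ?M k k (Winv k N L)" by (rule mmeas_Winv[OF L]) simp
  have dm: "(\<lambda>x. Winv k N L x $$ (i,i)) \<in> borel_measurable ?M" if "i < k" for i by (rule mmeas_entry[OF Wm that that])
  have nn: "0 \<le> Winv k N L x $$ (i,i)" if "i < k" for x i
    using Winv_quadratic_nonneg[OF L, of "unit_vec k i" N x] unit_quadratic[OF Wc that] by simp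
  have di: "(\<integral>\<^sup>+x. ennreal ((Winv k N L x $$ (i,i)) powr ?q) \<partial>?M) \<le> ennreal (\<kappa> powr ?q / gmoment p)" if "i < k" for i
  proof -
    have "(unit_vec k i :: real vec) \<bullet> unit_vec k i = 1" using that by simp
    thus ?thesis using Winv_moment[OF L Lnz _ N _ \<kappa>, of "unit_vec k i"] p unit_quadratic[OF Wc that] by simp
  qed
  have "(\<integral>\<^sup>+x. ennreal ((mtrace (Winv k N L x)) powr ?q) \<partial>?M)
     \<le> (\<integral>\<^sup>+x. ennreal (real k powr (?q - 1)) * (\<Sum>i<k. ennreal ((Winv k N L x $$ (i,i)) powr ?q)) \<partial>?M)"
  proof (intro nn_integral_mono)
    fix x
    have "mtrace (Winv k N L x) = (\<Sum>i<k. Winv k N L x $$ (i,i))" using Wc[of x] by (simp add: mtrace_def)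
    hence "(mtrace (Winv k N L x)) powr ?q \<le> real k powr (?q - 1) * (\<Sum>i<k. (Winv k N L x $$ (i,i)) powr ?q)"
      using sum_powr_le[of ?q k "\<lambda>i. Winv k N L x $$ (i,i)"] nn p by simp
    thus "ennreal ((mtrace (Winv k N L x)) powr ?q) \<le> ennreal (real k powr (?q - 1)) * (\<Sum>i<k. ennreal ((Winv k N L x $$ (i,i)) powr ?q))"
      by (simp add: ennreal_leI sum_nonneg ennreal_mult'[symmetric])
  qed
  also have "\<dots> = ennreal (real k powr (?q - 1)) * (\<Sum>i<k. \<integral>\<^sup>+x. ennreal ((Winv k N L x $$ (i,i)) powr ?q) \<partial>?M)"
  proof -
    have em: "(\<lambda>x. ennreal ((Winv k N L x $$ (i,i)) powr ?q)) \<in> borel_measurable ?M" if "i \<in> {..<k}" for i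
      using dm[of i] that by simp
    have "(\<integral>\<^sup>+x. (\<Sum>i<k. ennreal ((Winv k N L x $$ (i,i)) powr ?q)) \<partial>?M) = (\<Sum>i<k. \<integral>\<^sup>+x. ennreal ((Winv k N L x $$ (i,i)) powr ?q) \<partial>?M)"
      by (rule nn_integral_sum[OF em])
    moreover have "(\<lambda>x. \<Sum>i<k. ennreal ((Winv k N L x $$ (i,i)) powr ?q)) \<in> borel_measurable ?M"
      by (rule borel_measurable_sum[OF em])
    note nn_integral_cmult[OF this]
    ultimately show ?thesis by (simp only:)
  qed
  also have "\<dots> \<le> ennreal (real k powr (?q - 1)) * (\<Sum>i<k. ennreal (\<kappa> powr ?q / gmoment p))"
    by (intro mult_left_mono sum_mono di) auto
  also have "\<dots> = ennreal (real k powr (?q - 1) * (real k * (\<kappa> powr ?q / gmoment p)))"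
    using gmoment_pos[of p] by (simp add: ennreal_mult'[symmetric] ennreal_of_nat_eq_real_of_nat)
  also have "real k powr (?q - 1) * (real k * (\<kappa> powr ?q / gmoment p)) = (real k * \<kappa>) powr ?q / gmoment p"
    using k \<kappa>0 by (simp add: powr_diff powr_mult)
  finally have "emeasure ?M {x \<in> space ?M. \<tau> < mtrace (Winv k N L x)} \<le> ennreal ((real k * \<kappa>) powr ?q / gmoment p / \<tau> powr ?q)"
    using p gmoment_pos[of p] by (intro Markov_powr[OF mmeas_mtrace[OF Wm] \<tau>]) auto
  also have "(real k * \<kappa>) powr ?q / gmoment p / \<tau> powr ?q = (real k * \<kappa> / \<tau>) powr ?q / gmoment p"
    using \<tau> \<kappa>0 by (simp add: powr_divide)
  finally show ?thesis .
qed

text \<open>Averages a power of the form over Gaussian directions, in place of its supremum over the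
  unit sphere. The average is measurable in W and can be exchanged with the expectation over
  W.\<close>

definition Gmom :: "nat \<Rightarrow> nat \<Rightarrow> real mat \<Rightarrow> ennreal" where
  "Gmom k p W = (\<integral>\<^sup>+z. ennreal ((Matrix.vec k z \<bullet> (W *\<^sub>v Matrix.vec k z)) powr (real p / 2)) \<partial>gaussp {..<k})"

lemma measurable_Winv_form:
  assumes L: "L \<in> carrier_mat k k"
  shows "(\<lambda>(x,z). ennreal ((Matrix.vec k z \<bullet> (Winv k N L x *\<^sub>v Matrix.vec k z)) powr q))
    \<in> borel_measurable (gaussp ({..<k} \<times> {..<N}) \<Otimes>\<^sub>M gaussp {..<k})"
proof -
  have [measurable]: "(\<lambda>x. Winv k N L x $$ (i,j)) \<in> borel_measurable (gaussp ({..<k} \<times> {..<N}))" if "i < k" "j < k" for i j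
    by (rule mmeas_entry[OF mmeas_Winv[OF L] that]) simp
  have "Matrix.vec k z \<bullet> (Winv k N L x *\<^sub>v Matrix.vec k z) = (\<Sum>i<k. \<Sum>j<k. z i * Winv k N L x $$ (i,j) * z j)" for x z
    by (subst quadratic_sum[OF Winv_carrier[OF L]]) auto
  moreover have "(\<lambda>a. \<Sum>i<k. \<Sum>j<k. snd a i * Winv k N L (fst a) $$ (i,j) * snd a j)
      \<in> borel_measurable (gaussp ({..<k} \<times> {..<N}) \<Otimes>\<^sub>M gaussp {..<k})"
  proof (intro borel_measurable_sum borel_measurable_times)
    fix i j assume "i \<in> {..<k}" "j \<in> {..<k}"
    hence ij: "i < k" "j < k" by auto
    have c: "(\<lambda>z. z i) \<in> borel_measurable (gaussp {..<k})" if "i < k" for i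
      by (subst measurable_cong_sets[OF refl, of borel gauss])
         (use that in \<open>auto intro!: measurable_component_singleton\<close>)
    show "(\<lambda>a. snd a i) \<in> borel_measurable (gaussp ({..<k} \<times> {..<N}) \<Otimes>\<^sub>M gaussp {..<k})"
      by (rule measurable_compose[OF measurable_snd c[OF ij(1)]])
    show "(\<lambda>a. snd a j) \<in> borel_measurable (gaussp ({..<k} \<times> {..<N}) \<Otimes>\<^sub>M gaussp {..<k})"
      by (rule measurable_compose[OF measurable_snd c[OF ij(2)]])
    show "(\<lambda>a. Winv k N L (fst a) $$ (i,j)) \<in> borel_measurable (gaussp ({..<k} \<times> {..<N}) \<Otimes>\<^sub>M gaussp {..<k})"
      using ij by measurable
  qed
  ultimately show ?thesis unfolding split_beta by simp
qed

text \<open>Fubini's theorem puts the direction z outside. For fixed z the moment of the form is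
  known, and averaging over z costs the p-th moment of the Gaussian norm in dimension k, hence the
  factor k + p. One factor \<open>gmoment p\<close> comes from the inverse moment, the other from
  the threshold.\<close>

lemma Winv_Gmom_tail:
  assumes L: "L \<in> carrier_mat k k" and Lnz: "det L \<noteq> 0" and N: "N = k + p" and p: "0 < p" and k: "0 < k"
    and \<kappa>0: "0 \<le> \<kappa>" and \<kappa>: "\<And>y. dim_vec y = k \<Longrightarrow> (minv L *\<^sub>v y) \<bullet> (minv L *\<^sub>v y) \<le> \<kappa> * (y \<bullet> y)" and \<tau>: "0 < \<tau>"
  shows "(\<lambda>x. Gmom k p (Winv k N L x)) \<in> borel_measurable (gaussp ({..<k} \<times> {..<N}))"
    and "emeasure (gaussp ({..<k} \<times> {..<N})) {x \<in> space (gaussp ({..<k} \<times> {..<N})). ennreal (\<tau> powr (real p / 2) * gmoment p) < Gmom k p (Winv k N L x)}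
    \<le> ennreal ((\<kappa> * (real k + real p) / \<tau>) powr (real p / 2) / (gmoment p)\<^sup>2)"
proof -
  let ?M = "gaussp ({..<k} \<times> {..<N})" and ?K = "gaussp {..<k}" and ?q = "real p / 2"
  interpret sK: sigma_finite_measure ?K by (intro prob_space_imp_sigma_finite prob_space_gaussp)
  interpret sM: sigma_finite_measure ?M by (intro prob_space_imp_sigma_finite prob_space_gaussp)
  interpret pair_sigma_finite ?M ?K ..
  note jm = measurable_Winv_form[OF L, of N ?q]
  show Gm: "(\<lambda>x. Gmom k p (Winv k N L x)) \<in> borel_measurable ?M"
    unfolding Gmom_def using sK.borel_measurable_nn_integral[OF jm] by simp
  have "(\<integral>\<^sup>+x. Gmom k p (Winv k N L x) \<partial>?M) = (\<integral>\<^sup>+z. \<integral>\<^sup>+x. ennreal ((Matrix.vec k z \<bullet> (Winv k N L x *\<^sub>v Matrix.vec k z)) powr ?q) \<partial>?M \<partial>?K)"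
    unfolding Gmom_def by (rule Fubini'[OF jm, symmetric])
  also have "\<dots> \<le> (\<integral>\<^sup>+z. ennreal (\<kappa> powr ?q / gmoment p) * ennreal ((\<Sum>i<k. (z i)\<^sup>2) powr ?q) \<partial>?K)"
  proof (intro nn_integral_mono)
    fix z :: "nat \<Rightarrow> real"
    have "Matrix.vec k z \<bullet> Matrix.vec k z = (\<Sum>i<k. (z i)\<^sup>2)" by (simp add: sprod_self)
    moreover have "(\<integral>\<^sup>+x. ennreal ((Matrix.vec k z \<bullet> (Winv k N L x *\<^sub>v Matrix.vec k z)) powr ?q) \<partial>?M)
        \<le> ennreal ((\<kappa> * (Matrix.vec k z \<bullet> Matrix.vec k z)) powr ?q / gmoment p)"
      by (rule Winv_moment[OF L Lnz _ N p \<kappa>]) simp_all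
    moreover have "(\<kappa> * (\<Sum>i<k. (z i)\<^sup>2)) powr ?q / gmoment p = \<kappa> powr ?q / gmoment p * (\<Sum>i<k. (z i)\<^sup>2) powr ?q"
      using \<kappa>0 by (simp add: powr_mult sum_nonneg)
    ultimately show "(\<integral>\<^sup>+x. ennreal ((Matrix.vec k z \<bullet> (Winv k N L x *\<^sub>v Matrix.vec k z)) powr ?q) \<partial>?M)
        \<le> ennreal (\<kappa> powr ?q / gmoment p) * ennreal ((\<Sum>i<k. (z i)\<^sup>2) powr ?q)"
      by (simp add: ennreal_mult''[symmetric])
  qed
  also have "\<dots> = ennreal (\<kappa> powr ?q / gmoment p) * (\<integral>\<^sup>+z. ennreal ((\<Sum>i<k. (z i)\<^sup>2) powr ?q) \<partial>?K)"
    by (rule nn_integral_cmult) measurable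
  also have "\<dots> \<le> ennreal (\<kappa> powr ?q / gmoment p) * ennreal ((real k + real p) powr ?q)"
    using nn_integral_gaussp_norm_power[of "{..<k}" p] k p by (intro mult_left_mono) auto
  also have "\<dots> = ennreal ((\<kappa> * (real k + real p)) powr ?q / gmoment p)"
    using \<kappa>0 by (simp add: ennreal_mult''[symmetric] powr_mult)
  finally have int: "(\<integral>\<^sup>+x. Gmom k p (Winv k N L x) \<partial>?M) \<le> ennreal ((\<kappa> * (real k + real p)) powr ?q / gmoment p)" .
  define c where "c = \<tau> powr ?q * gmoment p"
  have c: "0 < c" using \<tau> gmoment_pos[of p] by (simp add: c_def)
  have "emeasure ?M {x \<in> space ?M. ennreal c < Gmom k p (Winv k N L x)} \<le> emeasure ?M {x \<in> space ?M. 1 \<le> ennreal (1 / c) * Gmom k p (Winv k N L x)}"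
  proof (rule emeasure_mono)
    show "{x \<in> space ?M. ennreal c < Gmom k p (Winv k N L x)} \<subseteq> {x \<in> space ?M. 1 \<le> ennreal (1 / c) * Gmom k p (Winv k N L x)}"
    proof safe
      fix x assume "ennreal c < Gmom k p (Winv k N L x)"
      hence "ennreal (1 / c) * ennreal c \<le> ennreal (1 / c) * Gmom k p (Winv k N L x)" by (intro mult_left_mono) auto
      thus "1 \<le> ennreal (1 / c) * Gmom k p (Winv k N L x)" using c by (simp add: ennreal_mult''[symmetric])
    qed
  qed (use Gm in measurable)
  also have "\<dots> \<le> ennreal (1 / c) * (\<integral>\<^sup>+x. Gmom k p (Winv k N L x) \<partial>?M)"
  proof -
    have "(\<integral>\<^sup>+x. Gmom k p (Winv k N L x) * indicator (space ?M) x \<partial>?M) = (\<integral>\<^sup>+x. Gmom k p (Winv k N L x) \<partial>?M)"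
      by (intro nn_integral_cong) auto
    moreover have "(\<lambda>x. Gmom k p (Winv k N L x) * indicator (space ?M) x) \<in> borel_measurable ?M"
      using Gm by measurable
    ultimately show ?thesis using nn_integral_Markov_inequality[OF _ sets.top, of "\<lambda>x. Gmom k p (Winv k N L x)" ?M "ennreal (1 / c)"]
      by simp
  qed
  also have "\<dots> \<le> ennreal (1 / c) * ennreal ((\<kappa> * (real k + real p)) powr ?q / gmoment p)" by (intro mult_left_mono int) simp
  also have "\<dots> = ennreal (1 / c * ((\<kappa> * (real k + real p)) powr ?q / gmoment p))"
    using gmoment_pos[of p] by (simp add: ennreal_mult''[symmetric])
  also have "1 / c * ((\<kappa> * (real k + real p)) powr ?q / gmoment p) = (\<kappa> * (real k + real p) / \<tau>) powr ?q / (gmoment p)\<^sup>2"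
    using \<tau> \<kappa>0 by (simp add: c_def powr_divide power2_eq_square)
  finally show "emeasure ?M {x \<in> space ?M. ennreal (\<tau> powr ?q * gmoment p) < Gmom k p (Winv k N L x)}
    \<le> ennreal ((\<kappa> * (real k + real p) / \<tau>) powr ?q / (gmoment p)\<^sup>2)" unfolding c_def .
qed

text \<open>By the Cauchy--Schwarz inequality for the form W, a p-th moment of the quadratic form at a Gaussian
  vector dominates that of the linear form \<open>z \<bullet> W y\<close>, which is known exactly. This replaces a net argument.\<close>
lemma Gmom_bounds_form:
  fixes W :: "real mat"
  assumes W: "W \<in> carrier_mat k k" "W\<^sup>T = W" "\<And>v. dim_vec v = k \<Longrightarrow> 0 \<le> v \<bullet> (W *\<^sub>v v)"
    and G: "Gmom k p W \<le> ennreal (\<tau> powr (real p / 2) * gmoment p)" and \<tau>: "0 \<le> \<tau>" and p: "0 < p" and y: "dim_vec y = k"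
  shows "y \<bullet> (W *\<^sub>v y) \<le> \<tau> * (y \<bullet> y)"
    and "(W *\<^sub>v y) \<bullet> (W *\<^sub>v y) \<le> \<tau> * (y \<bullet> (W *\<^sub>v y))"
proof -
  obtain R where R: "R \<in> carrier_mat k k" "W = R * R\<^sup>T" using psd_factor[OF W] by blast
  have Rd: "dim_row R = k" "dim_col R = k" using R by auto
  have form: "z \<bullet> (W *\<^sub>v x) = (R\<^sup>T *\<^sub>v z) \<bullet> (R\<^sup>T *\<^sub>v x)" if "dim_vec z = k" "dim_vec x = k" for x z
    unfolding R(2) using that by (simp add: sprod_trans vassoc Rd)
  define a where "a = W *\<^sub>v y"
  define g where "g = y \<bullet> a"
  have ad: "dim_vec a = k" using W(1) by (simp add: a_def)
  have g0: "0 \<le> g" unfolding g_def a_def by (rule W(3)[OF y])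
  let ?q = "real p / 2"
  \<comment> \<open>Cauchy-Schwarz for the form W between z and y; the sum is
    \<open>z \<bullet> (W *\<^sub>v y)\<close>.\<close>
  have "\<bar>\<Sum>i<k. a $ i * z i\<bar> ^ p \<le> g powr ?q * (Matrix.vec k z \<bullet> (W *\<^sub>v Matrix.vec k z)) powr ?q" for z
  proof -
    let ?z = "Matrix.vec k z" and ?s = "\<Sum>i<k. a $ i * z i"
    have "?s = a \<bullet> ?z" by (simp add: sprod_index)
    also have "\<dots> = ?z \<bullet> a" by (rule sprod_comm) (simp add: ad)
    finally have s: "?s = (R\<^sup>T *\<^sub>v ?z) \<bullet> (R\<^sup>T *\<^sub>v y)" using form[of ?z y] y by (simp add: a_def)
    have gg: "g = (R\<^sup>T *\<^sub>v y) \<bullet> (R\<^sup>T *\<^sub>v y)" unfolding g_def a_def by (rule form[OF y y])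
    have zz: "?z \<bullet> (W *\<^sub>v ?z) = (R\<^sup>T *\<^sub>v ?z) \<bullet> (R\<^sup>T *\<^sub>v ?z)" by (rule form) simp_all
    have "?s\<^sup>2 \<le> (?z \<bullet> (W *\<^sub>v ?z)) * g" unfolding s gg zz
      by (rule sprod_cauchy_schwarz) (simp add: Rd)
    hence "(?s\<^sup>2) powr ?q \<le> ((?z \<bullet> (W *\<^sub>v ?z)) * g) powr ?q" by (intro powr_mono2) auto
    also have "\<dots> = g powr ?q * (?z \<bullet> (W *\<^sub>v ?z)) powr ?q" using g0 W(3)[of ?z] by (simp add: powr_mult mult.commute)
    also have "(?s\<^sup>2) powr ?q = \<bar>?s\<bar> ^ p"
    proof (cases "?s = 0")
      case False
      hence "(?s\<^sup>2) powr ?q = (\<bar>?s\<bar> powr 2) powr ?q" by (simp add: powr_numeral)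
      also have "\<dots> = \<bar>?s\<bar> powr real p" by (simp only: powr_powr) simp
      finally show ?thesis using False by (simp add: powr_realpow)
    qed (use p in simp)
    finally show ?thesis .
  qed
  hence "(\<integral>\<^sup>+z. ennreal (\<bar>\<Sum>i<k. a $ i * z i\<bar> ^ p) \<partial>gaussp {..<k})
      \<le> (\<integral>\<^sup>+z. ennreal (g powr ?q) * ennreal ((Matrix.vec k z \<bullet> (W *\<^sub>v Matrix.vec k z)) powr ?q) \<partial>gaussp {..<k})"
    by (intro nn_integral_mono) (simp add: ennreal_mult''[symmetric] ennreal_leI)
  also have "\<dots> = ennreal (g powr ?q) * Gmom k p W"
  proof -
    have "(\<lambda>z. Matrix.vec k z \<bullet> (W *\<^sub>v Matrix.vec k z)) \<in> borel_measurable (gaussp {..<k})"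
    proof -
      have "Matrix.vec k z \<bullet> (W *\<^sub>v Matrix.vec k z) = (\<Sum>i<k. \<Sum>j<k. z i * W $$ (i,j) * z j)" for z
        by (subst quadratic_sum[OF W(1)]) auto
      thus ?thesis by simp
    qed
    hence "(\<lambda>z. ennreal ((Matrix.vec k z \<bullet> (W *\<^sub>v Matrix.vec k z)) powr ?q)) \<in> borel_measurable (gaussp {..<k})" by simp
    thus ?thesis unfolding Gmom_def by (rule nn_integral_cmult)
  qed
  also have "\<dots> \<le> ennreal (g powr ?q) * ennreal (\<tau> powr ?q * gmoment p)" by (intro mult_left_mono G) simp
  also have "\<dots> = ennreal ((g * \<tau>) powr ?q * gmoment p)"
    using g0 \<tau> gmoment_pos[of p] by (simp add: ennreal_mult''[symmetric] powr_mult mult.assoc)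
  finally have "(\<integral>\<^sup>+z. ennreal (\<bar>\<Sum>i<k. a $ i * z i\<bar> ^ p) \<partial>gaussp {..<k}) \<le> ennreal ((g * \<tau>) powr ?q * gmoment p)" .
  moreover have "(\<integral>\<^sup>+z. ennreal (\<bar>\<Sum>i<k. a $ i * z i\<bar> ^ p) \<partial>gaussp {..<k}) = ennreal (sqrt (\<Sum>i<k. (a $ i)\<^sup>2) ^ p * gmoment p)"
    using nn_integral_eq_integral[OF gaussp_linear_form_moment(1)[of "{..<k}" "\<lambda>i. a $ i" p]]
      gaussp_linear_form_moment(2)[of "{..<k}" "\<lambda>i. a $ i" p] by simp
  \<comment> \<open>Both sides carry the factor \<open>gmoment p\<close>, which is why the threshold
    was scaled by it. What remains is the p-th power of the length of
    \<open>W *\<^sub>v y\<close>.\<close>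
  ultimately have le: "sqrt (\<Sum>i<k. (a $ i)\<^sup>2) ^ p * gmoment p \<le> (g * \<tau>) powr ?q * gmoment p"
    using gmoment_pos[of p] by (simp add: ennreal_le_iff)
  have aa: "a \<bullet> a = (\<Sum>i<k. (a $ i)\<^sup>2)" by (simp add: sprod_self ad)
  have fin: "a \<bullet> a \<le> \<tau> * g"
  proof (cases "a \<bullet> a = 0")
    case False
    hence pos: "0 < a \<bullet> a" using sprod_self_nonneg[of a] by simp
    have "sqrt (a \<bullet> a) ^ p = (a \<bullet> a) powr ?q"
      using pos by (simp add: powr_half_sqrt[symmetric] powr_realpow[symmetric] powr_powr)
    hence "(a \<bullet> a) powr ?q \<le> (g * \<tau>) powr ?q" using le gmoment_pos[of p] by (simp add: aa)
    hence "a \<bullet> a \<le> g * \<tau>" using powr_less_mono2[of ?q "g * \<tau>" "a \<bullet> a"] p g0 \<tau> by (meson divide_pos_pos linorder_not_le mult_nonneg_nonneg of_nat_0_less_iff zero_less_numeral)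
    thus ?thesis by (simp add: mult.commute)
  qed (use g0 \<tau> in simp)
  thus "(W *\<^sub>v y) \<bullet> (W *\<^sub>v y) \<le> \<tau> * (y \<bullet> (W *\<^sub>v y))" by (simp add: a_def g_def)
  have "g\<^sup>2 \<le> (y \<bullet> y) * (a \<bullet> a)" unfolding g_def by (rule sprod_cauchy_schwarz) (simp add: y ad)
  also have "\<dots> \<le> (y \<bullet> y) * (\<tau> * g)" by (intro mult_left_mono fin sprod_self_nonneg)
  finally have "g\<^sup>2 \<le> (\<tau> * (y \<bullet> y)) * g" by (simp add: mult_ac)
  hence "g \<le> \<tau> * (y \<bullet> y)"
    by (rule square_le_imp_le[OF _ g0 mult_nonneg_nonneg[OF \<tau> sprod_self_nonneg]])
  thus "y \<bullet> (W *\<^sub>v y) \<le> \<tau> * (y \<bullet> y)" by (simp add: g_def a_def)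
qed

section \<open>Numerical constants and the exceptional set\<close>

lemma gmoment_trace_constant:
  assumes p: "4 \<le> p" and t: "1 \<le> t"
  shows "((real p + 1) / (3 * t\<^sup>2)) powr (real p / 2) / gmoment p \<le> 11 / 10 * t powr (- real p)"
proof -
  let ?q = "real p / 2" and ?e = "exp 1 :: real"
  have e: "0 < ?e / 3" "?e / 3 \<le> 1" "?e < 272 / 100" using e_less_272 by auto
  have tp: "(1 / t\<^sup>2) powr ?q = t powr (- real p)"
  proof -
    have "(1 / t\<^sup>2) powr ?q = (t powr -2) powr ?q" using t by (simp add: powr_minus_divide powr_numeral)
    thus ?thesis by (simp add: powr_powr)
  qed
  have base: "((real p + 1) / (3 * t\<^sup>2)) powr ?q = ((real p + 1) / ?e) powr ?q * (?e / 3) powr ?q * t powr (- real p)"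
  proof -
    have "(real p + 1) / (3 * t\<^sup>2) = (real p + 1) / ?e * (?e / 3) * (1 / t\<^sup>2)" using t by (simp add: field_simps)
    thus ?thesis unfolding tp[symmetric] using t by (simp only: powr_mult) 
  qed
  \<comment> \<open>Since e < 3, the worst exponent is the smallest, p / 2 = 2. The square of
    272/300 is below 33/40, and 4/3 * 33/40 = 11/10.\<close>
  have "(?e / 3) powr ?q \<le> (?e / 3) powr 2" using p e by (intro powr_mono') auto
  also have "\<dots> = (?e / 3)\<^sup>2" using e by (simp add: powr_numeral)
  also have "\<dots> \<le> ((272 / 100) / 3)\<^sup>2" using e by (intro power_mono divide_right_mono) auto
  finally have e2: "(?e / 3) powr ?q \<le> 33 / 40" by (simp add: power2_eq_square)
  have m: "((real p + 1) / ?e) powr ?q \<le> 4 / 3 * gmoment p" using gmoment_lower[OF p] by simp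
  have "((real p + 1) / (3 * t\<^sup>2)) powr ?q \<le> (4 / 3 * gmoment p) * (33 / 40) * t powr (- real p)"
    unfolding base using gmoment_pos[of p] by (intro mult_right_mono mult_mono m e2) auto
  also have "\<dots> = (11 / 10 * t powr (- real p)) * gmoment p" by simp
  finally show ?thesis using gmoment_pos[of p] by (simp add: divide_le_eq)
qed

text \<open>The lower bound for \<open>gmoment\<close> enters twice, which explains 16/9 as the
  square of 4/3 and the factor \<open>exp 2\<close> in d2 as the square of e.\<close>

lemma gmoment_form_constant:
  assumes p: "4 \<le> p" and t: "1 \<le> t"
  shows "(((real p + 1) / exp 1)\<^sup>2 / t\<^sup>2) powr (real p / 2) / (gmoment p)\<^sup>2 \<le> 16 / 9 * t powr (- real p)"
proof -
  let ?q = "real p / 2" and ?r = "(real p + 1) / exp 1 :: real"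
  have tp: "(1 / t\<^sup>2) powr ?q = t powr (- real p)"
  proof -
    have "(1 / t\<^sup>2) powr ?q = (t powr -2) powr ?q" using t by (simp add: powr_minus_divide powr_numeral)
    thus ?thesis by (simp add: powr_powr)
  qed
  have base: "(?r\<^sup>2 / t\<^sup>2) powr ?q = (?r powr ?q)\<^sup>2 * t powr (- real p)"
  proof -
    have "?r\<^sup>2 / t\<^sup>2 = ?r * ?r * (1 / t\<^sup>2)" by (simp add: power2_eq_square)
    thus ?thesis unfolding tp[symmetric] by (simp only: powr_mult power2_eq_square)
  qed
  have m: "?r powr ?q \<le> 4 / 3 * gmoment p" using gmoment_lower[OF p] by simp
  have "(?r\<^sup>2 / t\<^sup>2) powr ?q \<le> (4 / 3 * gmoment p)\<^sup>2 * t powr (- real p)"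
    unfolding base by (intro mult_right_mono power_mono m) auto
  also have "\<dots> = (16 / 9 * t powr (- real p)) * (gmoment p)\<^sup>2" by (simp add: power2_eq_square)
  finally show ?thesis using gmoment_pos[of p] by (simp add: divide_le_eq)
qed

text \<open>The factor 3 covers 11/10 for the trace and 16/9 for the form; singular Gram matrices
  have probability 0. The conclusion provides a measurable exceptional set, because the last
  condition ranges over all vectors y.\<close>

lemma Winv_good_event:
  fixes L :: "real mat"
  assumes L: "L \<in> carrier_mat k k" and Lnz: "det L \<noteq> 0" and p: "4 \<le> p" and k: "0 < k" and t: "1 \<le> t"
    and \<kappa>0: "0 < \<kappa>" and \<kappa>: "\<And>y. dim_vec y = k \<Longrightarrow> (minv L *\<^sub>v y) \<bullet> (minv L *\<^sub>v y) \<le> \<kappa> * (y \<bullet> y)"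
  defines "\<tau>\<^sub>1 \<equiv> t\<^sup>2 * (3 * real k / (real p + 1)) * \<kappa>" and "\<tau>\<^sub>2 \<equiv> t\<^sup>2 * (exp 2 * (real k + real p) / (real p + 1)\<^sup>2) * \<kappa>"
    and "P \<equiv> gaussp ({..<k} \<times> {..<k + p})"
  shows "\<exists>B\<in>sets P. emeasure P B \<le> ennreal (3 * t powr (- real p)) \<and>
     (\<forall>x\<in>space P - B. det ((L * gmat k (k + p) x) * (L * gmat k (k + p) x)\<^sup>T) \<noteq> 0 \<and> mtrace (Winv k (k + p) L x) \<le> \<tau>\<^sub>1 \<and>
       (\<forall>y. dim_vec y = k \<longrightarrow> y \<bullet> (Winv k (k + p) L x *\<^sub>v y) \<le> \<tau>\<^sub>2 * (y \<bullet> y) \<and>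
          (Winv k (k + p) L x *\<^sub>v y) \<bullet> (Winv k (k + p) L x *\<^sub>v y) \<le> \<tau>\<^sub>2\<^sup>2 * (y \<bullet> y)))"
proof -
  let ?N = "k + p" and ?q = "real p / 2"
  have tpos: "0 < t" using t by simp
  have \<tau>: "0 < \<tau>\<^sub>1" "0 < \<tau>\<^sub>2" using tpos k \<kappa>0 by (auto simp: \<tau>\<^sub>1_def \<tau>\<^sub>2_def)
  have Wm: "mmeas P k k (Winv k ?N L)" unfolding P_def by (rule mmeas_Winv[OF L]) simp
  define B1 where "B1 = {x\<in>space P. \<tau>\<^sub>1 < mtrace (Winv k ?N L x)}"
  define B2 where "B2 = {x\<in>space P. ennreal (\<tau>\<^sub>2 powr ?q * gmoment p) < Gmom k p (Winv k ?N L x)}"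
  define B3 where "B3 = {x\<in>space P. det (gmat k ?N x * (gmat k ?N x)\<^sup>T) = 0}"
  have p0: "0 < p" "2 \<le> p" using p by auto
  note T2 = Winv_Gmom_tail[OF L Lnz refl p0(1) k less_imp_le[OF \<kappa>0] \<kappa> \<tau>(2), folded P_def]
  have B1s: "B1 \<in> sets P" unfolding B1_def using mmeas_mtrace[OF Wm] by measurable
  have B2s: "B2 \<in> sets P" unfolding B2_def using T2(1) by measurable
  have dm: "(\<lambda>x. det (gmat k ?N x * (gmat k ?N x)\<^sup>T)) \<in> borel_measurable P"
    unfolding P_def by (rule mmeas_det[OF mmeas_gram]) simp
  have B3s: "B3 \<in> sets P" unfolding B3_def using dm by measurable
  have "emeasure P B1 \<le> ennreal ((real k * \<kappa> / \<tau>\<^sub>1) powr ?q / gmoment p)"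
    using Winv_trace_tail[OF L Lnz refl p0(2) k less_imp_le[OF \<kappa>0] \<kappa> \<tau>(1)] unfolding B1_def P_def by simp
  also have "real k * \<kappa> / \<tau>\<^sub>1 = (real p + 1) / (3 * t\<^sup>2)"
    using tpos k \<kappa>0 by (simp add: \<tau>\<^sub>1_def field_simps)
  also have "ennreal (((real p + 1) / (3 * t\<^sup>2)) powr ?q / gmoment p) \<le> ennreal (11 / 10 * t powr (- real p))"
    by (intro ennreal_leI gmoment_trace_constant p t)
  finally have e1: "emeasure P B1 \<le> ennreal (11 / 10 * t powr (- real p))" .
  have "emeasure P B2 \<le> ennreal ((\<kappa> * (real k + real p) / \<tau>\<^sub>2) powr ?q / (gmoment p)\<^sup>2)"
    using T2(2) unfolding B2_def by simp
  also have "\<kappa> * (real k + real p) / \<tau>\<^sub>2 = ((real p + 1) / exp 1)\<^sup>2 / t\<^sup>2"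
  proof -
    have "exp (2::real) = (exp 1)\<^sup>2" by (simp add: exp_double[symmetric])
    moreover have "0 < real k + real p" using k by simp
    ultimately show ?thesis using tpos \<kappa>0 by (simp add: \<tau>\<^sub>2_def power_divide)
  qed
  also have "ennreal ((((real p + 1) / exp 1)\<^sup>2 / t\<^sup>2) powr ?q / (gmoment p)\<^sup>2) \<le> ennreal (16 / 9 * t powr (- real p))"
    by (intro ennreal_leI gmoment_form_constant p t)
  finally have e2: "emeasure P B2 \<le> ennreal (16 / 9 * t powr (- real p))" .
  have e3: "emeasure P B3 = 0"
  proof -
    have "AE x in P. det (gmat k ?N x * (gmat k ?N x)\<^sup>T) \<noteq> 0" unfolding P_def by (rule gram_det_AE) simp
    thus ?thesis unfolding B3_def by (subst (asm) AE_iff_measurable[OF B3s[unfolded B3_def]]) auto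
  qed
  show ?thesis
  proof (intro bexI conjI ballI)
    show "B1 \<union> B2 \<union> B3 \<in> sets P" using B1s B2s B3s by blast
    have "emeasure P (B1 \<union> B2 \<union> B3) \<le> emeasure P B1 + emeasure P B2 + emeasure P B3"
      by (meson B1s B2s B3s add_right_mono emeasure_subadditive order_trans sets.Un)
    also have "\<dots> \<le> ennreal (11 / 10 * t powr (- real p)) + ennreal (16 / 9 * t powr (- real p)) + 0"
      unfolding e3 by (intro add_mono e1 e2) simp
    also have "\<dots> \<le> ennreal (3 * t powr (- real p))" by (simp add: ennreal_plus[symmetric] ennreal_leI del: ennreal_plus)
    finally show "emeasure P (B1 \<union> B2 \<union> B3) \<le> ennreal (3 * t powr (- real p))" .
  next
    fix x assume x: "x \<in> space P - (B1 \<union> B2 \<union> B3)"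
    hence nz: "det (gmat k ?N x * (gmat k ?N x)\<^sup>T) \<noteq> 0" by (auto simp: B3_def)
    show Xnz: "det ((L * gmat k ?N x) * (L * gmat k ?N x)\<^sup>T) \<noteq> 0" by (rule gram_inverse_mult(1)[OF gmat_carrier L Lnz nz])
    show "mtrace (Winv k ?N L x) \<le> \<tau>\<^sub>1" using x by (auto simp: B1_def)
    let ?W = "Winv k ?N L x"
    have sym: "?W\<^sup>T = ?W" unfolding Winv_def
      by (rule minv_symmetric[OF gram_product_carrier[OF L] _ Xnz]) (rule mtrans[THEN trans], simp_all)
    have G: "Gmom k p ?W \<le> ennreal (\<tau>\<^sub>2 powr ?q * gmoment p)" using x by (auto simp: B2_def)
    show "\<forall>y. dim_vec y = k \<longrightarrow> y \<bullet> (?W *\<^sub>v y) \<le> \<tau>\<^sub>2 * (y \<bullet> y) \<and> (?W *\<^sub>v y) \<bullet> (?W *\<^sub>v y) \<le> \<tau>\<^sub>2\<^sup>2 * (y \<bullet> y)"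
    proof (intro allI impI conjI)
      fix y :: "real vec" assume y: "dim_vec y = k"
      note F = Gmom_bounds_form[OF Winv_carrier[OF L] sym Winv_quadratic_nonneg[OF L] G less_imp_le[OF \<tau>(2)] p0(1) y]
      show "y \<bullet> (?W *\<^sub>v y) \<le> \<tau>\<^sub>2 * (y \<bullet> y)" by (rule F(1))
      have "\<tau>\<^sub>2 * (y \<bullet> (?W *\<^sub>v y)) \<le> \<tau>\<^sub>2 * (\<tau>\<^sub>2 * (y \<bullet> y))" using F(1) \<tau>(2) by (intro mult_left_mono) auto
      with F(2) show "(?W *\<^sub>v y) \<bullet> (?W *\<^sub>v y) \<le> \<tau>\<^sub>2\<^sup>2 * (y \<bullet> y)" by (simp add: power2_eq_square mult.assoc)
    qed
  qed
qed

section \<open>The Gaussian part of the error\<close>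

text \<open>The rows from k on. They use coordinates disjoint from those of \<open>gmat k N\<close>
  and are therefore independent of it.\<close>

definition lowmat :: "nat \<Rightarrow> nat \<Rightarrow> nat \<Rightarrow> (nat \<times> nat \<Rightarrow> real) \<Rightarrow> real mat" where
  "lowmat k r N y = Matrix.mat r N (\<lambda>(i,j). y (k + i, j))"

lemma lowmat_dims: "dim_row (lowmat k r N y) = r" "dim_col (lowmat k r N y) = N"
  by (simp_all add: lowmat_def)

lemma lowmat_index: "i < r \<Longrightarrow> j < N \<Longrightarrow> lowmat k r N y $$ (i,j) = y (k + i, j)"
  by (simp add: lowmat_def)

lemma mmeas_lowmat: "{k..<k+r} \<times> {..<N} \<subseteq> I \<Longrightarrow> mmeas (gaussp I) r N (lowmat k r N)"
proof -
  assume I: "{k..<k+r} \<times> {..<N} \<subseteq> I"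
  have "(\<lambda>y. y (k + i, j)) \<in> borel_measurable (gaussp I)" if "i < r" "j < N" for i j
  proof -
    have "(k + i, j) \<in> I" using that I by auto
    from measurable_component_singleton[OF this, of "\<lambda>_. gauss"] show ?thesis
      by (subst measurable_cong_sets[OF refl, of borel gauss]) auto
  qed
  thus ?thesis by (auto simp: mmeas_def lowmat_dims lowmat_index)
qed

lemma sum_low: "(\<Sum>z\<in>{k..<k+r} \<times> {..<N}. f z) = (\<Sum>i<r. \<Sum>j<N. f (k + i, j))" for f :: "nat \<times> nat \<Rightarrow> real"
proof -
  have "(\<Sum>i\<in>{k..<k+r}. g i) = (\<Sum>i<r. g (k + i))" for g :: "nat \<Rightarrow> real"
    using sum.shift_bounds_nat_ivl[of g 0 k r] by (simp add: lessThan_atLeast0 add.commute)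
  thus ?thesis by (simp add: sum_times)
qed

lemma sum4_product:
  fixes f :: "nat \<Rightarrow> nat \<Rightarrow> real"
  shows "(\<Sum>a<r. \<Sum>b<r. \<Sum>c<k. \<Sum>d<k. f a b * g c d) = (\<Sum>a<r. \<Sum>b<r. f a b) * (\<Sum>c<k. \<Sum>d<k. g c d)"
proof -
  have "(\<Sum>a<r. \<Sum>b<r. \<Sum>c<k. \<Sum>d<k. f a b * g c d) = (\<Sum>a<r. \<Sum>b<r. f a b * (\<Sum>c<k. \<Sum>d<k. g c d))"
    by (simp only: sum_distrib_left)
  thus ?thesis by (simp only: sum_distrib_right)
qed

lemma fro_norm_square_gram:
  assumes Y: "dim_row Y = r" "dim_col Y = k"
  shows "(fro_norm (Y * Y\<^sup>T))\<^sup>2 = (\<Sum>a<r. \<Sum>b<r. \<Sum>c<k. \<Sum>d<k. Y $$ (a,c) * Y $$ (b,c) * Y $$ (a,d) * Y $$ (b,d))"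
proof -
  have e: "(Y * Y\<^sup>T) $$ (a,b) = (\<Sum>c<k. Y $$ (a,c) * Y $$ (b,c))" if "a < r" "b < r" for a b
    using that Y by (subst mult_mat_index) auto
  show ?thesis unfolding fro_norm_square fip_def
    using Y by (auto simp: e sum_product mult_ac intro!: sum.cong simp del: index_mult_mat(1))
qed

text \<open>Entries (a,c) and (b,e) of the Gaussian product have covariance
  \<open>C $$ (a,b) * W $$ (c,e)\<close>. The fourth power of the norm is a sum of products of four
  entries, and the three pairings in Wick's formula give the three summands in the order
  stated.\<close>

lemma s4_norm_fourth_moment:
  fixes S R :: "real mat"
  assumes S: "S \<in> carrier_mat r r" and R: "R \<in> carrier_mat N k"
  defines "F \<equiv> \<lambda>y. s4_norm (S * (lowmat k r N y * R))"
    and "C \<equiv> S * S\<^sup>T" and "W \<equiv> R\<^sup>T * R" and "J \<equiv> {k..<k+r} \<times> {..<N}"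
  shows "integrable (gaussp J) (\<lambda>y. F y ^ 4)"
    and "(\<integral>y. F y ^ 4 \<partial>gaussp J) = (fro_norm C)\<^sup>2 * (mtrace W)\<^sup>2 + (mtrace C)\<^sup>2 * (fro_norm W)\<^sup>2 + (fro_norm C)\<^sup>2 * (fro_norm W)\<^sup>2"
proof -
  have fJ: "finite J" by (simp add: J_def)
  have d: "dim_row S = r" "dim_col S = r" "dim_row R = N" "dim_col R = k" using S R by auto
  define \<alpha> where "\<alpha> = (\<lambda>(a,c) z. S $$ (a, fst z - k) * R $$ (snd z, c))"
  have Ye: "(S * (lowmat k r N y * R)) $$ (a,c) = (\<Sum>z\<in>J. \<alpha> (a,c) z * y z)" if "a < r" "c < k" for a c y
  proof -
    have "(S * (lowmat k r N y * R)) $$ (a,c) = (\<Sum>i<r. S $$ (a,i) * (lowmat k r N y * R) $$ (i,c))"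
      using that d by (subst mult_mat_index) (auto simp: lowmat_dims)
    also have "\<dots> = (\<Sum>i<r. S $$ (a,i) * (\<Sum>j<N. y (k + i, j) * R $$ (j,c)))"
    proof (intro sum.cong refl arg_cong2[where f="(*)"])
      fix i assume "i \<in> {..<r}"
      thus "(lowmat k r N y * R) $$ (i,c) = (\<Sum>j<N. y (k + i, j) * R $$ (j,c))"
        using that d by (subst mult_mat_index) (auto simp: lowmat_dims lowmat_index)
    qed
    also have "\<dots> = (\<Sum>z\<in>J. \<alpha> (a,c) z * y z)"
      unfolding J_def sum_low by (simp add: \<alpha>_def sum_distrib_left mult_ac)
    finally show ?thesis .
  qed
  have Ce: "C $$ (a,b) = (\<Sum>i<r. S $$ (a,i) * S $$ (b,i))" if "a < r" "b < r" for a b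
    unfolding C_def using that d by (subst mult_mat_index) auto
  have We: "W $$ (c,e) = (\<Sum>j<N. R $$ (j,c) * R $$ (j,e))" if "c < k" "e < k" for c e
    unfolding W_def using that d by (subst mult_mat_index) auto
  have Cd: "dim_row C = r" "dim_col C = r" "dim_row W = k" "dim_col W = k" by (simp_all add: C_def W_def d)
  have D: "(\<Sum>z\<in>J. \<alpha> (a,c) z * \<alpha> (b,e) z) = C $$ (a,b) * W $$ (c,e)" if "a < r" "b < r" "c < k" "e < k" for a b c e
    unfolding J_def sum_low Ce[OF that(1,2)] We[OF that(3,4)]
    unfolding sum_product by (simp add: \<alpha>_def mult_ac)
  have Cs: "C $$ (b,a) = C $$ (a,b)" if "a < r" "b < r" for a b using that by (simp add: Ce mult.commute)
  let ?T = "\<lambda>a b c e y. (\<Sum>z\<in>J. \<alpha> (a,c) z * y z) * (\<Sum>z\<in>J. \<alpha> (b,c) z * y z) * (\<Sum>z\<in>J. \<alpha> (a,e) z * y z) * (\<Sum>z\<in>J. \<alpha> (b,e) z * y z)"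
  have F4: "F y ^ 4 = (\<Sum>a<r. \<Sum>b<r. \<Sum>c<k. \<Sum>e<k. ?T a b c e y)" for y
  proof -
    have "F y ^ 4 = ((F y)\<^sup>2)\<^sup>2" by simp
    also have "\<dots> = (fro_norm ((S * (lowmat k r N y * R)) * (S * (lowmat k r N y * R))\<^sup>T))\<^sup>2"
      unfolding F_def s4_norm_square ..
    also have "\<dots> = (\<Sum>a<r. \<Sum>b<r. \<Sum>c<k. \<Sum>e<k. ?T a b c e y)"
      by (subst fro_norm_square_gram[of _ r k]) (simp_all add: d Ye del: index_mult_mat(1))
    finally show ?thesis .
  qed
  note wick = gaussp_Wick4[OF fJ]
  have wi: "integrable (gaussp J) (?T a b c e)" for a b c e by (rule wick(1))
  have wv: "(\<integral>y. ?T a b c e y \<partial>gaussp J) = (C $$ (a,b) * C $$ (a,b)) * (W $$ (c,c) * W $$ (e,e))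
      + (C $$ (a,a) * C $$ (b,b)) * (W $$ (c,e) * W $$ (c,e)) + (C $$ (a,b) * C $$ (a,b)) * (W $$ (c,e) * W $$ (c,e))"
    if "a < r" "b < r" "c < k" "e < k" for a b c e
    unfolding wick(2) using that Cs[of a b] by (simp add: D)
  show "integrable (gaussp J) (\<lambda>y. F y ^ 4)"
    unfolding F4 by (intro Bochner_Integration.integrable_sum wi)
  have "(\<integral>y. F y ^ 4 \<partial>gaussp J) = (\<Sum>a<r. \<Sum>b<r. \<Sum>c<k. \<Sum>e<k. \<integral>y. ?T a b c e y \<partial>gaussp J)"
    unfolding F4 by (simp only: Bochner_Integration.integral_sum Bochner_Integration.integrable_sum wi)
  also have "\<dots> = (\<Sum>a<r. \<Sum>b<r. \<Sum>c<k. \<Sum>e<k. (C $$ (a,b) * C $$ (a,b)) * (W $$ (c,c) * W $$ (e,e))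
      + (C $$ (a,a) * C $$ (b,b)) * (W $$ (c,e) * W $$ (c,e)) + (C $$ (a,b) * C $$ (a,b)) * (W $$ (c,e) * W $$ (c,e)))"
    by (intro sum.cong refl wv) simp_all
  also have "\<dots> = (\<Sum>a<r. \<Sum>b<r. C $$ (a,b) * C $$ (a,b)) * (\<Sum>c<k. \<Sum>e<k. W $$ (c,c) * W $$ (e,e))
     + (\<Sum>a<r. \<Sum>b<r. C $$ (a,a) * C $$ (b,b)) * (\<Sum>c<k. \<Sum>e<k. W $$ (c,e) * W $$ (c,e))
     + (\<Sum>a<r. \<Sum>b<r. C $$ (a,b) * C $$ (a,b)) * (\<Sum>c<k. \<Sum>e<k. W $$ (c,e) * W $$ (c,e))"
    unfolding sum4_product[symmetric] by (simp only: sum.distrib)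
  also have "\<dots> = (fro_norm C)\<^sup>2 * (mtrace W)\<^sup>2 + (mtrace C)\<^sup>2 * (fro_norm W)\<^sup>2 + (fro_norm C)\<^sup>2 * (fro_norm W)\<^sup>2"
  proof -
    have fro: "(fro_norm C)\<^sup>2 = (\<Sum>a<r. \<Sum>b<r. C $$ (a,b) * C $$ (a,b))" "(fro_norm W)\<^sup>2 = (\<Sum>c<k. \<Sum>e<k. W $$ (c,e) * W $$ (c,e))"
      unfolding fro_norm_square fip_def Cd by (rule refl)+
    have tr: "(mtrace C)\<^sup>2 = (\<Sum>a<r. \<Sum>b<r. C $$ (a,a) * C $$ (b,b))" "(mtrace W)\<^sup>2 = (\<Sum>c<k. \<Sum>e<k. W $$ (c,c) * W $$ (e,e))"
      unfolding mtrace_def Cd power2_eq_square sum_product by (rule refl)+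
    show ?thesis unfolding fro tr ..
  qed
  finally show "(\<integral>y. F y ^ 4 \<partial>gaussp J) = (fro_norm C)\<^sup>2 * (mtrace W)\<^sup>2 + (mtrace C)\<^sup>2 * (fro_norm W)\<^sup>2 + (fro_norm C)\<^sup>2 * (fro_norm W)\<^sup>2" .
qed

text \<open>The Schatten 4-norm is at most the Frobenius norm, in which the factors S and R cost
  only their operator norms. So the deviation is governed by spectral norms alone, the source of the
  term with \<open>beta_k spec_norm\<close>.\<close>

lemma s4_norm_Lipschitz:
  fixes S R :: "real mat"
  assumes S: "S \<in> carrier_mat r r" and R: "R \<in> carrier_mat N k"
    and lam: "0 \<le> lam" "\<And>v. dim_vec v = r \<Longrightarrow> (S\<^sup>T *\<^sub>v v) \<bullet> (S\<^sup>T *\<^sub>v v) \<le> lam * (v \<bullet> v)"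
    and tau: "0 \<le> tau" "\<And>v. dim_vec v = k \<Longrightarrow> (R *\<^sub>v v) \<bullet> (R *\<^sub>v v) \<le> tau * (v \<bullet> v)"
  shows "s4_norm (S * (lowmat k r N x * R)) - s4_norm (S * (lowmat k r N y * R))
    \<le> sqrt (lam * tau) * sqrt (\<Sum>z\<in>{k..<k+r} \<times> {..<N}. (x z - y z)\<^sup>2)"
proof -
  have d: "dim_row S = r" "dim_col S = r" "dim_row R = N" "dim_col R = k" using S R by auto
  define D where "D = lowmat k r N (\<lambda>z. x z - y z)"
  have Dd: "dim_row D = r" "dim_col D = N" by (simp_all add: D_def lowmat_dims)
  have c: "lowmat k r N y \<in> carrier_mat r N" "D \<in> carrier_mat r N" "lowmat k r N y * R \<in> carrier_mat r k" "D * R \<in> carrier_mat r k"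
    by (auto simp: Dd lowmat_dims d intro!: carrier_matI)
  have "lowmat k r N x = lowmat k r N y + D"
    by (rule eq_matI) (auto simp: D_def lowmat_dims lowmat_index)
  hence "S * (lowmat k r N x * R) = S * (lowmat k r N y * R) + S * (D * R)"
    by (simp only: add_mult_distrib_mat[OF c(1,2) R] mult_add_distrib_mat[OF S c(3,4)])
  hence "s4_norm (S * (lowmat k r N x * R)) \<le> s4_norm (S * (lowmat k r N y * R)) + s4_norm (S * (D * R))"
    using s4_norm_triangle[of "S * (lowmat k r N y * R)" "S * (D * R)"] by (simp add: d)
  moreover have "s4_norm (S * (D * R)) \<le> sqrt (lam * tau) * sqrt (\<Sum>z\<in>{k..<k+r} \<times> {..<N}. (x z - y z)\<^sup>2)"
  proof -
    have RT: "((R\<^sup>T) *\<^sub>v v) \<bullet> ((R\<^sup>T) *\<^sub>v v) \<le> tau * (v \<bullet> v)" if "dim_vec v = N" for v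
      using gram_bound_swap[of "R\<^sup>T" tau v] tau that by (simp add: d)
    have "fip (S * (D * R)) (S * (D * R)) \<le> lam * fip (D * R) (D * R)"
      by (rule fip_mult_le, rule gram_bound_swap) (use lam d Dd in auto)
    also have "fip (D * R) (D * R) = fip (R\<^sup>T * D\<^sup>T) (R\<^sup>T * D\<^sup>T)"
      using fip_trans[of "D * R" "D * R"] by (simp add: mtrans d Dd)
    also have "fip (R\<^sup>T * D\<^sup>T) (R\<^sup>T * D\<^sup>T) \<le> tau * fip (D\<^sup>T) (D\<^sup>T)"
      by (rule fip_mult_le) (use RT d Dd in auto)
    also have "fip (D\<^sup>T) (D\<^sup>T) = fip D D" by (rule fip_trans) simp_all
    also have "fip D D = (\<Sum>z\<in>{k..<k+r} \<times> {..<N}. (x z - y z)\<^sup>2)"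
      unfolding fip_def sum_low Dd by (simp add: D_def lowmat_index power2_eq_square)
    finally have "fip (S * (D * R)) (S * (D * R)) \<le> lam * tau * (\<Sum>z\<in>{k..<k+r} \<times> {..<N}. (x z - y z)\<^sup>2)"
      using lam(1) by (simp add: mult_left_mono mult.assoc)
    hence "fro_norm (S * (D * R)) \<le> sqrt (lam * tau) * sqrt (\<Sum>z\<in>{k..<k+r} \<times> {..<N}. (x z - y z)\<^sup>2)"
      unfolding fro_norm_eq real_sqrt_mult[symmetric] by (rule real_sqrt_le_mono)
    thus ?thesis using s4_norm_le_fro[of "S * (D * R)"] by simp
  qed
  ultimately show ?thesis by simp
qed

text \<open>Jensen's inequality bounds the mean of F by the fourth root of its fourth moment. The
  three squares in that moment are at most the square of the sum of their roots, which is the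
  quantity compared with \<open>b\<^sup>2\<close>.\<close>

lemma s4_norm_tail:
  fixes S R :: "real mat"
  assumes S: "S \<in> carrier_mat r r" and R: "R \<in> carrier_mat N k"
    and lam: "0 \<le> lam" "\<And>v. dim_vec v = r \<Longrightarrow> (S\<^sup>T *\<^sub>v v) \<bullet> (S\<^sup>T *\<^sub>v v) \<le> lam * (v \<bullet> v)"
    and tau: "0 \<le> tau" "\<And>v. dim_vec v = k \<Longrightarrow> (R *\<^sub>v v) \<bullet> (R *\<^sub>v v) \<le> tau * (v \<bullet> v)" and u: "0 \<le> u"
  defines "F \<equiv> \<lambda>y. s4_norm (S * (lowmat k r N y * R))"
    and "C \<equiv> S * S\<^sup>T" and "W \<equiv> R\<^sup>T * R" and "J \<equiv> {k..<k+r} \<times> {..<N}"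
  assumes b: "fro_norm C * mtrace W + mtrace C * fro_norm W + fro_norm C * fro_norm W \<le> b\<^sup>2" "0 \<le> b"
  shows "measure (gaussp J) {y \<in> space (gaussp J). b + sqrt (lam * tau) * u < F y} \<le> exp (- u\<^sup>2 / 2)"
proof -
  interpret prob_space "gaussp J" by (rule prob_space_gaussp)
  have fJ: "finite J" by (simp add: J_def)
  have d: "dim_row S = r" "dim_col S = r" "dim_row R = N" "dim_col R = k" using S R by auto
  have Ym: "mmeas (gaussp J) r k (\<lambda>y. S * (lowmat k r N y * R))"
    by (intro mmeas_mult[OF mmeas_const[OF S]] mmeas_mult[OF mmeas_lowmat mmeas_const[OF R]]) (simp add: J_def)
  have Fm: "F \<in> borel_measurable (gaussp J)" unfolding F_def by (rule mmeas_s4_norm[OF Ym])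
  have Lip: "\<bar>F x - F y\<bar> \<le> sqrt (lam * tau) * sqrt (\<Sum>z\<in>J. (x z - y z)\<^sup>2)" for x y
  proof -
    have "F x - F y \<le> sqrt (lam * tau) * sqrt (\<Sum>z\<in>J. (x z - y z)\<^sup>2)" for x y
      unfolding F_def J_def by (rule s4_norm_Lipschitz[OF S R lam tau])
    from this[of x y] this[of y x] show ?thesis by (simp add: power2_commute abs_le_iff)
  qed
  have L0: "0 \<le> sqrt (lam * tau)" using lam tau by simp
  note conc = gauss_concentration[OF fJ Fm L0 Lip u]
  have i4: "integrable (gaussp J) (\<lambda>y. F y ^ 4)"
    unfolding F_def J_def by (rule s4_norm_fourth_moment(1)[OF S R])
  have e4: "expectation (\<lambda>y. F y ^ 4) = (fro_norm C)\<^sup>2 * (mtrace W)\<^sup>2 + (mtrace C)\<^sup>2 * (fro_norm W)\<^sup>2 + (fro_norm C)\<^sup>2 * (fro_norm W)\<^sup>2"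
    unfolding F_def J_def C_def W_def by (rule s4_norm_fourth_moment(2)[OF S R])
  have tr: "0 \<le> mtrace C" "0 \<le> mtrace W"
  proof -
    have "C $$ (a,a) = row S a \<bullet> row S a" if "a < r" for a using that d by (simp add: C_def)
    thus "0 \<le> mtrace C" unfolding mtrace_def by (auto intro!: sum_nonneg sprod_self_nonneg simp: C_def d)
    have "W $$ (a,a) = col R a \<bullet> col R a" if "a < k" for a using that d by (simp add: W_def)
    thus "0 \<le> mtrace W" unfolding mtrace_def by (auto intro!: sum_nonneg sprod_self_nonneg simp: W_def d)
  qed
  have F0: "0 \<le> F y" for y by (simp add: F_def s4_norm_nonneg)
  have E0: "0 \<le> expectation F" using F0 by simp
  have "(expectation F) ^ 4 \<le> expectation (\<lambda>y. F y ^ 4)"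
    using jensens_inequality[OF conc(1), of UNIV 0 0 "\<lambda>x. x ^ 4"] i4 convex_power_even[of 4] by simp
  also have "\<dots> \<le> (fro_norm C * mtrace W + mtrace C * fro_norm W + fro_norm C * fro_norm W)\<^sup>2"
  proof -
    have "x\<^sup>2 + y\<^sup>2 + z\<^sup>2 \<le> (x + y + z)\<^sup>2" if "0 \<le> x" "0 \<le> y" "0 \<le> z" for x y z :: real
      using that by (simp add: power2_eq_square algebra_simps)
    from this[of "fro_norm C * mtrace W" "mtrace C * fro_norm W" "fro_norm C * fro_norm W"]
    show ?thesis unfolding e4 using tr by (simp add: power_mult_distrib fro_norm_nonneg)
  qed
  also have "\<dots> \<le> (b\<^sup>2)\<^sup>2" by (rule power_mono[OF b(1)]) (intro add_nonneg_nonneg mult_nonneg_nonneg tr fro_norm_nonneg)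
  finally have "(expectation F) ^ 4 \<le> b ^ 4" by simp
  hence Eb: "expectation F \<le> b" using b(2) by (simp add: power_mono_iff E0)
  have "measure (gaussp J) {y \<in> space (gaussp J). b + sqrt (lam * tau) * u < F y}
      \<le> measure (gaussp J) {y \<in> space (gaussp J). expectation F + sqrt (lam * tau) * u < F y}"
    using Fm Eb by (intro finite_measure_mono) auto
  also have "\<dots> \<le> exp (- u\<^sup>2 / 2)" by (rule conc(2))
  finally show ?thesis .
qed

text \<open>For this right inverse the Gram matrix is the inverse Gram matrix of X, so every
  estimate for R becomes one for W.\<close>

lemma right_inverse_gram:
  fixes X :: "real mat"
  assumes X: "X \<in> carrier_mat k N" and nz: "det (X * X\<^sup>T) \<noteq> 0"
  defines "W \<equiv> minv (X * X\<^sup>T)" and "R \<equiv> X\<^sup>T * minv (X * X\<^sup>T)"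
  shows "R \<in> carrier_mat N k" "X * R = 1\<^sub>m k" "R\<^sup>T * R = W"
    "dim_vec v = k \<Longrightarrow> (R *\<^sub>v v) \<bullet> (R *\<^sub>v v) = v \<bullet> (W *\<^sub>v v)"
proof -
  have d: "dim_row X = k" "dim_col X = N" using X by auto
  have c: "X * X\<^sup>T \<in> carrier_mat k k" by (rule carrier_matI) (simp_all add: d)
  note Wi = minv[OF c, folded W_def]
  have Wd: "dim_row W = k" "dim_col W = k" using Wi(1) by auto
  have R: "R = X\<^sup>T * W" by (simp add: R_def W_def)
  have sym: "W\<^sup>T = W" unfolding W_def by (rule minv_symmetric[OF c _ nz]) (simp add: mtrans)
  show "R \<in> carrier_mat N k" unfolding R by (rule carrier_matI) (simp_all add: d Wd)
  have Rd: "dim_row R = N" "dim_col R = k" by (simp_all add: R d Wd)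
  show XR: "X * R = 1\<^sub>m k" unfolding R using Wi(2)[OF nz] by (simp add: massoc[symmetric] d Wd)
  have "R\<^sup>T * R = W * (X * R)" unfolding R by (simp add: mtrans sym massoc d Wd)
  thus RR: "R\<^sup>T * R = W" unfolding XR using Wi(1) by simp
  assume v: "dim_vec v = k"
  have "(R *\<^sub>v v) \<bullet> (R *\<^sub>v v) = ((R\<^sup>T)\<^sup>T *\<^sub>v v) \<bullet> (R *\<^sub>v v)" by simp
  also have "\<dots> = v \<bullet> (R\<^sup>T *\<^sub>v (R *\<^sub>v v))" by (rule sprod_trans) (simp_all add: Rd v)
  also have "\<dots> = v \<bullet> (W *\<^sub>v v)" unfolding RR[symmetric] by (simp add: vassoc Rd v)
  finally show "(R *\<^sub>v v) \<bullet> (R *\<^sub>v v) = v \<bullet> (W *\<^sub>v v)" .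
qed

text \<open>Each of the k columns is the image of a unit vector. The resulting sqrt k is what
  separates d3 from d2.\<close>

lemma fro_norm_le_spectral:
  assumes W: "W \<in> carrier_mat k k" and \<tau>: "0 \<le> \<tau>"
    and le: "\<And>y. dim_vec y = k \<Longrightarrow> (W *\<^sub>v y) \<bullet> (W *\<^sub>v y) \<le> \<tau>\<^sup>2 * (y \<bullet> y)"
  shows "fro_norm W \<le> sqrt (real k) * \<tau>"
proof (rule power2_le_imp_le)
  have "fip W W = (\<Sum>j<k. col W j \<bullet> col W j)" using fip_columns[of W] W by simp
  also have "\<dots> \<le> (\<Sum>j<k. \<tau>\<^sup>2)"
  proof (intro sum_mono)
    fix j assume "j \<in> {..<k}"
    hence j: "j < k" by simp
    have "W *\<^sub>v unit_vec k j = col W j" by (rule eq_vecI) (use W j in auto)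
    thus "col W j \<bullet> col W j \<le> \<tau>\<^sup>2" using le[of "unit_vec k j"] j by simp
  qed
  finally show "(fro_norm W)\<^sup>2 \<le> (sqrt (real k) * \<tau>)\<^sup>2" by (simp add: fro_norm_square power_mult_distrib)
qed (use \<tau> in simp)

section \<open>Passage to the given covariance\<close>

lemma congruence_index:
  fixes A B K :: "real mat"
  assumes "dim_row A = n" "dim_row B = n" "K \<in> carrier_mat n n" "i < dim_col A" "j < dim_col B"
  shows "(A\<^sup>T * K * B) $$ (i,j) = col A i \<bullet> (K *\<^sub>v col B j)"
proof -
  have d: "dim_row K = n" "dim_col K = n" using assms(3) by auto
  have "(A\<^sup>T * K * B) $$ (i,j) = (A\<^sup>T * (K * B)) $$ (i,j)" using assms d by (simp add: massoc)
  also have "\<dots> = col A i \<bullet> col (K * B) j" using assms d by simp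
  also have "col (K * B) j = K *\<^sub>v col B j"
    using assms d by (intro col_mult2[of _ n n _ "dim_col B"]) (auto intro: carrier_matI)
  finally show ?thesis .
qed

lemma U_dims: "dim_row (U1 n k U) = n" "dim_col (U1 n k U) = k" "dim_row (U2 n k U) = n" "dim_col (U2 n k U) = n - k"
  by (simp_all add: U1_def U2_def)

lemma U_cols:
  assumes "orthogonal_real_mat n U" "k \<le> n"
  shows "i < k \<Longrightarrow> col (U1 n k U) i = col U i" "i < n - k \<Longrightarrow> col (U2 n k U) i = col U (k + i)"
  using orthogonal_dims[OF assms(1)] assms(2) by (auto simp: U1_def U2_def intro!: eq_vecI)

lemma Kt_dims:
  "Kt11 n k U K \<in> carrier_mat k k" "Kt21 n k U K \<in> carrier_mat (n - k) k" "Kt22 n k U K \<in> carrier_mat (n - k) (n - k)"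
  by (auto simp: Kt11_def Kt21_def Kt22_def U_dims intro!: carrier_matI)

text \<open>Writing \<open>K = Q * Q\<^sup>T\<close>, the form of the Schur complement at w is the squared distance of
  \<open>Q\<^sup>T * U2 * w\<close> from the range of \<open>Q\<^sup>T * U1\<close>.\<close>
lemma schur_complement:
  assumes U: "orthogonal_real_mat n U" and K: "sym_psd n K" and inv: "invertible_mat (Kt11 n k U K)"
  shows "(Kt11 n k U K)\<^sup>T = Kt11 n k U K" "det (Kt11 n k U K) \<noteq> 0" "mat_inv (Kt11 n k U K) = minv (Kt11 n k U K)"
    "dim_vec v = k \<Longrightarrow> 0 \<le> v \<bullet> (Kt11 n k U K *\<^sub>v v)"
    "Kt22_1 n k U K \<in> carrier_mat (n - k) (n - k)" "(Kt22_1 n k U K)\<^sup>T = Kt22_1 n k U K"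
    "dim_vec w = n - k \<Longrightarrow> 0 \<le> w \<bullet> (Kt22_1 n k U K *\<^sub>v w)"
proof -
  have Kc: "K \<in> carrier_mat n n" "K\<^sup>T = K" "\<And>v. dim_vec v = n \<Longrightarrow> 0 \<le> v \<bullet> (K *\<^sub>v v)"
    using K by (auto simp: sym_psd_def intro: carrier_vecI)
  obtain Q where Q: "Q \<in> carrier_mat n n" "K = Q * Q\<^sup>T" using psd_factor[OF Kc] by blast
  have Qd: "dim_row Q = n" "dim_col Q = n" using Q by auto
  define P where "P = (U1 n k U)\<^sup>T * Q"
  define P' where "P' = (U2 n k U)\<^sup>T * Q"
  have Pd: "dim_row P = k" "dim_col P = n" "dim_row P' = n - k" "dim_col P' = n"
    by (simp_all add: P_def P'_def U_dims Qd)
  have Pc: "P \<in> carrier_mat k n" by (rule carrier_matI) (simp_all add: Pd)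
  have K11: "Kt11 n k U K = P * P\<^sup>T" and K21: "Kt21 n k U K = P' * P\<^sup>T" and K22: "Kt22 n k U K = P' * P'\<^sup>T"
    unfolding Kt11_def Kt21_def Kt22_def Q(2) P_def P'_def by (simp_all add: mtrans massoc U_dims Qd)
  show sym: "(Kt11 n k U K)\<^sup>T = Kt11 n k U K" unfolding K11 by (simp add: mtrans)
  note mi = mat_inv_eq_minv[OF Kt_dims(1) inv]
  show nz: "det (Kt11 n k U K) \<noteq> 0" and mi': "mat_inv (Kt11 n k U K) = minv (Kt11 n k U K)" by (rule mi)+
  show "0 \<le> v \<bullet> (Kt11 n k U K *\<^sub>v v)" if "dim_vec v = k"
  proof -
    have "v \<bullet> (Kt11 n k U K *\<^sub>v v) = (P\<^sup>T *\<^sub>v v) \<bullet> (P\<^sup>T *\<^sub>v v)"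
      unfolding K11 using that by (simp add: sprod_trans vassoc Pd)
    thus ?thesis by (simp only: sprod_self_nonneg)
  qed
  define W where "W = minv (P * P\<^sup>T)"
  define R where "R = P\<^sup>T * W"
  have nz': "det (P * P\<^sup>T) \<noteq> 0" unfolding K11[symmetric] by (rule nz)
  note RI = right_inverse_gram[OF Pc nz', folded W_def, folded R_def]
  have Rd: "dim_row R = n" "dim_col R = k" using RI(1) by auto
  have Wc: "W \<in> carrier_mat k k" unfolding W_def K11[symmetric] by (rule minv(1)[OF Kt_dims(1)])
  have Wd: "dim_row W = k" "dim_col W = k" using Wc by auto
  have WT: "W\<^sup>T = W" unfolding W_def K11[symmetric] by (rule minv_symmetric[OF Kt_dims(1) sym nz])
  have M: "Kt21 n k U K * mat_inv (Kt11 n k U K) * (Kt21 n k U K)\<^sup>T = P' * (R * (P * P'\<^sup>T))"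
    unfolding mi' unfolding K11 K21 W_def[symmetric] R_def by (simp add: mtrans massoc Pd Wd)
  have S: "Kt22_1 n k U K = P' * P'\<^sup>T - P' * (R * (P * P'\<^sup>T))" unfolding Kt22_1_def M K22 ..
  have c: "P' * P'\<^sup>T \<in> carrier_mat (n - k) (n - k)" "P' * (R * (P * P'\<^sup>T)) \<in> carrier_mat (n - k) (n - k)"
    by (auto intro!: carrier_matI simp: Pd Rd)
  show "Kt22_1 n k U K \<in> carrier_mat (n - k) (n - k)" unfolding S by (rule minus_carrier_mat[OF c(2)])
  show "(Kt22_1 n k U K)\<^sup>T = Kt22_1 n k U K"
    unfolding S transpose_minus[OF c] unfolding R_def by (simp add: mtrans massoc Pd Wd WT)
  show "0 \<le> w \<bullet> (Kt22_1 n k U K *\<^sub>v w)" if w: "dim_vec w = n - k"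
  proof -
    \<comment> \<open>The vector \<open>R *\<^sub>v b\<close> is the orthogonal projection of a onto
      the range of \<open>P\<^sup>T\<close>, and s is its squared length. The Schur form is
      therefore \<open>a \<bullet> a - s\<close>.\<close>
    define a where "a = P'\<^sup>T *\<^sub>v w"
    define b where "b = P *\<^sub>v a"
    have ad: "dim_vec a = n" "dim_vec b = k" by (simp_all add: a_def b_def Pd)
    define s where "s = b \<bullet> (W *\<^sub>v b)"
    have xx: "(R *\<^sub>v b) \<bullet> (R *\<^sub>v b) = s" unfolding s_def by (rule RI(4)[OF ad(2)])
    have ax: "a \<bullet> (R *\<^sub>v b) = s"
    proof -
      have "a \<bullet> (R *\<^sub>v b) = (P\<^sup>T *\<^sub>v (W *\<^sub>v b)) \<bullet> a"
        unfolding R_def by (subst sprod_comm) (simp_all add: ad Pd vassoc Wd)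
      also have "\<dots> = (W *\<^sub>v b) \<bullet> b" unfolding b_def by (rule sprod_trans) (simp_all add: ad Pd Wd)
      also have "\<dots> = s" unfolding s_def by (rule sprod_comm) (simp add: ad Wd)
      finally show ?thesis .
    qed
    have s0: "0 \<le> s" unfolding xx[symmetric] by (rule sprod_self_nonneg)
    have "s\<^sup>2 \<le> (a \<bullet> a) * s" using sprod_cauchy_schwarz[of a "R *\<^sub>v b"] unfolding xx ax by (simp add: ad Rd)
    hence sa: "s \<le> a \<bullet> a" by (rule square_le_imp_le[OF _ s0 sprod_self_nonneg])
    have wc: "w \<in> carrier_vec (n - k)" by (rule carrier_vecI[OF w])
    have 1: "w \<bullet> ((P' * P'\<^sup>T) *\<^sub>v w) = a \<bullet> a" unfolding a_def using w by (simp add: sprod_trans vassoc Pd)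
    have 2: "w \<bullet> ((P' * (R * (P * P'\<^sup>T))) *\<^sub>v w) = s"
    proof -
      have "w \<bullet> ((P' * (R * (P * P'\<^sup>T))) *\<^sub>v w) = w \<bullet> (P' *\<^sub>v (R *\<^sub>v b))"
        unfolding a_def b_def using w by (simp add: vassoc Pd Rd)
      moreover have "(P'\<^sup>T *\<^sub>v w) \<bullet> (R *\<^sub>v b) = w \<bullet> (P' *\<^sub>v (R *\<^sub>v b))"
        by (rule sprod_trans) (simp_all add: w Pd Rd)
      ultimately show ?thesis unfolding ax[symmetric] a_def[symmetric] by (simp only:)
    qed
    have cv: "(P' * P'\<^sup>T) *\<^sub>v w \<in> carrier_vec (n - k)" "(P' * (R * (P * P'\<^sup>T))) *\<^sub>v w \<in> carrier_vec (n - k)"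
      by (rule mult_mat_vec_carrier[OF c(1) wc] mult_mat_vec_carrier[OF c(2) wc])+
    have "w \<bullet> (Kt22_1 n k U K *\<^sub>v w) = a \<bullet> a - s"
      unfolding S minus_mult_distrib_mat_vec[OF c wc] scalar_prod_minus_distrib[OF wc cv] 1 2 ..
    thus ?thesis using sa by simp
  qed
qed

text \<open>For any factor L of \<open>Kt11\<close>, symmetric or not, the squared length of
  \<open>minv L *\<^sub>v y\<close> is the form of the inverse of \<open>Kt11\<close> at y. This is
  how the spectral norm of that inverse becomes the constant \<open>\<kappa>\<close>.\<close>

lemma minv_gram:
  fixes L :: "real mat"
  assumes L: "L \<in> carrier_mat k k" and nz: "det (L * L\<^sup>T) \<noteq> 0"
  shows "det L \<noteq> 0" "dim_vec y = k \<Longrightarrow> (minv L *\<^sub>v y) \<bullet> (minv L *\<^sub>v y) = y \<bullet> (minv (L * L\<^sup>T) *\<^sub>v y)"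
proof -
  have d: "dim_row L = k" "dim_col L = k" using L by auto
  have LTc: "L\<^sup>T \<in> carrier_mat k k" and c: "L * L\<^sup>T \<in> carrier_mat k k" by (auto intro!: carrier_matI simp: d)
  show Lnz: "det L \<noteq> 0" using nz det_mult[OF L LTc] by auto
  note Li = minv[OF L]
  have md: "dim_row (minv L) = k" "dim_col (minv L) = k" using Li(1) by auto
  have "(minv L)\<^sup>T * minv L = minv (L * L\<^sup>T)"
  proof (rule inverse_unique[OF c _ minv(1)[OF c] _ minv(2)[OF c nz]])
    show "(minv L)\<^sup>T * minv L \<in> carrier_mat k k" by (rule carrier_matI) (simp_all add: md)
    have "(minv L)\<^sup>T * minv L * (L * L\<^sup>T) = (minv L)\<^sup>T * ((minv L * L) * L\<^sup>T)" by (simp add: massoc d md)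
    also have "\<dots> = (L * minv L)\<^sup>T" unfolding Li(3)[OF Lnz] by (simp add: mtrans d md)
    finally show "(minv L)\<^sup>T * minv L * (L * L\<^sup>T) = 1\<^sub>m k" unfolding Li(2)[OF Lnz] by simp
  qed
  hence e: "minv (L * L\<^sup>T) = (minv L)\<^sup>T * minv L" ..
  assume y: "dim_vec y = k"
  have "(minv L *\<^sub>v y) \<bullet> (minv L *\<^sub>v y) = (((minv L)\<^sup>T)\<^sup>T *\<^sub>v y) \<bullet> (minv L *\<^sub>v y)" by simp
  also have "\<dots> = y \<bullet> ((minv L)\<^sup>T *\<^sub>v (minv L *\<^sub>v y))" by (rule sprod_trans) (simp_all add: md y)
  also have "\<dots> = y \<bullet> (minv (L * L\<^sup>T) *\<^sub>v y)" unfolding e by (simp add: vassoc md y)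
  finally show "(minv L *\<^sub>v y) \<bullet> (minv L *\<^sub>v y) = y \<bullet> (minv (L * L\<^sup>T) *\<^sub>v y)" .
qed

text \<open>Gaussian regression in matrix form: the lower block is B times the upper one plus an
  independent part whose covariance is the Schur complement. L1 and L2 may be any factors of
  \<open>Kt11\<close> and \<open>Kt22_1\<close>.\<close>

definition block_factor :: "nat \<Rightarrow> nat \<Rightarrow> real mat \<Rightarrow> real mat \<Rightarrow> real mat \<Rightarrow> real mat" where
  "block_factor n k L1 B L2 = four_block_mat L1 (0\<^sub>m k (n - k)) (B * L1) L2"

lemma block_factor_carrier:
  assumes "L1 \<in> carrier_mat k k" "L2 \<in> carrier_mat (n - k) (n - k)" "k \<le> n"
  shows "block_factor n k L1 B L2 \<in> carrier_mat n n"
  unfolding block_factor_def using four_block_carrier_mat[OF assms(1,2)] assms(3) by simp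

text \<open>A block Cholesky identity: in the lower right corner the regression term and the Schur
  complement add up to \<open>Kt22\<close>.\<close>

lemma block_factor_gram:
  assumes U: "orthogonal_real_mat n U" and K: "sym_psd n K" and inv: "invertible_mat (Kt11 n k U K)" and kn: "k \<le> n"
    and L1: "L1 \<in> carrier_mat k k" "Kt11 n k U K = L1 * L1\<^sup>T"
    and L2: "L2 \<in> carrier_mat (n - k) (n - k)" "Kt22_1 n k U K = L2 * L2\<^sup>T"
  defines "Lf \<equiv> block_factor n k L1 (Kt21 n k U K * minv (Kt11 n k U K)) L2"
  shows "Lf * Lf\<^sup>T = U\<^sup>T * K * U"
proof -
  note S = schur_complement[OF U K inv]
  let ?r = "n - k" and ?K11 = "Kt11 n k U K" and ?K21 = "Kt21 n k U K" and ?K22 = "Kt22 n k U K"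
  define W where "W = minv ?K11"
  define B where "B = ?K21 * W"
  have Kd: "dim_row ?K11 = k" "dim_col ?K11 = k" "dim_row ?K21 = ?r" "dim_col ?K21 = k" "dim_row ?K22 = ?r" "dim_col ?K22 = ?r"
    using Kt_dims[of n k U K] by auto
  have Wi: "W \<in> carrier_mat k k" "?K11 * W = 1\<^sub>m k" "W * ?K11 = 1\<^sub>m k"
    unfolding W_def by (rule minv[OF Kt_dims(1)] minv(2,3)[OF Kt_dims(1) S(2)])+
  have Wd: "dim_row W = k" "dim_col W = k" using Wi(1) by auto
  have WT: "W\<^sup>T = W" unfolding W_def by (rule minv_symmetric[OF Kt_dims(1) S(1,2)])
  have Ld: "dim_row L1 = k" "dim_col L1 = k" "dim_row L2 = ?r" "dim_col L2 = ?r" using L1 L2 by auto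
  have Bd: "dim_row B = ?r" "dim_col B = k" by (simp_all add: B_def Kd Wd)
  have Kc: "K \<in> carrier_mat n n" and KT: "K\<^sup>T = K" using K by (auto simp: sym_psd_def)
  have Kdd: "dim_row K = n" "dim_col K = n" using Kc by auto
  have BL: "B * L1 \<in> carrier_mat ?r k" by (rule carrier_matI) (simp_all add: Bd Ld)
  have z: "0\<^sub>m k ?r \<in> carrier_mat k ?r" by simp
  have cT: "L1\<^sup>T \<in> carrier_mat k k" "(B * L1)\<^sup>T \<in> carrier_mat k ?r" "(0\<^sub>m k ?r)\<^sup>T \<in> carrier_mat ?r k" "L2\<^sup>T \<in> carrier_mat ?r ?r"
    using L1 L2 BL by auto
  have e11: "L1 * L1\<^sup>T + 0\<^sub>m k ?r * (0\<^sub>m k ?r)\<^sup>T = ?K11" unfolding L1(2)[symmetric]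
    by (simp add: right_add_zero_mat[OF Kt_dims(1)])
  have B11: "B * ?K11 = ?K21" unfolding B_def using Wi(3) by (simp add: massoc Kd Wd)
  have e21: "(B * L1) * L1\<^sup>T + L2 * (0\<^sub>m k ?r)\<^sup>T = ?K21"
  proof -
    have "(B * L1) * L1\<^sup>T = B * ?K11" unfolding L1(2) by (simp add: massoc Bd Ld)
    thus ?thesis unfolding B11 using Kt_dims(2)[of n k U K] L2(1) by simp
  qed
  have e12: "L1 * (B * L1)\<^sup>T + 0\<^sub>m k ?r * L2\<^sup>T = ?K21\<^sup>T"
  proof -
    have "L1 * (B * L1)\<^sup>T = ((B * L1) * L1\<^sup>T)\<^sup>T" by (simp add: mtrans Bd Ld massoc)
    also have "\<dots> = (B * ?K11)\<^sup>T" unfolding L1(2) by (simp add: massoc Bd Ld)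
    finally show ?thesis unfolding B11 using Kt_dims(2)[of n k U K] cT(4) by simp
  qed
  have e22: "(B * L1) * (B * L1)\<^sup>T + L2 * L2\<^sup>T = ?K22"
  proof -
    have "(B * L1) * (B * L1)\<^sup>T = B * (L1 * L1\<^sup>T) * B\<^sup>T" by (simp add: mtrans massoc Bd Ld)
    also have "\<dots> = ?K21 * B\<^sup>T" unfolding L1(2)[symmetric] B11 ..
    also have "\<dots> = ?K21 * W * ?K21\<^sup>T" unfolding B_def by (simp add: mtrans massoc Kd Wd WT)
    finally have a: "(B * L1) * (B * L1)\<^sup>T = ?K21 * W * ?K21\<^sup>T" .
    have c: "?K21 * W * ?K21\<^sup>T \<in> carrier_mat ?r ?r" by (rule carrier_matI) (simp_all add: Kd)
    show ?thesis unfolding a L2(2)[symmetric] Kt22_1_def S(3) W_def[symmetric]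
      by (rule eq_matI) (use c Kt_dims(3)[of n k U K] in auto)
  qed
  have LLT: "Lf * Lf\<^sup>T = four_block_mat ?K11 (?K21\<^sup>T) ?K21 ?K22"
    unfolding Lf_def block_factor_def W_def[symmetric] B_def[symmetric]
      transpose_four_block_mat[OF L1(1) z BL L2(1)]
      mult_four_block_mat[OF L1(1) z BL L2(1) cT(1,2,3,4)] e11 e12 e21 e22 ..
  note Ud = orthogonal_dims[OF U]
  have Uc: "dim_vec (col U i) = n" for i by (simp add: Ud)
  have sw: "col U i \<bullet> (K *\<^sub>v col U j) = col U j \<bullet> (K *\<^sub>v col U i)" if "i < n" "j < n" for i j
  proof -
    have "col U i \<bullet> (K *\<^sub>v col U j) = (K\<^sup>T *\<^sub>v col U i) \<bullet> col U j" by (rule sprod_trans[symmetric]) (simp_all add: Kdd Ud)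
    thus ?thesis unfolding KT by (simp add: sprod_comm[of "K *\<^sub>v col U i"] Kdd Ud)
  qed
  have kdd: "k + (n - k) = n" using kn by simp
  show ?thesis unfolding LLT
  proof (rule eq_matI)
    show "dim_row (four_block_mat ?K11 (?K21\<^sup>T) ?K21 ?K22) = dim_row (U\<^sup>T * K * U)"
      "dim_col (four_block_mat ?K11 (?K21\<^sup>T) ?K21 ?K22) = dim_col (U\<^sup>T * K * U)"
      using kn by (simp_all add: Kd Ud)
    fix i j assume "i < dim_row (U\<^sup>T * K * U)" "j < dim_col (U\<^sup>T * K * U)"
    hence ij: "i < n" "j < n" by (simp_all add: Ud)
    have rhs: "(U\<^sup>T * K * U) $$ (i,j) = col U i \<bullet> (K *\<^sub>v col U j)"
      by (rule congruence_index[of _ n]) (simp_all add: Ud Kc ij)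
    have i11: "?K11 $$ (i,j) = col U i \<bullet> (K *\<^sub>v col U j)" if "i < k" "j < k" for i j
      unfolding Kt11_def using that kn by (subst congruence_index[of _ n]) (simp_all add: U_dims Kc U_cols[OF U kn])
    have i21: "?K21 $$ (i,j) = col U (k + i) \<bullet> (K *\<^sub>v col U j)" if "i < ?r" "j < k" for i j
      unfolding Kt21_def using that kn by (subst congruence_index[of _ n]) (simp_all add: U_dims Kc U_cols[OF U kn])
    have i22: "?K22 $$ (i,j) = col U (k + i) \<bullet> (K *\<^sub>v col U (k + j))" if "i < ?r" "j < ?r" for i j
      unfolding Kt22_def using that kn by (subst congruence_index[of _ n]) (simp_all add: U_dims Kc U_cols[OF U kn])
    have ix: "four_block_mat ?K11 (?K21\<^sup>T) ?K21 ?K22 $$ (i,j) =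
       (if i < k then if j < k then ?K11 $$ (i,j) else ?K21\<^sup>T $$ (i, j - k)
        else if j < k then ?K21 $$ (i - k, j) else ?K22 $$ (i - k, j - k))"
      using ij kn by (subst index_mat_four_block) (simp_all add: Kd)
    consider "i < k" "j < k" | "i < k" "k \<le> j" | "k \<le> i" "j < k" | "k \<le> i" "k \<le> j" by linarith
    thus "four_block_mat ?K11 (?K21\<^sup>T) ?K21 ?K22 $$ (i,j) = (U\<^sup>T * K * U) $$ (i,j)"
    proof cases
      case 1 thus ?thesis unfolding ix rhs by (simp add: i11)
    next
      case 2
      hence "?K21\<^sup>T $$ (i, j - k) = ?K21 $$ (j - k, i)" using ij by (simp add: Kd)
      also have "\<dots> = col U j \<bullet> (K *\<^sub>v col U i)" using 2 ij i21[of "j - k" i] by simp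
      also have "\<dots> = col U i \<bullet> (K *\<^sub>v col U j)" by (rule sw[OF ij(2,1)])
      finally show ?thesis unfolding ix rhs using 2 by simp
    next
      case 3 thus ?thesis unfolding ix rhs using ij i21[of "i - k" j] by simp
    next
      case 4 thus ?thesis unfolding ix rhs using ij i22[of "i - k" "j - k"] by simp
    qed
  qed
qed

text \<open>The same matrix \<open>L1 * gmat k N x\<close> occurs in both blocks. Its right inverse
  will therefore turn the regression term of the lower block into the constant B.\<close>

lemma block_factor_action:
  assumes L1: "L1 \<in> carrier_mat k k" and L2: "L2 \<in> carrier_mat (n - k) (n - k)" and B: "B \<in> carrier_mat (n - k) k" and kn: "k \<le> n"
  defines "Lf \<equiv> block_factor n k L1 B L2"
  shows "gmat k N (lact n N Lf x) = L1 * gmat k N x"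
    and "lowmat k (n - k) N (lact n N Lf x) = B * (L1 * gmat k N x) + L2 * lowmat k (n - k) N x"
proof -
  let ?r = "n - k"
  have Lc: "Lf \<in> carrier_mat n n" unfolding Lf_def by (rule block_factor_carrier[OF L1 L2 kn])
  have Ld: "dim_row L1 = k" "dim_col L1 = k" "dim_row L2 = ?r" "dim_col L2 = ?r" "dim_row B = ?r" "dim_col B = k"
    using L1 L2 B by auto
  have act: "lact n N Lf x (i,j) = (\<Sum>l<k. Lf $$ (i,l) * x (l,j)) + (\<Sum>l<?r. Lf $$ (i,k + l) * x (k + l,j))" if "i < n" "j < N" for i j
  proof -
    have "lact n N Lf x (i,j) = gmat n N (lact n N Lf x) $$ (i,j)" using that by (simp add: gmat_index)
    also have "\<dots> = (\<Sum>l<n. Lf $$ (i,l) * x (l,j))" unfolding gmat_lact[OF Lc]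
      using that Lc by (subst mult_mat_index) (auto simp: gmat_dims gmat_index)
    finally show ?thesis unfolding sum_split_index[OF kn] .
  qed
  have ix: "Lf $$ (i,j) = (if i < k then if j < k then L1 $$ (i,j) else 0 else if j < k then (B * L1) $$ (i - k, j) else L2 $$ (i - k, j - k))"
    if "i < n" "j < n" for i j
    unfolding Lf_def block_factor_def using that kn by (subst index_mat_four_block) (auto simp: Ld)
  show "gmat k N (lact n N Lf x) = L1 * gmat k N x"
  proof (rule eq_matI)
    fix i j assume "i < dim_row (L1 * gmat k N x)" "j < dim_col (L1 * gmat k N x)"
    hence ij: "i < k" "j < N" by (simp_all add: Ld gmat_dims)
    have "gmat k N (lact n N Lf x) $$ (i,j) = (\<Sum>l<k. L1 $$ (i,l) * x (l,j))"
      using ij kn by (simp add: gmat_index act ix)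
    also have "\<dots> = (L1 * gmat k N x) $$ (i,j)" using ij by (subst mult_mat_index) (auto simp: Ld gmat_dims gmat_index)
    finally show "gmat k N (lact n N Lf x) $$ (i,j) = (L1 * gmat k N x) $$ (i,j)" .
  qed (simp_all add: gmat_dims Ld)
  show "lowmat k ?r N (lact n N Lf x) = B * (L1 * gmat k N x) + L2 * lowmat k ?r N x"
  proof (rule eq_matI)
    fix i j assume "i < dim_row (B * (L1 * gmat k N x) + L2 * lowmat k ?r N x)" "j < dim_col (B * (L1 * gmat k N x) + L2 * lowmat k ?r N x)"
    hence ij: "i < ?r" "j < N" by (simp_all add: Ld lowmat_dims)
    have "lowmat k ?r N (lact n N Lf x) $$ (i,j) = (\<Sum>l<k. (B * L1) $$ (i,l) * x (l,j)) + (\<Sum>l<?r. L2 $$ (i,l) * x (k + l,j))"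
      using ij kn by (simp add: lowmat_index act ix del: index_mult_mat(1))
    also have "(\<Sum>l<k. (B * L1) $$ (i,l) * x (l,j)) = ((B * L1) * gmat k N x) $$ (i,j)"
      using ij by (subst mult_mat_index[of i "B * L1"]) (auto simp: Ld gmat_dims gmat_index simp del: index_mult_mat(1))
    also have "(B * L1) * gmat k N x = B * (L1 * gmat k N x)" by (simp add: massoc Ld gmat_dims)
    also have "(\<Sum>l<?r. L2 $$ (i,l) * x (k + l,j)) = (L2 * lowmat k ?r N x) $$ (i,j)"
      using ij by (subst mult_mat_index) (auto simp: Ld lowmat_dims lowmat_index)
    also have "(B * (L1 * gmat k N x)) $$ (i,j) + (L2 * lowmat k ?r N x) $$ (i,j) = (B * (L1 * gmat k N x) + L2 * lowmat k ?r N x) $$ (i,j)"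
      using ij by (subst index_add_mat) (simp_all add: Ld lowmat_dims)
    finally show "lowmat k ?r N (lact n N Lf x) $$ (i,j) = (B * (L1 * gmat k N x) + L2 * lowmat k ?r N x) $$ (i,j)" .
  qed (simp_all add: lowmat_dims Ld)
qed

section \<open>The law of the rotated sample\<close>

lemma measurable_iid_entries:
  assumes M: "prob_space M" and Om: "iid_gaussian_cols M n m K \<Omega>" and ij: "i < n" "j < m"
  shows "(\<lambda>\<omega>. \<Omega> \<omega> $$ (i,j)) \<in> borel_measurable M"
proof -
  interpret prob_space M by (rule M)
  have "(\<lambda>\<omega>. \<lambda>i\<in>{..<n}. \<Omega> \<omega> $$ (i,j)) \<in> measurable M (PiM {..<n} (\<lambda>_. borel))"
    using Om ij unfolding iid_gaussian_cols_def indep_vars_def by auto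
  from measurable_compose[OF this measurable_component_singleton[of i]] show ?thesis using ij by simp
qed

text \<open>Both laws have the same characteristic function: rotating the test vectors by U turns
  the form of K into the form of \<open>U\<^sup>T * K * U\<close>, and only a factor of the latter
  enters the model.\<close>

lemma distr_rotated_sample:
  assumes M: "prob_space M" and Om: "iid_gaussian_cols M n N K \<Omega>" and K: "sym_psd n K" and U: "orthogonal_real_mat n U"
    and L: "L \<in> carrier_mat n n" "L * L\<^sup>T = U\<^sup>T * K * U"
  defines "I \<equiv> {..<n} \<times> {..<N}"
  defines "Y \<equiv> \<lambda>\<omega>. \<lambda>z\<in>I. (U\<^sup>T * \<Omega> \<omega>) $$ z"
  shows "Y \<in> measurable M (PiM I (\<lambda>_. borel))"
    and "distr M (PiM I (\<lambda>_. borel)) Y = distr (gaussp I) (PiM I (\<lambda>_. borel)) (lact n N L)"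
proof -
  note Ud = orthogonal_dims[OF U]
  have Kd: "dim_row K = n" "dim_col K = n" using K by (auto simp: sym_psd_def)
  have Od: "dim_row (\<Omega> \<omega>) = n" "dim_col (\<Omega> \<omega>) = N" if "\<omega> \<in> space M" for \<omega>
    using Om that by (auto simp: iid_gaussian_cols_def)
  have Ye: "(U\<^sup>T * \<Omega> \<omega>) $$ (i,j) = (\<Sum>l<n. U $$ (l,i) * \<Omega> \<omega> $$ (l,j))" if "i < n" "j < N" "\<omega> \<in> space M" for i j \<omega>
    using that Od[OF that(3)] by (subst mult_mat_index) (auto simp: Ud)
  have "(\<lambda>\<omega>. (U\<^sup>T * \<Omega> \<omega>) $$ z) \<in> borel_measurable M" if "z \<in> I" for z
  proof -
    obtain i j where zij: "z = (i,j)" by (cases z)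
    hence z: "z = (i,j)" "i < n" "j < N" using that by (auto simp: I_def)
    have "(\<lambda>\<omega>. \<Sum>l<n. U $$ (l,i) * \<Omega> \<omega> $$ (l,j)) \<in> borel_measurable M"
      by (intro borel_measurable_sum borel_measurable_times borel_measurable_const measurable_iid_entries[OF M Om])
         (use z(2,3) in auto)
    moreover have "(\<lambda>\<omega>. (U\<^sup>T * \<Omega> \<omega>) $$ (i,j)) \<in> borel_measurable M \<longleftrightarrow> (\<lambda>\<omega>. \<Sum>l<n. U $$ (l,i) * \<Omega> \<omega> $$ (l,j)) \<in> borel_measurable M"
      by (rule measurable_cong) (rule Ye[OF z(2,3)])
    ultimately show ?thesis unfolding z(1) by (simp only:)
  qed
  thus Ym: "Y \<in> measurable M (PiM I (\<lambda>_. borel))" unfolding Y_def by (intro measurable_restrict)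
  define w where "w = (\<lambda>v :: nat \<times> nat \<Rightarrow> real. \<lambda>j. Matrix.vec n (\<lambda>i. v (i,j)))"
  have char: "(CLINT \<omega>|M. iexp (\<Sum>z\<in>I. v z * Y \<omega> z)) =
      exp (- complex_of_real ((\<Sum>z'\<in>I. (\<Sum>z\<in>I. v z * (if snd z = snd z' then L $$ (fst z, fst z') else 0))\<^sup>2) / 2))" for v
  proof -
    define V where "V = (\<lambda>j. U *\<^sub>v w v j)"
    have Vc: "V j \<in> carrier_vec n" for j unfolding V_def by (rule carrier_vecI) (simp add: Ud)
    have wd: "dim_vec (w v j) = n" for j by (simp add: w_def)
    have lin: "(\<Sum>z\<in>I. v z * Y \<omega> z) = (\<Sum>j<N. V j \<bullet> col (\<Omega> \<omega>) j)" if \<omega>: "\<omega> \<in> space M" for \<omega>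
    proof -
      have "(\<Sum>z\<in>I. v z * Y \<omega> z) = (\<Sum>j<N. \<Sum>i<n. v (i,j) * (U\<^sup>T * \<Omega> \<omega>) $$ (i,j))"
        unfolding I_def sum_times by (subst sum.swap) (auto simp: Y_def I_def intro!: sum.cong simp del: index_mult_mat(1))
      also have "\<dots> = (\<Sum>j<N. w v j \<bullet> (U\<^sup>T *\<^sub>v col (\<Omega> \<omega>) j))"
      proof (intro sum.cong refl)
        fix j assume j: "j \<in> {..<N}"
        show "(\<Sum>i<n. v (i,j) * (U\<^sup>T * \<Omega> \<omega>) $$ (i,j)) = w v j \<bullet> (U\<^sup>T *\<^sub>v col (\<Omega> \<omega>) j)"
          unfolding sprod_index using j Od[OF \<omega>] by (auto simp: Ud w_def intro!: sum.cong)
      qed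
      also have "\<dots> = (\<Sum>j<N. V j \<bullet> col (\<Omega> \<omega>) j)"
      proof (intro sum.cong refl)
        fix j
        have "((U\<^sup>T)\<^sup>T *\<^sub>v w v j) \<bullet> col (\<Omega> \<omega>) j = w v j \<bullet> (U\<^sup>T *\<^sub>v col (\<Omega> \<omega>) j)"
          by (rule sprod_trans) (simp_all add: Ud wd Od[OF \<omega>])
        thus "w v j \<bullet> (U\<^sup>T *\<^sub>v col (\<Omega> \<omega>) j) = V j \<bullet> col (\<Omega> \<omega>) j" by (simp add: V_def)
      qed
      finally show ?thesis .
    qed
    have quad: "V j \<bullet> (K *\<^sub>v V j) = w v j \<bullet> ((L * L\<^sup>T) *\<^sub>v w v j)" for j
    proof -
      have "V j \<bullet> (K *\<^sub>v V j) = ((U\<^sup>T)\<^sup>T *\<^sub>v w v j) \<bullet> (K *\<^sub>v (U *\<^sub>v w v j))" by (simp add: V_def)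
      also have "\<dots> = w v j \<bullet> (U\<^sup>T *\<^sub>v (K *\<^sub>v (U *\<^sub>v w v j)))" by (rule sprod_trans) (simp_all add: Ud wd Kd)
      also have "\<dots> = w v j \<bullet> ((L * L\<^sup>T) *\<^sub>v w v j)" unfolding L(2) by (simp add: vassoc Ud Kd wd)
      finally show ?thesis .
    qed
    have "(CLINT \<omega>|M. iexp (\<Sum>z\<in>I. v z * Y \<omega> z)) = (CLINT \<omega>|M. iexp (\<Sum>j<N. V j \<bullet> col (\<Omega> \<omega>) j))"
      by (intro Bochner_Integration.integral_cong refl) (simp only: lin)
    also have "\<dots> = exp (- complex_of_real ((\<Sum>j<N. V j \<bullet> (K *\<^sub>v V j)) / 2))"
      by (rule char_iid_gaussian_cols[OF M Om K Vc])
    finally show ?thesis unfolding quad I_def lact_quadratic[OF L(1)] w_def .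
  qed
  have fI: "finite I" by (simp add: I_def)
  show "distr M (PiM I (\<lambda>_. borel)) Y = distr (gaussp I) (PiM I (\<lambda>_. borel)) (lact n N L)"
    using distr_linear_gaussp[OF M fI fI Ym char] unfolding lact_def I_def by simp
qed

section \<open>The error bound in the Gaussian model\<close>

lemma mmeas_add:
  assumes X: "mmeas M r c X" and Y: "mmeas M r c Y" shows "mmeas M r c (\<lambda>\<omega>. X \<omega> + Y \<omega>)"
  unfolding mmeas_def
  by (auto simp: mmeas_dims[OF X] mmeas_dims[OF Y] intro!: borel_measurable_add mmeas_entry[OF X] mmeas_entry[OF Y])

text \<open>The matrix F of \<open>nystrom_error_bound\<close>, for \<open>X = U1\<^sup>T * \<Omega>\<close> and \<open>Z = U2\<^sup>T * \<Omega>\<close>.\<close>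
definition coupling :: "real mat \<Rightarrow> real mat \<Rightarrow> real mat \<Rightarrow> real mat" where
  "coupling S X Z = S * (Z * (X\<^sup>T * minv (X * X\<^sup>T)))"

lemma mmeas_coupling:
  assumes S: "S \<in> carrier_mat r r" and X: "mmeas M k N X" and Z: "mmeas M r N Z"
  shows "mmeas M r k (\<lambda>\<omega>. coupling S (X \<omega>) (Z \<omega>))"
  unfolding coupling_def
  by (intro mmeas_mult[OF mmeas_const[OF S]] mmeas_mult[OF Z] mmeas_mult[OF mmeas_trans[OF X]] mmeas_minv
      mmeas_mult[OF X mmeas_trans[OF X]])

text \<open>R inverts X, so the regression part contributes exactly \<open>S * B\<close>, and what
  is left is \<open>(S * L) * (G * R)\<close>. The weights 4, 4 and 2 keep the deviation term
  cheaper than the other two.\<close>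

lemma coupling_bound:
  fixes S B L X G :: "real mat"
  assumes S: "S \<in> carrier_mat r r" and B: "B \<in> carrier_mat r k" and L: "L \<in> carrier_mat r r"
    and X: "X \<in> carrier_mat k N" and G: "G \<in> carrier_mat r N" and nz: "det (X * X\<^sup>T) \<noteq> 0"
    and bc: "0 \<le> b" "0 \<le> c" and le: "s4_norm ((S * L) * (G * (X\<^sup>T * minv (X * X\<^sup>T)))) \<le> b + c"
  defines "Y \<equiv> coupling S X (B * X + L * G)"
  shows "fro_norm (Y * Y\<^sup>T) \<le> 4 * fro_norm ((S * B) * (S * B)\<^sup>T) + 4 * b\<^sup>2 + 2 * c\<^sup>2"
proof -
  define R where "R = X\<^sup>T * minv (X * X\<^sup>T)"
  note RI = right_inverse_gram[OF X nz, folded R_def]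
  have d: "dim_row S = r" "dim_col S = r" "dim_row B = r" "dim_col B = k" "dim_row L = r" "dim_col L = r"
    "dim_row X = k" "dim_col X = N" "dim_row G = r" "dim_col G = N" "dim_row R = N" "dim_col R = k"
    using S B L X G RI(1) by auto
  have c1: "B * X \<in> carrier_mat r N" "L * G \<in> carrier_mat r N" "(B * X) * R \<in> carrier_mat r k" "(L * G) * R \<in> carrier_mat r k"
    by (auto intro!: carrier_matI simp: d)
  have BXR: "(B * X) * R = B" using RI(2) B by (simp add: massoc d)
  have "Y = S * ((B * X) * R + (L * G) * R)"
    unfolding Y_def coupling_def R_def[symmetric] add_mult_distrib_mat[OF c1(1,2) RI(1)] ..
  also have "\<dots> = S * ((B * X) * R) + S * ((L * G) * R)" by (rule mult_add_distrib_mat[OF S c1(3,4)])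
  also have "S * ((L * G) * R) = (S * L) * (G * R)" by (simp add: massoc d)
  finally have Y: "Y = S * B + (S * L) * (G * R)" unfolding BXR .
  let ?a = "s4_norm (S * B)"
  have "s4_norm Y \<le> ?a + s4_norm ((S * L) * (G * R))" unfolding Y by (rule s4_norm_triangle) (simp_all add: d)
  also have "\<dots> \<le> ?a + b + c" using le by (simp add: R_def)
  finally have "(s4_norm Y)\<^sup>2 \<le> (?a + b + c)\<^sup>2" by (intro power_mono s4_norm_nonneg)
  \<comment> \<open>The difference of the two sides is
    \<open>(?a + b - c)\<^sup>2 + 2 * (?a - b)\<^sup>2\<close>.\<close>
  also have "\<dots> \<le> 4 * ?a\<^sup>2 + 4 * b\<^sup>2 + 2 * c\<^sup>2"
  proof -
    have "0 \<le> (?a + b - c)\<^sup>2" "0 \<le> (?a - b)\<^sup>2" by simp_all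
    thus ?thesis by (simp add: power2_eq_square algebra_simps)
  qed
  finally show ?thesis unfolding s4_norm_square .
qed

text \<open>Conditionally on the first k rows, the lower rows fail with probability at most
  \<open>exp (- u\<^sup>2 / 2)\<close> off the exceptional set of \<open>Winv_good_event\<close>; on
  that set the trivial bound 1 is used. Integration over the first k rows adds the two
  probabilities.\<close>

lemma model_bad_event:
  fixes S B L1 L2 :: "real mat"
  assumes S: "S \<in> carrier_mat r r" and B: "B \<in> carrier_mat r k" and L1: "L1 \<in> carrier_mat k k" "det L1 \<noteq> 0" and L2: "L2 \<in> carrier_mat r r"
    and p: "4 \<le> p" and k: "0 < k" and t: "1 \<le> t" and u: "1 \<le> u"
    and \<kappa>0: "0 < \<kappa>" and \<kappa>: "\<And>y. dim_vec y = k \<Longrightarrow> (minv L1 *\<^sub>v y) \<bullet> (minv L1 *\<^sub>v y) \<le> \<kappa> * (y \<bullet> y)"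
  defines "N \<equiv> k + p"
  defines "C \<equiv> (S * L2) * (S * L2)\<^sup>T" and "d1 \<equiv> 3 * real k / (real p + 1)" and "d2 \<equiv> exp 2 * (real k + real p) / (real p + 1)\<^sup>2"
  defines "X \<equiv> \<lambda>x. L1 * gmat k N x"
  defines "Y \<equiv> \<lambda>x. coupling S (X x) (B * X x + L2 * lowmat k r N x)"
  assumes bd: "4 * fro_norm ((S * B) * (S * B)\<^sup>T)
      + 4 * (t\<^sup>2 * \<kappa> * ((d1 + sqrt (real k) * d2) * fro_norm C + sqrt (real k) * d2 * mtrace C)) + 2 * (t\<^sup>2 * u\<^sup>2 * d2 * \<kappa> * spec_norm C) \<le> bd"
  shows "emeasure (gaussp ({..<k+r} \<times> {..<N})) {x \<in> space (gaussp ({..<k+r} \<times> {..<N})). \<not> (det (X x * (X x)\<^sup>T) \<noteq> 0 \<and> fro_norm (Y x * (Y x)\<^sup>T) \<le> bd)}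
    \<le> ennreal (3 * t powr (- real p) + exp (- u\<^sup>2 / 2))"
proof -
  let ?I = "{..<k+r} \<times> {..<N}" and ?H = "{..<k} \<times> {..<N}" and ?J = "{k..<k+r} \<times> {..<N}"
  define Bad where "Bad = {x \<in> space (gaussp ?I). \<not> (det (X x * (X x)\<^sup>T) \<noteq> 0 \<and> fro_norm (Y x * (Y x)\<^sup>T) \<le> bd)}"
  have d: "dim_row S = r" "dim_col S = r" "dim_row L2 = r" "dim_col L2 = r" "dim_row L1 = k" "dim_col L1 = k" "dim_row B = r" "dim_col B = k"
    using S L1 L2 B by auto
  have SL: "S * L2 \<in> carrier_mat r r" by (rule carrier_matI) (simp_all add: d)
  have Cc: "C \<in> carrier_mat r r" and CT: "C\<^sup>T = C" unfolding C_def by (auto intro!: carrier_matI simp: d mtrans)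
  note sp = spec_norm_symmetric[OF Cc CT]
  have lam: "((S * L2)\<^sup>T *\<^sub>v v) \<bullet> ((S * L2)\<^sup>T *\<^sub>v v) \<le> spec_norm C * (v \<bullet> v)" if "dim_vec v = r" for v
  proof -
    have "((S * L2)\<^sup>T *\<^sub>v v) \<bullet> ((S * L2)\<^sup>T *\<^sub>v v) = v \<bullet> ((S * L2) *\<^sub>v ((S * L2)\<^sup>T *\<^sub>v v))"
      by (rule sprod_trans) (simp_all add: that d)
    also have "\<dots> = v \<bullet> (C *\<^sub>v v)" unfolding C_def by (simp add: vassoc that d)
    finally show ?thesis using sp(2)[OF that] by simp
  qed
  have tp: "0 < t" using t by simp
  define \<tau>\<^sub>1 where "\<tau>\<^sub>1 = t\<^sup>2 * d1 * \<kappa>"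
  define \<tau>\<^sub>2 where "\<tau>\<^sub>2 = t\<^sup>2 * d2 * \<kappa>"
  have d0: "0 \<le> d1" "0 \<le> d2" by (simp_all add: d1_def d2_def)
  have \<tau>0: "0 \<le> \<tau>\<^sub>1" "0 \<le> \<tau>\<^sub>2" using \<kappa>0 d0 by (simp_all add: \<tau>\<^sub>1_def \<tau>\<^sub>2_def)
  have tr0: "0 \<le> mtrace C"
  proof -
    have "C $$ (a,a) = row (S * L2) a \<bullet> row (S * L2) a" if "a < r" for a using that d by (simp add: C_def)
    thus ?thesis unfolding mtrace_def by (auto intro!: sum_nonneg sprod_self_nonneg simp: C_def d)
  qed
  \<comment> \<open>The three products of norms from \<open>s4_norm_tail\<close>, with
    \<open>\<tau>\<^sub>1\<close> in place of the trace of W and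
    \<open>sqrt k * \<tau>\<^sub>2\<close> in place of its Frobenius norm.\<close>
  define bb where "bb = fro_norm C * \<tau>\<^sub>1 + mtrace C * (sqrt (real k) * \<tau>\<^sub>2) + fro_norm C * (sqrt (real k) * \<tau>\<^sub>2)"
  have bb0: "0 \<le> bb" unfolding bb_def by (intro add_nonneg_nonneg mult_nonneg_nonneg fro_norm_nonneg tr0 \<tau>0) simp_all
  define b where "b = sqrt bb"
  define c where "c = sqrt (spec_norm C * \<tau>\<^sub>2) * u"
  have b2: "b\<^sup>2 = bb" "0 \<le> b" using bb0 by (simp_all add: b_def)
  have c2: "c\<^sup>2 = spec_norm C * \<tau>\<^sub>2 * u\<^sup>2" "0 \<le> c" using sp(1) \<tau>0 u by (simp_all add: c_def power_mult_distrib)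
  have final: "4 * fro_norm ((S * B) * (S * B)\<^sup>T) + 4 * b\<^sup>2 + 2 * c\<^sup>2 \<le> bd"
  proof -
    have "bb = t\<^sup>2 * \<kappa> * ((d1 + sqrt (real k) * d2) * fro_norm C + sqrt (real k) * d2 * mtrace C)"
      by (simp add: bb_def \<tau>\<^sub>1_def \<tau>\<^sub>2_def algebra_simps)
    moreover have "spec_norm C * \<tau>\<^sub>2 * u\<^sup>2 = t\<^sup>2 * u\<^sup>2 * d2 * \<kappa> * spec_norm C" by (simp add: \<tau>\<^sub>2_def mult_ac)
    ultimately show ?thesis unfolding b2 c2 by (simp only: bd)
  qed
  obtain E where E: "E \<in> sets (gaussp ?H)" "emeasure (gaussp ?H) E \<le> ennreal (3 * t powr (- real p))"
    "\<And>x. x \<in> space (gaussp ?H) - E \<Longrightarrow> det (X x * (X x)\<^sup>T) \<noteq> 0 \<and> mtrace (minv (X x * (X x)\<^sup>T)) \<le> \<tau>\<^sub>1 \<and>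
       (\<forall>y. dim_vec y = k \<longrightarrow> y \<bullet> (minv (X x * (X x)\<^sup>T) *\<^sub>v y) \<le> \<tau>\<^sub>2 * (y \<bullet> y) \<and>
          (minv (X x * (X x)\<^sup>T) *\<^sub>v y) \<bullet> (minv (X x * (X x)\<^sup>T) *\<^sub>v y) \<le> \<tau>\<^sub>2\<^sup>2 * (y \<bullet> y))"
    using Winv_good_event[OF L1 p k t \<kappa>0 \<kappa>] unfolding X_def Winv_def N_def \<tau>\<^sub>1_def \<tau>\<^sub>2_def d1_def d2_def by blast
  have Xc: "X x \<in> carrier_mat k N" for x unfolding X_def by (rule carrier_matI) (simp_all add: d gmat_dims)
  have Gc: "lowmat k r N x \<in> carrier_mat r N" for x by (rule carrier_matI) (simp_all add: lowmat_dims)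
  have inner: "emeasure (gaussp ?J) {y \<in> space (gaussp ?J). merge ?H ?J (x,y) \<in> Bad} \<le> ennreal (exp (- u\<^sup>2 / 2))"
    if x: "x \<in> space (gaussp ?H)" "x \<notin> E" for x
  proof -
    interpret J: prob_space "gaussp ?J" by (rule prob_space_gaussp)
    define W where "W = minv (X x * (X x)\<^sup>T)"
    define R where "R = (X x)\<^sup>T * minv (X x * (X x)\<^sup>T)"
    have good: "det (X x * (X x)\<^sup>T) \<noteq> 0" "mtrace W \<le> \<tau>\<^sub>1" "\<And>y. dim_vec y = k \<Longrightarrow> y \<bullet> (W *\<^sub>v y) \<le> \<tau>\<^sub>2 * (y \<bullet> y)"
      "\<And>y. dim_vec y = k \<Longrightarrow> (W *\<^sub>v y) \<bullet> (W *\<^sub>v y) \<le> \<tau>\<^sub>2\<^sup>2 * (y \<bullet> y)"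
      using E(3)[of x] x unfolding W_def by auto
    note RI = right_inverse_gram[OF Xc good(1), folded W_def R_def]
    have Wc: "W \<in> carrier_mat k k" unfolding W_def by (rule minv(1)) (use Xc[of x] in \<open>auto intro!: carrier_matI\<close>)
    have fW: "fro_norm W \<le> sqrt (real k) * \<tau>\<^sub>2" by (rule fro_norm_le_spectral[OF Wc \<tau>0(2) good(4)])
    have Rb: "(R *\<^sub>v v) \<bullet> (R *\<^sub>v v) \<le> \<tau>\<^sub>2 * (v \<bullet> v)" if "dim_vec v = k" for v
      unfolding RI(4)[OF that] by (rule good(3)[OF that])
    have bcond: "fro_norm ((S * L2) * (S * L2)\<^sup>T) * mtrace (R\<^sup>T * R) + mtrace ((S * L2) * (S * L2)\<^sup>T) * fro_norm (R\<^sup>T * R)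
        + fro_norm ((S * L2) * (S * L2)\<^sup>T) * fro_norm (R\<^sup>T * R) \<le> b\<^sup>2"
      unfolding RI(3) C_def[symmetric] b2 bb_def
      by (intro add_mono mult_left_mono good(2) fW fro_norm_nonneg tr0)
    note tail = s4_norm_tail[OF SL RI(1) sp(1) lam \<tau>0(2) Rb _ bcond b2(2), where u = u]
    have Fm: "(\<lambda>y. s4_norm ((S * L2) * (lowmat k r N y * R))) \<in> borel_measurable (gaussp ?J)"
      by (intro mmeas_s4_norm[of _ r k] mmeas_mult[OF mmeas_const[OF SL]] mmeas_mult[OF mmeas_lowmat mmeas_const[OF RI(1)]]) simp
    have sub: "{y \<in> space (gaussp ?J). merge ?H ?J (x,y) \<in> Bad} \<subseteq> {y \<in> space (gaussp ?J). b + c < s4_norm ((S * L2) * (lowmat k r N y * R))}"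
    proof safe
      fix y assume "merge ?H ?J (x,y) \<in> Bad"
      moreover have "gmat k N (merge ?H ?J (x,y)) = gmat k N x"
        by (rule eq_matI) (auto simp: gmat_dims gmat_index merge_def)
      moreover have "lowmat k r N (merge ?H ?J (x,y)) = lowmat k r N y"
        by (rule eq_matI) (auto simp: lowmat_dims lowmat_index merge_def)
      ultimately have n: "\<not> fro_norm (coupling S (X x) (B * X x + L2 * lowmat k r N y) * (coupling S (X x) (B * X x + L2 * lowmat k r N y))\<^sup>T) \<le> bd"
        using good(1) unfolding Bad_def Y_def X_def by auto
      show "b + c < s4_norm ((S * L2) * (lowmat k r N y * R))"
      proof (rule ccontr)
        assume "\<not> b + c < s4_norm ((S * L2) * (lowmat k r N y * R))"
        hence "s4_norm ((S * L2) * (lowmat k r N y * ((X x)\<^sup>T * minv (X x * (X x)\<^sup>T)))) \<le> b + c" unfolding R_def by simp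
        from coupling_bound[OF S B L2 Xc Gc good(1) b2(2) c2(2) this] n final show False by linarith
      qed
    qed
    have "emeasure (gaussp ?J) {y \<in> space (gaussp ?J). merge ?H ?J (x,y) \<in> Bad}
       \<le> emeasure (gaussp ?J) {y \<in> space (gaussp ?J). b + c < s4_norm ((S * L2) * (lowmat k r N y * R))}"
      by (rule emeasure_mono[OF sub]) (use Fm in measurable)
    also have "\<dots> \<le> ennreal (exp (- u\<^sup>2 / 2))"
      using tail u unfolding c_def by (simp add: J.emeasure_eq_measure ennreal_leI)
    finally show ?thesis .
  qed
  have un: "?I = ?H \<union> ?J" by auto
  have Im: "{..<k} \<times> {..<N} \<subseteq> ?I" "{k..<k+r} \<times> {..<N} \<subseteq> ?I" by auto
  have Xm: "mmeas (gaussp ?I) k N X" unfolding X_def by (rule mmeas_mult[OF mmeas_const[OF L1(1)] mmeas_gmat[OF Im(1)]])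
  have Ym: "mmeas (gaussp ?I) r k Y" unfolding Y_def
    by (intro mmeas_coupling[OF S Xm] mmeas_add mmeas_mult[OF mmeas_const[OF B] Xm] mmeas_mult[OF mmeas_const[OF L2] mmeas_lowmat[OF Im(2)]])
  have Bm: "Bad \<in> sets (gaussp ?I)"
    unfolding Bad_def
    using mmeas_det[OF mmeas_mult[OF Xm mmeas_trans[OF Xm]]] mmeas_fro_norm[OF mmeas_mult[OF Ym mmeas_trans[OF Ym]]] by measurable
  have "emeasure (gaussp ?I) Bad = (\<integral>\<^sup>+z. indicator Bad z \<partial>gaussp (?H \<union> ?J))"
    unfolding un[symmetric] using Bm by simp
  also have "\<dots> = (\<integral>\<^sup>+x. (\<integral>\<^sup>+y. indicator Bad (merge ?H ?J (x,y)) \<partial>gaussp ?J) \<partial>gaussp ?H)"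
    by (rule merge_measurable_nn) (use Bm in \<open>auto simp: un[symmetric]\<close>)
  also have "\<dots> \<le> (\<integral>\<^sup>+x. indicator E x + ennreal (exp (- u\<^sup>2 / 2)) \<partial>gaussp ?H)"
  proof (rule nn_integral_mono)
    fix x assume x: "x \<in> space (gaussp ?H)"
    have mx: "{y \<in> space (gaussp ?J). merge ?H ?J (x,y) \<in> Bad} \<in> sets (gaussp ?J)"
    proof -
      have mg: "(\<lambda>y. merge ?H ?J (x,y)) \<in> measurable (gaussp ?J) (gaussp ?I)"
        unfolding un using measurable_compose[OF measurable_Pair1'[OF x] measurable_merge[of ?H ?J "\<lambda>_. gauss"]] by simp
      from measurable_sets[OF mg Bm] show ?thesis by (simp add: vimage_def Int_def conj_commute)
    qed
    have "(\<integral>\<^sup>+y. indicator Bad (merge ?H ?J (x,y)) \<partial>gaussp ?J) = (\<integral>\<^sup>+y. indicator {y \<in> space (gaussp ?J). merge ?H ?J (x,y) \<in> Bad} y \<partial>gaussp ?J)"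
      by (intro nn_integral_cong) (auto simp: indicator_def)
    also have "\<dots> = emeasure (gaussp ?J) {y \<in> space (gaussp ?J). merge ?H ?J (x,y) \<in> Bad}" using mx by simp
    also have "\<dots> \<le> indicator E x + ennreal (exp (- u\<^sup>2 / 2))"
    proof (cases "x \<in> E")
      case True
      have "emeasure (gaussp ?J) {y \<in> space (gaussp ?J). merge ?H ?J (x,y) \<in> Bad} \<le> 1"
        by (rule prob_space.emeasure_le_1[OF prob_space_gaussp])
      also have "1 \<le> indicator E x + ennreal (exp (- u\<^sup>2 / 2))" using True by simp
      finally show ?thesis .
    next
      case False
      thus ?thesis using inner[OF x False] by simp
    qed
    finally show "(\<integral>\<^sup>+y. indicator Bad (merge ?H ?J (x,y)) \<partial>gaussp ?J) \<le> indicator E x + ennreal (exp (- u\<^sup>2 / 2))" .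
  qed
  also have "\<dots> = emeasure (gaussp ?H) E + ennreal (exp (- u\<^sup>2 / 2))"
    using E(1) by (subst nn_integral_add) (auto simp: prob_space.emeasure_space_1[OF prob_space_gaussp])
  also have "\<dots> \<le> ennreal (3 * t powr (- real p)) + ennreal (exp (- u\<^sup>2 / 2))" by (intro add_mono E(2)) simp
  finally show ?thesis unfolding Bad_def by (simp add: ennreal_plus[symmetric] del: ennreal_plus)
qed

section \<open>Comparison with the stated bound and conclusion\<close>

lemma spec_norm_zero: "spec_norm (0\<^sub>m r r) = 0"
proof -
  have z: "mat_diag r (\<lambda>_. 0 :: real) = 0\<^sub>m r r" by (rule eq_matI) (simp_all add: mat_diag_def)
  have "0\<^sub>m r r = 1\<^sub>m r * mat_diag r (\<lambda>_. 0 :: real) * (1\<^sub>m r)\<^sup>T" unfolding z by simp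
  from sing_vals_symmetric(1)[OF orthogonal_one this] have "sq_sing_vals (0\<^sub>m r r) \<subseteq> {0}" by auto
  hence sv: "insert 0 (sq_sing_vals (0\<^sub>m r r)) = {0}" by auto
  show ?thesis unfolding spec_norm_def sv by simp
qed

lemma Sig2_dims: "dim_row (Sig2 n k \<sigma>) = n - k" "dim_col (Sig2 n k \<sigma>) = n - k"
  "dim_row (Sig2_half n k \<sigma>) = n - k" "dim_col (Sig2_half n k \<sigma>) = n - k"
  by (simp_all add: Sig2_def Sig2_half_def mat_diag_dims)

lemma Sig2_trans: "(Sig2 n k \<sigma>)\<^sup>T = Sig2 n k \<sigma>" "(Sig2_half n k \<sigma>)\<^sup>T = Sig2_half n k \<sigma>"
  unfolding Sig2_def Sig2_half_def by (rule eq_matI; simp add: mat_diag_dims mat_diag_index)+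

lemma Sig2_norms_pos:
  assumes \<sigma>: "\<And>i. i < n \<Longrightarrow> 0 \<le> \<sigma> i" and i: "i < n - k" "\<sigma> (k + i) \<noteq> 0"
  shows "0 < fro_norm (Sig2 n k \<sigma>)" "0 < nuc_norm (Sig2 n k \<sigma>)" "0 < spec_norm (Sig2 n k \<sigma>)"
proof -
  let ?s = "Sig2 n k \<sigma>"
  have sc: "?s \<in> carrier_mat (n - k) (n - k)" by (rule carrier_matI) (simp_all add: Sig2_dims)
  have e: "?s $$ (a,b) = (if a = b then \<sigma> (k + a) else 0)" if "a < n - k" "b < n - k" for a b
    using that by (simp add: Sig2_def mat_diag_index)
  have "k + i < n" using i(1) by linarith
  hence pos: "0 < \<sigma> (k + i)" using \<sigma>[of "k + i"] i(2) by simp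
  have "0 < mtrace ?s" unfolding mtrace_def Sig2_dims
    by (rule sum_pos2[of _ i]) (use i pos \<sigma> in \<open>auto simp: e\<close>)
  thus "0 < nuc_norm ?s" using mtrace_le_nuc_norm[OF sc Sig2_trans(1)] by linarith
  have "0 < (\<Sum>b<n - k. ?s $$ (i,b) * ?s $$ (i,b))"
    by (rule sum_pos2[of _ i]) (use i pos in \<open>auto simp: e\<close>)
  also have "\<dots> \<le> fip ?s ?s" unfolding fip_def Sig2_dims
    by (rule member_le_sum[of i "{..<n - k}" "\<lambda>a. \<Sum>b<n - k. ?s $$ (a,b) * ?s $$ (a,b)"]) (use i in \<open>auto intro!: sum_nonneg\<close>)
  finally have "0 < fip ?s ?s" .
  thus "0 < fro_norm ?s" unfolding fro_norm_eq by simp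
  have "(unit_vec (n - k) i :: real vec) \<bullet> (?s *\<^sub>v unit_vec (n - k) i) \<le> spec_norm ?s * ((unit_vec (n - k) i :: real vec) \<bullet> unit_vec (n - k) i)"
    by (rule spec_norm_symmetric(2)[OF sc Sig2_trans(1)]) simp
  thus "0 < spec_norm ?s" unfolding unit_quadratic[OF sc i(1)] using i pos by (simp add: e)
qed

lemma Sig2_half_zero:
  assumes "\<And>i. i < n - k \<Longrightarrow> \<sigma> (k + i) = 0" shows "Sig2_half n k \<sigma> = 0\<^sub>m (n - k) (n - k)"
  unfolding Sig2_half_def by (rule eq_matI) (auto simp: mat_diag_dims mat_diag_index assms)

text \<open>Each norm of \<open>Sig2\<close> cancels against the denominator of its coefficient, and
  the trace is replaced by the nuclear norm. If \<open>Sig2\<close> is 0, the cancellation fails,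
  but then \<open>S\<close> is 0 as well and the left side vanishes.\<close>

lemma bound_comparison:
  fixes \<sigma> :: "nat \<Rightarrow> real"
  assumes \<sigma>: "\<And>i. i < n \<Longrightarrow> 0 \<le> \<sigma> i"
    and U: "orthogonal_real_mat n U" and K: "sym_psd n K" and inv: "invertible_mat (Kt11 n k U K)"
    and L2: "L2 \<in> carrier_mat (n - k) (n - k)" "Kt22_1 n k U K = L2 * L2\<^sup>T"
    and a: "0 \<le> a1" "0 \<le> a3" "0 \<le> a2"
  defines "S \<equiv> Sig2_half n k \<sigma>" and "B \<equiv> Kt21 n k U K * minv (Kt11 n k U K)" and "\<kappa> \<equiv> spec_norm (mat_inv (Kt11 n k U K))"
  defines "C \<equiv> (S * L2) * (S * L2)\<^sup>T"
  shows "4 * fro_norm ((S * B) * (S * B)\<^sup>T) + 4 * (t\<^sup>2 * \<kappa> * (a1 * fro_norm C + a3 * mtrace C)) + 2 * (t\<^sup>2 * u\<^sup>2 * a2 * \<kappa> * spec_norm C)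
    \<le> 4 * (delta_k fro_norm n k U \<sigma> K + t\<^sup>2 * a1 * beta_k fro_norm n k U \<sigma> K) * fro_norm (Sig2 n k \<sigma>)
      + 4 * t\<^sup>2 * a3 * beta_k nuc_norm n k U \<sigma> K * nuc_norm (Sig2 n k \<sigma>)
      + 2 * t\<^sup>2 * u\<^sup>2 * a2 * beta_k spec_norm n k U \<sigma> K * spec_norm (Sig2 n k \<sigma>)"
proof -
  let ?r = "n - k" and ?s = "Sig2 n k \<sigma>"
  note Sc = schur_complement[OF U K inv]
  define W where "W = minv (Kt11 n k U K)"
  have Wc: "W \<in> carrier_mat k k" unfolding W_def by (rule minv(1)[OF Kt_dims(1)])
  have WT: "W\<^sup>T = W" unfolding W_def by (rule minv_symmetric[OF Kt_dims(1) Sc(1,2)])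
  have d: "dim_row S = ?r" "dim_col S = ?r" "dim_row L2 = ?r" "dim_col L2 = ?r" "dim_row W = k" "dim_col W = k"
    "dim_row (Kt21 n k U K) = ?r" "dim_col (Kt21 n k U K) = k"
    using L2 Wc Kt_dims(2)[of n k U K] by (auto simp: S_def Sig2_dims)
  have ST: "S\<^sup>T = S" unfolding S_def by (rule Sig2_trans)
  have eqC: "S * Kt22_1 n k U K * S = C" unfolding C_def L2(2) by (simp add: mtrans massoc d ST)
  have eqD: "S * Kt21 n k U K * mat_inv (Kt11 n k U K) * mat_inv (Kt11 n k U K) * (Kt21 n k U K)\<^sup>T * S = (S * B) * (S * B)\<^sup>T"
    unfolding B_def Sc(3) W_def[symmetric] by (simp add: mtrans massoc d ST WT)
  have Cc: "C \<in> carrier_mat ?r ?r" and CT: "C\<^sup>T = C" unfolding C_def by (auto intro!: carrier_matI simp: d mtrans)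
  have \<kappa>0: "0 \<le> \<kappa>" unfolding \<kappa>_def Sc(3) by (rule spec_norm_symmetric(1)[OF minv(1)[OF Kt_dims(1)] minv_symmetric[OF Kt_dims(1) Sc(1,2)]])
  have b: "beta_k nrm n k U \<sigma> K = nrm C / nrm ?s * \<kappa>" "delta_k nrm n k U \<sigma> K = nrm ((S * B) * (S * B)\<^sup>T) / nrm ?s" for nrm
    unfolding beta_k_def delta_k_def \<kappa>_def[symmetric] S_def[symmetric] eqC eqD by (rule refl)+
  show ?thesis
  proof (cases "\<exists>i<?r. \<sigma> (k + i) \<noteq> 0")
    case True
    then obtain i where i: "i < ?r" "\<sigma> (k + i) \<noteq> 0" by blast
    note pos = Sig2_norms_pos[of n \<sigma>, OF \<sigma> i]
    have tr: "t\<^sup>2 * \<kappa> * a3 * mtrace C \<le> t\<^sup>2 * \<kappa> * a3 * nuc_norm C"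
      by (intro mult_left_mono mtrace_le_nuc_norm[OF Cc CT] mult_nonneg_nonneg \<kappa>0 a) simp
    have "4 * (delta_k fro_norm n k U \<sigma> K + t\<^sup>2 * a1 * beta_k fro_norm n k U \<sigma> K) * fro_norm ?s = 4 * fro_norm ((S * B) * (S * B)\<^sup>T) + 4 * (t\<^sup>2 * \<kappa> * (a1 * fro_norm C))"
      unfolding b using pos(1) by (simp add: field_simps)
    moreover have "4 * t\<^sup>2 * a3 * beta_k nuc_norm n k U \<sigma> K * nuc_norm ?s = 4 * (t\<^sup>2 * \<kappa> * a3 * nuc_norm C)"
      unfolding b using pos(2) by simp
    moreover have "2 * t\<^sup>2 * u\<^sup>2 * a2 * beta_k spec_norm n k U \<sigma> K * spec_norm ?s = 2 * (t\<^sup>2 * u\<^sup>2 * a2 * \<kappa> * spec_norm C)"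
      unfolding b using pos(3) by simp
    moreover have "4 * (t\<^sup>2 * \<kappa> * (a1 * fro_norm C + a3 * mtrace C)) = 4 * (t\<^sup>2 * \<kappa> * (a1 * fro_norm C)) + 4 * (t\<^sup>2 * \<kappa> * a3 * mtrace C)"
      by (simp add: distrib_left mult.assoc)
    ultimately show ?thesis using tr by linarith
  next
    case False
    hence S0: "S = 0\<^sub>m ?r ?r" unfolding S_def by (intro Sig2_half_zero) auto
    have SB: "S * B = 0\<^sub>m ?r k" unfolding S0 by (rule left_mult_zero_mat) (auto intro!: carrier_matI simp: B_def W_def[symmetric] d)
    have SL: "S * L2 = 0\<^sub>m ?r ?r" unfolding S0 by (rule left_mult_zero_mat[OF L2(1)])
    have C0: "C = 0\<^sub>m ?r ?r" unfolding C_def SL by simp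
    have z: "fro_norm ((S * B) * (S * B)\<^sup>T) = 0" "fro_norm C = 0" "mtrace C = 0" "spec_norm C = 0"
      unfolding SB C0 by (simp_all add: fro_norm_def mtrace_def spec_norm_zero)
    have nn: "0 \<le> nuc_norm C" "0 \<le> nuc_norm ?s"
      by (rule nuc_norm_nonneg[OF Cc CT]) (rule nuc_norm_nonneg[OF _ Sig2_trans(1)], auto intro!: carrier_matI simp: Sig2_dims)
    have "0 \<le> 4 * t\<^sup>2 * a3 * (nuc_norm C / nuc_norm ?s * \<kappa>) * nuc_norm ?s"
      by (intro mult_nonneg_nonneg divide_nonneg_nonneg nn \<kappa>0 a) simp_all
    thus ?thesis unfolding b z by simp
  qed
qed

theorem theorem2p6:
  fixes M :: "'w measure" and \<Omega> :: "'w \<Rightarrow> real mat"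
    and A K U :: "real mat" and \<sigma> :: "nat \<Rightarrow> real"
    and n k p :: nat and t u :: real
  assumes M: "prob_space M"
    and A: "sym_psd n A"
    and U: "orthogonal_real_mat n U"
    and eig: "A = U * mat_diag n \<sigma> * transpose_mat U"
    and sorted: "\<And>i j. i \<le> j \<Longrightarrow> j < n \<Longrightarrow> \<sigma> j \<le> \<sigma> i"
    and nonneg: "\<And>i. i < n \<Longrightarrow> 0 \<le> \<sigma> i"
    and k: "2 \<le> k" "k \<le> vec_space.rank n A"
    and p: "4 \<le> p"
    and K: "sym_psd n K"
    and K11: "invertible_mat (Kt11 n k U K)"
    and Om: "iid_gaussian_cols M n (k + p) K \<Omega>"
    and t: "1 \<le> t" and u: "1 \<le> u"
  shows "let d1 = 3 * real k / (real p + 1);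
             d2 = exp 2 * (real k + real p) / (real p + 1)\<^sup>2;
             d3 = sqrt (real k) * d2
         in \<exists>E \<in> sets M.
              E \<subseteq> {\<omega> \<in> space M.
                   fro_norm (A - nystrom A (\<Omega> \<omega>))
                   \<le> fro_norm (Sig2 n k \<sigma>)
                     + 4 * (delta_k fro_norm n k U \<sigma> K
                            + t\<^sup>2 * (d1 + d3) * beta_k fro_norm n k U \<sigma> K) * fro_norm (Sig2 n k \<sigma>)
                     + 4 * t\<^sup>2 * d3 * beta_k nuc_norm n k U \<sigma> K * nuc_norm (Sig2 n k \<sigma>)
                     + 2 * t\<^sup>2 * u\<^sup>2 * d2 * beta_k spec_norm n k U \<sigma> K * spec_norm (Sig2 n k \<sigma>)}
              \<and> measure M E \<ge> 1 - 3 * t powr (- real p) - exp (- u\<^sup>2 / 2)"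
proof -
  interpret M: prob_space M by (rule M)
  have Ac: "A \<in> carrier_mat n n" using A by (simp add: sym_psd_def)
  have kn: "k \<le> n" using k(2) vec_space.rank_le_nc[OF Ac] by (rule order_trans)
  have k0: "0 < k" using k(1) by simp
  define d1 where "d1 = 3 * real k / (real p + 1)"
  define d2 where "d2 = exp 2 * (real k + real p) / (real p + 1)\<^sup>2"
  define d3 where "d3 = sqrt (real k) * d2"
  have d0: "0 \<le> d1 + d3" "0 \<le> d3" "0 \<le> d2" by (simp_all add: d1_def d2_def d3_def)
  let ?r = "n - k" and ?N = "k + p"
  let ?S = "Sig2_half n k \<sigma>"
  let ?I = "{..<n} \<times> {..<?N}"
  let ?G = "gaussp ?I" and ?P = "PiM ?I (\<lambda>_. borel :: real measure)"
  define bd where "bd = 4 * (delta_k fro_norm n k U \<sigma> K + t\<^sup>2 * (d1 + d3) * beta_k fro_norm n k U \<sigma> K) * fro_norm (Sig2 n k \<sigma>)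
      + 4 * t\<^sup>2 * d3 * beta_k nuc_norm n k U \<sigma> K * nuc_norm (Sig2 n k \<sigma>)
      + 2 * t\<^sup>2 * u\<^sup>2 * d2 * beta_k spec_norm n k U \<sigma> K * spec_norm (Sig2 n k \<sigma>)"
  note Sc = schur_complement[OF U K K11]
  define \<kappa> where "\<kappa> = spec_norm (mat_inv (Kt11 n k U K))"
  obtain L1 where L1: "L1 \<in> carrier_mat k k" "Kt11 n k U K = L1 * L1\<^sup>T" using psd_factor[OF Kt_dims(1) Sc(1,4)] by blast
  obtain L2 where L2: "L2 \<in> carrier_mat ?r ?r" "Kt22_1 n k U K = L2 * L2\<^sup>T" using psd_factor[OF Sc(5,6,7)] by blast
  note mg = minv_gram[OF L1(1) Sc(2)[unfolded L1(2)], folded L1(2)]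
  have mc: "minv (Kt11 n k U K) \<in> carrier_mat k k" "(minv (Kt11 n k U K))\<^sup>T = minv (Kt11 n k U K)"
    by (rule minv(1)[OF Kt_dims(1)], rule minv_symmetric[OF Kt_dims(1) Sc(1,2)])
  have \<kappa>: "(minv L1 *\<^sub>v y) \<bullet> (minv L1 *\<^sub>v y) \<le> \<kappa> * (y \<bullet> y)" if "dim_vec y = k" for y
    unfolding mg(2)[OF that] \<kappa>_def Sc(3) by (rule spec_norm_symmetric(2)[OF mc that])
  \<comment> \<open>The thresholds of the tail bounds are proportional to \<open>\<kappa>\<close>
    and must be positive. Were it not positive, the invertible matrix \<open>minv L1\<close> would
    annihilate a unit vector.\<close>
  have \<kappa>0: "0 < \<kappa>"
  proof (rule ccontr)
    let ?e = "unit_vec k 0 :: real vec"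
    assume "\<not> 0 < \<kappa>"
    hence "(minv L1 *\<^sub>v ?e) \<bullet> (minv L1 *\<^sub>v ?e) \<le> 0" using \<kappa>[of ?e] k0 by simp
    hence "(minv L1 *\<^sub>v ?e) \<bullet> (minv L1 *\<^sub>v ?e) = 0" using sprod_self_nonneg[of "minv L1 *\<^sub>v ?e"] by linarith
    hence z: "minv L1 *\<^sub>v ?e = 0\<^sub>v k" unfolding sprod_self_eq_0 using minv(1)[OF L1(1)] by simp
    have "?e = (L1 * minv L1) *\<^sub>v ?e" unfolding minv(2)[OF L1(1) mg(1)] by simp
    also have "\<dots> = L1 *\<^sub>v (minv L1 *\<^sub>v ?e)" by (rule vassoc) (use minv(1)[OF L1(1)] L1(1) in auto)
    also have "\<dots> = 0\<^sub>v k" unfolding z using L1(1) by (intro eq_vecI) auto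
    finally have "?e $ 0 = 0\<^sub>v k $ 0" by simp
    thus False using k0 by simp
  qed
  define B where "B = Kt21 n k U K * minv (Kt11 n k U K)"
  have Bc: "B \<in> carrier_mat ?r k" unfolding B_def by (rule mult_carrier_mat[OF Kt_dims(2) mc(1)])
  have Shc: "?S \<in> carrier_mat ?r ?r" by (rule carrier_matI) (simp_all add: Sig2_dims)
  define Lf where "Lf = block_factor n k L1 B L2"
  have Lfc: "Lf \<in> carrier_mat n n" unfolding Lf_def by (rule block_factor_carrier[OF L1(1) L2(1) kn])
  have LL: "Lf * Lf\<^sup>T = U\<^sup>T * K * U" unfolding Lf_def B_def by (rule block_factor_gram[OF U K K11 kn L1 L2])
  note act = block_factor_action[OF L1(1) L2(1) Bc kn, folded Lf_def]
  define Y where "Y = (\<lambda>\<omega>. \<lambda>z\<in>?I. (U\<^sup>T * \<Omega> \<omega>) $$ z)"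
  have Ym: "Y \<in> measurable M ?P" and Yd: "distr M ?P Y = distr ?G ?P (lact n ?N Lf)"
    unfolding Y_def by (rule distr_rotated_sample[OF M Om K U Lfc LL])+
  \<comment> \<open>The condition involves the sample only through the blocks of
    \<open>U\<^sup>T * \<Omega>\<close>, so its probability can be computed from the law in the
    model.\<close>
  define ok where "ok = (\<lambda>X Z. det (X * X\<^sup>T) \<noteq> 0 \<and> fro_norm (coupling ?S X Z * (coupling ?S X Z)\<^sup>T) \<le> bd)"
  define Good where "Good = {z \<in> space ?G. ok (gmat k ?N z) (lowmat k ?r ?N z)}"
  have kr: "k + ?r = n" using kn by simp
  have Xm: "mmeas ?G k ?N (gmat k ?N)" by (rule mmeas_gmat) (use kn in auto)
  have Zm: "mmeas ?G ?r ?N (lowmat k ?r ?N)" by (rule mmeas_lowmat) (use kn in auto)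
  note Cm = mmeas_coupling[OF Shc Xm Zm]
  have Gm: "Good \<in> sets ?G"
    unfolding Good_def ok_def
    using mmeas_det[OF mmeas_mult[OF Xm mmeas_trans[OF Xm]]] mmeas_fro_norm[OF mmeas_mult[OF Cm mmeas_trans[OF Cm]]] by measurable
  have GmP: "Good \<in> sets ?P" using Gm by (simp add: sets_gaussp)
  have lm: "lact n ?N Lf \<in> measurable ?G ?P" by (rule measurable_lact)
  \<comment> \<open>Defined through the coupling matrix instead of the error itself, so the
    measurability of the pseudoinverse never enters.\<close>
  define E where "E = Y -` Good \<inter> space M"
  have Es: "E \<in> sets M" unfolding E_def by (rule measurable_sets[OF Ym GmP])
  have sub: "E \<subseteq> {\<omega> \<in> space M. fro_norm (A - nystrom A (\<Omega> \<omega>)) \<le> fro_norm (Sig2 n k \<sigma>) + bd}"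
  proof safe
    fix \<omega> assume "\<omega> \<in> E"
    hence \<omega>: "\<omega> \<in> space M" and g: "ok (gmat k ?N (Y \<omega>)) (lowmat k ?r ?N (Y \<omega>))" by (auto simp: E_def Good_def)
    show "\<omega> \<in> space M" by (rule \<omega>)
    have Oc: "\<Omega> \<omega> \<in> carrier_mat n ?N" using Om \<omega> by (auto simp: iid_gaussian_cols_def)
    have Od: "dim_row (\<Omega> \<omega>) = n" "dim_col (\<Omega> \<omega>) = ?N" using Oc by auto
    note Ud = orthogonal_dims[OF U]
    have X: "gmat k ?N (Y \<omega>) = (U1 n k U)\<^sup>T * \<Omega> \<omega>"
    proof (rule eq_matI)
      fix i j assume "i < dim_row ((U1 n k U)\<^sup>T * \<Omega> \<omega>)" "j < dim_col ((U1 n k U)\<^sup>T * \<Omega> \<omega>)"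
      hence ij: "i < k" "j < ?N" by (simp_all add: U_dims Od)
      thus "gmat k ?N (Y \<omega>) $$ (i,j) = ((U1 n k U)\<^sup>T * \<Omega> \<omega>) $$ (i,j)"
        using kn by (simp add: gmat_index Y_def U_dims Ud Od U_cols[OF U kn])
    qed (simp_all add: gmat_dims U_dims Od)
    have Z: "lowmat k ?r ?N (Y \<omega>) = (U2 n k U)\<^sup>T * \<Omega> \<omega>"
    proof (rule eq_matI)
      fix i j assume "i < dim_row ((U2 n k U)\<^sup>T * \<Omega> \<omega>)" "j < dim_col ((U2 n k U)\<^sup>T * \<Omega> \<omega>)"
      hence ij: "i < ?r" "j < ?N" by (simp_all add: U_dims Od)
      moreover have "k + i < n" using ij(1) by linarith
      ultimately show "lowmat k ?r ?N (Y \<omega>) $$ (i,j) = ((U2 n k U)\<^sup>T * \<Omega> \<omega>) $$ (i,j)"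
        using kn by (simp add: lowmat_index Y_def U_dims Ud Od U_cols[OF U kn])
    qed (simp_all add: lowmat_dims U_dims Od)
    let ?X = "(U1 n k U)\<^sup>T * \<Omega> \<omega>"
    have Xc: "?X \<in> carrier_mat k ?N" by (rule carrier_matI) (simp_all add: U_dims Od)
    have nz: "det (?X * ?X\<^sup>T) \<noteq> 0" and le: "fro_norm (coupling ?S ?X ((U2 n k U)\<^sup>T * \<Omega> \<omega>) * (coupling ?S ?X ((U2 n k U)\<^sup>T * \<Omega> \<omega>))\<^sup>T) \<le> bd"
      using g unfolding ok_def X Z by auto
    note RI = right_inverse_gram[OF Xc nz]
    from nystrom_error_bound[OF U eig nonneg kn Oc RI(1,2)] le
    show "fro_norm (A - nystrom A (\<Omega> \<omega>)) \<le> fro_norm (Sig2 n k \<sigma>) + bd"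
      unfolding coupling_def by linarith
  qed
  have prob: "1 - 3 * t powr (- real p) - exp (- u\<^sup>2 / 2) \<le> measure M E"
  proof -
    interpret G: prob_space ?G by (rule prob_space_gaussp)
    have "measure M E = measure (distr M ?P Y) Good" unfolding E_def by (rule measure_distr[OF Ym GmP, symmetric])
    also have "\<dots> = measure ?G (lact n ?N Lf -` Good \<inter> space ?G)" unfolding Yd by (rule measure_distr[OF lm GmP])
    finally have e1: "measure M E = measure ?G (lact n ?N Lf -` Good \<inter> space ?G)" .
    have Bs: "lact n ?N Lf -` Good \<inter> space ?G \<in> sets ?G" by (rule measurable_sets[OF lm GmP])
    let ?X = "\<lambda>x. L1 * gmat k ?N x"
    have bdle: "4 * fro_norm ((?S * B) * (?S * B)\<^sup>T)
      + 4 * (t\<^sup>2 * \<kappa> * ((d1 + sqrt (real k) * d2) * fro_norm ((?S * L2) * (?S * L2)\<^sup>T) + sqrt (real k) * d2 * mtrace ((?S * L2) * (?S * L2)\<^sup>T)))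
      + 2 * (t\<^sup>2 * u\<^sup>2 * d2 * \<kappa> * spec_norm ((?S * L2) * (?S * L2)\<^sup>T)) \<le> bd"
      unfolding bd_def \<kappa>_def B_def d3_def[symmetric] by (rule bound_comparison[OF nonneg U K K11 L2 d0])
    \<comment> \<open>Under the action of \<open>Lf\<close> the two blocks become those of
      \<open>block_factor_action\<close>, and the complement of the good set is literally the event
      of \<open>model_bad_event\<close>.\<close>
    have "space ?G - (lact n ?N Lf -` Good \<inter> space ?G) =
       {x \<in> space ?G. \<not> (det (?X x * (?X x)\<^sup>T) \<noteq> 0 \<and>
          fro_norm (coupling ?S (?X x) (B * ?X x + L2 * lowmat k ?r ?N x) * (coupling ?S (?X x) (B * ?X x + L2 * lowmat k ?r ?N x))\<^sup>T) \<le> bd)}"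
      using measurable_space[OF measurable_lact_gaussp[of n ?N Lf]] by (auto simp: Good_def act ok_def)
    moreover have "emeasure ?G \<dots> \<le> ennreal (3 * t powr (- real p) + exp (- u\<^sup>2 / 2))"
      using model_bad_event[OF Shc Bc L1(1) mg(1) L2(1) p k0 t u \<kappa>0 \<kappa> bdle[unfolded d1_def d2_def]] unfolding kr by blast
    ultimately have "ennreal (measure ?G (space ?G - (lact n ?N Lf -` Good \<inter> space ?G))) \<le> ennreal (3 * t powr (- real p) + exp (- u\<^sup>2 / 2))"
      by (simp only: G.emeasure_eq_measure)
    hence "measure ?G (space ?G - (lact n ?N Lf -` Good \<inter> space ?G)) \<le> 3 * t powr (- real p) + exp (- u\<^sup>2 / 2)"
      by (subst (asm) ennreal_le_iff) simp_all
    thus ?thesis unfolding e1 G.prob_compl[OF Bs] by linarith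
  qed
  show ?thesis
    unfolding Let_def d1_def[symmetric] d2_def[symmetric] d3_def[symmetric]
    using Es sub prob unfolding bd_def by (intro bexI[of _ E] conjI) (auto simp: add.assoc)
qed

end
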